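(* Let $\mathcal{F}$ be a finite field of odd characteristic $p$, let $G$ be a finite group of odd order, and let $\mathcal{B}$ be a (finite-dimensional) symplectic $\mathcal{F}G$-module. Suppose that for every cyclic subgroup $N$ of $G$ the restriction $\mathcal{B}_N$ of $\mathcal{B}$ to a symplectic $\mathcal{F}N$-module is hyperbolic. Then $\mathcal{B}$ is hyperbolic (as an $\mathcal{F}G$-module).
   Context: All modules are finite-dimensional over $\mathcal{F}$. A symplectic $\mathcal{F}G$-module is a finite-dimensional $\mathcal{F}G$-module $\mathcal{B}$ equipped with a non-singular alternating $\mathcal{F}$-bilinear form $\langle\cdot,\cdot\rangle:\mathcal{B}\times\mathcal{B}\to\mathcal{F}$ that is $G$-invariant. For a subgroup $N\le G$, the restriction $\mathcal{B}_N$ carries the same form and is a symplectic $\mathcal{F}N$-module. For an $\mathcal{F}G$-submodule $\mathcal{S}\le\mathcal{B}$, put $\mathcal{S}^{\perp}=\{t\in\mathcal{B} : \langle s,t\rangle=0 \text{ for all } s\in\mathcal{S}\}$. A symplectic $\mathcal{F}G$-module $\mathcal{B}$ is hyperbolic if it contains an $\mathcal{F}G$-submodule $\mathcal{S}$ with $\mathcal{S}=\mathcal{S}^{\perp}$ (a self-perpendicular submodule); the same definition applies with $N$ in place of $G$. *)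

theory Defs
  imports "HOL-Algebra.Algebra"
begin

text \<open>
  Vector spaces are given as in \<^theory>\<open>HOL.Vector_Spaces\<close>: the vectors form a whole type and
  \<open>scale\<close> is scalar multiplication by elements of a type of class \<^class>\<open>field\<close>. Groups are taken
  from \<open>HOL-Algebra\<close>, since their subgroups are needed. \<^term>\<open>group_action G UNIV act\<close> says that
  \<open>act\<close> is a homomorphism from \<open>G\<close> to the permutations of the type of vectors, so modules are left
  modules.
\<close>

locale group_module =
  vector_space scale + group_action G UNIV act
  for scale :: "'f::field \<Rightarrow> 'b::ab_group_add \<Rightarrow> 'b"
    and G :: "'g monoid" (structure)
    and act :: "'g \<Rightarrow> 'b \<Rightarrow> 'b" +
  assumes finite_dimensional: "\<exists>Basis. finite_dimensional_vector_space scale Basis"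
    and linear_act: "g \<in> carrier G \<Longrightarrow> Vector_Spaces.linear scale scale (act g)"

locale symplectic_module = group_module scale G act
  for scale :: "'f::field \<Rightarrow> 'b::ab_group_add \<Rightarrow> 'b"
    and G :: "'g monoid" (structure)
    and act :: "'g \<Rightarrow> 'b \<Rightarrow> 'b" +
  fixes form :: "'b \<Rightarrow> 'b \<Rightarrow> 'f"
  assumes linear_form_left: "Vector_Spaces.linear scale (*) (\<lambda>s. form s t)"
    and linear_form_right: "Vector_Spaces.linear scale (*) (\<lambda>t. form s t)"
    and alternating: "form s s = 0"
    and non_singular: "(\<And>t. form s t = 0) \<Longrightarrow> s = 0"
    and invariant: "g \<in> carrier G \<Longrightarrow> form (act g s) (act g t) = form s t"

definition group_submodule ::
    "('f::field \<Rightarrow> 'b::ab_group_add \<Rightarrow> 'b) \<Rightarrow> 'g monoid \<Rightarrow> ('g \<Rightarrow> 'b \<Rightarrow> 'b) \<Rightarrow> 'b set \<Rightarrow> bool"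
  where "group_submodule scale G act S \<longleftrightarrow>
    module.subspace scale S \<and> (\<forall>g\<in>carrier G. \<forall>s\<in>S. act g s \<in> S)"

definition perp :: "('b \<Rightarrow> 'b \<Rightarrow> 'f::zero) \<Rightarrow> 'b set \<Rightarrow> 'b set"
  where "perp form S = {t. \<forall>s\<in>S. form s t = 0}"

definition hyperbolic ::
    "('f::field \<Rightarrow> 'b::ab_group_add \<Rightarrow> 'b) \<Rightarrow> 'g monoid \<Rightarrow> ('g \<Rightarrow> 'b \<Rightarrow> 'b) \<Rightarrow> ('b \<Rightarrow> 'b \<Rightarrow> 'f) \<Rightarrow> bool"
  where "hyperbolic scale G act form \<longleftrightarrow> (\<exists>S. group_submodule scale G act S \<and> S = perp form S)"

text \<open>
  The restriction of a module to a subgroup \<open>N\<close> is obtained by replacing \<open>G\<close> with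
  \<^term>\<open>G\<lparr>carrier := N\<rparr>\<close> and keeping \<open>scale\<close>, \<open>act\<close> and \<open>form\<close>.
\<close>

lemma (in group_module) restrict_subgroup:
  assumes N: "subgroup N G"
  shows "group_module scale (G\<lparr>carrier := N\<rparr>) act"
proof -
  interpret H: group_hom G "BijGroup UNIV" act
    by (rule group_hom)
  have sub: "N \<subseteq> carrier G"
    using N by (rule subgroup.subset)
  have "act \<in> hom (G\<lparr>carrier := N\<rparr>) (BijGroup UNIV)"
    using H.homh sub unfolding hom_def Pi_iff by (simp add: subset_iff)
  then have "group_action (G\<lparr>carrier := N\<rparr>) UNIV act"
    using H.G.subgroup_imp_group[OF N] H.H.is_group
    unfolding group_action_def group_hom_def group_hom_axioms_def by simp
  then show ?thesis
    using vector_space_axioms finite_dimensional linear_act sub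
    by (intro group_module.intro group_module_axioms.intro) (simp_all add: subset_iff)
qed

lemma (in symplectic_module) restrict_subgroup:
  assumes N: "subgroup N G"
  shows "symplectic_module scale (G\<lparr>carrier := N\<rparr>) act form"
proof -
  have sub: "N \<subseteq> carrier G"
    using N by (rule subgroup.subset)
  show ?thesis
  proof (intro symplectic_module.intro symplectic_module_axioms.intro)
    show "group_module scale (G\<lparr>carrier := N\<rparr>) act"
      using group_module_axioms N by (rule group_module.restrict_subgroup)
    show "form (act g s) (act g t) = form s t" if "g \<in> carrier (G\<lparr>carrier := N\<rparr>)" for g s t
      using that sub by (intro invariant) (simp add: subset_iff)
  qed (fact linear_form_left linear_form_right alternating | erule non_singular)+
qed

end

theory Submission
  imports Defs "HOL-Library.Product_Plus" "HOL-Library.Function_Algebras"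
    "HOL-Algebra.Algebraic_Closure_Type" "Jordan_Normal_Form.Schur_Decomposition"
begin

text \<open>
  Dividing by a maximal isotropic submodule, one may assume that the module \<open>V\<close> is anisotropic. An
  element \<open>a\<close> of the group ring acts as \<open>theta a\<close> on every induced module \<open>Ind\<^sub>H V\<close>, and \<open>fit\<close> denotes the
  part on which an operator is bijective. Artin's induction theorem for permutation characters, applied to
  characteristic polynomials lifted to characteristic zero, shows: if the order of the Fitting component of
  \<open>theta a\<close> on \<open>Ind\<^sub>C V\<close> is a power of \<open>q\<^sup>D\<close> for all cyclic \<open>C\<close>, then so is the \<open>|G|\<close>-th power of its
  order on \<open>V\<close>.

  Take \<open>a\<close> self-adjoint such that its Fitting component isolates the composition factors isomorphic to a fixed
  irreducible \<open>V\<^sub>1\<close>. On \<open>Ind\<^sub>C V\<close> a self-perpendicular \<open>C\<close>-submodule of \<open>V\<close> makes the multiplicity even; since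
  \<open>|G|\<close> is odd, the multiplicity in \<open>V\<close> is even as well. So there is a copy of \<open>V\<^sub>1\<close> orthogonal to \<open>V\<^sub>1\<close>, and its
  form differs from that of \<open>V\<^sub>1\<close> by a self-adjoint endomorphism \<open>e\<close>. If an endomorphism \<open>c\<close> satisfies
  \<open>c\<^sup>* c = -e\<close> and commutes with \<open>e\<close>, a twisted diagonal is isotropic, which is a contradiction. By counting
  squares in a finite field, \<open>c\<close> exists unless a maximal commutative ring \<open>L\<close> of endomorphisms of \<open>V\<^sub>1\<close> closed
  under adjoints and containing \<open>e\<close> is fixed by the adjunction.

  In that last case \<open>L\<close> is a field and the commutant of \<open>L\<close> and \<open>G\<close>. By density there are skew-adjoint elements
  \<open>x\<close>, \<open>y\<close> of the group ring over \<open>L\<close> whose product \<open>x y\<close> has a Fitting component of \<open>L\<close>-dimension one on \<open>V\<^sub>1\<close>. On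
  \<open>Ind\<^sub>C V\<^sub>1\<close>, with \<open>C\<close> generated by \<open>c\<close>, the dimension is even, because
  \<open>(\<phi>, \<psi>) \<mapsto> \<langle>\<phi>, y (c - c\<inverse>) \<psi>\<rangle>\<close> is alternating and \<open>c\<^sup>2\<close> generates \<open>C\<close>. This contradicts the first
  paragraph once more.
\<close>

section \<open>Fitting components and pairings\<close>

text \<open>The characteristic may divide |G|, so neither complete reducibility nor ordinary
  characters are available. Fitting components of group ring elements take their place: their orders
  are multiplicative along composition series and can be read off from characteristic polynomials,
  which satisfy, in multiplicative form, every linear relation between permutation characters.
  Artin's relation yields |G| times the trivial character and not that character itself, hence the
  |G|-th power. Even multiplicity alone does not suffice. If the adjunction fixes the field
  \<open>L\<close> and -e is not a square in it, two orthogonal copies of \<open>V\<^sub>1\<close>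
  with forms differing by e have an anisotropic sum, so this situation has to be excluded outright.
  There \<open>V\<^sub>1\<close> would be absolutely irreducible over \<open>L\<close> and self-dual
  with an alternating form, whereas for odd |G| only the trivial module is absolutely irreducible
  and self-dual, a fact in the spirit of Burnside. The rank count on cyclic subgroups proves as much
  of it as is required. The characteristic is odd so that 2 can be inverted.\<close>

definition add_subgroup :: "'a::ab_group_add set \<Rightarrow> bool"
  where "add_subgroup S \<longleftrightarrow> 0 \<in> S \<and> (\<forall>x\<in>S. \<forall>y\<in>S. x + y \<in> S) \<and> (\<forall>x\<in>S. - x \<in> S)"

definition additive_on :: "'a::ab_group_add set \<Rightarrow> ('a \<Rightarrow> 'b::ab_group_add) \<Rightarrow> bool"
  where "additive_on S h \<longleftrightarrow> (\<forall>x\<in>S. \<forall>y\<in>S. h (x + y) = h x + h y)"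

lemma add_subgroupD:
  assumes "add_subgroup S"
  shows "0 \<in> S" "\<And>x y. x \<in> S \<Longrightarrow> y \<in> S \<Longrightarrow> x + y \<in> S" "\<And>x. x \<in> S \<Longrightarrow> - x \<in> S"
    "\<And>x y. x \<in> S \<Longrightarrow> y \<in> S \<Longrightarrow> x - y \<in> S"
proof -
  show *: "0 \<in> S" "\<And>x y. x \<in> S \<Longrightarrow> y \<in> S \<Longrightarrow> x + y \<in> S" "\<And>x. x \<in> S \<Longrightarrow> - x \<in> S"
    using assms by (auto simp: add_subgroup_def)
  show "x - y \<in> S" if "x \<in> S" "y \<in> S" for x y
    using *(2)[OF that(1) *(3)[OF that(2)]] by simp
qed

lemma add_subgroupI:
  assumes "0 \<in> S" "\<And>x y. x \<in> S \<Longrightarrow> y \<in> S \<Longrightarrow> x + y \<in> S" "\<And>x. x \<in> S \<Longrightarrow> - x \<in> S"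
  shows "add_subgroup S"
  using assms by (simp add: add_subgroup_def)

lemma additive_onD:
  assumes "additive_on S h" and "add_subgroup S"
  shows "h 0 = 0" "\<And>x y. x \<in> S \<Longrightarrow> y \<in> S \<Longrightarrow> h (x + y) = h x + h y"
    "\<And>x. x \<in> S \<Longrightarrow> h (- x) = - h x" "\<And>x y. x \<in> S \<Longrightarrow> y \<in> S \<Longrightarrow> h (x - y) = h x - h y"
proof -
  note S = add_subgroupD[OF assms(2)]
  show add: "\<And>x y. x \<in> S \<Longrightarrow> y \<in> S \<Longrightarrow> h (x + y) = h x + h y"
    using assms(1) by (simp add: additive_on_def)
  have "h (0 + 0) = h 0 + h 0" using add S(1) by blast
  then show zero: "h 0 = 0" by simp
  show neg: "h (- x) = - h x" if "x \<in> S" for x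
    using add[OF that S(3)[OF that]] zero by (simp add: eq_neg_iff_add_eq_0 add.commute)
  show "h (x - y) = h x - h y" if "x \<in> S" "y \<in> S" for x y
    using add[OF that(1) S(3)[OF that(2)]] neg[OF that(2)] by simp
qed

lemma additive_onI: "(\<And>x y. x \<in> S \<Longrightarrow> y \<in> S \<Longrightarrow> h (x + y) = h x + h y) \<Longrightarrow> additive_on S h"
  by (simp add: additive_on_def)

lemma additive_on_subset: "additive_on S h \<Longrightarrow> S' \<subseteq> S \<Longrightarrow> additive_on S' h"
  by (auto simp: additive_on_def)

lemma additive_on_inj:
  assumes "add_subgroup S" "additive_on S h" "\<And>x. x \<in> S \<Longrightarrow> h x = 0 \<Longrightarrow> x = 0"
  shows "inj_on h S"
proof (rule inj_onI)
  fix x y assume xy: "x \<in> S" "y \<in> S" "h x = h y"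
  then have "h (x - y) = 0" using additive_onD(4)[OF assms(2,1)] by simp
  then show "x = y" using assms(3) add_subgroupD(4)[OF assms(1) xy(1,2)] by force
qed

lemma card_image_kernel:
  assumes "finite S" and S: "add_subgroup S" and h: "additive_on S h"
  shows "card S = card (h ` S) * card {s \<in> S. h s = 0}"
proof -
  note Sd = add_subgroupD[OF S] and hd = additive_onD[OF h S]
  have fib: "card {s \<in> S. h s = y} = card {s \<in> S. h s = 0}" if "y \<in> h ` S" for y
  proof -
    from that obtain t where t: "t \<in> S" "y = h t" by blast
    have "bij_betw (\<lambda>s. s + t) {s \<in> S. h s = 0} {s \<in> S. h s = y}"
    proof (rule bij_betwI[where g = "\<lambda>s. s - t"])
      show "(\<lambda>s. s + t) \<in> {s \<in> S. h s = 0} \<rightarrow> {s \<in> S. h s = y}"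
        using t Sd(2) hd(2) by simp
      show "(\<lambda>s. s - t) \<in> {s \<in> S. h s = y} \<rightarrow> {s \<in> S. h s = 0}"
        using t Sd(4) hd(4) by simp
    qed auto
    then show ?thesis by (rule bij_betw_same_card[symmetric])
  qed
  have "card S = (\<Sum>y\<in>h ` S. card {s \<in> S. h s = y})"
    using sum.image_gen[OF assms(1), of "\<lambda>_. 1::nat" h] by simp
  also have "\<dots> = card (h ` S) * card {s \<in> S. h s = 0}"
    by (simp add: fib)
  finally show ?thesis .
qed

text \<open>Addition maps \<open>A \<times> B\<close> onto \<open>N\<close>, and its kernel is the
  antidiagonal copy of \<open>A \<inter> B\<close>.\<close>

lemma card_sum_inter:
  assumes "finite N" "add_subgroup N" "add_subgroup A" "add_subgroup B" "A \<subseteq> N" "B \<subseteq> N"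
    and sum: "\<And>n. n \<in> N \<Longrightarrow> \<exists>a\<in>A. \<exists>b\<in>B. n = a + b"
  shows "card N * card (A \<inter> B) = card A * card B"
proof -
  note A = add_subgroupD[OF assms(3)] and B = add_subgroupD[OF assms(4)]
  have fA: "finite A" using assms(5,1) by (rule finite_subset)
  have fB: "finite B" using assms(6,1) by (rule finite_subset)
  let ?P = "A \<times> B" and ?h = "\<lambda>p. fst p + snd p"
  have P: "add_subgroup ?P"
    using A B by (auto intro!: add_subgroupI simp: zero_prod_def)
  have h: "additive_on ?P ?h" by (auto intro!: additive_onI simp: algebra_simps)
  have "?h ` ?P = N"
  proof
    show "?h ` ?P \<subseteq> N" using assms(5,6) add_subgroupD(2)[OF assms(2)] by (auto simp: subset_iff)
    show "N \<subseteq> ?h ` ?P" using sum by force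
  qed
  moreover have "card {p \<in> ?P. ?h p = 0} = card (A \<inter> B)"
  proof -
    have "bij_betw (\<lambda>x. (x, - x)) (A \<inter> B) {p \<in> ?P. ?h p = 0}"
    proof (rule bij_betwI[where g = fst])
      show "fst \<in> {p \<in> A \<times> B. fst p + snd p = 0} \<rightarrow> A \<inter> B"
      proof
        fix p assume "p \<in> {p \<in> A \<times> B. fst p + snd p = 0}"
        then have "fst p \<in> A" "snd p \<in> B" "fst p = - snd p" by (auto simp: eq_neg_iff_add_eq_0)
        then show "fst p \<in> A \<inter> B" using B(3) by auto
      qed
    qed (use B in \<open>auto simp: neg_eq_iff_add_eq_0\<close>)
    then show ?thesis by (rule bij_betw_same_card[symmetric])
  qed
  ultimately show ?thesis
    using card_image_kernel[OF _ P h] fA fB by (simp add: card_cartesian_product)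
qed

section \<open>Fitting components of self-maps of finite sets\<close>

text \<open>For a self-map of a finite set the images stabilise, and \<open>fit T N\<close> is the
  largest subset that \<open>T\<close> permutes. For additive \<open>T\<close> it is the Fitting
  component on which \<open>T\<close> is bijective. Taking the intersection of all images avoids
  naming the stage at which they stabilise.\<close>

definition fit :: "('a \<Rightarrow> 'a) \<Rightarrow> 'a set \<Rightarrow> 'a set"
  where "fit T N = (\<Inter>k. (T ^^ k) ` N)"

lemma funpow_maps: "T ` N \<subseteq> N \<Longrightarrow> x \<in> N \<Longrightarrow> (T ^^ k) x \<in> N"
  by (induction k) auto

lemma funpow_anti:
  assumes "T ` N \<subseteq> N" and "j \<le> k"
  shows "(T ^^ k) ` N \<subseteq> (T ^^ j) ` N"
proof
  fix y assume "y \<in> (T ^^ k) ` N"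
  then obtain x where x: "x \<in> N" "y = (T ^^ k) x" by blast
  have "(T ^^ k) x = (T ^^ j) ((T ^^ (k - j)) x)"
    using assms(2) by (metis comp_apply funpow_add le_add_diff_inverse)
  then show "y \<in> (T ^^ j) ` N" using x funpow_maps[OF assms(1) x(1)] by simp
qed

lemma fit_subset_funpow: "fit T N \<subseteq> (T ^^ k) ` N"
  unfolding fit_def by blast

lemma fit_subset: "fit T N \<subseteq> N"
  using fit_subset_funpow[of T N 0] by simp

lemma fit_eventually:
  assumes "finite N" and T: "T ` N \<subseteq> N"
  shows "\<exists>K. \<forall>k\<ge>K. (T ^^ k) ` N = fit T N"
proof -
  let ?c = "\<lambda>k. card ((T ^^ k) ` N)"
  have "\<exists>K. \<forall>k. ?c K \<le> ?c k"
    using ex_has_least_nat[of "\<lambda>_. True" 0 ?c] by blast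
  then obtain K where K: "\<And>k. ?c K \<le> ?c k" by blast
  have eq: "(T ^^ k) ` N = (T ^^ K) ` N" if "k \<ge> K" for k
    by (rule card_seteq) (use assms(1) funpow_anti[OF T that] K in auto)
  have "(T ^^ K) ` N \<subseteq> (T ^^ k) ` N" for k
  proof (cases "k \<ge> K")
    case True then show ?thesis using eq[OF True] by simp
  next
    case False then show ?thesis by (intro funpow_anti[OF T]) simp
  qed
  then have "(T ^^ K) ` N \<subseteq> fit T N" unfolding fit_def by blast
  then have "fit T N = (T ^^ K) ` N" using fit_subset_funpow[of T N K] by (rule equalityI[rotated])
  then have "\<forall>k\<ge>K. (T ^^ k) ` N = fit T N" using eq by metis
  then show ?thesis by blast
qed

lemma fit_image:
  assumes "finite N" and T: "T ` N \<subseteq> N"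
  shows "T ` fit T N = fit T N"
proof -
  obtain K where K: "\<forall>k\<ge>K. (T ^^ k) ` N = fit T N"
    using fit_eventually[OF assms] by blast
  have "T ` ((T ^^ K) ` N) = (T ^^ Suc K) ` N" by (simp add: image_image)
  moreover have "(T ^^ K) ` N = fit T N" "(T ^^ Suc K) ` N = fit T N"
    using K le_SucI[OF order_refl, of K] by blast+
  ultimately show ?thesis by metis
qed

lemma fit_inj:
  assumes "finite N" and T: "T ` N \<subseteq> N"
  shows "inj_on T (fit T N)"
proof (rule eq_card_imp_inj_on)
  show "finite (fit T N)" using fit_subset assms(1) by (rule finite_subset)
  show "card (T ` fit T N) = card (fit T N)" by (simp add: fit_image[OF assms])
qed

text \<open>\<open>T\<close> is injective on the finite set \<open>fit T N\<close>, so a subset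
  mapped into itself is mapped onto itself.\<close>

lemma stable_subset_fit:
  assumes "finite N" and T: "T ` N \<subseteq> N" and D: "D \<subseteq> fit T N" "T ` D \<subseteq> D"
  shows "(T ^^ k) ` D = D"
proof -
  have "D \<subseteq> N" using D(1) fit_subset[of T N] by (rule subset_trans)
  then have fD: "finite D" using assms(1) by (rule finite_subset)
  have "inj_on T D" using fit_inj[OF assms(1) T] D(1) by (rule inj_on_subset)
  then have *: "T ` D = D"
    using D(2) fD by (intro card_subset_eq) (auto simp: card_image)
  show "(T ^^ k) ` D = D"
  proof (induction k)
    case (Suc k)
    have "(T ^^ Suc k) ` D = T ` ((T ^^ k) ` D)" by (simp add: image_image)
    then show ?case by (simp add: Suc *)
  qed simp
qed

lemma fit_sub:
  assumes "finite N" and T: "T ` N \<subseteq> N" and N': "N' \<subseteq> N" "T ` N' \<subseteq> N'"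
  shows "fit T N' = fit T N \<inter> N'"
proof
  have "fit T N' \<subseteq> (T ^^ k) ` N" for k
    using fit_subset_funpow[of T N' k] N'(1) by blast
  then show "fit T N' \<subseteq> fit T N \<inter> N'"
    using fit_subset[of T N'] unfolding fit_def[of T N] by blast
  have "T ` (fit T N \<inter> N') \<subseteq> fit T N \<inter> N'"
    using fit_image[OF assms(1) T] N'(2) by blast
  then have "(T ^^ k) ` (fit T N \<inter> N') = fit T N \<inter> N'" for k
    by (intro stable_subset_fit[OF assms(1) T]) auto
  then have "fit T N \<inter> N' \<subseteq> (T ^^ k) ` N'" for k by blast
  then show "fit T N \<inter> N' \<subseteq> fit T N'" unfolding fit_def[of T N'] by blast
qed

lemma funpow_cong_on:
  assumes "T ` N \<subseteq> N" "\<And>x. x \<in> N \<Longrightarrow> T x = T' x" "x \<in> N"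
  shows "(T ^^ k) x = (T' ^^ k) x"
proof (induction k)
  case (Suc k)
  have "T ((T ^^ k) x) = T' ((T ^^ k) x)" using assms(2) funpow_maps[OF assms(1,3)] by blast
  then show ?case using Suc by simp
qed simp

lemma fit_cong:
  assumes "T ` N \<subseteq> N" "\<And>x. x \<in> N \<Longrightarrow> T x = T' x"
  shows "fit T N = fit T' N"
proof -
  have "(T ^^ k) ` N = (T' ^^ k) ` N" for k
    using funpow_cong_on[OF assms] by (intro image_cong) auto
  then show ?thesis by (simp add: fit_def)
qed

text \<open>For groups this is the case of an operator that is zero on \<open>N/N'\<close>: such a
  factor contributes nothing to the Fitting component. Its companion, for an operator that is the
  identity on the factor, is \<open>fit_unipotent\<close>.\<close>

lemma fit_nilpotent:
  assumes "finite N" and N': "N' \<subseteq> N" and T: "T ` N \<subseteq> N'"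
  shows "fit T N = fit T N'"
proof -
  have TN: "T ` N \<subseteq> N" "T ` N' \<subseteq> N'" using N' T by blast+
  have "fit T N = T ` fit T N" by (simp add: fit_image[OF assms(1) TN(1)])
  then have "fit T N \<subseteq> N'" using fit_subset[of T N] T by blast
  then show ?thesis using fit_sub[OF assms(1) TN(1) N' TN(2)] by blast
qed

lemma fit_power:
  assumes "finite N" and T: "T ` N \<subseteq> N" and "m > 0"
  shows "fit (T ^^ m) N = fit T N"
proof -
  obtain K where K: "\<forall>k\<ge>K. (T ^^ k) ` N = fit T N"
    using fit_eventually[OF assms(1,2)] by blast
  have "(T ^^ m) ` N \<subseteq> N" using funpow_maps[OF T] by blast
  then obtain J where J: "\<forall>k\<ge>J. ((T ^^ m) ^^ k) ` N = fit (T ^^ m) N"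
    using fit_eventually[OF assms(1)] by blast
  have "fit (T ^^ m) N = ((T ^^ m) ^^ max J K) ` N" using J by simp
  also have "\<dots> = (T ^^ (m * max J K)) ` N" by (simp add: funpow_mult)
  also have "\<dots> = fit T N"
  proof -
    have "K \<le> max J K" by simp
    also have "\<dots> \<le> m * max J K" using assms(3) by (cases m) auto
    finally have "K \<le> m * max J K" .
    then show ?thesis using K by blast
  qed
  finally show ?thesis .
qed

lemma fit_idem:
  assumes T: "T ` N \<subseteq> N" "\<And>x. x \<in> N \<Longrightarrow> T (T x) = T x"
  shows "fit T N = T ` N"
proof
  show "fit T N \<subseteq> T ` N" using fit_subset_funpow[of T N 1] by simp
  have "T ` N \<subseteq> (T ^^ k) ` N" for k
  proof (induction k)
    case (Suc k)
    have "T ` N = T ` (T ` N)" using T(2) by (simp add: image_image)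
    also have "\<dots> \<subseteq> T ` ((T ^^ k) ` N)" using Suc by (rule image_mono)
    finally show ?case by (simp add: image_image)
  qed (use T in simp)
  then show "T ` N \<subseteq> fit T N" unfolding fit_def by blast
qed

lemma funpow_comp_swap: "(v \<circ> u) ^^ k \<circ> v = v \<circ> (u \<circ> v) ^^ k"
proof (induction k)
  case (Suc k)
  have "(v \<circ> u) ^^ Suc k \<circ> v = v \<circ> u \<circ> ((v \<circ> u) ^^ k \<circ> v)" by (simp add: comp_assoc)
  also have "\<dots> = v \<circ> (u \<circ> v) ^^ Suc k" unfolding Suc by (simp add: comp_assoc)
  finally show ?case .
qed simp

text \<open>\<open>y\<close> carries the Fitting component of \<open>x \<circ> y\<close> injectively
  into that of \<open>y \<circ> x\<close>, and \<open>x\<close> does the converse; finiteness makes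
  both maps bijective. It will be applied to two skew-adjoint operators, for which
  \<open>y \<circ> x\<close> is the adjoint of \<open>x \<circ> y\<close>.\<close>

lemma fit_swap:
  assumes "finite N" and x: "x ` N \<subseteq> N" and y: "y ` N \<subseteq> N"
  shows "y ` fit (x \<circ> y) N = fit (y \<circ> x) N" "card (fit (x \<circ> y) N) = card (fit (y \<circ> x) N)"
proof -
  have sub: "v ` fit (u \<circ> v) N \<subseteq> fit (v \<circ> u) N"
    if "u ` N \<subseteq> N" "v ` N \<subseteq> N" for u v
  proof -
    have "v ` fit (u \<circ> v) N \<subseteq> ((v \<circ> u) ^^ k) ` N" for k
    proof -
      have "v ` fit (u \<circ> v) N \<subseteq> v ` (((u \<circ> v) ^^ k) ` N)"
        using fit_subset_funpow by (rule image_mono)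
      also have "\<dots> = ((v \<circ> u) ^^ k \<circ> v) ` N" by (simp only: funpow_comp_swap image_comp)
      also have "\<dots> \<subseteq> ((v \<circ> u) ^^ k) ` N" using that by (auto simp: image_comp[symmetric])
      finally show ?thesis .
    qed
    then show ?thesis unfolding fit_def[of "v \<circ> u"] by blast
  qed
  have fin: "finite (fit T N)" for T using fit_subset[of T N] assms(1) by (rule finite_subset)
  have inj: "inj_on v (fit (u \<circ> v) N)" if "u ` N \<subseteq> N" "v ` N \<subseteq> N" for u v
  proof -
    have "(u \<circ> v) ` N \<subseteq> N" using that by auto
    then show ?thesis using fit_inj[OF assms(1)] by (blast intro: inj_on_imageI2)
  qed
  have le: "card (fit (x \<circ> y) N) \<le> card (fit (y \<circ> x) N)"
    using inj[OF x y] sub[OF x y] fin by (rule card_inj_on_le)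
  moreover have "card (fit (y \<circ> x) N) \<le> card (fit (x \<circ> y) N)"
    using inj[OF y x] sub[OF y x] fin by (rule card_inj_on_le)
  ultimately show eq: "card (fit (x \<circ> y) N) = card (fit (y \<circ> x) N)" by simp
  show "y ` fit (x \<circ> y) N = fit (y \<circ> x) N"
    using fin sub[OF x y] by (rule card_subset_eq) (simp add: card_image[OF inj[OF x y]] eq)
qed

lemma additive_on_funpow:
  assumes "additive_on N T" "T ` N \<subseteq> N"
  shows "additive_on N (T ^^ k)"
proof (induction k)
  case (Suc k)
  show ?case
    using Suc assms(1) funpow_maps[OF assms(2)] by (simp add: additive_on_def)
qed (simp add: additive_on_def)

lemma add_subgroup_image:
  assumes "add_subgroup N" "additive_on N T"
  shows "add_subgroup (T ` N)"
proof (rule add_subgroupI)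
  note N = add_subgroupD[OF assms(1)] and T = additive_onD[OF assms(2,1)]
  show "0 \<in> T ` N" using T(1) N(1) by force
  show "x + y \<in> T ` N" if xy: "x \<in> T ` N" "y \<in> T ` N" for x y
  proof -
    obtain a b where "a \<in> N" "b \<in> N" "x = T a" "y = T b" using xy by blast
    then show ?thesis using T(2)[of a b] N(2)[of a b] by (metis imageI)
  qed
  show "- x \<in> T ` N" if x: "x \<in> T ` N" for x
  proof -
    obtain a where "a \<in> N" "x = T a" using x by blast
    then show ?thesis using T(3)[of a] N(3)[of a] by (metis imageI)
  qed
qed

lemma add_subgroup_fit:
  assumes "finite N" "add_subgroup N" "additive_on N T" "T ` N \<subseteq> N"
  shows "add_subgroup (fit T N)"
proof -
  obtain K where K: "\<forall>k\<ge>K. (T ^^ k) ` N = fit T N"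
    using fit_eventually[OF assms(1,4)] by blast
  then have "fit T N = (T ^^ K) ` N" by simp
  then show ?thesis
    using add_subgroup_image[OF assms(2) additive_on_funpow[OF assms(3,4)]] by simp
qed

text \<open>Each \<open>n\<close> differs by an element of \<open>N'\<close> from a high iterate of
  itself, and that iterate lies in the Fitting component. So \<open>N\<close> is the sum of
  \<open>fit T N\<close> and \<open>N'\<close>, and \<open>fit_sub\<close> identifies their
  intersection.\<close>

lemma fit_unipotent:
  assumes "finite N" "add_subgroup N" "additive_on N T" "T ` N \<subseteq> N"
    and N': "N' \<subseteq> N" "add_subgroup N'" and one: "\<And>x. x \<in> N \<Longrightarrow> T x - x \<in> N'"
  shows "card (fit T N) * card N' = card (fit T N') * card N"
proof -
  note d' = add_subgroupD[OF N'(2)] and d = add_subgroupD[OF assms(2)]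
  obtain K where K: "\<forall>k\<ge>K. (T ^^ k) ` N = fit T N"
    using fit_eventually[OF assms(1,4)] by blast
  have Tk: "(T ^^ k) x - x \<in> N'" if "x \<in> N" for k x
  proof (induction k)
    case (Suc k)
    have "T ((T ^^ k) x) - (T ^^ k) x \<in> N'"
      using one funpow_maps[OF assms(4) that] by blast
    from d'(2)[OF this Suc] show ?case by simp
  qed (simp add: d'(1))
  have TN': "T ` N' \<subseteq> N'"
  proof clarify
    fix x assume x: "x \<in> N'"
    then have "T x - x \<in> N'" using one N'(1) by blast
    from d'(2)[OF this x] show "T x \<in> N'" by simp
  qed
  have "card N * card (fit T N \<inter> N') = card (fit T N) * card N'"
  proof (rule card_sum_inter[OF assms(1,2) add_subgroup_fit[OF assms(1-4)] N'(2) fit_subset N'(1)])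
    fix n assume n: "n \<in> N"
    have "(T ^^ K) n \<in> fit T N" using K n by auto
    moreover have "n - (T ^^ K) n \<in> N'" using d'(3)[OF Tk[OF n, of K]] by simp
    ultimately show "\<exists>a\<in>fit T N. \<exists>b\<in>N'. n = a + b"
      by (intro bexI[of _ "(T ^^ K) n"] bexI[of _ "n - (T ^^ K) n"]) auto
  qed
  then show ?thesis
    using fit_sub[OF assms(1,4) N'(1) TN'] by (simp add: mult.commute)
qed

section \<open>Pairings of finite vector spaces\<close>

locale finite_field_space = vector_space scale
  for scale :: "'f::{field,finite} \<Rightarrow> 'v::ab_group_add \<Rightarrow> 'v"
begin

lemma subspace_add_subgroup: "subspace S \<Longrightarrow> add_subgroup S"
  by (auto intro!: add_subgroupI subspace_0 subspace_add subspace_neg)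

definition bilinear_on :: "'v set \<Rightarrow> 'v set \<Rightarrow> ('v \<Rightarrow> 'v \<Rightarrow> 'f) \<Rightarrow> bool"
  where "bilinear_on A B f \<longleftrightarrow>
    (\<forall>a\<in>A. \<forall>a'\<in>A. \<forall>b\<in>B. f (a + a') b = f a b + f a' b) \<and>
    (\<forall>c. \<forall>a\<in>A. \<forall>b\<in>B. f (scale c a) b = c * f a b) \<and>
    (\<forall>a\<in>A. \<forall>b\<in>B. \<forall>b'\<in>B. f a (b + b') = f a b + f a b') \<and>
    (\<forall>c. \<forall>a\<in>A. \<forall>b\<in>B. f a (scale c b) = c * f a b)"

lemma bilinear_onD:
  assumes "bilinear_on A B f"
  shows "\<And>a a' b. a \<in> A \<Longrightarrow> a' \<in> A \<Longrightarrow> b \<in> B \<Longrightarrow> f (a + a') b = f a b + f a' b"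
    "\<And>c a b. a \<in> A \<Longrightarrow> b \<in> B \<Longrightarrow> f (scale c a) b = c * f a b"
    "\<And>a b b'. a \<in> A \<Longrightarrow> b \<in> B \<Longrightarrow> b' \<in> B \<Longrightarrow> f a (b + b') = f a b + f a b'"
    "\<And>c a b. a \<in> A \<Longrightarrow> b \<in> B \<Longrightarrow> f a (scale c b) = c * f a b"
  using assms by (auto simp: bilinear_on_def)

lemma bilinear_on_zero:
  assumes "bilinear_on A B f" "a \<in> A" "b \<in> B"
  shows "f 0 b = 0" "f a 0 = 0" "f (- a) b = - f a b" "f a (- b) = - f a b"
  using bilinear_onD(2,4)[OF assms(1) assms(2,3), of 0]
    bilinear_onD(2,4)[OF assms(1) assms(2,3), of "-1"] by auto

lemma bilinear_on_diff:
  assumes "bilinear_on A B f" "subspace A" "subspace B"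
  shows "a \<in> A \<Longrightarrow> a' \<in> A \<Longrightarrow> b \<in> B \<Longrightarrow> f (a - a') b = f a b - f a' b"
    "a \<in> A \<Longrightarrow> b \<in> B \<Longrightarrow> b' \<in> B \<Longrightarrow> f a (b - b') = f a b - f a b'"
  using bilinear_onD(1)[OF assms(1), of a "- a'" b] bilinear_onD(3)[OF assms(1), of a b "- b'"]
    bilinear_on_zero[OF assms(1)] subspace_neg[OF assms(2)] subspace_neg[OF assms(3)] by auto

lemma bilinear_on_subset: "bilinear_on A B f \<Longrightarrow> A' \<subseteq> A \<Longrightarrow> B' \<subseteq> B \<Longrightarrow> bilinear_on A' B' f"
  unfolding bilinear_on_def by (meson subsetD)

lemma bilinear_on_swap: "bilinear_on A B f \<Longrightarrow> bilinear_on B A (\<lambda>b a. f a b)"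
  unfolding bilinear_on_def by simp

lemma subspace_annihilator:
  assumes "bilinear_on A B f" "subspace B" "S \<subseteq> A"
  shows "subspace {b \<in> B. \<forall>a\<in>S. f a b = 0}"
  unfolding subspace_def
  using assms(3) subspace_0[OF assms(2)] subspace_add[OF assms(2)] subspace_scale[OF assms(2)]
    bilinear_onD(3,4)[OF assms(1)] bilinear_on_zero(2)[OF assms(1)]
  by (auto simp: subset_iff)

definition extend :: "'v set \<Rightarrow> 'v \<Rightarrow> 'v set"
  where "extend S v = {s + scale c v | s c. s \<in> S}"

lemma extendI: "s \<in> S \<Longrightarrow> s + scale c v \<in> extend S v"
  by (auto simp: extend_def)

lemma extendE:
  assumes "x \<in> extend S v"
  obtains s c where "s \<in> S" "x = s + scale c v"
  using assms by (auto simp: extend_def)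

lemma subspace_extend:
  assumes "subspace S"
  shows "subspace (extend S v)"
proof (rule subspaceI)
  show "0 \<in> extend S v" using extendI[OF subspace_0[OF assms], of 0 v] by simp
  show "x + y \<in> extend S v" if xy: "x \<in> extend S v" "y \<in> extend S v" for x y
  proof -
    obtain s c where s: "s \<in> S" "x = s + scale c v" using xy(1) by (rule extendE)
    obtain s' c' where s': "s' \<in> S" "y = s' + scale c' v" using xy(2) by (rule extendE)
    have "x + y = (s + s') + scale (c + c') v"
      unfolding s s' by (simp add: scale_left_distrib)
    then show ?thesis using extendI[OF subspace_add[OF assms s(1) s'(1)], of "c + c'" v] by simp
  qed
  show "scale d x \<in> extend S v" if x: "x \<in> extend S v" for d x
  proof -
    obtain s c where s: "s \<in> S" "x = s + scale c v" using x by (rule extendE)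
    have "scale d x = scale d s + scale (d * c) v"
      unfolding s by (simp add: scale_right_distrib)
    then show ?thesis using extendI[OF subspace_scale[OF assms s(1)], of d "d * c" v] by simp
  qed
qed

lemma extend_props:
  assumes "subspace S"
  shows "S \<subseteq> extend S v" "v \<in> extend S v"
    "subspace A \<Longrightarrow> S \<subseteq> A \<Longrightarrow> v \<in> A \<Longrightarrow> extend S v \<subseteq> A"
proof -
  show "S \<subseteq> extend S v" using extendI[of _ S 0 v] by auto
  show "v \<in> extend S v" using extendI[OF subspace_0[OF assms], of 1 v] by simp
  show "extend S v \<subseteq> A" if "subspace A" "S \<subseteq> A" "v \<in> A"
  proof
    fix x assume "x \<in> extend S v"
    then obtain s c where s: "s \<in> S" "x = s + scale c v" by (rule extendE)
    show "x \<in> A" unfolding s(2) using that s(1) by (intro subspace_add subspace_scale) auto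
  qed
qed

lemma card_extend:
  assumes S: "subspace S" and "finite S" "v \<notin> S"
  shows "card (extend S v) = card (UNIV :: 'f set) * card S"
proof -
  have "bij_betw (\<lambda>(c, s). s + scale c v) (UNIV \<times> S) (extend S v)"
    unfolding bij_betw_def
  proof
    show "(\<lambda>(c, s). s + scale c v) ` (UNIV \<times> S) = extend S v"
      by (auto simp: extend_def)
    show "inj_on (\<lambda>(c, s). s + scale c v) (UNIV \<times> S)"
    proof (rule inj_onI, clarsimp)
      fix c s c' s' assume s: "s \<in> S" "s' \<in> S" and eq: "s + scale c v = s' + scale c' v"
      then have e: "scale (c - c') v = s' - s" by (simp add: algebra_simps)
      have "c = c'"
      proof (rule ccontr)
        assume "c \<noteq> c'"
        then have "v = scale (inverse (c - c')) (s' - s)"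
          unfolding e[symmetric] by simp
        then show False using s assms(3) by (metis S subspace_diff subspace_scale)
      qed
      then show "c = c' \<and> s = s'" using eq by simp
    qed
  qed
  from bij_betw_same_card[OF this] show ?thesis by (simp add: card_cartesian_product)
qed

text \<open>Let q be the order of the field. Adjoining one vector to \<open>S\<close> multiplies the
  order of \<open>S\<close> by q and divides the order of its annihilator by at most q. The product
  of the two orders therefore never decreases while \<open>S0\<close> grows to
  \<open>A\<close>.\<close>

lemma pairing_card_le:
  assumes f: "bilinear_on A B f" and A: "subspace A" "finite A" and B: "subspace B" "finite B"
    and S0: "subspace S0" "S0 \<subseteq> A"
  shows "card {b \<in> B. \<forall>a\<in>S0. f a b = 0} * card S0 \<le> card {b \<in> B. \<forall>a\<in>A. f a b = 0} * card A"
proof -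
  let ?P = "\<lambda>S. {b \<in> B. \<forall>a\<in>S. f a b = 0}"
  let ?good = "\<lambda>S. subspace S \<and> S \<subseteq> A \<and> card (?P S0) * card S0 \<le> card (?P S) * card S"
  \<comment> \<open>The bound in \<open>ex_has_greatest_nat\<close> is strict, hence the
    \<open>Suc\<close>; the same device recurs in all later maximality arguments over subspaces of a
    finite space.\<close>
  have "\<exists>S. ?good S \<and> (\<forall>S'. ?good S' \<longrightarrow> card S' \<le> card S)"
    by (rule ex_has_greatest_nat[where k = S0 and b = "Suc (card A)"])
      (use S0 A in \<open>auto simp: less_Suc_eq_le intro: card_mono\<close>)
  then obtain S where S: "?good S" and max: "\<And>S'. ?good S' \<Longrightarrow> card S' \<le> card S" by blast
  have "S = A"
  proof (rule ccontr)
    assume "S \<noteq> A"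
    then obtain v where v: "v \<in> A" "v \<notin> S" using S by blast
    have fS: "finite S" using S A(2) finite_subset by auto
    note ext = extend_props[of S] card_extend[of S v]
    let ?S' = "extend S v"
    have PS: "subspace (?P S)" using subspace_annihilator[OF f B(1)] S by blast
    have "card (?P S) = card (f v ` ?P S) * card {b \<in> ?P S. f v b = 0}"
      by (rule card_image_kernel)
        (use B PS f v in \<open>auto simp: additive_on_def bilinear_on_def intro: subspace_add_subgroup\<close>)
    moreover have "{b \<in> ?P S. f v b = 0} = ?P ?S'"
    proof
      show "{b \<in> ?P S. f v b = 0} \<subseteq> ?P ?S'"
      proof (clarsimp simp: extend_def)
        fix b s c assume "b \<in> B" "\<forall>a\<in>S. f a b = 0" "f v b = 0" "s \<in> S"
        then show "f (s + scale c v) b = 0"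
          using bilinear_onD(1,2)[OF f] v S A subspace_scale by auto
      qed
      show "?P ?S' \<subseteq> {b \<in> ?P S. f v b = 0}" using ext S by blast
    qed
    moreover have "card (f v ` ?P S) \<le> card (UNIV :: 'f set)" by (simp add: card_mono)
    ultimately have "card (?P S) \<le> card (UNIV :: 'f set) * card (?P ?S')" by simp
    then have "card (?P S) * card S \<le> card (?P ?S') * card ?S'"
      using ext(4) S fS v by (simp add: mult.commute mult.left_commute)
    then have "?good ?S'"
      using S subspace_extend[of S v] ext(3)[of A v] A(1) v(1) by auto
    from max[OF this] ext(4) S fS v have "card (UNIV :: 'f set) * card S \<le> card S" by simp
    moreover have "card S > 0" using fS S subspace_0[of S] by (auto simp: card_gt_0_iff)
    moreover have "card {0, 1 :: 'f} \<le> card (UNIV :: 'f set)" by (rule card_mono) auto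
    ultimately show False by simp
  qed
  then show ?thesis using S by auto
qed

text \<open>For \<open>S0\<close> the left radical, the annihilator of \<open>S0\<close> is all of
  \<open>B\<close>, and \<open>pairing_card_le\<close> gives one inequality. Exchanging the two
  sides gives the other.\<close>

lemma pairing_card:
  assumes f: "bilinear_on A B f" and A: "subspace A" "finite A" and B: "subspace B" "finite B"
  shows "card A * card {b \<in> B. \<forall>a\<in>A. f a b = 0} = card B * card {a \<in> A. \<forall>b\<in>B. f a b = 0}"
proof -
  have le: "card B * card {a \<in> A. \<forall>b\<in>B. f a b = 0} \<le> card A * card {b \<in> B. \<forall>a\<in>A. f a b = 0}"
    if f: "bilinear_on A B f" and A: "subspace A" "finite A" and B: "subspace B" "finite B"
    for A B f
  proof -
    let ?A0 = "{a \<in> A. \<forall>b\<in>B. f a b = 0}"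
    have "subspace ?A0"
      using subspace_annihilator[OF bilinear_on_swap[OF f] A(1) subset_refl] by simp
    moreover have "{b \<in> B. \<forall>a\<in>?A0. f a b = 0} = B" by auto
    ultimately show ?thesis
      using pairing_card_le[OF f A B, of ?A0] by (simp add: mult.commute)
  qed
  show ?thesis
    using le[OF f A B] le[OF bilinear_on_swap[OF f] B A] by simp
qed

lemma subspace_image:
  assumes "subspace N" "additive_on N T" "\<And>c x. x \<in> N \<Longrightarrow> T (scale c x) = scale c (T x)"
  shows "subspace (T ` N)"
  unfolding subspace_def
  using add_subgroupD[OF add_subgroup_image[OF subspace_add_subgroup[OF assms(1)] assms(2)]]
    assms(3) subspace_scale[OF assms(1)]
  by (auto simp flip: assms(3))

definition linear_on :: "'v set \<Rightarrow> ('v \<Rightarrow> 'v) \<Rightarrow> bool"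
  where "linear_on N T \<longleftrightarrow> (\<forall>x\<in>N. T x \<in> N) \<and> additive_on N T \<and>
    (\<forall>c. \<forall>x\<in>N. T (scale c x) = scale c (T x))"

lemma linear_onI:
  assumes "\<And>x. x \<in> N \<Longrightarrow> T x \<in> N" "\<And>x y. x \<in> N \<Longrightarrow> y \<in> N \<Longrightarrow> T (x + y) = T x + T y"
    "\<And>c x. x \<in> N \<Longrightarrow> T (scale c x) = scale c (T x)"
  shows "linear_on N T"
  using assms by (simp add: linear_on_def additive_on_def)

lemma linear_onD:
  assumes "linear_on N T"
  shows "\<And>x. x \<in> N \<Longrightarrow> T x \<in> N" "additive_on N T"
    "\<And>c x. x \<in> N \<Longrightarrow> T (scale c x) = scale c (T x)"
    "\<And>x y. x \<in> N \<Longrightarrow> y \<in> N \<Longrightarrow> T (x + y) = T x + T y"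
  using assms by (auto simp: linear_on_def additive_on_def)

lemma linear_on_image: "linear_on N T \<Longrightarrow> T ` N \<subseteq> N"
  using linear_onD(1) by blast

lemma linear_on_more:
  assumes "linear_on N T" "subspace N"
  shows "T 0 = 0" "\<And>x. x \<in> N \<Longrightarrow> T (- x) = - T x"
    "\<And>x y. x \<in> N \<Longrightarrow> y \<in> N \<Longrightarrow> T (x - y) = T x - T y"
  using additive_onD[OF linear_onD(2)[OF assms(1)] subspace_add_subgroup[OF assms(2)]] by auto

lemma linear_on_sub: "linear_on N T \<Longrightarrow> N' \<subseteq> N \<Longrightarrow> (\<And>x. x \<in> N' \<Longrightarrow> T x \<in> N') \<Longrightarrow> linear_on N' T"
  by (auto simp: linear_on_def intro: additive_on_subset)

lemma linear_on_funpow: "linear_on N T \<Longrightarrow> linear_on N (T ^^ k)"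
  by (induction k) (auto simp: linear_on_def additive_on_def)

lemma subspace_fit:
  assumes "finite N" "subspace N" and T: "linear_on N T"
  shows "subspace (fit T N)"
proof -
  obtain K where "\<forall>k\<ge>K. (T ^^ k) ` N = fit T N"
    using fit_eventually[OF assms(1)] linear_on_image[OF T] by blast
  then have "fit T N = (T ^^ K) ` N" by simp
  then show ?thesis
    using subspace_image[OF assms(2), of "T ^^ K"] linear_onD[OF linear_on_funpow[OF T, of K]]
    by simp
qed

lemma funpow_adjoint:
  assumes "T ` A \<subseteq> A" "T' ` B \<subseteq> B"
    and "\<And>m m'. m \<in> A \<Longrightarrow> m' \<in> B \<Longrightarrow> f (T m) m' = f m (T' m')"
    and "m \<in> A" "m' \<in> B"
  shows "f ((T ^^ k) m) m' = f m ((T' ^^ k) m')"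
  using assms(4,5)
proof (induction k arbitrary: m m')
  case (Suc k)
  have "f ((T ^^ Suc k) m) m' = f (T ((T ^^ k) m)) m'" by simp
  also have "\<dots> = f ((T ^^ k) m) (T' m')"
    using assms(3) Suc.prems funpow_maps[OF assms(1)] by blast
  also have "\<dots> = f m ((T' ^^ k) (T' m'))" using Suc assms(2) by blast
  finally show ?case by (simp add: funpow_swap1)
qed simp

text \<open>The vectors of \<open>fit T A\<close> orthogonal to \<open>fit T' B\<close> form a set
  permuted by \<open>T\<close>. Such a \<open>z\<close> is thus a high iterate of another vector of
  this kind, and moving the iterate to the other side turns \<open>b\<close> into an element of
  \<open>fit T' B\<close>.\<close>

lemma fit_orthogonal:
  assumes "finite A" "finite B" and T: "T ` A \<subseteq> A" and T': "T' ` B \<subseteq> B"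
    and adj: "\<And>m m'. m \<in> A \<Longrightarrow> m' \<in> B \<Longrightarrow> f (T m) m' = f m (T' m')"
    and z: "z \<in> fit T A" "\<And>b. b \<in> fit T' B \<Longrightarrow> f z b = 0" and b: "b \<in> B"
  shows "f z b = 0"
proof -
  let ?Z = "{z \<in> fit T A. \<forall>b\<in>fit T' B. f z b = 0}"
  obtain K where K: "\<forall>k\<ge>K. (T' ^^ k) ` B = fit T' B"
    using fit_eventually[OF assms(2) T'] by blast
  have "(T ^^ K) ` ?Z = ?Z"
  proof (rule stable_subset_fit[OF assms(1) T])
    show "T ` ?Z \<subseteq> ?Z"
    proof clarify
      fix x assume x: "x \<in> fit T A" "\<forall>b\<in>fit T' B. f x b = 0"
      have "T x \<in> fit T A" using fit_image[OF assms(1) T] x(1) by blast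
      moreover have "f (T x) b = 0" if b: "b \<in> fit T' B" for b
      proof -
        have "T' b \<in> fit T' B" using fit_image[OF assms(2) T'] b by blast
        moreover have "f (T x) b = f x (T' b)"
          using adj x(1) fit_subset[of T A] fit_subset[of T' B] b by blast
        ultimately show ?thesis using x(2) by simp
      qed
      ultimately show "T x \<in> fit T A \<and> (\<forall>b\<in>fit T' B. f (T x) b = 0)" by blast
    qed
  qed auto
  then have "z \<in> (T ^^ K) ` ?Z" using z by auto
  then obtain z' where z': "z' \<in> ?Z" "z = (T ^^ K) z'" by blast
  have "f z b = f z' ((T' ^^ K) b)"
    unfolding z'(2) using z'(1) fit_subset[of T A] b
    by (intro funpow_adjoint[where f = f and A = A and B = B and T = T and T' = T'])
      (use T T' adj in auto)
  moreover have "(T' ^^ K) b \<in> fit T' B" using K b by blast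
  ultimately show ?thesis using z'(1) by auto
qed

text \<open>\<open>M\<close> modulo the annihilator of \<open>N\<close> is dual to \<open>N\<close>,
  with \<open>T\<close> corresponding to \<open>T'\<close>, and the Fitting component splits
  accordingly. Instead of a quotient, the pairing between \<open>fit T M\<close> and
  \<open>fit T' N\<close> is used: its right radical is zero, and its left radical is the Fitting
  component on the annihilator.\<close>

lemma fit_dual:
  assumes M: "subspace M" "finite M" and f: "bilinear_on M M f"
    and nondeg: "\<And>m. m \<in> M \<Longrightarrow> (\<And>m'. m' \<in> M \<Longrightarrow> f m' m = 0) \<Longrightarrow> m = 0"
    and T: "linear_on M T" and T': "linear_on M T'"
    and adj: "\<And>m m'. m \<in> M \<Longrightarrow> m' \<in> M \<Longrightarrow> f (T m) m' = f m (T' m')"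
    and N: "subspace N" "N \<subseteq> M" "T' ` N \<subseteq> N"
  shows "card (fit T M) = card (fit T {m \<in> M. \<forall>n\<in>N. f m n = 0}) * card (fit T' N)"
proof -
  let ?A = "fit T M" and ?B = "fit T' N" and ?P = "{m \<in> M. \<forall>n\<in>N. f m n = 0}"
  have fN: "finite N" using N(2) M(2) by (rule finite_subset)
  have T'N: "linear_on N T'" using linear_on_sub[OF T' N(2)] N(3) by blast
  have sub: "?A \<subseteq> M" "?B \<subseteq> N" by (rule fit_subset)+
  have fin: "finite ?A" "finite ?B" using sub M fN by (auto intro: finite_subset)
  have sA: "subspace ?A" and sB: "subspace ?B"
    using subspace_fit[OF M(2,1) T] subspace_fit[OF fN N(1) T'N] by auto
  have fAB: "bilinear_on ?A ?B f" using f sub N(2) by (intro bilinear_on_subset[OF f]) auto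
  have "card ?A * card {b \<in> ?B. \<forall>a\<in>?A. f a b = 0} = card ?B * card {a \<in> ?A. \<forall>b\<in>?B. f a b = 0}"
    by (rule pairing_card[OF fAB sA fin(1) sB fin(2)])
  moreover have "{b \<in> ?B. \<forall>a\<in>?A. f a b = 0} = {0}"
  proof
    show "{0} \<subseteq> {b \<in> ?B. \<forall>a\<in>?A. f a b = 0}"
      using subspace_0[OF sB] subspace_0[OF sA] bilinear_on_zero(2)[OF fAB] by auto
    show "{b \<in> ?B. \<forall>a\<in>?A. f a b = 0} \<subseteq> {0}"
    proof clarify
      fix b assume b: "b \<in> ?B" "\<forall>a\<in>?A. f a b = 0"
      have "f m b = 0" if "m \<in> M" for m
      proof (rule fit_orthogonal[where A = N and B = M and T = T' and T' = T and f = "\<lambda>x y. f y x"])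
        show "f m' (T' m) = f (T m') m" if "m \<in> N" "m' \<in> M" for m m'
          using adj[of m' m] that N(2) by auto
      qed (use fN M N b that linear_on_image[OF T] in auto)
      then show "b = 0" using nondeg b(1) sub N(2) by blast
    qed
  qed
  moreover have "{a \<in> ?A. \<forall>b\<in>?B. f a b = 0} = fit T ?P"
  proof -
    have "fit T ?P = ?A \<inter> ?P"
    proof (rule fit_sub[OF M(2) linear_on_image[OF T]])
      show "T ` ?P \<subseteq> ?P"
      proof clarify
        fix m assume m: "m \<in> M" "\<forall>n\<in>N. f m n = 0"
        have "f (T m) n = 0" if "n \<in> N" for n
          using adj[of m n] m N(2,3) that by (auto simp: subset_iff image_subset_iff)
        then show "T m \<in> M \<and> (\<forall>n\<in>N. f (T m) n = 0)" using linear_onD(1)[OF T m(1)] by blast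
      qed
    qed auto
    moreover have "f a n = 0" if "a \<in> ?A" "\<forall>b\<in>?B. f a b = 0" "n \<in> N" for a n
    proof (rule fit_orthogonal[where A = M and B = N and T = T and T' = T'])
      show "f (T m) m' = f m (T' m')" if "m \<in> M" "m' \<in> N" for m m'
        using adj[of m m'] that N(2) by auto
    qed (use fN M N that linear_on_image[OF T] in auto)
    ultimately show ?thesis using sub by blast
  qed
  ultimately show ?thesis by (simp add: mult.commute)
qed

end

section \<open>Traces and characteristic polynomials\<close>

text \<open>A generator \<open>\<alpha>\<close> makes the field the image of the integral
  polynomials under evaluation at \<open>\<alpha>\<close>. This is how matrices are lifted to
  characteristic zero.\<close>

lemma finite_field_generator: "\<exists>\<alpha>::'f::{field,finite}. \<forall>y. y \<noteq> 0 \<longrightarrow> (\<exists>k::nat. y = \<alpha> ^ k)"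
proof -
  let ?K = "ring_of_type_algebra :: 'f ring"
  interpret K: field ?K by (rule field_class.field_from_type_algebra)
  have pow: "x [^]\<^bsub>mult_of ?K\<^esub> k = x ^ k" for x :: 'f and k :: nat
    by (induction k) (auto simp: ring_of_type_algebra_def nat_pow_def mult_of_def)
  have "finite (carrier ?K)" by (rule finite_subset[OF subset_UNIV finite])
  from K.finite_field_mult_group_has_gen[OF this]
  obtain a where "carrier (mult_of ?K) = {a [^]\<^bsub>mult_of ?K\<^esub> i | i::nat. i \<in> UNIV}"
    by (auto simp: nat_pow_mult_of)
  moreover have "carrier (mult_of ?K) = UNIV - {0 :: 'f}"
    by (simp add: ring_of_type_algebra_def mult_of_def)
  ultimately have "UNIV - {0} = {a ^ i | i::nat. True}" by (simp add: pow)
  then show ?thesis by blast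
qed

definition mtrace :: "'a::comm_monoid_add mat \<Rightarrow> 'a"
  where "mtrace A = (\<Sum>i<dim_row A. A $$ (i, i))"

lemma mtrace_mult_commute:
  assumes "A \<in> carrier_mat n m" "B \<in> carrier_mat m (n::nat)"
  shows "mtrace (A * B) = mtrace (B * A :: 'a::comm_ring_1 mat)"
proof -
  have "mtrace (A * B) = (\<Sum>i<n. \<Sum>k<m. A $$ (i, k) * B $$ (k, i))"
    using assms by (auto simp: mtrace_def scalar_prod_def atLeast0LessThan intro!: sum.cong)
  also have "\<dots> = (\<Sum>k<m. \<Sum>i<n. B $$ (k, i) * A $$ (i, k))"
    by (subst sum.swap) (simp add: mult.commute)
  also have "\<dots> = mtrace (B * A)"
    using assms by (auto simp: mtrace_def scalar_prod_def atLeast0LessThan intro!: sum.cong)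
  finally show ?thesis .
qed

lemma mtrace_similar:
  assumes "similar_mat A (B :: 'a::comm_ring_1 mat)"
  shows "mtrace A = mtrace B"
proof -
  obtain n P Q where c: "{A, B, P, Q} \<subseteq> carrier_mat n n" and
    PQ: "Q * P = 1\<^sub>m n" and AB: "A = P * B * Q"
    using similar_matD[OF assms] by metis
  have "mtrace A = mtrace (Q * (P * B))"
    unfolding AB using c by (intro mtrace_mult_commute[of _ n n]) auto
  also have "Q * (P * B) = (Q * P) * B"
    using c by (intro assoc_mult_mat[symmetric, of _ n n _ n _ n]) auto
  also have "\<dots> = B" using c PQ by auto
  finally show ?thesis .
qed

lemma upper_triangular_pow:
  assumes B: "B \<in> carrier_mat n n" "upper_triangular (B :: 'a::comm_ring_1 mat)"
  shows "upper_triangular (B ^\<^sub>m k) \<and> (\<forall>i<n. (B ^\<^sub>m k) $$ (i, i) = (B $$ (i, i)) ^ k)"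
proof (induction k)
  case (Suc k)
  let ?C = "B ^\<^sub>m k"
  have C: "?C \<in> carrier_mat n n" "dim_row ?C = n" using B(1) by auto
  have entry: "(?C * B) $$ (i, j) = (\<Sum>l<n. ?C $$ (i, l) * B $$ (l, j))" if "i < n" "j < n" for i j
    using that B(1) C by (auto simp: scalar_prod_def atLeast0LessThan intro!: sum.cong)
  have low: "?C $$ (i, l) * B $$ (l, j) = 0" if "i < n" "l < n" "j < n" "l < i \<or> j < l" for i j l
    using that Suc B C by (auto simp: upper_triangular_def)
  show ?case
  proof (intro conjI allI impI)
    show "upper_triangular (B ^\<^sub>m Suc k)"
    proof (rule upper_triangularI)
      fix i j assume ij: "j < i" "i < dim_row (B ^\<^sub>m Suc k)"
      then have "i < n" "j < n" using B C by auto
      then show "(B ^\<^sub>m Suc k) $$ (i, j) = 0"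
      proof -
        have "?C $$ (i, l) * B $$ (l, j) = 0" if "l < n" for l
        proof -
          have "l < i \<or> j < l" using ij(1) by linarith
          then show ?thesis using low \<open>i < n\<close> \<open>j < n\<close> that by blast
        qed
        then show ?thesis using entry[OF \<open>i < n\<close> \<open>j < n\<close>] by simp
      qed
    qed
    fix i assume i: "i < n"
    have "(B ^\<^sub>m Suc k) $$ (i, i) = (\<Sum>l<n. ?C $$ (i, l) * B $$ (l, i))"
      using entry[OF i i] by simp
    also have "\<dots> = (\<Sum>l<n. if l = i then ?C $$ (i, i) * B $$ (i, i) else 0)"
      using low[OF i _ i] by (intro sum.cong) (auto simp: nat_neq_iff)
    also have "\<dots> = ?C $$ (i, i) * B $$ (i, i)" using i by (simp add: sum.delta)
    finally show "(B ^\<^sub>m Suc k) $$ (i, i) = (B $$ (i, i)) ^ Suc k"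
      using Suc i by simp
  qed
qed (use B in auto)

text \<open>Schur triangulation exhibits a single list of eigenvalues, with multiplicity, that
  governs both the characteristic polynomial and the traces of all powers.\<close>

lemma complex_eigenvalues:
  assumes A: "A \<in> carrier_mat n (n::nat)"
  shows "\<exists>es :: complex list. char_poly A = (\<Prod>e\<leftarrow>es. [:- e, 1:]) \<and>
    (\<forall>k. mtrace (A ^\<^sub>m k) = (\<Sum>e\<leftarrow>es. e ^ k))"
proof -
  obtain as where "char_poly A = (\<Prod>a\<leftarrow>as. [:- a, 1:])" using char_poly_factorized[OF A] by blast
  from schur_decomposition_exists[OF A this]
  obtain B where B: "B \<in> carrier_mat n n" "upper_triangular B" and sim: "similar_mat A B" by blast
  have "char_poly A = (\<Prod>e\<leftarrow>diag_mat B. [:- e, 1:])"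
    using char_poly_similar[OF sim] char_poly_upper_triangular[OF B] by simp
  moreover have "mtrace (A ^\<^sub>m k) = (\<Sum>e\<leftarrow>diag_mat B. e ^ k)" for k
  proof -
    obtain P Q where "similar_mat_wit A B P Q" using sim unfolding similar_mat_def by blast
    from similar_mat_wit_pow[OF this, of k]
    have "similar_mat (A ^\<^sub>m k) (B ^\<^sub>m k)" unfolding similar_mat_def by blast
    then have "mtrace (A ^\<^sub>m k) = mtrace (B ^\<^sub>m k)" by (rule mtrace_similar)
    also have "\<dots> = (\<Sum>i<n. (B $$ (i, i)) ^ k)"
      using upper_triangular_pow[OF B, of k] B(1) by (auto simp: mtrace_def)
    also have "\<dots> = (\<Sum>e\<leftarrow>diag_mat B. e ^ k)"
      using B(1) by (simp add: diag_mat_def interv_sum_list_conv_sum_set_nat comp_def atLeast0LessThan)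
    finally show ?thesis .
  qed
  ultimately show ?thesis by blast
qed

lemma prod_list_count:
  "finite E \<Longrightarrow> set xs \<subseteq> E \<Longrightarrow> (\<Prod>x\<leftarrow>xs. f x) = (\<Prod>e\<in>E. f e ^ count_list xs e :: 'a::comm_monoid_mult)"
proof (induction xs)
  case (Cons x xs)
  have "(\<Prod>e\<in>E. f e ^ count_list (x # xs) e)
      = (\<Prod>e\<in>E. (if e = x then f x else 1) * f e ^ count_list xs e)"
    by (intro prod.cong) auto
  also have "\<dots> = f x * (\<Prod>e\<in>E. f e ^ count_list xs e)"
    using Cons.prems by (simp add: prod.distrib prod.delta)
  finally show ?case using Cons by simp
qed simp

lemma sum_list_count:
  "finite E \<Longrightarrow> set xs \<subseteq> E \<Longrightarrow>
    (\<Sum>x\<leftarrow>xs. f x) = (\<Sum>e\<in>E. of_nat (count_list xs e) * f e :: 'a::comm_semiring_1)"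
proof (induction xs)
  case (Cons x xs)
  have "(\<Sum>e\<in>E. of_nat (count_list (x # xs) e) * f e)
      = (\<Sum>e\<in>E. (if e = x then f x else 0) + of_nat (count_list xs e) * f e)"
    by (intro sum.cong) (auto simp: algebra_simps)
  also have "\<dots> = f x + (\<Sum>e\<in>E. of_nat (count_list xs e) * f e)"
    using Cons.prems by (simp add: sum.distrib sum.delta)
  finally show ?case using Cons by simp
qed simp

text \<open>In characteristic zero, power sums determine multiplicities. The integral exponents are
  split into \<open>nat (c i)\<close> and \<open>nat (- c i)\<close>, which turns a relation between
  rational functions into an equation of polynomials.\<close>

lemma power_sums_determine_product:
  fixes es :: "'i \<Rightarrow> complex list" and c :: "'i \<Rightarrow> int"
  assumes I: "finite I" and power_sums: "\<And>k. (\<Sum>i\<in>I. of_int (c i) * (\<Sum>e\<leftarrow>es i. e ^ k)) = 0"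
  shows "(\<Prod>i\<in>I. (\<Prod>e\<leftarrow>es i. [:- e, 1:]) ^ nat (c i))
    = (\<Prod>i\<in>I. (\<Prod>e\<leftarrow>es i. [:- e, 1:]) ^ nat (- c i))"
proof -
  define E where "E = (\<Union>i\<in>I. set (es i))"
  have E: "finite E" "\<And>i. i \<in> I \<Longrightarrow> set (es i) \<subseteq> E" using I by (auto simp: E_def)
  let ?m = "\<lambda>i e. count_list (es i) e"
  have zero: "(\<Sum>i\<in>I. c i * int (?m i e)) = 0" if e: "e \<in> E" for e
  proof -
    \<comment> \<open>\<open>p\<close> vanishes at every eigenvalue except \<open>e\<close>. The
      relation for powers extends linearly to \<open>p\<close> and then involves only the
      multiplicities of \<open>e\<close>.\<close>
    define p where "p = (\<Prod>x\<in>E - {e}. [:- x, 1:])"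
    have "(\<Sum>i\<in>I. of_int (c i) * (\<Sum>x\<leftarrow>es i. poly p x)) = 0"
    proof -
      have "(\<Sum>x\<leftarrow>xs. poly p x) = (\<Sum>k\<le>degree p. coeff p k * (\<Sum>x\<leftarrow>xs. x ^ k))" for xs
        by (induction xs) (simp_all add: poly_altdef sum.distrib algebra_simps)
      then have "(\<Sum>i\<in>I. of_int (c i) * (\<Sum>x\<leftarrow>es i. poly p x))
          = (\<Sum>i\<in>I. \<Sum>k\<le>degree p. coeff p k * (of_int (c i) * (\<Sum>x\<leftarrow>es i. x ^ k)))"
        by (simp add: sum_distrib_left mult.left_commute)
      also have "\<dots> = (\<Sum>k\<le>degree p. coeff p k * (\<Sum>i\<in>I. of_int (c i) * (\<Sum>x\<leftarrow>es i. x ^ k)))"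
        by (subst sum.swap) (simp add: sum_distrib_left)
      finally show ?thesis using power_sums by simp
    qed
    moreover have "(\<Sum>x\<leftarrow>es i. poly p x) = of_nat (?m i e) * poly p e" if "i \<in> I" for i
    proof -
      have "(\<Sum>x\<leftarrow>es i. poly p x) = (\<Sum>x\<in>E. of_nat (?m i x) * poly p x)"
        by (rule sum_list_count[OF E(1) E(2)[OF that]])
      also have "\<dots> = (\<Sum>x\<in>E. if x = e then of_nat (?m i e) * poly p e else 0)"
        using E(1) by (intro sum.cong) (auto simp: p_def poly_prod)
      finally show ?thesis using e E(1) by (simp add: sum.delta)
    qed
    ultimately have "(\<Sum>i\<in>I. of_int (c i) * (of_nat (?m i e) * poly p e)) = 0" by simp
    then have "of_int (\<Sum>i\<in>I. c i * int (?m i e)) * poly p e = 0"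
      by (simp add: sum_distrib_right mult.assoc)
    moreover have "poly p e \<noteq> 0" using E(1) by (auto simp: p_def poly_prod)
    ultimately show ?thesis by (metis mult_eq_0_iff of_int_eq_0_iff)
  qed
  have prod: "(\<Prod>i\<in>I. (\<Prod>e\<leftarrow>es i. [:- e, 1:]) ^ a i) = (\<Prod>e\<in>E. [:- e, 1:] ^ (\<Sum>i\<in>I. ?m i e * a i))" for a
  proof -
    have "(\<Prod>i\<in>I. (\<Prod>e\<leftarrow>es i. [:- e, 1:]) ^ a i) = (\<Prod>i\<in>I. \<Prod>e\<in>E. [:- e, 1:] ^ (?m i e * a i))"
    proof (intro prod.cong refl)
      fix i assume i: "i \<in> I"
      show "(\<Prod>e\<leftarrow>es i. [:- e, 1:]) ^ a i = (\<Prod>e\<in>E. [:- e, 1:] ^ (?m i e * a i))"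
        unfolding prod_list_count[OF E(1) E(2)[OF i]] by (simp add: prod_power_distrib power_mult)
    qed
    also have "\<dots> = (\<Prod>e\<in>E. \<Prod>i\<in>I. [:- e, 1:] ^ (?m i e * a i))" by (rule prod.swap)
    finally show ?thesis by (simp add: power_sum)
  qed
  have "(\<Sum>i\<in>I. ?m i e * nat (c i)) = (\<Sum>i\<in>I. ?m i e * nat (- c i))" if "e \<in> E" for e
  proof -
    have "int (\<Sum>i\<in>I. ?m i e * nat (c i)) - int (\<Sum>i\<in>I. ?m i e * nat (- c i))
        = (\<Sum>i\<in>I. c i * int (?m i e))"
      unfolding of_nat_sum sum_subtractf[symmetric]
    proof (intro sum.cong refl)
      fix i
      show "int (?m i e * nat (c i)) - int (?m i e * nat (- c i)) = c i * int (?m i e)"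
        by (cases "c i \<ge> 0") simp_all
    qed
    then show ?thesis using zero[OF that] by linarith
  qed
  then show ?thesis unfolding prod by (intro prod.cong) auto
qed

section \<open>Group ring elements acting on permutation modules\<close>

text \<open>The sum over \<open>g\<close> of the permutation matrix of \<open>\<sigma> g\<close>
  tensored with the matrix \<open>t g\<close>; position \<open>i\<close> stands for block
  \<open>i div n\<close> and offset \<open>i mod n\<close>. The family \<open>t\<close> is an
  arbitrary matrix over the group ring, so its entries can be lifted one by one.\<close>

definition block_mat :: "('g, 'm) monoid_scheme \<Rightarrow> nat \<Rightarrow> nat \<Rightarrow> ('g \<Rightarrow> nat \<Rightarrow> nat) \<Rightarrow>
    ('g \<Rightarrow> nat \<Rightarrow> nat \<Rightarrow> 'a::comm_ring_1) \<Rightarrow> 'a mat"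
  where "block_mat G r n \<sigma> t = mat (r * n) (r * n) (\<lambda>(i, j).
    \<Sum>g\<in>carrier G. if \<sigma> g (j div n) = i div n then t g (i mod n) (j mod n) else 0)"

lemma block_mat_carrier [simp]: "block_mat G r n \<sigma> t \<in> carrier_mat (r * n) (r * n)"
  "dim_row (block_mat G r n \<sigma> t) = r * n" "dim_col (block_mat G r n \<sigma> t) = r * n"
  by (simp_all add: block_mat_def)

lemma block_mat_hom:
  assumes "comm_ring_hom h"
  shows "map_mat h (block_mat G r n \<sigma> t) = block_mat G r n \<sigma> (\<lambda>g a b. h (t g a b))"
proof -
  interpret comm_ring_hom h by fact
  show ?thesis
    by (rule eq_matI) (auto simp: block_mat_def hom_sum intro!: sum.cong)
qed

lemma block_index:
  assumes "(i::nat) < r * n"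
  shows "i div n < r" "i mod n < n"
proof -
  show "i div n < r" using assms by (simp add: less_mult_imp_div_less)
  have "n > 0" using assms by (cases n) auto
  then show "i mod n < n" by simp
qed

lemma sum_block:
  "(\<Sum>k<r * n. f (k div n) (k mod n)) = (\<Sum>l<r. \<Sum>c<(n::nat). f l c :: 'a::comm_monoid_add)"
proof -
  have "(\<Sum>k<r * n. f (k div n) (k mod n)) = (\<Sum>(l, c)\<in>{..<r} \<times> {..<n}. f l c)"
  proof (rule sum.reindex_bij_witness[where i = "\<lambda>(l, c). l * n + c" and j = "\<lambda>k. (k div n, k mod n)"])
    fix k assume "k \<in> {..<r * n}"
    then show "(k div n, k mod n) \<in> {..<r} \<times> {..<n}" using block_index[of k r n] by auto
  next
    fix p assume p: "p \<in> {..<r} \<times> {..<n}"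
    obtain l c where lc: "p = (l, c)" "l < r" "c < n" using p by auto
    have "l * n + c < Suc l * n" using lc by simp
    also have "\<dots> \<le> r * n" using lc by (intro mult_right_mono) auto
    finally show "(case p of (l, c) \<Rightarrow> l * n + c) \<in> {..<r * n}" using lc by simp
    show "((case p of (l, c) \<Rightarrow> l * n + c) div n, (case p of (l, c) \<Rightarrow> l * n + c) mod n) = p"
      using lc by simp
  qed auto
  then show ?thesis by (simp add: sum.cartesian_product)
qed

definition (in group) perm_rep :: "nat \<Rightarrow> ('a \<Rightarrow> nat \<Rightarrow> nat) \<Rightarrow> bool"
  where "perm_rep r \<sigma> \<longleftrightarrow> (\<forall>g\<in>carrier G. \<forall>l<r. \<sigma> g l < r) \<and> (\<forall>l<r. \<sigma> \<one> l = l) \<and>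
    (\<forall>g\<in>carrier G. \<forall>h\<in>carrier G. \<forall>l<r. \<sigma> (g \<otimes> h) l = \<sigma> g (\<sigma> h l))"

text \<open>Multiplication of n by n matrices over the group ring. It does not involve
  \<open>\<sigma>\<close>: the powers of a block matrix have coefficients that are common to all
  permutation representations.\<close>

definition (in group) conv :: "nat \<Rightarrow> ('a \<Rightarrow> nat \<Rightarrow> nat \<Rightarrow> 'r::comm_ring_1) \<Rightarrow>
    ('a \<Rightarrow> nat \<Rightarrow> nat \<Rightarrow> 'r) \<Rightarrow> 'a \<Rightarrow> nat \<Rightarrow> nat \<Rightarrow> 'r"
  where "conv n s t w a b = (\<Sum>g\<in>carrier G. \<Sum>c<n. s g a c * t (inv g \<otimes> w) c b)"

context group
begin

lemma block_mat_mult: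
  assumes fin: "finite (carrier G)" and \<sigma>: "perm_rep r \<sigma>"
  shows "block_mat G r n \<sigma> s * block_mat G r n \<sigma> t = block_mat G r n \<sigma> (conv n s t)"
proof (rule eq_matI)
  fix i j assume "i < dim_row (block_mat G r n \<sigma> (conv n s t))" "j < dim_col (block_mat G r n \<sigma> (conv n s t))"
  then have ij: "i < r * n" "j < r * n" by auto
  define i1 i2 j1 j2 where d1: "i1 = i div n" and d2: "i2 = i mod n"
    and d3: "j1 = j div n" and d4: "j2 = j mod n"
  note d = d1 d2 d3 d4
  have j1: "j1 < r" using block_index[OF ij(2)] by (simp add: d)
  have "(block_mat G r n \<sigma> s * block_mat G r n \<sigma> t) $$ (i, j)
      = (\<Sum>k<r * n. (\<Sum>g\<in>carrier G. if \<sigma> g (k div n) = i1 then s g i2 (k mod n) else 0) *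
          (\<Sum>h\<in>carrier G. if \<sigma> h j1 = k div n then t h (k mod n) j2 else 0))"
    unfolding d using ij by (simp add: scalar_prod_def atLeast0LessThan block_mat_def)
  also have "\<dots> = (\<Sum>l<r. \<Sum>c<n. (\<Sum>g\<in>carrier G. if \<sigma> g l = i1 then s g i2 c else 0) *
          (\<Sum>h\<in>carrier G. if \<sigma> h j1 = l then t h c j2 else 0))"
    by (rule sum_block)
  also have "\<dots> = (\<Sum>l<r. \<Sum>c<n. \<Sum>g\<in>carrier G. \<Sum>h\<in>carrier G.
          if \<sigma> h j1 = l then (if \<sigma> g l = i1 then s g i2 c * t h c j2 else 0) else 0)"
    unfolding sum_product by (intro sum.cong refl) auto
  also have "\<dots> = (\<Sum>g\<in>carrier G. \<Sum>h\<in>carrier G. \<Sum>c<n. \<Sum>l<r.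
          if \<sigma> h j1 = l then (if \<sigma> g l = i1 then s g i2 c * t h c j2 else 0) else 0)"
    by (subst sum.swap[where A = "{..<r}"], subst sum.swap[where A = "{..<r}"],
        subst sum.swap[where A = "{..<r}" and B = "carrier G"],
        subst sum.swap[where A = "{..<n}"], subst sum.swap[where A = "{..<n}" and B = "carrier G"]) (rule refl)
  also have "\<dots> = (\<Sum>g\<in>carrier G. \<Sum>h\<in>carrier G. if \<sigma> (g \<otimes> h) j1 = i1 then \<Sum>c<n. s g i2 c * t h c j2 else 0)"
  proof (intro sum.cong refl)
    fix g h assume gh: "g \<in> carrier G" "h \<in> carrier G"
    have hj: "\<sigma> h j1 < r" and gj: "\<sigma> (g \<otimes> h) j1 = \<sigma> g (\<sigma> h j1)"
      using \<sigma> gh j1 by (auto simp: perm_rep_def)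
    show "(\<Sum>c<n. \<Sum>l<r. if \<sigma> h j1 = l then (if \<sigma> g l = i1 then s g i2 c * t h c j2 else 0) else 0)
      = (if \<sigma> (g \<otimes> h) j1 = i1 then \<Sum>c<n. s g i2 c * t h c j2 else 0)"
      using hj gj by (simp add: sum.delta')
  qed
  also have "\<dots> = (\<Sum>g\<in>carrier G. \<Sum>w\<in>carrier G. if \<sigma> w j1 = i1 then \<Sum>c<n. s g i2 c * t (inv g \<otimes> w) c j2 else 0)"
  proof (rule sum.cong[OF refl])
    fix g assume g: "g \<in> carrier G"
    show "(\<Sum>h\<in>carrier G. if \<sigma> (g \<otimes> h) j1 = i1 then \<Sum>c<n. s g i2 c * t h c j2 else 0)
      = (\<Sum>w\<in>carrier G. if \<sigma> w j1 = i1 then \<Sum>c<n. s g i2 c * t (inv g \<otimes> w) c j2 else 0)"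
      by (rule sum.reindex_bij_witness[where i = "\<lambda>w. inv g \<otimes> w" and j = "\<lambda>h. g \<otimes> h"])
        (use g in \<open>auto simp: m_assoc[symmetric]\<close>)
  qed
  also have "\<dots> = (\<Sum>w\<in>carrier G. if \<sigma> w j1 = i1 then conv n s t w i2 j2 else 0)"
    by (subst sum.swap) (auto simp: conv_def intro!: sum.cong)
  finally show "(block_mat G r n \<sigma> s * block_mat G r n \<sigma> t) $$ (i, j) = block_mat G r n \<sigma> (conv n s t) $$ (i, j)"
    unfolding d using ij by (simp add: block_mat_def)
qed auto

fun conv_pow :: "nat \<Rightarrow> ('a \<Rightarrow> nat \<Rightarrow> nat \<Rightarrow> 'r::comm_ring_1) \<Rightarrow> nat \<Rightarrow> 'a \<Rightarrow> nat \<Rightarrow> nat \<Rightarrow> 'r"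
  where "conv_pow n t 0 = (\<lambda>w a b. if w = \<one> \<and> a = b then 1 else 0)"
  | "conv_pow n t (Suc k) = conv n (conv_pow n t k) t"

lemma block_mat_pow:
  assumes fin: "finite (carrier G)" and \<sigma>: "perm_rep r \<sigma>"
  shows "block_mat G r n \<sigma> t ^\<^sub>m k = block_mat G r n \<sigma> (conv_pow n t k)"
proof (induction k)
  case 0
  show ?case
  proof (rule eq_matI)
    fix i j assume "i < dim_row (block_mat G r n \<sigma> (conv_pow n t 0))" "j < dim_col (block_mat G r n \<sigma> (conv_pow n t 0))"
    then have ij: "i < r * n" "j < r * n" by auto
    have "(\<Sum>g\<in>carrier G. if \<sigma> g (j div n) = i div n then conv_pow n t 0 g (i mod n) (j mod n) else 0)
      = (\<Sum>g\<in>carrier G. if g = \<one> then (if \<sigma> \<one> (j div n) = i div n \<and> i mod n = j mod n then 1 else 0) else 0)"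
      by (intro sum.cong) auto
    also have "\<dots> = (if \<sigma> \<one> (j div n) = i div n \<and> i mod n = j mod n then 1 else 0)"
      using fin by simp
    also have "\<dots> = (if i = j then 1 else 0)"
    proof -
      have "\<sigma> \<one> (j div n) = j div n" using \<sigma> block_index[OF ij(2)] by (simp add: perm_rep_def)
      moreover have "j div n = i div n \<and> i mod n = j mod n \<longleftrightarrow> i = j"
        by (metis div_mult_mod_eq)
      ultimately show ?thesis by simp
    qed
    finally show "(block_mat G r n \<sigma> t ^\<^sub>m 0) $$ (i, j) = block_mat G r n \<sigma> (conv_pow n t 0) $$ (i, j)"
      using ij by (simp add: block_mat_def del: conv_pow.simps)
  qed auto
next
  case (Suc k)
  then show ?case by (simp add: block_mat_mult[OF assms])
qed

text \<open>The trace of a permutation matrix counts fixed points. With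
  \<open>block_mat_pow\<close>, the trace of every power becomes linear in the permutation
  character.\<close>

lemma mtrace_block_mat:
  "mtrace (block_mat G r n \<sigma> t) =
    (\<Sum>g\<in>carrier G. of_nat (card {l. l < r \<and> \<sigma> g l = l}) * (\<Sum>c<n. t g c c))"
proof -
  have "mtrace (block_mat G r n \<sigma> t)
      = (\<Sum>i<r * n. \<Sum>g\<in>carrier G. if \<sigma> g (i div n) = i div n then t g (i mod n) (i mod n) else 0)"
    by (simp add: mtrace_def block_mat_def)
  also have "\<dots> = (\<Sum>l<r. \<Sum>c<n. \<Sum>g\<in>carrier G. if \<sigma> g l = l then t g c c else 0)"
    by (rule sum_block)
  also have "\<dots> = (\<Sum>g\<in>carrier G. \<Sum>l<r. \<Sum>c<n. if \<sigma> g l = l then t g c c else 0)"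
    by (subst sum.swap[where A = "{..<n}"], subst sum.swap[where A = "{..<r}"]) (rule refl)
  also have "\<dots> = (\<Sum>g\<in>carrier G. of_nat (card {l. l < r \<and> \<sigma> g l = l}) * (\<Sum>c<n. t g c c))"
  proof (intro sum.cong refl)
    fix g
    have "(\<Sum>l<r. \<Sum>c<n. if \<sigma> g l = l then t g c c else 0) = (\<Sum>l<r. if \<sigma> g l = l then \<Sum>c<n. t g c c else 0)"
      by (intro sum.cong) auto
    also have "\<dots> = (\<Sum>l\<in>{l \<in> {..<r}. \<sigma> g l = l}. \<Sum>c<n. t g c c)"
      by (rule sum.inter_filter[symmetric]) simp
    finally show "(\<Sum>l<r. \<Sum>c<n. if \<sigma> g l = l then t g c c else 0)
      = of_nat (card {l. l < r \<and> \<sigma> g l = l}) * (\<Sum>c<n. t g c c)" by simp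
  qed
  finally show ?thesis .
qed

lemma char_poly_relation_complex:
  fixes t :: "'a \<Rightarrow> nat \<Rightarrow> nat \<Rightarrow> complex"
  assumes fin: "finite (carrier G)" and I: "finite I" and \<sigma>: "\<And>i. i \<in> I \<Longrightarrow> perm_rep (r i) (\<sigma> i)"
    and fixed: "\<And>g. g \<in> carrier G \<Longrightarrow> (\<Sum>i\<in>I. c i * int (card {l. l < r i \<and> \<sigma> i g l = l})) = 0"
  shows "(\<Prod>i\<in>I. char_poly (block_mat G (r i) n (\<sigma> i) t) ^ nat (c i))
    = (\<Prod>i\<in>I. char_poly (block_mat G (r i) n (\<sigma> i) t) ^ nat (- c i))"
proof -
  let ?A = "\<lambda>i. block_mat G (r i) n (\<sigma> i) t"
  have "\<exists>es. \<forall>i. char_poly (?A i) = (\<Prod>e\<leftarrow>es i. [:- e, 1:]) \<and>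
    (\<forall>k. mtrace (?A i ^\<^sub>m k) = (\<Sum>e\<leftarrow>es i. e ^ k))"
    by (intro choice allI complex_eigenvalues[OF block_mat_carrier(1)])
  then obtain es where es: "\<And>i. char_poly (?A i) = (\<Prod>e\<leftarrow>es i. [:- e, 1:])"
    "\<And>i k. mtrace (?A i ^\<^sub>m k) = (\<Sum>e\<leftarrow>es i. e ^ k)" by blast
  have "(\<Sum>i\<in>I. of_int (c i) * (\<Sum>e\<leftarrow>es i. e ^ k)) = 0" for k
  proof -
    let ?T = "\<lambda>g. \<Sum>a<n. conv_pow n t k g a a"
    have "(\<Sum>i\<in>I. of_int (c i) * (\<Sum>e\<leftarrow>es i. e ^ k))
        = (\<Sum>i\<in>I. \<Sum>g\<in>carrier G. of_int (c i * int (card {l. l < r i \<and> \<sigma> i g l = l})) * ?T g)"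
      unfolding es(2)[symmetric]
      by (intro sum.cong refl)
        (simp add: block_mat_pow[OF fin \<sigma>] mtrace_block_mat sum_distrib_left mult.assoc)
    also have "\<dots> = (\<Sum>g\<in>carrier G. of_int (\<Sum>i\<in>I. c i * int (card {l. l < r i \<and> \<sigma> i g l = l})) * ?T g)"
      by (subst sum.swap) (simp add: sum_distrib_right)
    also have "\<dots> = 0" using fixed by (intro sum.neutral) simp
    finally show ?thesis .
  qed
  from power_sums_determine_product[OF I this] show ?thesis unfolding es(1) .
qed

text \<open>In positive characteristic power sums do not determine a characteristic polynomial. The
  entries are therefore lifted to integral polynomials, where the relation follows from
  characteristic zero, and are then reduced by a ring homomorphism.\<close>

lemma char_poly_relation:
  fixes t :: "'a \<Rightarrow> nat \<Rightarrow> nat \<Rightarrow> 'f::{field,finite}"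
  assumes fin: "finite (carrier G)" and I: "finite I" and \<sigma>: "\<And>i. i \<in> I \<Longrightarrow> perm_rep (r i) (\<sigma> i)"
    and fixed: "\<And>g. g \<in> carrier G \<Longrightarrow> (\<Sum>i\<in>I. c i * int (card {l. l < r i \<and> \<sigma> i g l = l})) = 0"
  shows "(\<Prod>i\<in>I. char_poly (block_mat G (r i) n (\<sigma> i) t) ^ nat (c i))
    = (\<Prod>i\<in>I. char_poly (block_mat G (r i) n (\<sigma> i) t) ^ nat (- c i))"
proof -
  obtain \<alpha> :: 'f where \<alpha>: "\<And>y. y \<noteq> 0 \<Longrightarrow> \<exists>k::nat. y = \<alpha> ^ k"
    using finite_field_generator by blast
  define red where "red p = poly (map_poly of_int p) \<alpha>" for p :: "int poly"
  interpret of_int_poly: map_poly_comm_ring_hom "of_int :: int \<Rightarrow> 'f" ..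
  have red: "comm_ring_hom red"
    by unfold_locales (simp_all add: red_def hom_distribs)
  have "\<exists>p. red p = y" for y
  proof (cases "y = 0")
    case True
    then show ?thesis by (intro exI[of _ 0]) (simp add: red_def)
  next
    case False
    then obtain k where "y = \<alpha> ^ k" using \<alpha> by blast
    then have "red (monom 1 k) = y" by (simp add: red_def map_poly_monom poly_monom)
    then show ?thesis ..
  qed
  \<comment> \<open>\<open>lift\<close> is a choice of preimages and not a homomorphism. The
    relation holds for every coefficient family, so any choice serves.\<close>
  then obtain lift where lift: "\<And>y. red (lift y) = y" by metis
  let ?B = "\<lambda>i. block_mat G (r i) n (\<sigma> i) (\<lambda>g a b. lift (t g a b))"
  let ?P = "\<lambda>s. \<Prod>i\<in>I. char_poly (?B i) ^ nat (s * c i)"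
  have hom: "map_poly h (?P s)
      = (\<Prod>i\<in>I. char_poly (block_mat G (r i) n (\<sigma> i) (\<lambda>g a b. h (lift (t g a b)))) ^ nat (s * c i))"
    if "comm_ring_hom h" for h :: "int poly \<Rightarrow> 'r::comm_ring_1" and s
  proof -
    interpret h: comm_ring_hom h by fact
    interpret hp: map_poly_comm_ring_hom h ..
    show ?thesis
      unfolding hp.hom_prod hp.hom_power h.char_poly_hom[OF block_mat_carrier(1), symmetric]
        block_mat_hom[OF that] ..
  qed
  \<comment> \<open>A coefficient of either side is an integral polynomial. Evaluating its variable
    at an integer \<open>x\<close> leads to complex matrices, so both sides agree at all integers
    and are equal.\<close>
  have "?P 1 = ?P (-1)"
  proof (rule poly_eqI)
    fix m
    show "coeff (?P 1) m = coeff (?P (-1)) m"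
    proof -
      have "poly (coeff (?P 1) m) x = poly (coeff (?P (-1)) m) x" for x
      proof -
        define ev where "ev p = complex_of_int (poly p x)" for p
        have ev: "comm_ring_hom ev" by unfold_locales (simp_all add: ev_def)
        have "map_poly ev (?P 1) = map_poly ev (?P (-1))"
          unfolding hom[OF ev] using char_poly_relation_complex[OF fin I \<sigma> fixed] by simp
        then have "coeff (map_poly ev (?P 1)) m = coeff (map_poly ev (?P (-1))) m" by simp
        then have "ev (coeff (?P 1) m) = ev (coeff (?P (-1)) m)"
          by (subst (asm) (1 2) coeff_map_poly) (simp_all add: ev_def)
        then show ?thesis by (simp add: ev_def)
      qed
      then show ?thesis using poly_eq_poly_eq_iff by blast
    qed
  qed
  then have "map_poly red (?P 1) = map_poly red (?P (-1))" by simp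
  then show ?thesis unfolding hom[OF red] lift by simp
qed

end

section \<open>Coordinates, cosets and Artin's relation\<close>

context finite_field_space
begin

text \<open>A basis \<open>b\<close> of the subspace \<open>W\<close> together with its dual
  coordinate functions \<open>\<kappa>\<close>, indexed by the numbers below \<open>n\<close> to
  match matrix indices.\<close>

definition coords :: "'v set \<Rightarrow> nat \<Rightarrow> (nat \<Rightarrow> 'v) \<Rightarrow> (nat \<Rightarrow> 'v \<Rightarrow> 'f) \<Rightarrow> bool"
  where "coords W n b \<kappa> \<longleftrightarrow> (\<forall>i<n. b i \<in> W) \<and> (\<forall>w\<in>W. w = (\<Sum>i<n. scale (\<kappa> i w) (b i))) \<and>
    (\<forall>i<n. \<forall>w\<in>W. \<forall>w'\<in>W. \<kappa> i (w + w') = \<kappa> i w + \<kappa> i w') \<and>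
    (\<forall>c. \<forall>i<n. \<forall>w\<in>W. \<kappa> i (scale c w) = c * \<kappa> i w) \<and>
    (\<forall>i<n. \<forall>j<n. \<kappa> i (b j) = (if i = j then 1 else 0))"

lemma coordsD:
  assumes "coords W n b \<kappa>"
  shows "\<And>i. i < n \<Longrightarrow> b i \<in> W" "\<And>w. w \<in> W \<Longrightarrow> (\<Sum>i<n. scale (\<kappa> i w) (b i)) = w"
    "\<And>i w w'. i < n \<Longrightarrow> w \<in> W \<Longrightarrow> w' \<in> W \<Longrightarrow> \<kappa> i (w + w') = \<kappa> i w + \<kappa> i w'"
    "\<And>c i w. i < n \<Longrightarrow> w \<in> W \<Longrightarrow> \<kappa> i (scale c w) = c * \<kappa> i w"
    "\<And>i j. i < n \<Longrightarrow> j < n \<Longrightarrow> \<kappa> i (b j) = (if i = j then 1 else 0)"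
  using assms unfolding coords_def by (blast, metis, blast, blast, blast)

lemma coords_sum:
  assumes c: "coords W n b \<kappa>" and W: "subspace W" and "finite I" and i: "i < n"
    and w: "\<And>k. k \<in> I \<Longrightarrow> w k \<in> W"
  shows "\<kappa> i (\<Sum>k\<in>I. scale (d k) (w k)) = (\<Sum>k\<in>I. d k * \<kappa> i (w k))"
  using assms(3) w
proof (induction I)
  case empty
  show ?case using coordsD(4)[OF c i subspace_0[OF W], of 0] by simp
next
  case (insert x I)
  have "scale (d x) (w x) \<in> W" "(\<Sum>k\<in>I. scale (d k) (w k)) \<in> W"
    using insert.prems W by (auto intro!: subspace_sum subspace_scale)
  then show ?case
    using insert coordsD(3)[OF c i] coordsD(4)[OF c i, of "w x"] by simp
qed

lemma coords_sum':
  assumes c: "coords W n b \<kappa>" and W: "subspace W" and "finite I" and i: "i < n"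
    and w: "\<And>k. k \<in> I \<Longrightarrow> w k \<in> W"
  shows "\<kappa> i (\<Sum>k\<in>I. w k) = (\<Sum>k\<in>I. \<kappa> i (w k))"
  using coords_sum[OF c W assms(3) i w, where d = "\<lambda>_. 1"] by simp

lemma ex_coords:
  assumes "subspace W" "finite W"
  shows "\<exists>n b \<kappa>. coords W n b \<kappa>"
proof -
  let ?good = "\<lambda>S. subspace S \<and> S \<subseteq> W \<and> (\<exists>n b \<kappa>. coords S n b \<kappa>)"
  have zero: "?good {0}"
    using subspace_0[OF assms(1)] subspace_single_0
    by (auto simp: coords_def intro!: exI[of _ 0])
  have "\<exists>S. ?good S \<and> (\<forall>S'. ?good S' \<longrightarrow> card S' \<le> card S)"
    by (rule ex_has_greatest_nat[where k = "{0}" and b = "Suc (card W)"])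
      (use zero assms in \<open>auto simp: less_Suc_eq_le intro: card_mono\<close>)
  then obtain S where S: "?good S" and max: "\<And>S'. ?good S' \<Longrightarrow> card S' \<le> card S" by blast
  from S obtain n b \<kappa> where c: "coords S n b \<kappa>" and sS: "subspace S" "S \<subseteq> W" by blast
  have "S = W"
  proof (rule ccontr)
    assume "S \<noteq> W"
    then obtain v where v: "v \<in> W" "v \<notin> S" using sS by blast
    have fS: "finite S" using sS(2) assms(2) by (rule finite_subset)
    let ?S' = "extend S v"
    define \<delta> where "\<delta> x = (SOME d. \<exists>s\<in>S. x = s + scale d v)" for x
    have uniq: "d = d'" if "s \<in> S" "s' \<in> S" "s + scale d v = s' + scale d' v" for s s' d d'
    proof (rule ccontr)
      assume "d \<noteq> d'"
      have "scale (d - d') v = s' - s" using that(3) by (simp add: algebra_simps)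
      then have "v = scale (inverse (d - d')) (s' - s)"
        using \<open>d \<noteq> d'\<close> by (metis eq_iff_diff_eq_0 field_class.field_inverse scale_one scale_scale)
      then show False using that v(2) by (metis sS(1) subspace_diff subspace_scale)
    qed
    have \<delta>: "\<delta> (s + scale d v) = d" if "s \<in> S" for s d
      unfolding \<delta>_def using uniq that by (intro some_equality) blast+
    define b' where "b' = b(n := v)"
    define \<kappa>' where "\<kappa>' i x = (if i < n then \<kappa> i (x - scale (\<delta> x) v) else \<delta> x)" for i x
    have \<kappa>': "\<kappa>' i (s + scale d v) = (if i < n then \<kappa> i s else d)" if "s \<in> S" for i s d
      by (simp add: \<kappa>'_def \<delta>[OF that])
    note cd = coordsD[OF c]
    have "coords ?S' (Suc n) b' \<kappa>'"
      unfolding coords_def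
    proof (intro conjI allI impI ballI)
      fix i assume "i < Suc n"
      then show "b' i \<in> ?S'"
        using cd(1)[of i] extend_props(1,2)[OF sS(1), where v = v] by (auto simp: b'_def)
    next
      fix w assume "w \<in> ?S'"
      then obtain s d where s: "s \<in> S" "w = s + scale d v" by (rule extendE)
      have "(\<Sum>i<Suc n. scale (\<kappa>' i w) (b' i)) = (\<Sum>i<n. scale (\<kappa> i s) (b i)) + scale d v"
        by (simp add: s(2) \<kappa>'[OF s(1)] b'_def)
      then show "w = (\<Sum>i<Suc n. scale (\<kappa>' i w) (b' i))" using cd(2)[OF s(1)] s(2) by simp
    next
      fix i w w' assume i: "i < Suc n" and w: "w \<in> ?S'" "w' \<in> ?S'"
      obtain s d where s: "s \<in> S" "w = s + scale d v" using w(1) by (rule extendE)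
      obtain s' d' where s': "s' \<in> S" "w' = s' + scale d' v" using w(2) by (rule extendE)
      have eq: "w + w' = (s + s') + scale (d + d') v" by (simp add: s s' scale_left_distrib)
      show "\<kappa>' i (w + w') = \<kappa>' i w + \<kappa>' i w'"
        unfolding eq \<kappa>'[OF subspace_add[OF sS(1) s(1) s'(1)]]
        unfolding s(2) s'(2) \<kappa>'[OF s(1)] \<kappa>'[OF s'(1)] using cd(3)[OF _ s(1) s'(1)] by simp
    next
      fix e i w assume i: "i < Suc n" and w: "w \<in> ?S'"
      obtain s d where s: "s \<in> S" "w = s + scale d v" using w by (rule extendE)
      have eq: "scale e w = scale e s + scale (e * d) v" by (simp add: s scale_right_distrib)
      show "\<kappa>' i (scale e w) = e * \<kappa>' i w"
        unfolding eq \<kappa>'[OF subspace_scale[OF sS(1) s(1)]]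
        unfolding s(2) \<kappa>'[OF s(1)] using cd(4)[OF _ s(1)] by simp
    next
      fix i j assume ij: "i < Suc n" "j < Suc n"
      show "\<kappa>' i (b' j) = (if i = j then 1 else 0)"
      proof (cases "j = n")
        case True
        have "\<kappa> i 0 = 0" if "i < n"
          using cd(4)[OF that subspace_0[OF sS(1)], of 0] by simp
        then show ?thesis
          using \<kappa>'[OF subspace_0[OF sS(1)], of i 1] True ij by (auto simp: b'_def)
      next
        case False
        then have j: "j < n" using ij by simp
        then show ?thesis
          using \<kappa>'[OF cd(1)[OF j], of i 0] cd(5)[OF _ j, of i] ij by (auto simp: b'_def)
      qed
    qed
    then have "?good ?S'"
      using subspace_extend[OF sS(1)] extend_props(3)[OF sS(1) assms(1) sS(2) v(1)] by blast
    from max[OF this] card_extend[OF sS(1) fS v(2)]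
    have "card (UNIV :: 'f set) * card S \<le> card S" by simp
    moreover have "card S > 0" using fS subspace_0[OF sS(1)] by (auto simp: card_gt_0_iff)
    moreover have "card {0, 1 :: 'f} \<le> card (UNIV :: 'f set)" by (rule card_mono) auto
    ultimately show False by simp
  qed
  then show ?thesis using c by blast
qed

lemma card_coords:
  assumes c: "coords W n b \<kappa>" and W: "subspace W"
  shows "card W = card (UNIV :: 'f set) ^ n"
proof -
  have "bij_betw (\<lambda>w. restrict (\<lambda>i. \<kappa> i w) {..<n}) W (PiE {..<n} (\<lambda>_. UNIV))"
  proof (rule bij_betwI[where g = "\<lambda>h. \<Sum>i<n. scale (h i) (b i)"])
    show "(\<Sum>i<n. scale (restrict (\<lambda>i. \<kappa> i w) {..<n} i) (b i)) = w" if "w \<in> W" for w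
      using coordsD(2)[OF c that] by simp
    show "restrict (\<lambda>i. \<kappa> i (\<Sum>i<n. scale (h i) (b i))) {..<n} = h"
      if h: "h \<in> PiE {..<n} (\<lambda>_. UNIV)" for h
    proof (rule PiE_ext[OF _ h])
      fix i assume i: "i \<in> {..<n}"
      have "\<kappa> i (\<Sum>j<n. scale (h j) (b j)) = (\<Sum>j<n. h j * \<kappa> i (b j))"
        using i coordsD(1)[OF c] by (intro coords_sum[OF c W]) auto
      also have "\<dots> = (\<Sum>j<n. if j = i then h i else 0)"
        using i coordsD(5)[OF c] by (intro sum.cong) auto
      finally show "restrict (\<lambda>i. \<kappa> i (\<Sum>i<n. scale (h i) (b i))) {..<n} i = h i"
        using i by simp
    qed auto
  qed (use coordsD(1)[OF c] W in \<open>auto intro!: subspace_sum subspace_scale\<close>)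
  from bij_betw_same_card[OF this] show ?thesis by (simp add: card_PiE)
qed

definition matrix_of :: "nat \<Rightarrow> (nat \<Rightarrow> 'v) \<Rightarrow> (nat \<Rightarrow> 'v \<Rightarrow> 'f) \<Rightarrow> ('v \<Rightarrow> 'v) \<Rightarrow> 'f mat"
  where "matrix_of n b \<kappa> T = mat n n (\<lambda>(i, j). \<kappa> i (T (b j)))"

lemma linear_on_sum:
  assumes T: "linear_on W T" and W: "subspace W" and "finite I" "\<And>k. k \<in> I \<Longrightarrow> w k \<in> W"
  shows "T (\<Sum>k\<in>I. scale (d k) (w k)) = (\<Sum>k\<in>I. scale (d k) (T (w k)))"
  using assms(3,4)
proof (induction I)
  case empty
  show ?case using linear_on_more(1)[OF T W] by simp
next
  case (insert x I)
  have "scale (d x) (w x) \<in> W" "(\<Sum>k\<in>I. scale (d k) (w k)) \<in> W"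
    using insert.prems W by (auto intro!: subspace_sum subspace_scale)
  then show ?case using insert linear_onD[OF T] by simp
qed

lemma matrix_of_similar:
  assumes c: "coords W n b \<kappa>" and c': "coords W n b' \<kappa>'" and W: "subspace W" and T: "linear_on W T"
  shows "similar_mat (matrix_of n b \<kappa> T) (matrix_of n b' \<kappa>' T)"
proof -
  have change: "(\<Sum>k<n. \<kappa> i (w k) * \<kappa>2 k v) = \<kappa> i (\<Sum>k<n. scale (\<kappa>2 k v) (w k))"
    if "coords W n b \<kappa>" "i < n" "\<And>k. k < n \<Longrightarrow> w k \<in> W" for b \<kappa> \<kappa>2 i v w
    using coords_sum[OF that(1) W _ that(2), of "{..<n}" w "\<lambda>k. \<kappa>2 k v"] that(3)
    by (simp add: mult.commute)
  let ?P = "mat n n (\<lambda>(i, j). \<kappa> i (b' j))" and ?Q = "mat n n (\<lambda>(i, j). \<kappa>' i (b j))"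
  let ?A = "matrix_of n b \<kappa> T" and ?A' = "matrix_of n b' \<kappa>' T"
  note cd = coordsD[OF c] and cd' = coordsD[OF c']
  have PQ: "?P * ?Q = 1\<^sub>m n"
    by (rule eq_matI)
      (simp_all add: scalar_prod_def atLeast0LessThan change[OF c] cd cd')
  have QP: "?Q * ?P = 1\<^sub>m n"
    by (rule eq_matI)
      (simp_all add: scalar_prod_def atLeast0LessThan change[OF c'] cd cd')
  have PA: "?P * ?A' = mat n n (\<lambda>(i, j). \<kappa> i (T (b' j)))"
    by (rule eq_matI)
      (simp_all add: scalar_prod_def atLeast0LessThan matrix_of_def change[OF c] cd cd' linear_onD(1)[OF T])
  have "?P * ?A' * ?Q = ?A"
  proof (rule eq_matI)
    fix i j assume "i < dim_row ?A" "j < dim_col ?A"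
    then have ij: "i < n" "j < n" by (auto simp: matrix_of_def)
    have "(?P * ?A' * ?Q) $$ (i, j) = (\<Sum>k<n. \<kappa> i (T (b' k)) * \<kappa>' k (b j))"
      unfolding PA using ij by (simp add: scalar_prod_def atLeast0LessThan)
    also have "\<dots> = \<kappa> i (\<Sum>k<n. scale (\<kappa>' k (b j)) (T (b' k)))"
      using ij linear_onD(1)[OF T] cd' by (intro change[OF c]) auto
    also have "\<dots> = \<kappa> i (T (b j))"
      using linear_on_sum[OF T W, of "{..<n}" b' "\<lambda>k. \<kappa>' k (b j)"] cd'(1) cd'(2)[OF cd(1)[OF ij(2)]] by simp
    finally show "(?P * ?A' * ?Q) $$ (i, j) = ?A $$ (i, j)" using ij by (simp add: matrix_of_def)
  qed (auto simp: matrix_of_def)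
  then show ?thesis
    by (intro similar_matI[of _ _ ?P ?Q n]) (use PQ QP in \<open>auto simp: matrix_of_def\<close>)
qed

lemma sum_append:
  "(\<Sum>i<z + (m::nat). if i < z then f i else g (i - z)) = (\<Sum>i<z. f i) + (\<Sum>i<m. g i :: 'v)"
  by (induction m) (simp_all add: add.assoc)

lemma coords_direct_sum:
  assumes W: "subspace W" and T: "linear_on W T" and idem: "\<And>w. w \<in> W \<Longrightarrow> T (T w) = T w"
    and c1: "coords (T ` W) z b1 \<kappa>1" and c0: "coords {w \<in> W. T w = 0} m b0 \<kappa>0"
  shows "coords W (z + m) (\<lambda>i. if i < z then b1 i else b0 (i - z))
    (\<lambda>i w. if i < z then \<kappa>1 i (T w) else \<kappa>0 (i - z) (w - T w))"
  unfolding coords_def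
proof (intro conjI allI impI ballI)
  note T' = linear_onD[OF T] and Tm = linear_on_more[OF T W] and d1 = coordsD[OF c1] and d0 = coordsD[OF c0]
  have TT: "w - T w \<in> {w \<in> W. T w = 0}" if "w \<in> W" for w
    using that Tm(3)[OF that T'(1)[OF that]] idem[OF that] subspace_diff[OF W that T'(1)[OF that]] by simp
  have TW: "T ` W \<subseteq> W" using T'(1) by blast
  fix i assume i: "i < z + m"
  show "(if i < z then b1 i else b0 (i - z)) \<in> W" using d1(1)[of i] d0(1)[of "i - z"] i TW by auto
  fix j assume j: "j < z + m"
  have b1: "T (b1 j) = b1 j" if "j < z" using d1(1)[OF that] idem by auto
  have b0: "T (b0 (j - z)) = 0" if "\<not> j < z" using d0(1)[of "j - z"] j that by auto
  have k1: "\<kappa>1 i 0 = 0" if "i < z"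
    using d1(4)[OF that, of "T 0" 0] imageI[OF subspace_0[OF W], of T] by (simp add: Tm(1))
  have k0: "\<kappa>0 (i - z) 0 = 0" if "\<not> i < z"
    using d0(4)[of "i - z" 0 0] i that subspace_0[OF W] Tm(1) by simp
  show "(if i < z then \<kappa>1 i (T (if j < z then b1 j else b0 (j - z)))
      else \<kappa>0 (i - z) ((if j < z then b1 j else b0 (j - z)) - T (if j < z then b1 j else b0 (j - z))))
    = (if i = j then 1 else 0)"
    using b1 b0 k1 k0 d1(5)[of i j] d0(5)[of "i - z" "j - z"] i j by auto
next
  note T' = linear_onD[OF T] and Tm = linear_on_more[OF T W] and d1 = coordsD[OF c1] and d0 = coordsD[OF c0]
  have TT: "w - T w \<in> {w \<in> W. T w = 0}" if "w \<in> W" for w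
    using that Tm(3)[OF that T'(1)[OF that]] idem[OF that] subspace_diff[OF W that T'(1)[OF that]] by simp
  fix w assume w: "w \<in> W"
  have "(\<Sum>i<z + m. scale (if i < z then \<kappa>1 i (T w) else \<kappa>0 (i - z) (w - T w)) (if i < z then b1 i else b0 (i - z)))
    = (\<Sum>i<z. scale (\<kappa>1 i (T w)) (b1 i)) + (\<Sum>i<m. scale (\<kappa>0 i (w - T w)) (b0 i))"
    unfolding sum_append[symmetric] by (intro sum.cong) auto
  also have "\<dots> = T w + (w - T w)" using d1(2)[of "T w"] d0(2)[OF TT[OF w]] w by simp
  finally show "w = (\<Sum>i<z + m. scale (if i < z then \<kappa>1 i (T w) else \<kappa>0 (i - z) (w - T w)) (if i < z then b1 i else b0 (i - z)))"
    by simp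
next
  note T' = linear_onD[OF T] and Tm = linear_on_more[OF T W] and d1 = coordsD[OF c1] and d0 = coordsD[OF c0]
  have TT: "w - T w \<in> {w \<in> W. T w = 0}" if "w \<in> W" for w
    using that Tm(3)[OF that T'(1)[OF that]] idem[OF that] subspace_diff[OF W that T'(1)[OF that]] by simp
  fix i w w' assume i: "i < z + m" and w: "w \<in> W" "w' \<in> W"
  have eq: "w + w' - (T w + T w') = (w - T w) + (w' - T w')" by simp
  show "(if i < z then \<kappa>1 i (T (w + w')) else \<kappa>0 (i - z) (w + w' - T (w + w')))
    = (if i < z then \<kappa>1 i (T w) else \<kappa>0 (i - z) (w - T w)) + (if i < z then \<kappa>1 i (T w') else \<kappa>0 (i - z) (w' - T w'))"
    unfolding T'(4)[OF w] eq
    using d1(3)[of i "T w" "T w'"] d0(3)[OF _ TT[OF w(1)] TT[OF w(2)], of "i - z"] i w by simp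
next
  note T' = linear_onD[OF T] and Tm = linear_on_more[OF T W] and d1 = coordsD[OF c1] and d0 = coordsD[OF c0]
  have TT: "w - T w \<in> {w \<in> W. T w = 0}" if "w \<in> W" for w
    using that Tm(3)[OF that T'(1)[OF that]] idem[OF that] subspace_diff[OF W that T'(1)[OF that]] by simp
  fix c i w assume i: "i < z + m" and w: "w \<in> W"
  have "scale c w - T (scale c w) = scale c (w - T w)" using T'(3)[OF w] by (simp add: scale_right_diff_distrib)
  then show "(if i < z then \<kappa>1 i (T (scale c w)) else \<kappa>0 (i - z) (scale c w - T (scale c w)))
    = c * (if i < z then \<kappa>1 i (T w) else \<kappa>0 (i - z) (w - T w))"
    using T'(3)[OF w] d1(4)[of i "T w" c] d0(4)[OF _ TT[OF w], of "i - z" c] i w by simp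
qed

text \<open>In a basis adapted to image and kernel the idempotent is diagonal with \<open>z\<close>
  ones and \<open>n - z\<close> zeros. The order at 0 is recorded because it turns products of
  characteristic polynomials into sums.\<close>

lemma order_char_poly_idempotent:
  assumes c: "coords W n b \<kappa>" and W: "subspace W" "finite W"
    and T: "linear_on W T" and idem: "\<And>w. w \<in> W \<Longrightarrow> T (T w) = T w"
  shows "\<exists>z\<le>n. card (T ` W) = card (UNIV :: 'f set) ^ z \<and> order 0 (char_poly (matrix_of n b \<kappa> T)) = n - z"
proof -
  note T' = linear_onD[OF T] and Tm = linear_on_more[OF T W(1)]
  have s1: "subspace (T ` W)" using subspace_image[OF W(1) T'(2,3)] .
  have s0: "subspace {w \<in> W. T w = 0}"
    unfolding subspace_def using W(1) Tm(1) T'(3,4) by (auto intro: subspace_0 subspace_add subspace_scale)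
  obtain z b1 \<kappa>1 where c1: "coords (T ` W) z b1 \<kappa>1" using ex_coords[OF s1] W(2) by blast
  obtain m b0 \<kappa>0 where c0: "coords {w \<in> W. T w = 0} m b0 \<kappa>0" using ex_coords[OF s0] W(2) by auto
  let ?b = "\<lambda>i. if i < z then b1 i else b0 (i - z)"
    and ?\<kappa> = "\<lambda>i w. if i < z then \<kappa>1 i (T w) else \<kappa>0 (i - z) (w - T w)"
  have c': "coords W (z + m) ?b ?\<kappa>" by (rule coords_direct_sum[OF W(1) T idem c1 c0])
  have "card (UNIV :: 'f set) > 1"
  proof -
    have "card {0, 1 :: 'f} \<le> card (UNIV :: 'f set)" by (rule card_mono) auto
    then show ?thesis by simp
  qed
  \<comment> \<open>Both coordinate systems count the elements of \<open>W\<close>, and powers of a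
    number above 1 have unique exponents.\<close>
  then have n: "n = z + m"
    using card_coords[OF c W(1)] card_coords[OF c' W(1)] by simp
  let ?D = "matrix_of n ?b ?\<kappa> T"
  have entry: "?D $$ (i, j) = (if i = j \<and> i < z then 1 else 0)" if "i < n" "j < n" for i j
  proof -
    note cc = coordsD[OF c']
    have "?\<kappa> i (T (?b j)) = (if i = j \<and> i < z then 1 else 0)"
    proof (cases "j < z")
      case True
      then have "T (?b j) = ?b j" using coordsD(1)[OF c1 True] idem by auto
      then have "?\<kappa> i (T (?b j)) = ?\<kappa> i (?b j)" by (rule arg_cong)
      then show ?thesis using cc(5)[of i j] that n True by auto
    next
      case False
      then have "T (?b j) = 0" using coordsD(1)[OF c0, of "j - z"] that n by auto
      then have "?\<kappa> i (T (?b j)) = ?\<kappa> i (scale 0 0)" by (metis scale_zero_left)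
      also have "\<dots> = 0" using cc(4)[of i 0 0] that n subspace_0[OF W(1)] by simp
      finally show ?thesis using False by simp
    qed
    then show ?thesis using that by (simp add: matrix_of_def)
  qed
  have D: "?D \<in> carrier_mat n n" "upper_triangular ?D"
    using entry by (auto simp: matrix_of_def upper_triangular_def)
  have "similar_mat (matrix_of n b \<kappa> T) ?D"
    using matrix_of_similar[OF c _ W(1) T] c' n by blast
  then have "char_poly (matrix_of n b \<kappa> T) = char_poly ?D" by (rule char_poly_similar)
  also have "\<dots> = (\<Prod>a\<leftarrow>diag_mat ?D. [:- a, 1:])" by (rule char_poly_upper_triangular[OF D])
  also have "diag_mat ?D = replicate z 1 @ replicate m 0"
    using D(1) entry by (intro nth_equalityI) (auto simp: diag_mat_def n nth_append)
  also have "(\<Prod>a\<leftarrow>replicate z 1 @ replicate m 0. [:- a, 1:]) = [:-1, 1:] ^ z * [:0, 1 :: 'f:] ^ m"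
    by (simp add: map_replicate_const prod_list_replicate)
  finally have cp: "char_poly (matrix_of n b \<kappa> T) = [:-1, 1:] ^ z * [:0, 1:] ^ m" .
  have "order 0 ([:-1, 1:] ^ z * [:0, 1 :: 'f:] ^ m) = order 0 ([:-1, 1 :: 'f:] ^ z) + order (0 :: 'f) ([:0, 1:] ^ m)"
    by (rule Polynomial.order_mult) simp
  also have "order 0 ([:-1, 1 :: 'f:] ^ z) = 0" by (rule order_0I) simp
  also have "order (0 :: 'f) ([:0, 1:] ^ m) = m" using order_power_n_n[of "0 :: 'f" m] by simp
  finally have "order 0 (char_poly (matrix_of n b \<kappa> T)) = n - z" using cp n by simp
  moreover have "card (T ` W) = card (UNIV :: 'f set) ^ z" by (rule card_coords[OF c1 s1])
  ultimately show ?thesis using n by (intro exI[of _ z]) auto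
qed

end

section \<open>Left cosets and Artin's relation between permutation characters\<close>

lemma (in group) ex_transversal:
  assumes fin: "finite (carrier G)" and H: "subgroup H G"
  shows "\<exists>(r::nat) t. (\<forall>i<r. t i \<in> carrier G) \<and> (\<forall>x\<in>carrier G. \<exists>!i. i < r \<and> inv (t i) \<otimes> x \<in> H)"
proof -
  define cls where "cls x = {y \<in> carrier G. inv x \<otimes> y \<in> H}" for x
  note Hm = subgroup.mem_carrier[OF H] and H1 = subgroup.one_closed[OF H]
    and Hinv = subgroup.m_inv_closed[OF H] and Hmult = subgroup.m_closed[OF H]
  have self: "x \<in> cls x" if "x \<in> carrier G" for x using that H1 by (simp add: cls_def)
  have cls_eq: "cls x = cls y" if x: "x \<in> carrier G" and y: "y \<in> carrier G" and xy: "inv x \<otimes> y \<in> H" for x y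
  proof -
    have "inv x \<otimes> w \<in> H \<longleftrightarrow> inv y \<otimes> w \<in> H" if w: "w \<in> carrier G" for w
    proof
      have e: "inv y \<otimes> w = inv (inv x \<otimes> y) \<otimes> (inv x \<otimes> w)"
        using x y w by (simp add: inv_mult_group m_assoc inv_solve_left')
          (simp add: m_assoc[symmetric])
      show "inv y \<otimes> w \<in> H" if "inv x \<otimes> w \<in> H"
        unfolding e using that xy Hinv Hmult by blast
      have e': "inv x \<otimes> w = (inv x \<otimes> y) \<otimes> (inv y \<otimes> w)"
        using x y w by (simp add: m_assoc) (simp add: m_assoc[symmetric])
      show "inv x \<otimes> w \<in> H" if "inv y \<otimes> w \<in> H"
        unfolding e' using that xy Hmult by blast
    qed
    then show ?thesis by (auto simp: cls_def)
  qed
  have "finite (cls ` carrier G)" using fin by simp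
  then obtain e where e: "bij_betw e {0..<card (cls ` carrier G)} (cls ` carrier G)"
    using ex_bij_betw_nat_finite by blast
  let ?r = "card (cls ` carrier G)"
  define t where "t i = (SOME x. x \<in> carrier G \<and> cls x = e i)" for i
  have t: "t i \<in> carrier G \<and> cls (t i) = e i" if "i < ?r" for i
    unfolding t_def
  proof (rule someI_ex)
    have "e i \<in> e ` {0..<?r}" using that by simp
    then have "e i \<in> cls ` carrier G" using e by (simp add: bij_betw_def)
    then show "\<exists>x. x \<in> carrier G \<and> cls x = e i" by auto
  qed
  have "\<exists>!i. i < ?r \<and> inv (t i) \<otimes> x \<in> H" if x: "x \<in> carrier G" for x
  proof (rule ex_ex1I)
    have "cls x \<in> e ` {0..<?r}" using e x by (auto simp: bij_betw_def)
    then obtain i where i: "i < ?r" "e i = cls x" by auto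
    then have "x \<in> cls (t i)" using t self[OF x] by simp
    then show "\<exists>i. i < ?r \<and> inv (t i) \<otimes> x \<in> H" using i by (auto simp: cls_def)
    fix i j assume ij: "i < ?r \<and> inv (t i) \<otimes> x \<in> H" "j < ?r \<and> inv (t j) \<otimes> x \<in> H"
    have "cls (t i) = cls x" "cls (t j) = cls x"
      using cls_eq[of "t i" x] cls_eq[of "t j" x] t[of i] t[of j] ij x by simp_all
    then have "e i = e j" using t[of i] t[of j] ij by simp
    then show "i = j" using e ij by (auto simp: bij_betw_def inj_on_def)
  qed
  then have key: "(\<forall>i<?r. t i \<in> carrier G) \<and> (\<forall>x\<in>carrier G. \<exists>!i. i < ?r \<and> inv (t i) \<otimes> x \<in> H)"
    using t by simp
  show ?thesis by (rule exI[of _ ?r], rule exI[of _ t], rule key)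
qed

text \<open>Values are assigned from the larger sets downwards. The value at a minimal
  \<open>D0\<close> enters only the sum for \<open>D0\<close> itself, so it can be chosen
  last.\<close>

lemma ex_moebius:
  assumes "finite (\<C> :: 'a set set)"
  shows "\<exists>n :: 'a set \<Rightarrow> int. \<forall>D\<in>\<C>. (\<Sum>C\<in>{C \<in> \<C>. D \<subseteq> C}. n C) = 1"
  using assms
proof (induction "card \<C>" arbitrary: \<C>)
  case 0
  then show ?case by simp
next
  case (Suc k)
  then have "\<C> \<noteq> {}" by auto
  then obtain D0 where D0: "D0 \<in> \<C>" and min: "\<And>D. D \<in> \<C> \<Longrightarrow> D \<subseteq> D0 \<Longrightarrow> D = D0"
    using finite_has_minimal[OF Suc.prems] by metis
  have "k = card (\<C> - {D0})" "finite (\<C> - {D0})" using Suc.hyps(2) Suc.prems D0 by auto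
  from Suc.hyps(1)[OF this] obtain n where
    n: "\<forall>D\<in>\<C> - {D0}. (\<Sum>C\<in>{C \<in> \<C> - {D0}. D \<subseteq> C}. n C) = (1 :: int)" by blast
  let ?s = "\<Sum>C\<in>{C \<in> \<C> - {D0}. D0 \<subseteq> C}. n C"
  let ?n = "n(D0 := 1 - ?s)"
  have "(\<Sum>C\<in>{C \<in> \<C>. D \<subseteq> C}. ?n C) = 1" if D: "D \<in> \<C>" for D
  proof (cases "D = D0")
    case True
    have "{C \<in> \<C>. D0 \<subseteq> C} = insert D0 {C \<in> \<C> - {D0}. D0 \<subseteq> C}" using D0 by auto
    moreover have "(\<Sum>C\<in>{C \<in> \<C> - {D0}. D0 \<subseteq> C}. ?n C) = ?s" by (intro sum.cong) auto
    ultimately show ?thesis using True Suc.prems by simp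
  next
    case False
    have "{C \<in> \<C>. D \<subseteq> C} = {C \<in> \<C> - {D0}. D \<subseteq> C}" using min[OF D] False by auto
    moreover have "(\<Sum>C\<in>{C \<in> \<C> - {D0}. D \<subseteq> C}. ?n C) = (\<Sum>C\<in>{C \<in> \<C> - {D0}. D \<subseteq> C}. n C)"
      by (intro sum.cong) auto
    ultimately show ?thesis using n D False by simp
  qed
  then show ?case by blast
qed

context group
begin

text \<open>For a subgroup \<open>H\<close> this is |H| times the value at \<open>g\<close> of the
  permutation character on the cosets of \<open>H\<close>, as \<open>card_fixed_cosets\<close>
  shows.\<close>

definition conj_count :: "'a set \<Rightarrow> 'a \<Rightarrow> nat"
  where "conj_count H g = card {x \<in> carrier G. inv x \<otimes> g \<otimes> x \<in> H}"

lemma generate_subset_iff: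
  assumes "subgroup H G" "h \<in> carrier G"
  shows "generate G {h} \<subseteq> H \<longleftrightarrow> h \<in> H"
  using generate_subgroup_incl[of "{h}" H] assms generate.incl[of h "{h}" G] by auto

text \<open>A conjugate of \<open>g\<close> lies in \<open>C\<close> exactly when the cyclic group
  generated by that conjugate is contained in \<open>C\<close>. For each of the |G| conjugating
  elements, the weights of the cyclic groups above this one sum to 1.\<close>

lemma artin_relation:
  assumes fin: "finite (carrier G)"
  shows "\<exists>n :: 'a set \<Rightarrow> int. \<forall>g\<in>carrier G.
    (\<Sum>C\<in>(\<lambda>c. generate G {c}) ` carrier G. n C * int (conj_count C g)) = int (card (carrier G))"
proof -
  let ?C = "(\<lambda>c. generate G {c}) ` carrier G"
  have fC: "finite ?C" using fin by simp
  obtain n :: "'a set \<Rightarrow> int" where n: "\<And>D. D \<in> ?C \<Longrightarrow> (\<Sum>C\<in>{C \<in> ?C. D \<subseteq> C}. n C) = 1"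
    using ex_moebius[OF fC] by blast
  have sub: "subgroup C G" if "C \<in> ?C" for C
    using that by (auto intro: generate_is_subgroup)
  have "(\<Sum>C\<in>?C. n C * int (conj_count C g)) = int (card (carrier G))" if g: "g \<in> carrier G" for g
  proof -
    let ?c = "\<lambda>x. inv x \<otimes> g \<otimes> x"
    have "int (conj_count C g) = (\<Sum>x\<in>carrier G. if generate G {?c x} \<subseteq> C then 1 else 0)" if "C \<in> ?C" for C
    proof -
      have "{x \<in> carrier G. ?c x \<in> C} = {x \<in> carrier G. generate G {?c x} \<subseteq> C}"
        using generate_subset_iff[OF sub[OF that]] g by (intro Collect_cong conj_cong) simp_all
      then show ?thesis using fin by (simp add: conj_count_def sum.If_cases Int_def)
    qed
    then have "(\<Sum>C\<in>?C. n C * int (conj_count C g))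
        = (\<Sum>C\<in>?C. \<Sum>x\<in>carrier G. if generate G {?c x} \<subseteq> C then n C else 0)"
      by (intro sum.cong refl) (simp add: sum_distrib_left if_distrib cong: if_cong)
    also have "\<dots> = (\<Sum>x\<in>carrier G. \<Sum>C\<in>{C \<in> ?C. generate G {?c x} \<subseteq> C}. n C)"
      by (subst sum.swap) (intro sum.cong refl sum.inter_filter[OF fC, symmetric])
    also have "\<dots> = (\<Sum>x\<in>carrier G. 1)" using g by (intro sum.cong refl n) auto
    finally show ?thesis by simp
  qed
  then show ?thesis by blast
qed

definition is_transversal :: "'a set \<Rightarrow> nat \<Rightarrow> (nat \<Rightarrow> 'a) \<Rightarrow> bool"
  where "is_transversal H r t \<longleftrightarrow>
    (\<forall>i<r. t i \<in> carrier G) \<and> (\<forall>x\<in>carrier G. \<exists>!i. i < r \<and> inv (t i) \<otimes> x \<in> H)"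

definition coset_index :: "'a set \<Rightarrow> nat \<Rightarrow> (nat \<Rightarrow> 'a) \<Rightarrow> 'a \<Rightarrow> nat"
  where "coset_index H r t x = (THE i. i < r \<and> inv (t i) \<otimes> x \<in> H)"

text \<open>Left translation by \<open>g\<close> on the left cosets of \<open>H\<close>, transported
  to the indices of their representatives.\<close>

definition coset_perm :: "'a set \<Rightarrow> nat \<Rightarrow> (nat \<Rightarrow> 'a) \<Rightarrow> 'a \<Rightarrow> nat \<Rightarrow> nat"
  where "coset_perm H r t g l = coset_index H r t (g \<otimes> t l)"

lemma transversal_closed: "is_transversal H r t \<Longrightarrow> i < r \<Longrightarrow> t i \<in> carrier G"
  by (simp add: is_transversal_def)

lemma coset_index:
  assumes t: "is_transversal H r t" and x: "x \<in> carrier G"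
  shows "coset_index H r t x < r" "inv (t (coset_index H r t x)) \<otimes> x \<in> H"
    "\<And>i. i < r \<Longrightarrow> coset_index H r t x = i \<longleftrightarrow> inv (t i) \<otimes> x \<in> H"
proof -
  have ex: "\<exists>!i. i < r \<and> inv (t i) \<otimes> x \<in> H" using t x by (simp add: is_transversal_def)
  from theI'[OF ex] show *: "coset_index H r t x < r" "inv (t (coset_index H r t x)) \<otimes> x \<in> H"
    by (auto simp: coset_index_def)
  show "coset_index H r t x = i \<longleftrightarrow> inv (t i) \<otimes> x \<in> H" if "i < r" for i
    using ex * that by metis
qed

lemma coset_index_mult:
  assumes H: "subgroup H G" and t: "is_transversal H r t" and x: "x \<in> carrier G" and h: "h \<in> H"
  shows "coset_index H r t (x \<otimes> h) = coset_index H r t x"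
proof -
  have hG: "h \<in> carrier G" using subgroup.mem_carrier[OF H h] .
  let ?i = "coset_index H r t x"
  have "inv (t ?i) \<otimes> (x \<otimes> h) = (inv (t ?i) \<otimes> x) \<otimes> h"
    using x hG transversal_closed[OF t coset_index(1)[OF t x]] by (simp add: m_assoc)
  then have "inv (t ?i) \<otimes> (x \<otimes> h) \<in> H"
    using coset_index(2)[OF t x] h subgroup.m_closed[OF H] by simp
  then show ?thesis using coset_index(3)[OF t _ coset_index(1)[OF t x], of "x \<otimes> h"] x hG by simp
qed

lemma coset_decomp:
  assumes H: "subgroup H G" and t: "is_transversal H r t" and x: "x \<in> carrier G"
  obtains h where "h \<in> H" "x = t (coset_index H r t x) \<otimes> h"
proof
  let ?i = "coset_index H r t x"
  show "inv (t ?i) \<otimes> x \<in> H" by (rule coset_index(2)[OF t x])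
  show "x = t ?i \<otimes> (inv (t ?i) \<otimes> x)"
    using x transversal_closed[OF t coset_index(1)[OF t x]] by (simp add: m_assoc[symmetric])
qed

lemma coset_index_rep:
  assumes H: "subgroup H G" and t: "is_transversal H r t" and i: "i < r" and h: "h \<in> H"
  shows "coset_index H r t (t i \<otimes> h) = i" "coset_index H r t (t i) = i"
proof -
  have c: "t i \<in> carrier G" "h \<in> carrier G"
    using transversal_closed[OF t i] subgroup.mem_carrier[OF H h] by auto
  show "coset_index H r t (t i) = i"
    using coset_index(3)[OF t c(1) i] c subgroup.one_closed[OF H] by simp
  then show "coset_index H r t (t i \<otimes> h) = i" using coset_index_mult[OF H t c(1) h] by simp
qed

lemma coset_perm_rep:
  assumes H: "subgroup H G" and t: "is_transversal H r t"
  shows "perm_rep r (coset_perm H r t)"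
  unfolding perm_rep_def
proof (intro conjI ballI allI impI)
  fix l assume l: "l < r"
  note tl = transversal_closed[OF t l]
  show "coset_perm H r t \<one> l = l"
    using coset_index_rep(2)[OF H t l subgroup.one_closed[OF H]] tl by (simp add: coset_perm_def)
  fix g assume g: "g \<in> carrier G"
  then show "coset_perm H r t g l < r" using coset_index(1)[OF t] tl by (simp add: coset_perm_def)
  fix h assume h: "h \<in> carrier G"
  let ?j = "coset_index H r t (h \<otimes> t l)"
  have htl: "h \<otimes> t l \<in> carrier G" using h tl by simp
  obtain k where k: "k \<in> H" "h \<otimes> t l = t ?j \<otimes> k" using coset_decomp[OF H t htl] .
  have tj: "t ?j \<in> carrier G" "k \<in> carrier G"
    using transversal_closed[OF t coset_index(1)[OF t htl]] subgroup.mem_carrier[OF H k(1)] by auto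
  have "g \<otimes> h \<otimes> t l = (g \<otimes> t ?j) \<otimes> k"
    using g h tl tj k(2) by (simp add: m_assoc)
  then show "coset_perm H r t (g \<otimes> h) l = coset_perm H r t g (coset_perm H r t h l)"
    using coset_index_mult[OF H t _ k(1), of "g \<otimes> t ?j"] g tj by (simp add: coset_perm_def)
qed

text \<open>Each \<open>x\<close> is \<open>t l \<otimes> h\<close> for exactly one pair. Whether
  \<open>inv x \<otimes> g \<otimes> x\<close> lies in \<open>H\<close> depends only on the coset of
  \<open>x\<close>, and it means that \<open>g\<close> fixes this coset.\<close>

lemma card_fixed_cosets:
  assumes fin: "finite (carrier G)" and H: "subgroup H G" and t: "is_transversal H r t" and g: "g \<in> carrier G"
  shows "card H * card {l. l < r \<and> coset_perm H r t g l = l} = conj_count H g"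
proof -
  let ?X = "{x \<in> carrier G. inv x \<otimes> g \<otimes> x \<in> H}" and ?L = "{l. l < r \<and> coset_perm H r t g l = l}"
  have iff: "coset_perm H r t g l = l \<longleftrightarrow> inv (t l \<otimes> h) \<otimes> g \<otimes> (t l \<otimes> h) \<in> H" if l: "l < r" and h: "h \<in> H" for l h
  proof -
    have c: "t l \<in> carrier G" "h \<in> carrier G"
      using transversal_closed[OF t l] subgroup.mem_carrier[OF H h] by auto
    let ?m = "inv (t l) \<otimes> (g \<otimes> t l)"
    have e: "inv (t l \<otimes> h) \<otimes> g \<otimes> (t l \<otimes> h) = inv h \<otimes> ?m \<otimes> h"
      using c g by (simp add: inv_mult_group m_assoc)
    have e': "?m = h \<otimes> (inv h \<otimes> ?m \<otimes> h) \<otimes> inv h"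
      using c g by (simp add: m_assoc) (simp add: m_assoc[symmetric])
    have "?m \<in> H \<longleftrightarrow> inv h \<otimes> ?m \<otimes> h \<in> H"
      using h subgroup.m_inv_closed[OF H h] subgroup.m_closed[OF H] e' by metis
    then show ?thesis
      using coset_index(3)[OF t _ l, of "g \<otimes> t l"] c g by (simp add: coset_perm_def e)
  qed
  have "bij_betw (\<lambda>(l, h). t l \<otimes> h) (?L \<times> H) ?X"
  proof (rule bij_betwI[where g = "\<lambda>x. (coset_index H r t x, inv (t (coset_index H r t x)) \<otimes> x)"])
    show "(\<lambda>(l, h). t l \<otimes> h) \<in> ?L \<times> H \<rightarrow> ?X"
      using iff transversal_closed[OF t] subgroup.mem_carrier[OF H] by auto
    show "(\<lambda>x. (coset_index H r t x, inv (t (coset_index H r t x)) \<otimes> x)) \<in> ?X \<rightarrow> ?L \<times> H"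
    proof (rule Pi_I)
      fix x assume "x \<in> ?X"
      then have x: "x \<in> carrier G" "inv x \<otimes> g \<otimes> x \<in> H" by auto
      let ?i = "coset_index H r t x"
      obtain h where h: "h \<in> H" "x = t ?i \<otimes> h" using coset_decomp[OF H t x(1)] .
      have "coset_perm H r t g ?i = ?i"
        using iff[OF coset_index(1)[OF t x(1)] h(1)] x(2) h(2) by simp
      then show "(?i, inv (t ?i) \<otimes> x) \<in> ?L \<times> H"
        using coset_index(1,2)[OF t x(1)] by simp
    qed
    show "(coset_index H r t (case p of (l, h) \<Rightarrow> t l \<otimes> h),
        inv (t (coset_index H r t (case p of (l, h) \<Rightarrow> t l \<otimes> h))) \<otimes> (case p of (l, h) \<Rightarrow> t l \<otimes> h)) = p"
      if "p \<in> ?L \<times> H" for p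
      using that coset_index_rep(1)[OF H t] transversal_closed[OF t] subgroup.mem_carrier[OF H]
      by (auto simp: m_assoc[symmetric])
    show "(case (coset_index H r t x, inv (t (coset_index H r t x)) \<otimes> x) of (l, h) \<Rightarrow> t l \<otimes> h) = x" if "x \<in> ?X" for x
      using that transversal_closed[OF t coset_index(1)[OF t]] by (auto simp: m_assoc[symmetric])
  qed
  from bij_betw_same_card[OF this] show ?thesis
    by (simp add: card_cartesian_product conj_count_def mult.commute)
qed

end

section \<open>Operators on induced modules\<close>

text \<open>A self-map of a finite set has finitely many powers, so the sequence of powers is
  eventually periodic.\<close>

lemma ex_idempotent_power:
  assumes "finite N" and T: "T ` N \<subseteq> N"
  shows "\<exists>m>0. \<forall>x\<in>N. (T ^^ m) ((T ^^ m) x) = (T ^^ m) x"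
proof -
  let ?F = "\<lambda>k. restrict (T ^^ k) N"
  have "range ?F \<subseteq> PiE N (\<lambda>_. N)" using funpow_maps[OF T] by auto
  then have "finite (range ?F)" using assms(1) by (meson finite_PiE finite_subset)
  then have "\<not> inj ?F" using finite_imageD infinite_UNIV_nat by blast
  then obtain i j where ij: "i \<noteq> j" "?F i = ?F j" by (auto simp: inj_def)
  then obtain i j where ij: "i < j" "?F i = ?F j" by (metis nat_neq_iff)
  define d where "d = j - i"
  have d: "d > 0" "j = i + d" using ij by (auto simp: d_def)
  have ij': "(T ^^ (i + d)) x = (T ^^ i) x" if "x \<in> N" for x
    using ij(2) d(2) that by (metis restrict_apply')
  have step: "(T ^^ (n + d)) x = (T ^^ n) x" if x: "x \<in> N" and n: "n \<ge> i" for x n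
  proof -
    have "(T ^^ (n + d)) x = (T ^^ (n - i)) ((T ^^ (i + d)) x)"
      using n by (metis comp_apply funpow_add le_add_diff_inverse2 add.assoc)
    also have "\<dots> = (T ^^ (n - i)) ((T ^^ i) x)" using ij'[OF x] by simp
    also have "\<dots> = (T ^^ n) x" using n by (metis comp_apply funpow_add le_add_diff_inverse2)
    finally show ?thesis .
  qed
  have steps: "(T ^^ (n + d * q)) x = (T ^^ n) x" if "x \<in> N" "n \<ge> i" for x n q
  proof (induction q)
    case (Suc q)
    have e: "n + d * Suc q = (n + d * q) + d" by simp
    show ?case unfolding e using step[OF that(1), of "n + d * q"] that(2) Suc by simp
  qed simp
  \<comment> \<open>A positive multiple of the period \<open>d\<close> that is not below the
    pre-period \<open>i\<close>.\<close>
  let ?m = "d * (i + 1)"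
  have m: "?m > 0" "?m \<ge> i" using d(1) by (cases d; simp)+
  have "(T ^^ ?m) ((T ^^ ?m) x) = (T ^^ ?m) x" if "x \<in> N" for x
    using steps[OF that m(2), of "i + 1"] by (simp add: funpow_add)
  then show ?thesis using m(1) by blast
qed

lemma sum_fun_apply: "(\<Sum>i\<in>A. f i) x = (\<Sum>i\<in>A. f i x :: 'a::ab_group_add)"
  by (induction A rule: infinite_finite_induct) auto

lemma order_power_poly: "p \<noteq> 0 \<Longrightarrow> order x (p ^ n) = n * order x (p :: 'a::idom poly)"
  by (induction n) (auto simp: Polynomial.order_mult order_0I)

text \<open>The module is a finite subspace \<open>V\<close> of the type, and \<open>\<rho>\<close>
  is constrained only on \<open>V\<close>. The same theory then applies to submodules and to a
  complement that models a subquotient.\<close>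

locale group_rep = finite_field_space scale + group G
  for scale :: "'f::{field,finite} \<Rightarrow> 'v::ab_group_add \<Rightarrow> 'v" and G :: "'g monoid" (structure) +
  fixes V :: "'v set" and \<rho> :: "'g \<Rightarrow> 'v \<Rightarrow> 'v"
  assumes fin_G: "finite (carrier G)"
    and V_subspace: "subspace V" and V_finite: "finite V"
    and \<rho>_linear: "g \<in> carrier G \<Longrightarrow> linear_on V (\<rho> g)"
    and \<rho>_one: "v \<in> V \<Longrightarrow> \<rho> \<one> v = v"
    and \<rho>_mult: "g \<in> carrier G \<Longrightarrow> h \<in> carrier G \<Longrightarrow> v \<in> V \<Longrightarrow> \<rho> (g \<otimes> h) v = \<rho> g (\<rho> h v)"
begin

sublocale fn: finite_field_space "\<lambda>c (\<phi> :: 'g \<Rightarrow> 'v) x. scale c (\<phi> x)"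
  by unfold_locales (auto simp: fun_eq_iff scale_right_distrib scale_left_distrib)

lemma \<rho>_closed: "g \<in> carrier G \<Longrightarrow> v \<in> V \<Longrightarrow> \<rho> g v \<in> V"
  using linear_onD(1)[OF \<rho>_linear] .

lemma \<rho>_inv: "g \<in> carrier G \<Longrightarrow> v \<in> V \<Longrightarrow> \<rho> (inv g) (\<rho> g v) = v"
  "g \<in> carrier G \<Longrightarrow> v \<in> V \<Longrightarrow> \<rho> g (\<rho> (inv g) v) = v"
  by (simp_all add: \<rho>_mult[symmetric] \<rho>_one)

text \<open>The module induced from \<open>H\<close>, as functions on the group that are equivariant
  under \<open>H\<close> from the right. For every subgroup it lies in \<open>ind {\<one>}\<close>,
  so identities between operators can be checked there once; the value 0 off the carrier keeps the
  set finite.\<close>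

definition ind :: "'g set \<Rightarrow> ('g \<Rightarrow> 'v) set"
  where "ind H = {\<phi>. (\<forall>x\<in>carrier G. \<phi> x \<in> V) \<and> (\<forall>x. x \<notin> carrier G \<longrightarrow> \<phi> x = 0) \<and>
    (\<forall>x\<in>carrier G. \<forall>h\<in>H. \<phi> (x \<otimes> h) = \<rho> (inv h) (\<phi> x))}"

text \<open>The group ring element with coefficient \<open>a g\<close> at \<open>g\<close>, acting
  by left translation, which takes \<open>\<phi>\<close> to
  \<open>\<phi> (inv g \<otimes> x)\<close> at \<open>x\<close>. The coefficients are operators on
  \<open>V\<close> that commute with the group, as expressed by \<open>coef\<close>.\<close>

definition theta :: "('g \<Rightarrow> 'v \<Rightarrow> 'v) \<Rightarrow> ('g \<Rightarrow> 'v) \<Rightarrow> 'g \<Rightarrow> 'v"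
  where "theta a \<phi> x = (if x \<in> carrier G then \<Sum>g\<in>carrier G. a g (\<phi> (inv g \<otimes> x)) else 0)"

definition coef :: "('g \<Rightarrow> 'v \<Rightarrow> 'v) \<Rightarrow> bool"
  where "coef a \<longleftrightarrow> (\<forall>g\<in>carrier G. linear_on V (a g) \<and>
    (\<forall>h\<in>carrier G. \<forall>v\<in>V. a g (\<rho> h v) = \<rho> h (a g v)))"

lemma coefD:
  assumes "coef a" "g \<in> carrier G"
  shows "linear_on V (a g)" "\<And>v. v \<in> V \<Longrightarrow> a g v \<in> V"
    "\<And>h v. h \<in> carrier G \<Longrightarrow> v \<in> V \<Longrightarrow> a g (\<rho> h v) = \<rho> h (a g v)"
  using assms linear_onD(1)[of V "a g"] by (auto simp: coef_def)

lemma indD: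
  assumes "\<phi> \<in> ind H"
  shows "\<And>x. x \<in> carrier G \<Longrightarrow> \<phi> x \<in> V" "\<And>x. x \<notin> carrier G \<Longrightarrow> \<phi> x = 0"
    "\<And>x h. x \<in> carrier G \<Longrightarrow> h \<in> H \<Longrightarrow> \<phi> (x \<otimes> h) = \<rho> (inv h) (\<phi> x)"
  using assms by (auto simp: ind_def)

lemma finite_ind: "finite (ind H)"
proof (rule finite_subset)
  show "ind H \<subseteq> {\<phi>. \<forall>x. (x \<in> carrier G \<longrightarrow> \<phi> x \<in> V) \<and> (x \<notin> carrier G \<longrightarrow> \<phi> x = 0)}"
    by (auto simp: ind_def)
  show "finite {\<phi>. \<forall>x. (x \<in> carrier G \<longrightarrow> \<phi> x \<in> V) \<and> (x \<notin> carrier G \<longrightarrow> \<phi> x = (0 :: 'v))}"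
    using finite_set_of_finite_funs[OF fin_G V_finite] .
qed

lemma subspace_ind:
  assumes "subgroup H G"
  shows "fn.subspace (ind H)"
  unfolding fn.subspace_def
proof (intro conjI ballI allI)
  note H = subgroup.mem_carrier[OF assms]
  note lin = linear_onD[OF \<rho>_linear] and more = linear_on_more[OF \<rho>_linear V_subspace]
  show "0 \<in> ind H" using subspace_0[OF V_subspace] more(1) H by (auto simp: ind_def)
  show "\<phi> + \<psi> \<in> ind H" if "\<phi> \<in> ind H" "\<psi> \<in> ind H" for \<phi> \<psi>
    using that subspace_add[OF V_subspace] lin(4) H by (auto simp: ind_def)
  show "(\<lambda>x. scale c (\<phi> x)) \<in> ind H" if "\<phi> \<in> ind H" for c \<phi>
    using that subspace_scale[OF V_subspace] lin(3) H by (auto simp: ind_def)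
qed

lemma ind_subset_ind_one: "subgroup H G \<Longrightarrow> ind H \<subseteq> ind {\<one>}"
  using subgroup.one_closed[of H G] by (auto simp: ind_def \<rho>_one)

lemma linear_on_theta:
  assumes a: "coef a" and H: "subgroup H G"
  shows "fn.linear_on (ind H) (theta a)"
proof (rule fn.linear_onI)
  note lin = linear_onD[OF coefD(1)[OF a]]
  note Hc = subgroup.mem_carrier[OF H]
  fix \<phi> assume \<phi>: "\<phi> \<in> ind H"
  show "theta a \<phi> \<in> ind H"
    unfolding ind_def
  proof (intro CollectI conjI ballI allI impI)
    show "theta a \<phi> x \<in> V" if "x \<in> carrier G" for x
      using that indD(1)[OF \<phi>] coefD(2)[OF a] by (auto simp: theta_def intro!: subspace_sum V_subspace)
    show "theta a \<phi> x = 0" if "x \<notin> carrier G" for x using that by (simp add: theta_def)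
    fix x h assume x: "x \<in> carrier G" and h: "h \<in> H"
    note hc = Hc[OF h]
    have "theta a \<phi> (x \<otimes> h) = (\<Sum>g\<in>carrier G. a g (\<phi> (inv g \<otimes> x \<otimes> h)))"
      using x hc by (auto simp: theta_def m_assoc intro!: sum.cong)
    also have "\<dots> = (\<Sum>g\<in>carrier G. \<rho> (inv h) (a g (\<phi> (inv g \<otimes> x))))"
      using x hc h indD[OF \<phi>] coefD(3)[OF a] by (intro sum.cong) auto
    also have "\<dots> = \<rho> (inv h) (\<Sum>g\<in>carrier G. a g (\<phi> (inv g \<otimes> x)))"
      using linear_on_sum[OF \<rho>_linear[of "inv h"] V_subspace fin_G, of "\<lambda>g. a g (\<phi> (inv g \<otimes> x))" "\<lambda>_. 1"]
        x hc indD(1)[OF \<phi>] coefD(2)[OF a] by simp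
    finally show "theta a \<phi> (x \<otimes> h) = \<rho> (inv h) (theta a \<phi> x)" using x by (simp add: theta_def)
  qed
  show "theta a (\<lambda>x. scale c (\<phi> x)) = (\<lambda>x. scale c (theta a \<phi> x))" for c
    using lin(3) indD(1)[OF \<phi>] by (auto simp: theta_def fun_eq_iff scale_sum_right intro!: sum.cong)
  fix \<psi> assume \<psi>: "\<psi> \<in> ind H"
  show "theta a (\<phi> + \<psi>) = theta a \<phi> + theta a \<psi>"
    using lin(4) indD(1)[OF \<phi>] indD(1)[OF \<psi>]
    by (auto simp: theta_def fun_eq_iff sum.distrib[symmetric] intro!: sum.cong)
qed

lemma trivial_subgroup: "subgroup {\<one>} G"
  by (rule triv_subgroup)

definition conv_op :: "('g \<Rightarrow> 'v \<Rightarrow> 'v) \<Rightarrow> ('g \<Rightarrow> 'v \<Rightarrow> 'v) \<Rightarrow> 'g \<Rightarrow> 'v \<Rightarrow> 'v"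
  where "conv_op a b w v = (\<Sum>g\<in>carrier G. a g (b (inv g \<otimes> w) v))"

lemma coef_conv_op:
  assumes a: "coef a" and b: "coef b"
  shows "coef (conv_op a b)"
  unfolding coef_def
proof (intro ballI conjI)
  fix w assume w: "w \<in> carrier G"
  note la = linear_onD[OF coefD(1)[OF a]] and lb = linear_onD[OF coefD(1)[OF b]]
  show "linear_on V (conv_op a b w)"
  proof (rule linear_onI)
    fix v assume v: "v \<in> V"
    show "conv_op a b w v \<in> V"
      using w v coefD(2)[OF a] coefD(2)[OF b] by (auto simp: conv_op_def intro!: subspace_sum V_subspace)
    show "conv_op a b w (scale c v) = scale c (conv_op a b w v)" for c
      using w v la(3) lb(3) lb(1) by (auto simp: conv_op_def scale_sum_right intro!: sum.cong)
    fix v' assume v': "v' \<in> V"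
    show "conv_op a b w (v + v') = conv_op a b w v + conv_op a b w v'"
      using w v v' la(4) lb(4) lb(1) by (auto simp: conv_op_def sum.distrib[symmetric] intro!: sum.cong)
  qed
  fix h v assume h: "h \<in> carrier G" and v: "v \<in> V"
  have "conv_op a b w (\<rho> h v) = (\<Sum>g\<in>carrier G. \<rho> h (a g (b (inv g \<otimes> w) v)))"
    using w v h coefD(2,3)[OF a] coefD(2,3)[OF b] by (auto simp: conv_op_def intro!: sum.cong)
  also have "\<dots> = \<rho> h (conv_op a b w v)"
    using linear_on_sum[OF \<rho>_linear[OF h] V_subspace fin_G, of "\<lambda>g. a g (b (inv g \<otimes> w) v)" "\<lambda>_. 1"]
      w v coefD(2)[OF a] coefD(2)[OF b] by (simp add: conv_op_def)
  finally show "conv_op a b w (\<rho> h v) = \<rho> h (conv_op a b w v)" .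
qed

lemma theta_conv_op:
  assumes a: "coef a" and b: "coef b" and \<phi>: "\<phi> \<in> ind {\<one>}"
  shows "theta a (theta b \<phi>) = theta (conv_op a b) \<phi>"
proof
  fix x
  show "theta a (theta b \<phi>) x = theta (conv_op a b) \<phi> x"
  proof (cases "x \<in> carrier G")
    case x: True
    have "theta a (theta b \<phi>) x = (\<Sum>g\<in>carrier G. a g (\<Sum>h\<in>carrier G. b h (\<phi> (inv h \<otimes> (inv g \<otimes> x)))))"
      using x by (auto simp: theta_def intro!: sum.cong)
    also have "\<dots> = (\<Sum>g\<in>carrier G. \<Sum>h\<in>carrier G. a g (b h (\<phi> (inv h \<otimes> (inv g \<otimes> x)))))"
    proof (intro sum.cong refl)
      fix g assume g: "g \<in> carrier G"
      show "a g (\<Sum>h\<in>carrier G. b h (\<phi> (inv h \<otimes> (inv g \<otimes> x))))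
        = (\<Sum>h\<in>carrier G. a g (b h (\<phi> (inv h \<otimes> (inv g \<otimes> x)))))"
        using linear_on_sum[OF coefD(1)[OF a g] V_subspace fin_G, of "\<lambda>h. b h (\<phi> (inv h \<otimes> (inv g \<otimes> x)))" "\<lambda>_. 1"]
          x g indD(1)[OF \<phi>] coefD(2)[OF b] by simp
    qed
    also have "\<dots> = (\<Sum>g\<in>carrier G. \<Sum>w\<in>carrier G. a g (b (inv g \<otimes> w) (\<phi> (inv w \<otimes> x))))"
    proof (rule sum.cong[OF refl])
      fix g assume g: "g \<in> carrier G"
      show "(\<Sum>h\<in>carrier G. a g (b h (\<phi> (inv h \<otimes> (inv g \<otimes> x)))))
        = (\<Sum>w\<in>carrier G. a g (b (inv g \<otimes> w) (\<phi> (inv w \<otimes> x))))"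
        by (rule sum.reindex_bij_witness[where i = "\<lambda>w. inv g \<otimes> w" and j = "\<lambda>h. g \<otimes> h"])
          (use g x in \<open>auto simp: m_assoc[symmetric] inv_mult_group\<close>)
    qed
    also have "\<dots> = theta (conv_op a b) \<phi> x"
      using x by (subst sum.swap) (simp add: theta_def conv_op_def)
    finally show ?thesis .
  qed (simp add: theta_def)
qed

definition delta :: "'g \<Rightarrow> 'v \<Rightarrow> 'v"
  where "delta g v = (if g = \<one> then v else 0)"

lemma coef_delta: "coef delta"
proof -
  have "\<rho> h 0 = 0" if "h \<in> carrier G" for h using linear_on_more(1)[OF \<rho>_linear[OF that] V_subspace] .
  then show ?thesis
    unfolding coef_def delta_def using subspace_0[OF V_subspace]
    by (auto intro!: linear_onI)
qed

lemma theta_delta: "\<phi> \<in> ind {\<one>} \<Longrightarrow> theta delta \<phi> = \<phi>"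
proof
  fix x assume \<phi>: "\<phi> \<in> ind {\<one>}"
  show "theta delta \<phi> x = \<phi> x"
  proof (cases "x \<in> carrier G")
    case True
    have "theta delta \<phi> x = (\<Sum>g\<in>carrier G. if g = \<one> then \<phi> x else 0)"
      using True by (auto simp: theta_def delta_def intro!: sum.cong)
    then show ?thesis using fin_G by simp
  qed (use indD(2)[OF \<phi>] in \<open>simp add: theta_def\<close>)
qed

text \<open>An idempotent power of \<open>theta a\<close> is thus again given by a coefficient
  family, to which the relation between characteristic polynomials applies.\<close>

lemma theta_power:
  assumes a: "coef a"
  shows "\<exists>c. coef c \<and> (\<forall>\<phi>\<in>ind {\<one>}. theta c \<phi> = (theta a ^^ k) \<phi>)"
proof (induction k)
  case 0
  then show ?case using coef_delta theta_delta by (intro exI[of _ delta]) auto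
next
  case (Suc k)
  then obtain c where c: "coef c" "\<forall>\<phi>\<in>ind {\<one>}. theta c \<phi> = (theta a ^^ k) \<phi>" by blast
  then show ?case using coef_conv_op[OF a c(1)] theta_conv_op[OF a c(1)]
    by (intro exI[of _ "conv_op a c"]) auto
qed

text \<open>In terms of \<open>\<psi> x = \<rho> x (\<phi> x)\<close> the space \<^term>\<open>ind H\<close> becomes the space of \<^term>\<open>V\<close>-valued functions on
  the cosets of \<^term>\<open>H\<close>, and \<^term>\<open>theta a\<close> the sum of the \<open>a g \<circ> \<rho> g\<close> tensored with the permutation of cosets by \<open>g\<close>.\<close>

lemma ind_coords:
  assumes H: "subgroup H G" and t: "is_transversal H r t" and c: "coords V n b \<kappa>"
  defines "B \<equiv> \<lambda>i x. if x \<in> carrier G \<and> coset_index H r t x = i div n then \<rho> (inv x) (b (i mod n)) else 0"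
    and "K \<equiv> \<lambda>i \<phi>. \<kappa> (i mod n) (\<rho> (t (i div n)) (\<phi> (t (i div n))))"
  shows "fn.coords (ind H) (r * n) B K"
    and "coef a \<Longrightarrow> fn.matrix_of (r * n) B K (theta a)
      = block_mat G r n (coset_perm H r t) (\<lambda>g i j. \<kappa> i (a g (\<rho> g (b j))))"
proof -
  note Hc = subgroup.mem_carrier[OF H] and tc = transversal_closed[OF t] and cd = coordsD[OF c]
  let ?ix = "coset_index H r t"
  have B: "B i \<in> ind H" if i: "i < r * n" for i
    unfolding ind_def
  proof (intro CollectI conjI ballI allI impI)
    note bi = cd(1)[OF block_index(2)[OF i]]
    show "B i x \<in> V" if "x \<in> carrier G" for x
      using that bi \<rho>_closed subspace_0[OF V_subspace] by (simp add: B_def)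
    show "B i x = 0" if "x \<notin> carrier G" for x using that by (simp add: B_def)
    fix x h assume x: "x \<in> carrier G" and h: "h \<in> H"
    show "B i (x \<otimes> h) = \<rho> (inv h) (B i x)"
      using coset_index_mult[OF H t x h] x Hc[OF h] bi linear_on_more(1)[OF \<rho>_linear V_subspace]
      by (simp add: B_def inv_mult_group \<rho>_mult)
  qed
  have \<kappa>0: "\<kappa> i 0 = 0" if "i < n" for i
    using cd(4)[OF that subspace_0[OF V_subspace], of 0] by simp
  have at: "\<rho> (t l) (\<phi> (t l)) \<in> V" if "l < r" "\<phi> \<in> ind H" for l \<phi>
    using that tc indD(1) \<rho>_closed by blast
  have KB: "K i (B j) = (if i = j then 1 else 0)" if i: "i < r * n" and j: "j < r * n" for i j
  proof -
    note bi = block_index[OF i] and bj = block_index[OF j]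
    have ix: "?ix (t (i div n)) = i div n"
      using coset_index_rep(2)[OF H t bi(1) subgroup.one_closed[OF H]] .
    have "\<rho> (t (i div n)) (B j (t (i div n))) = (if i div n = j div n then b (j mod n) else 0)"
      using tc[OF bi(1)] tc[OF bj(1)] ix \<rho>_inv(2) cd(1)[OF bj(2)] linear_on_more(1)[OF \<rho>_linear V_subspace]
      by (simp add: B_def)
    then have "K i (B j) = (if i div n = j div n then \<kappa> (i mod n) (b (j mod n)) else \<kappa> (i mod n) 0)"
      by (simp add: K_def)
    also have "\<dots> = (if i div n = j div n \<and> i mod n = j mod n then 1 else 0)"
      unfolding cd(5)[OF bi(2) bj(2)] \<kappa>0[OF bi(2)] by simp
    finally have "K i (B j) = (if i div n = j div n \<and> i mod n = j mod n then 1 else 0)" .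
    moreover have "i div n = j div n \<and> i mod n = j mod n \<longleftrightarrow> i = j" by (metis div_mult_mod_eq)
    ultimately show ?thesis by simp
  qed
  have expand: "(\<Sum>i<r * n. (\<lambda>x. scale (K i \<phi>) (B i x))) = \<phi>" if \<phi>: "\<phi> \<in> ind H" for \<phi>
  proof
    fix x
    show "(\<Sum>i<r * n. (\<lambda>x. scale (K i \<phi>) (B i x))) x = \<phi> x"
    proof (cases "x \<in> carrier G")
      case x: True
      let ?l = "?ix x"
      note l = coset_index(1)[OF t x]
      obtain h where h: "h \<in> H" "x = t ?l \<otimes> h" using coset_decomp[OF H t x] .
      let ?v = "\<rho> (t ?l) (\<phi> (t ?l))"
      have "(\<Sum>i<r * n. (\<lambda>x. scale (K i \<phi>) (B i x))) x = (\<Sum>i<r * n. scale (K i \<phi>) (B i x))"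
        by (simp add: sum_fun_apply)
      also have "\<dots> = (\<Sum>l<r. \<Sum>j<n. scale (\<kappa> j (\<rho> (t l) (\<phi> (t l)))) (if x \<in> carrier G \<and> ?ix x = l then \<rho> (inv x) (b j) else 0))"
        unfolding K_def B_def by (rule sum_block)
      also have "\<dots> = (\<Sum>l<r. if ?l = l then \<Sum>j<n. scale (\<kappa> j (\<rho> (t l) (\<phi> (t l)))) (\<rho> (inv x) (b j)) else 0)"
        using x by (intro sum.cong) auto
      also have "\<dots> = (\<Sum>j<n. scale (\<kappa> j ?v) (\<rho> (inv x) (b j)))" using l by (simp add: sum.delta')
      also have "\<dots> = \<rho> (inv x) (\<Sum>j<n. scale (\<kappa> j ?v) (b j))"
        using linear_on_sum[OF \<rho>_linear[of "inv x"] V_subspace, of "{..<n}" b "\<lambda>j. \<kappa> j ?v"] x cd(1) by simp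
      also have "\<dots> = \<rho> (inv x) ?v" using cd(2)[OF at[OF l \<phi>]] by simp
      also have "\<dots> = \<rho> (inv x \<otimes> t ?l) (\<phi> (t ?l))"
        using x tc[OF l] indD(1)[OF \<phi>] by (simp add: \<rho>_mult)
      also have "inv x \<otimes> t ?l = inv h"
      proof -
        have "inv (t ?l \<otimes> h) \<otimes> t ?l = inv h"
          using tc[OF l] Hc[OF h(1)] by (simp add: inv_mult_group m_assoc)
        then show ?thesis by (simp only: h(2)[symmetric])
      qed
      also have "\<rho> (inv h) (\<phi> (t ?l)) = \<phi> x" using indD(3)[OF \<phi> tc[OF l] h(1)] h(2) by simp
      finally show ?thesis .
    qed (use indD(2)[OF \<phi>] in \<open>simp add: sum_fun_apply B_def\<close>)
  qed
  show "fn.coords (ind H) (r * n) B K"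
    unfolding fn.coords_def
  proof (intro conjI allI impI ballI)
    show "B i \<in> ind H" if "i < r * n" for i by (rule B[OF that])
    show "\<phi> = (\<Sum>i<r * n. (\<lambda>x. scale (K i \<phi>) (B i x)))" if "\<phi> \<in> ind H" for \<phi>
      using expand[OF that] by simp
    show "K i (\<phi> + \<psi>) = K i \<phi> + K i \<psi>" if "i < r * n" "\<phi> \<in> ind H" "\<psi> \<in> ind H" for i \<phi> \<psi>
    proof -
      note bi = block_index[OF that(1)]
      show ?thesis
        using tc[OF bi(1)] indD(1)[OF that(2)] indD(1)[OF that(3)] linear_onD(4)[OF \<rho>_linear]
          cd(3)[OF bi(2) at[OF bi(1) that(2)] at[OF bi(1) that(3)]] by (simp add: K_def)
    qed
    show "K i (\<lambda>x. scale d (\<phi> x)) = d * K i \<phi>" if "i < r * n" "\<phi> \<in> ind H" for d i \<phi>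
    proof -
      note bi = block_index[OF that(1)]
      show ?thesis
        using tc[OF bi(1)] indD(1)[OF that(2)] linear_onD(3)[OF \<rho>_linear]
          cd(4)[OF bi(2) at[OF bi(1) that(2)]] by (simp add: K_def)
    qed
    show "K i (B j) = (if i = j then 1 else 0)" if "i < r * n" "j < r * n" for i j
      by (rule KB[OF that])
  qed
  assume a: "coef a"
  show "fn.matrix_of (r * n) B K (theta a)
      = block_mat G r n (coset_perm H r t) (\<lambda>g i j. \<kappa> i (a g (\<rho> g (b j))))"
  proof (rule eq_matI)
    fix i j
    assume "i < dim_row (block_mat G r n (coset_perm H r t) (\<lambda>g i j. \<kappa> i (a g (\<rho> g (b j)))))"
      "j < dim_col (block_mat G r n (coset_perm H r t) (\<lambda>g i j. \<kappa> i (a g (\<rho> g (b j)))))"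
    then have ij: "i < r * n" "j < r * n" by auto
    note bi = block_index[OF ij(1)] and bj = block_index[OF ij(2)]
    let ?l = "i div n" and ?m = "j div n"
    let ?b = "b (j mod n)"
    have bV: "?b \<in> V" by (rule cd(1)[OF bj(2)])
    note tl = tc[OF bi(1)] and tm = tc[OF bj(1)]
    have a0: "a g 0 = 0" if "g \<in> carrier G" for g
      using linear_on_more(1)[OF coefD(1)[OF a that] V_subspace] .
    have entry: "\<rho> (t ?l) (a g (B j (inv g \<otimes> t ?l)))
      = (if coset_perm H r t g ?m = ?l then a g (\<rho> g ?b) else 0)" if g: "g \<in> carrier G" for g
    proof -
      have "?ix (inv g \<otimes> t ?l) = ?m \<longleftrightarrow> inv (t ?m) \<otimes> (inv g \<otimes> t ?l) \<in> H"
        using g tl by (intro coset_index(3)[OF t _ bj(1)]) simp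
      also have "\<dots> \<longleftrightarrow> inv (t ?l) \<otimes> (g \<otimes> t ?m) \<in> H"
      proof -
        have e: "inv (t ?l) \<otimes> (g \<otimes> t ?m) = inv (inv (t ?m) \<otimes> (inv g \<otimes> t ?l))"
          using g tl tm by (simp add: inv_mult_group m_assoc)
        show ?thesis
          unfolding e using subgroup.m_inv_closed[OF H] g tl tm by (metis inv_closed inv_inv m_closed)
      qed
      also have "\<dots> \<longleftrightarrow> coset_perm H r t g ?m = ?l"
        using g tm coset_index(3)[OF t _ bi(1), of "g \<otimes> t ?m"] by (simp add: coset_perm_def)
      finally have iff: "?ix (inv g \<otimes> t ?l) = ?m \<longleftrightarrow> coset_perm H r t g ?m = ?l" .
      have "\<rho> (t ?l) (a g (\<rho> (inv (inv g \<otimes> t ?l)) ?b)) = a g (\<rho> g ?b)"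
      proof -
        have "\<rho> (t ?l) (a g (\<rho> (inv (inv g \<otimes> t ?l)) ?b)) = a g (\<rho> (t ?l) (\<rho> (inv (t ?l) \<otimes> g) ?b))"
          using g tl bV coefD(3)[OF a g tl, of "\<rho> (inv (t ?l) \<otimes> g) ?b"] \<rho>_closed by (simp add: inv_mult_group)
        also have "\<rho> (t ?l) (\<rho> (inv (t ?l) \<otimes> g) ?b) = \<rho> g ?b"
          using g tl bV \<rho>_inv(2)[OF tl] \<rho>_closed by (simp add: \<rho>_mult)
        finally show ?thesis .
      qed
      then show ?thesis
        using iff g tl a0[OF g] linear_on_more(1)[OF \<rho>_linear[OF tl] V_subspace] by (simp add: B_def)
    qed
    have BV: "a g (B j (inv g \<otimes> t ?l)) \<in> V" if "g \<in> carrier G" for g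
      using coefD(2)[OF a that] indD(1)[OF B[OF ij(2)]] that tl by simp
    have "K i (theta a (B j)) = \<kappa> (i mod n) (\<rho> (t ?l) (\<Sum>g\<in>carrier G. a g (B j (inv g \<otimes> t ?l))))"
      using tl by (simp add: K_def theta_def)
    also have "\<rho> (t ?l) (\<Sum>g\<in>carrier G. a g (B j (inv g \<otimes> t ?l)))
        = (\<Sum>g\<in>carrier G. \<rho> (t ?l) (a g (B j (inv g \<otimes> t ?l))))"
      using linear_on_sum[OF \<rho>_linear[OF tl] V_subspace fin_G, of "\<lambda>g. a g (B j (inv g \<otimes> t ?l))" "\<lambda>_. 1"] BV by simp
    also have "\<kappa> (i mod n) \<dots> = (\<Sum>g\<in>carrier G. \<kappa> (i mod n) (\<rho> (t ?l) (a g (B j (inv g \<otimes> t ?l)))))"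
      using BV tl \<rho>_closed by (intro coords_sum'[OF c V_subspace fin_G bi(2)]) blast
    also have "\<dots> = (\<Sum>g\<in>carrier G. if coset_perm H r t g ?m = ?l then \<kappa> (i mod n) (a g (\<rho> g ?b)) else 0)"
      using entry \<kappa>0[OF bi(2)] by (intro sum.cong) auto
    finally show "fn.matrix_of (r * n) B K (theta a) $$ (i, j)
      = block_mat G r n (coset_perm H r t) (\<lambda>g i j. \<kappa> i (a g (\<rho> g (b j)))) $$ (i, j)"
      using ij by (simp add: fn.matrix_of_def block_mat_def)
  qed (auto simp: fn.matrix_of_def)
qed

section \<open>Transfer of divisibility from cyclic subgroups to the whole group\<close>

text \<open>Orders at 0 of the characteristic polynomials and dimensions of the induced modules
  satisfy Artin's relation; hence so do the exponents \<open>z H\<close>. This writes |G| times the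
  exponent for the whole group as an integral combination of exponents for cyclic subgroups, all
  divisible by \<open>D\<close>.\<close>

lemma fit_exponent_idempotent:
  assumes a: "coef a" and idem: "\<And>\<phi>. \<phi> \<in> ind {\<one>} \<Longrightarrow> theta a (theta a \<phi>) = theta a \<phi>"
    and cyc: "\<And>c. c \<in> carrier G \<Longrightarrow> \<exists>k. card (theta a ` ind (generate G {c})) = card (UNIV :: 'f set) ^ (D * k)"
  shows "\<exists>k. card (theta a ` ind (carrier G)) ^ card (carrier G) = card (UNIV :: 'f set) ^ (D * k)"
proof (cases "\<exists>c\<in>carrier G. generate G {c} = carrier G")
  case True
  then obtain k where "card (theta a ` ind (carrier G)) = card (UNIV :: 'f set) ^ (D * k)"
    using cyc by metis
  then have "card (theta a ` ind (carrier G)) ^ card (carrier G)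
      = card (UNIV :: 'f set) ^ (D * (k * card (carrier G)))"
    by (simp add: power_mult[symmetric] mult.assoc)
  then show ?thesis by blast
next
  case noncyclic: False
  let ?q = "card (UNIV :: 'f set)"
  let ?\<C> = "(\<lambda>c. generate G {c}) ` carrier G"
  \<comment> \<open>The group is not cyclic here, so \<open>carrier G\<close> is a new index and can
    carry its own coefficient in \<open>co\<close>.\<close>
  let ?I = "insert (carrier G) ?\<C>"
  have fI: "finite ?I" using fin_G by simp
  have sub: "subgroup H G" if "H \<in> ?I" for H
    using that subgroup_self by (auto intro: generate_is_subgroup)
  obtain n b \<kappa> where c: "coords V n b \<kappa>" using ex_coords[OF V_subspace V_finite] by blast
  have "\<forall>H\<in>?I. \<exists>r t. is_transversal H r t"
    using ex_transversal[OF fin_G sub] unfolding is_transversal_def by blast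
  then obtain r where "\<forall>H\<in>?I. \<exists>t. is_transversal H (r H) t" by metis
  then obtain t where t: "\<And>H. H \<in> ?I \<Longrightarrow> is_transversal H (r H) (t H)" by metis
  let ?\<sigma> = "\<lambda>H. coset_perm H (r H) (t H)"
  have \<sigma>: "perm_rep (r H) (?\<sigma> H)" if "H \<in> ?I" for H using coset_perm_rep[OF sub[OF that] t[OF that]] .
  let ?A = "\<lambda>H. block_mat G (r H) n (?\<sigma> H) (\<lambda>g i j. \<kappa> i (a g (\<rho> g (b j))))"
  let ?ord = "\<lambda>H. order 0 (char_poly (?A H))"
  have "\<forall>H\<in>?I. \<exists>z\<le>r H * n. card (theta a ` ind H) = ?q ^ z \<and> ?ord H = r H * n - z"
  proof
    fix H assume H: "H \<in> ?I"
    note ic = ind_coords[OF sub[OF H] t[OF H] c]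
    have "ind H \<subseteq> ind {\<one>}" by (rule ind_subset_ind_one[OF sub[OF H]])
    then show "\<exists>z\<le>r H * n. card (theta a ` ind H) = ?q ^ z \<and> ?ord H = r H * n - z"
      using fn.order_char_poly_idempotent[OF ic(1) subspace_ind[OF sub[OF H]] finite_ind
          linear_on_theta[OF a sub[OF H]]] idem ic(2)[OF a] by auto
  qed
  from bchoice[OF this] obtain z where
    "\<forall>H\<in>?I. z H \<le> r H * n \<and> card (theta a ` ind H) = ?q ^ z H \<and> ?ord H = r H * n - z H" ..
  then have z: "z H \<le> r H * n \<and> card (theta a ` ind H) = ?q ^ z H \<and> ?ord H = r H * n - z H" if "H \<in> ?I" for H
    using that by (rule bspec)
  obtain m :: "'g set \<Rightarrow> int" where m: "\<And>g. g \<in> carrier G \<Longrightarrow>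
      (\<Sum>C\<in>?\<C>. m C * int (conj_count C g)) = int (card (carrier G))"
    using artin_relation[OF fin_G] by blast
  \<comment> \<open>\<open>conj_count H\<close> is |H| times a permutation character, hence the
    factor \<open>card H\<close>. For the whole group that character is 1, and the coefficient -|G|
    moves the right-hand side of Artin's relation to the left.\<close>
  define co where "co H = (if H = carrier G then - int (card (carrier G)) else m H * int (card H))" for H
  have notin: "carrier G \<notin> ?\<C>" using noncyclic by auto
  have sum_I: "(\<Sum>H\<in>?I. co H * f H) = (\<Sum>C\<in>?\<C>. m C * int (card C) * f C) - int (card (carrier G)) * f (carrier G)"
    for f :: "'g set \<Rightarrow> int"
  proof -
    have "(\<Sum>C\<in>?\<C>. co C * f C) = (\<Sum>C\<in>?\<C>. m C * int (card C) * f C)"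
      using notin by (intro sum.cong) (auto simp: co_def)
    then show ?thesis using notin fin_G by (simp add: co_def)
  qed
  have fixed: "(\<Sum>H\<in>?I. co H * int (card {l. l < r H \<and> ?\<sigma> H g l = l})) = 0" if g: "g \<in> carrier G" for g
  proof -
    have cf: "int (card H) * int (card {l. l < r H \<and> ?\<sigma> H g l = l}) = int (conj_count H g)" if "H \<in> ?I" for H
      using card_fixed_cosets[OF fin_G sub[OF that] t[OF that] g] by (metis of_nat_mult)
    have "conj_count (carrier G) g = card (carrier G)"
      using g by (auto simp: conj_count_def intro!: arg_cong[where f = card])
    then show ?thesis
      unfolding sum_I using cf m[OF g] by (simp add: mult.assoc)
  qed
  have ord: "(\<Sum>H\<in>?I. co H * int (?ord H)) = 0"
  proof -
    have nz: "char_poly (?A H) \<noteq> 0" for H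
    proof -
      have "coeff (char_poly (?A H)) (r H * n) = 1"
        using degree_monic_char_poly[OF block_mat_carrier(1)] by blast
      then show ?thesis by auto
    qed
    have prod: "order 0 (\<Prod>H\<in>S. char_poly (?A H) ^ e H) = (\<Sum>H\<in>S. e H * ?ord H)" if "finite S" for S e
      using that
    proof (induction S)
      case (insert x S)
      have nz': "(\<Prod>H\<in>S. char_poly (?A H) ^ e H) \<noteq> 0" using insert.hyps nz by simp
      have "order 0 (char_poly (?A x) ^ e x) = e x * ?ord x"
        by (rule order_power_poly[OF nz])
      then show ?case using insert nz nz' by (simp add: Polynomial.order_mult)
    qed simp
    have "order 0 (\<Prod>H\<in>?I. char_poly (?A H) ^ nat (co H)) = order 0 (\<Prod>H\<in>?I. char_poly (?A H) ^ nat (- co H))"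
      by (rule arg_cong[OF char_poly_relation[OF fin_G fI \<sigma> fixed]])
    then have "(\<Sum>H\<in>?I. nat (co H) * ?ord H) = (\<Sum>H\<in>?I. nat (- co H) * ?ord H)"
      unfolding prod[OF fI] .
    then have "(\<Sum>H\<in>?I. int (nat (co H) * ?ord H)) - (\<Sum>H\<in>?I. int (nat (- co H) * ?ord H)) = 0"
      by (simp only: of_nat_sum[symmetric] diff_self)
    moreover have "int (nat (co H) * ?ord H) - int (nat (- co H) * ?ord H) = co H * int (?ord H)" for H
      by (cases "co H \<ge> 0") simp_all
    ultimately show ?thesis by (simp only: sum_subtractf[symmetric])
  qed
  \<comment> \<open>The identity fixes every coset, so at \<open>\<one>\<close> the relation between
    numbers of fixed points becomes one between indices.\<close>
  have "(\<Sum>H\<in>?I. co H * int (r H)) = 0"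
  proof -
    have "{l. l < r H \<and> ?\<sigma> H \<one> l = l} = {..<r H}" if "H \<in> ?I" for H
      using \<sigma>[OF that] by (auto simp: perm_rep_def)
    then show ?thesis using fixed[OF one_closed] by simp
  qed
  then have dim: "(\<Sum>H\<in>?I. co H * int (r H * n)) = 0"
  proof -
    assume zero: "(\<Sum>H\<in>?I. co H * int (r H)) = 0"
    have "(\<Sum>H\<in>?I. co H * int (r H * n)) = (\<Sum>H\<in>?I. co H * int (r H)) * int n"
      by (simp only: of_nat_mult mult.assoc[symmetric] sum_distrib_right)
    then show ?thesis by (simp only: zero mult_zero_left)
  qed
  have "(\<Sum>H\<in>?I. co H * int (z H)) = (\<Sum>H\<in>?I. co H * int (r H * n) - co H * int (?ord H))"
  proof (intro sum.cong refl)
    fix H assume H: "H \<in> ?I"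
    have "int (z H) = int (r H * n) - int (?ord H)" using z[OF H] by (simp add: of_nat_diff)
    then show "co H * int (z H) = co H * int (r H * n) - co H * int (?ord H)"
      by (simp only: right_diff_distrib)
  qed
  also have "\<dots> = 0" using dim ord by (simp add: sum_subtractf)
  finally have rel: "int (card (carrier G)) * int (z (carrier G)) = (\<Sum>C\<in>?\<C>. m C * int (card C) * int (z C))"
    unfolding sum_I by simp
  have q1: "?q > 1"
  proof -
    have "card {0, 1 :: 'f} \<le> ?q" by (rule card_mono) auto
    then show ?thesis by simp
  qed
  have "int D dvd int (z C)" if "C \<in> ?\<C>" for C
  proof -
    obtain k where "?q ^ z C = ?q ^ (D * k)" 
    proof -
      obtain c where c: "c \<in> carrier G" "C = generate G {c}" using \<open>C \<in> ?\<C>\<close> by blast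
      have "card (theta a ` ind C) = ?q ^ z C" using z[of C] \<open>C \<in> ?\<C>\<close> by blast
      then show ?thesis using cyc[OF c(1)] that unfolding c(2) by metis
    qed
    then have "z C = D * k" using q1 by simp
    then show ?thesis by simp
  qed
  then have "int D dvd int (card (carrier G)) * int (z (carrier G))"
    unfolding rel by (intro dvd_sum dvd_mult) auto
  then obtain k where k: "card (carrier G) * z (carrier G) = D * k"
    by (metis dvd_def int_dvd_int_iff of_nat_mult)
  then have "card (theta a ` ind (carrier G)) ^ card (carrier G) = ?q ^ (D * k)"
    using z[of "carrier G"] by (simp add: power_mult[symmetric] mult.commute)
  then show ?thesis by blast
qed

text \<open>Passing to an idempotent power keeps the Fitting components and turns them into
  images.\<close>

lemma fit_exponent:
  assumes a: "coef a"
    and cyc: "\<And>c. c \<in> carrier G \<Longrightarrow> \<exists>k. card (fit (theta a) (ind (generate G {c}))) = card (UNIV :: 'f set) ^ (D * k)"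
  shows "\<exists>k. card (fit (theta a) (ind (carrier G))) ^ card (carrier G) = card (UNIV :: 'f set) ^ (D * k)"
proof -
  have st: "theta a ` ind H \<subseteq> ind H" if "subgroup H G" for H
    using fn.linear_on_image[OF linear_on_theta[OF a that]] .
  obtain k where k: "k > 0" "\<And>\<phi>. \<phi> \<in> ind {\<one>} \<Longrightarrow> (theta a ^^ k) ((theta a ^^ k) \<phi>) = (theta a ^^ k) \<phi>"
    using ex_idempotent_power[OF finite_ind st[OF trivial_subgroup]] by blast
  obtain e where e: "coef e" "\<And>\<phi>. \<phi> \<in> ind {\<one>} \<Longrightarrow> theta e \<phi> = (theta a ^^ k) \<phi>"
    using theta_power[OF a, of k] by blast
  have idem: "theta e (theta e \<phi>) = theta e \<phi>" if "\<phi> \<in> ind {\<one>}" for \<phi>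
  proof -
    have "(theta a ^^ k) \<phi> \<in> ind {\<one>}" using funpow_maps[OF st[OF trivial_subgroup] that] .
    then show ?thesis using e(2) k(2) that by simp
  qed
  have fit: "fit (theta a) (ind H) = theta e ` ind H" if H: "subgroup H G" for H
  proof -
    note sub = ind_subset_ind_one[OF H]
    have ste: "theta e ` ind H \<subseteq> ind H"
      using fn.linear_on_image[OF linear_on_theta[OF e(1) H]] .
    have "fit (theta a) (ind H) = fit (theta a ^^ k) (ind H)"
      by (rule fit_power[OF finite_ind st[OF H] k(1), symmetric])
    also have "\<dots> = fit (theta e) (ind H)"
      by (rule fit_cong[symmetric]) (use ste e(2) sub in auto)
    also have "\<dots> = theta e ` ind H"
      by (rule fit_idem) (use ste idem sub in auto)
    finally show ?thesis .
  qed
  have gen: "subgroup (generate G {c}) G" if "c \<in> carrier G" for c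
    using that by (intro generate_is_subgroup) auto
  show ?thesis
    using fit_exponent_idempotent[OF e(1) idem, of D] cyc fit[OF gen] fit[OF subgroup_self] by simp
qed

end

section \<open>Finite modules over rings of operators\<close>

text \<open>Operators are functions on the whole type, of which only the effect on \<open>M\<close>
  matters. Identity and negation are therefore asked for up to agreement on \<open>M\<close>, and
  zero and negatives in left ideals exist in the same sense.\<close>

locale op_ring =
  fixes M :: "'v::ab_group_add set" and R :: "('v \<Rightarrow> 'v) set"
  assumes M_group: "add_subgroup M" and M_finite: "finite M" and R_finite: "finite R"
    and R_closed: "r \<in> R \<Longrightarrow> m \<in> M \<Longrightarrow> r m \<in> M"
    and R_additive: "r \<in> R \<Longrightarrow> additive_on M r"
    and R_plus: "r \<in> R \<Longrightarrow> s \<in> R \<Longrightarrow> (\<lambda>m. r m + s m) \<in> R"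
    and R_comp: "r \<in> R \<Longrightarrow> s \<in> R \<Longrightarrow> r \<circ> s \<in> R"
    and R_one: "\<exists>i\<in>R. \<forall>m\<in>M. i m = m"
    and R_neg: "\<exists>i\<in>R. \<forall>m\<in>M. i m = - m"
begin

definition submod :: "'v set \<Rightarrow> bool"
  where "submod N \<longleftrightarrow> add_subgroup N \<and> N \<subseteq> M \<and> (\<forall>r\<in>R. \<forall>n\<in>N. r n \<in> N)"

text \<open>Simplicity of the quotient \<open>N/N'\<close>, expressed through submodules of
  \<open>M\<close>; a simple submodule is the case \<open>N' = {0}\<close>.\<close>

definition simple_factor :: "'v set \<Rightarrow> 'v set \<Rightarrow> bool"
  where "simple_factor N N' \<longleftrightarrow> submod N \<and> submod N' \<and> N' \<subset> N \<and>
    (\<forall>K. submod K \<longrightarrow> N' \<subseteq> K \<longrightarrow> K \<subseteq> N \<longrightarrow> K = N' \<or> K = N)"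

definition annihilator :: "'v set \<Rightarrow> 'v set \<Rightarrow> ('v \<Rightarrow> 'v) set"
  where "annihilator N N' = {r \<in> R. \<forall>n\<in>N. r n \<in> N'}"

definition left_ideal :: "('v \<Rightarrow> 'v) set \<Rightarrow> bool"
  where "left_ideal J \<longleftrightarrow> J \<subseteq> R \<and> J \<noteq> {} \<and> (\<forall>p\<in>J. \<forall>q\<in>J. (\<lambda>m. p m + q m) \<in> J) \<and> (\<forall>r\<in>R. \<forall>p\<in>J. r \<circ> p \<in> J)"

lemma submodD:
  assumes "submod N"
  shows "add_subgroup N" "N \<subseteq> M" "finite N" "\<And>r n. r \<in> R \<Longrightarrow> n \<in> N \<Longrightarrow> r n \<in> N"
proof -
  note * = assms[unfolded submod_def]
  show "add_subgroup N" using * by (rule conjunct1)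
  show sub: "N \<subseteq> M" using * by (rule conjunct2[THEN conjunct1])
  show "r n \<in> N" if "r \<in> R" "n \<in> N" for r n
    using *[THEN conjunct2, THEN conjunct2, rule_format, OF that] .
  show "finite N" using sub M_finite by (rule finite_subset)
qed

lemma submodI:
  assumes "add_subgroup N" "N \<subseteq> M" "\<And>r n. r \<in> R \<Longrightarrow> n \<in> N \<Longrightarrow> r n \<in> N"
  shows "submod N"
  using assms by (simp add: submod_def)

lemma R_lin:
  assumes "r \<in> R"
  shows "r 0 = 0" "\<And>x y. x \<in> M \<Longrightarrow> y \<in> M \<Longrightarrow> r (x + y) = r x + r y"
    "\<And>x. x \<in> M \<Longrightarrow> r (- x) = - r x" "\<And>x y. x \<in> M \<Longrightarrow> y \<in> M \<Longrightarrow> r (x - y) = r x - r y"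
  using additive_onD[OF R_additive[OF assms] M_group] by auto

lemma submod_zero: "submod {0}"
  using add_subgroupD(1)[OF M_group] R_lin(1) by (auto intro!: submodI add_subgroupI)

lemma left_idealD:
  assumes "left_ideal J"
  shows "J \<subseteq> R" "J \<noteq> {}" "\<And>p q. p \<in> J \<Longrightarrow> q \<in> J \<Longrightarrow> (\<lambda>m. p m + q m) \<in> J" "\<And>r p. r \<in> R \<Longrightarrow> p \<in> J \<Longrightarrow> r \<circ> p \<in> J"
  using assms by (auto simp: left_ideal_def)

lemma left_ideal_neg:
  assumes J: "left_ideal J" and p: "p \<in> J"
  shows "\<exists>q\<in>J. \<forall>m\<in>M. q m = - p m"
proof -
  obtain i where i: "i \<in> R" "\<forall>m\<in>M. i m = - m" using R_neg by blast
  have "i \<circ> p \<in> J" using left_idealD(4)[OF J i(1) p] .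
  moreover have "\<forall>m\<in>M. (i \<circ> p) m = - p m" using i(2) R_closed left_idealD(1)[OF J] p by auto
  ultimately show ?thesis by blast
qed

lemma left_ideal_zero:
  assumes J: "left_ideal J"
  shows "\<exists>q\<in>J. \<forall>m\<in>M. q m = 0"
proof -
  obtain p where p: "p \<in> J" using left_idealD(2)[OF J] by blast
  obtain q where q: "q \<in> J" "\<forall>m\<in>M. q m = - p m" using left_ideal_neg[OF J p] by blast
  have "(\<lambda>m. p m + q m) \<in> J" using left_idealD(3)[OF J p q(1)] .
  moreover have "\<forall>m\<in>M. p m + q m = 0" using q(2) by simp
  ultimately show ?thesis by (intro bexI[of _ "\<lambda>m. p m + q m"])
qed

lemma left_ideal_R: "left_ideal R"
  using R_plus R_comp R_one by (auto simp: left_ideal_def)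

lemma left_ideal_annihilator:
  assumes "submod N" "submod N'"
  shows "left_ideal (annihilator N N')"
  unfolding left_ideal_def
proof (intro conjI ballI)
  note N = submodD[OF assms(1)] and N' = submodD[OF assms(2)]
  show "annihilator N N' \<subseteq> R" by (auto simp: annihilator_def)
  obtain i j where i: "i \<in> R" "\<forall>m\<in>M. i m = m" and j: "j \<in> R" "\<forall>m\<in>M. j m = - m" using R_one R_neg by blast
  have "(\<lambda>m. i m + j m) \<in> annihilator N N'"
    using R_plus[OF i(1) j(1)] i(2) j(2) N(2) add_subgroupD(1)[OF N'(1)] by (auto simp: annihilator_def subset_iff)
  then show "annihilator N N' \<noteq> {}" by blast
  show "(\<lambda>m. p m + q m) \<in> annihilator N N'" if "p \<in> annihilator N N'" "q \<in> annihilator N N'" for p q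
    using that R_plus add_subgroupD(2)[OF N'(1)] by (auto simp: annihilator_def)
  show "r \<circ> p \<in> annihilator N N'" if "r \<in> R" "p \<in> annihilator N N'" for r p
    using that R_comp N'(4) by (auto simp: annihilator_def)
qed

lemma submod_ideal_orbit:
  assumes J: "left_ideal J" and N': "submod N'" and v: "v \<in> M"
  shows "submod {p v + n | p n. p \<in> J \<and> n \<in> N'}" (is "submod ?K")
proof (rule submodI)
  note Jd = left_idealD[OF J] and Nd = submodD[OF N'] and Ng = add_subgroupD[OF submodD(1)[OF N']]
  have JR: "p \<in> R" if "p \<in> J" for p using that Jd(1) by blast
  show "add_subgroup ?K"
  proof (rule add_subgroupI)
    obtain q where "q \<in> J" "q v = 0" using left_ideal_zero[OF J] v by blast
    then show "0 \<in> ?K" using Ng(1) by force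
    show "x + y \<in> ?K" if xy: "x \<in> ?K" "y \<in> ?K" for x y
    proof -
      obtain p n q n' where pq: "p \<in> J" "n \<in> N'" "x = p v + n" "q \<in> J" "n' \<in> N'" "y = q v + n'" using xy by blast
      have "x + y = (\<lambda>m. p m + q m) v + (n + n')" by (simp add: pq algebra_simps)
      then show ?thesis using Jd(3)[OF pq(1,4)] Ng(2)[OF pq(2,5)]
        by (intro CollectI exI[of _ "\<lambda>m. p m + q m"] exI[of _ "n + n'"]) simp
    qed
    show "- x \<in> ?K" if x: "x \<in> ?K" for x
    proof -
      obtain p n where p: "p \<in> J" "n \<in> N'" "x = p v + n" using x by blast
      obtain q where q: "q \<in> J" "q v = - p v" using left_ideal_neg[OF J p(1)] v by blast
      have "- x = q v + (- n)" by (simp add: p q)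
      then show ?thesis using q(1) Ng(3)[OF p(2)] by blast
    qed
  qed
  show "?K \<subseteq> M" using JR R_closed v Nd(2) add_subgroupD(2)[OF M_group] by (auto simp: subset_iff)
  show "r x \<in> ?K" if r: "r \<in> R" and x: "x \<in> ?K" for r x
  proof -
    obtain p n where p: "p \<in> J" "n \<in> N'" "x = p v + n" using x by blast
    have "p v \<in> M" "n \<in> M" using R_closed[OF JR[OF p(1)] v] p(2) Nd(2) by auto
    then have "r x = (r \<circ> p) v + r n" using R_lin(2)[OF r] p(3) by simp
    then show ?thesis using Jd(4)[OF r p(1)] Nd(4)[OF r p(2)] by blast
  qed
qed

section \<open>Simple factors and their annihilators\<close>

text \<open>The left-hand side is a submodule between \<open>N'\<close> and \<open>N\<close>, and
  the given \<open>p v\<close> keeps it from being \<open>N'\<close>.\<close>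

lemma simple_factor_orbit:
  assumes s: "simple_factor N N'" and J: "left_ideal J" and v: "v \<in> N" and p: "p \<in> J" "p v \<notin> N'"
  shows "{p v + n | p n. p \<in> J \<and> n \<in> N'} = N" (is "?K = N")
proof -
  have N: "submod N" "submod N'" "N' \<subseteq> N" using s by (auto simp: simple_factor_def)
  have vM: "v \<in> M" using v submodD(2)[OF N(1)] by blast
  have K: "submod ?K" by (rule submod_ideal_orbit[OF J N(2) vM])
  obtain z where z: "z \<in> J" "z v = 0" using left_ideal_zero[OF J] vM by blast
  have "N' \<subseteq> ?K"
  proof
    fix n assume "n \<in> N'"
    then show "n \<in> ?K" using z by (auto intro!: exI[of _ z] exI[of _ n])
  qed
  moreover have "?K \<subseteq> N"
  proof clarify
    fix p n assume "p \<in> J" "n \<in> N'"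
    then show "p v + n \<in> N"
      using submodD(4)[OF N(1) _ v] left_idealD(1)[OF J] N(3) add_subgroupD(2)[OF submodD(1)[OF N(1)]] by blast
  qed
  moreover have "?K \<noteq> N'"
  proof -
    have "p v + 0 \<in> ?K" using p(1) add_subgroupD(1)[OF submodD(1)[OF N(2)]] by blast
    then show ?thesis using p(2) by auto
  qed
  ultimately show ?thesis using s K unfolding simple_factor_def by blast
qed

text \<open>Take the element of \<open>P\<close> that fixes the most vectors of \<open>N\<close>
  modulo \<open>N'\<close>. A vector that it moves could be fixed as well without losing the others.
  This elementary argument stands in for the structure theory of finite simple rings.\<close>

lemma ideal_contains_identity:
  assumes s: "simple_factor N N'" and P: "left_ideal P" and right: "\<And>p r. p \<in> P \<Longrightarrow> r \<in> R \<Longrightarrow> p \<circ> r \<in> P"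
    and nz: "\<exists>p\<in>P. \<exists>n\<in>N. p n \<notin> N'"
  shows "\<exists>p\<in>P. \<forall>n\<in>N. p n - n \<in> N'"
proof -
  have N: "submod N" "submod N'" "N' \<subseteq> N" using s by (auto simp: simple_factor_def)
  note Nd = submodD[OF N(1)] and N'd = submodD[OF N(2)] and Pd = left_idealD[OF P]
  note Ng = add_subgroupD[OF Nd(1)] and N'g = add_subgroupD[OF N'd(1)]
  have PR: "p \<in> R" if "p \<in> P" for p using that Pd(1) by blast
  \<comment> \<open>The vectors killed by \<open>P\<close> modulo \<open>N'\<close>. Closure of
    \<open>P\<close> under right multiplication makes them a submodule; it is proper and contains
    \<open>N'\<close>, hence equals \<open>N'\<close>.\<close>
  let ?Z = "{v \<in> N. \<forall>p\<in>P. p v \<in> N'}"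
  have "submod ?Z"
  proof (rule submodI)
    show "add_subgroup ?Z"
    proof (rule add_subgroupI)
      have "p 0 \<in> N'" if "p \<in> P" for p using R_lin(1)[OF PR[OF that]] N'g(1) by simp
      then show "0 \<in> ?Z" using Ng(1) by blast
      show "x + y \<in> ?Z" if "x \<in> ?Z" "y \<in> ?Z" for x y
      proof -
        have "p (x + y) \<in> N'" if p: "p \<in> P" for p
        proof -
          have "p (x + y) = p x + p y"
            using R_lin(2)[OF PR[OF p], of x y] \<open>x \<in> ?Z\<close> \<open>y \<in> ?Z\<close> Nd(2) by blast
          then show ?thesis using N'g(2)[of "p x" "p y"] p \<open>x \<in> ?Z\<close> \<open>y \<in> ?Z\<close> by simp
        qed
        then show ?thesis using that Ng(2) by blast
      qed
      show "- x \<in> ?Z" if "x \<in> ?Z" for x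
      proof -
        have "p (- x) \<in> N'" if p: "p \<in> P" for p
        proof -
          have "p (- x) = - p x"
            using R_lin(3)[OF PR[OF p], of x] \<open>x \<in> ?Z\<close> Nd(2) by blast
          then show ?thesis using N'g(3)[of "p x"] p \<open>x \<in> ?Z\<close> by simp
        qed
        then show ?thesis using that Ng(3) by blast
      qed
    qed
    show "?Z \<subseteq> M" using Nd(2) by blast
    fix r n assume r: "r \<in> R" and n: "n \<in> ?Z"
    have "p (r n) \<in> N'" if "p \<in> P" for p
    proof -
      have "(p \<circ> r) n \<in> N'" using right[OF that r] n by blast
      then show ?thesis by simp
    qed
    then show "r n \<in> ?Z" using Nd(4)[OF r] n by blast
  qed
  moreover have "N' \<subseteq> ?Z" using N(3) N'd(4) PR by blast
  moreover have "?Z \<noteq> N" using nz by blast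
  ultimately have Z: "?Z = N'" using s by (auto simp: simple_factor_def)
  let ?F = "\<lambda>p. {n \<in> N. p n - n \<in> N'}"
  have "\<exists>p. p \<in> P \<and> (\<forall>q. q \<in> P \<longrightarrow> card (?F q) \<le> card (?F p))"
  proof -
    obtain p0 where "p0 \<in> P" using Pd(2) by blast
    then show ?thesis
      by (intro ex_has_greatest_nat[where k = p0 and b = "Suc (card N)"])
        (auto simp: less_Suc_eq_le intro!: card_mono Nd(3))
  qed
  then obtain p where p: "p \<in> P" "\<And>q. q \<in> P \<Longrightarrow> card (?F q) \<le> card (?F p)" by blast
  have "?F p = N"
  proof (rule ccontr)
    assume "?F p \<noteq> N"
    then obtain v where v: "v \<in> N" "p v - v \<notin> N'" by blast
    let ?w = "v - p v"
    have pv: "p v \<in> N" using Nd(4)[OF PR[OF p(1)] v(1)] .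
    have w: "?w \<in> N" "?w \<notin> N'" using v Ng(4)[OF v(1) pv] N'g(3)[of ?w] by auto
    then have "?w \<notin> ?Z" using Z by simp
    then obtain q where q: "q \<in> P" "q ?w \<notin> N'" using w by blast
    from simple_factor_orbit[OF s P w(1) q] w(1)
    obtain r n' where r: "r \<in> P" "n' \<in> N'" "?w = r ?w + n'" by blast
    obtain q' where q': "q' \<in> P" "\<And>m. m \<in> M \<Longrightarrow> q' m = - (r \<circ> p) m"
      using left_ideal_neg[OF P right[OF r(1) PR[OF p(1)]]] by blast
    \<comment> \<open>Chosen so that \<open>1 - p' = (1 - r) (1 - p)\<close> on \<open>N\<close>. It
      kills modulo \<open>N'\<close> whatever \<open>1 - p\<close> kills, and also \<open>v\<close>,
      because \<open>r\<close> fixes \<open>v - p v\<close> modulo \<open>N'\<close>.\<close>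
    define p' where "p' = (\<lambda>m. (\<lambda>m. p m + r m) m + q' m)"
    have p'P: "p' \<in> P" unfolding p'_def by (rule Pd(3)[OF Pd(3)[OF p(1) r(1)] q'(1)])
    have p': "p' n - n = (p n - n) - r (p n - n)" if "n \<in> N" for n
    proof -
      have "n \<in> M" "p n \<in> M" using that Nd(2) Nd(4)[OF PR[OF p(1)] that] by auto
      then show ?thesis using q'(2)[of n] R_lin(4)[OF PR[OF r(1)], of "p n" n] by (simp add: p'_def algebra_simps)
    qed
    have "insert v (?F p) \<subseteq> ?F p'"
    proof -
      have "r (v - p v) - (v - p v) \<in> N'"
      proof -
        have "r ?w - ?w = - n'" using r(3) by (simp add: algebra_simps)
        then show ?thesis using N'g(3)[OF r(2)] by simp
      qed
      moreover have "p' v - v = r (v - p v) - (v - p v)"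
      proof -
        have "v \<in> M" "p v \<in> M" using v(1) pv Nd(2) by auto
        then have "r (p v - v) = - r (v - p v)" using R_lin(4)[OF PR[OF r(1)]] by simp
        then show ?thesis using p'[OF v(1)] by simp
      qed
      ultimately have "p' v - v \<in> N'" by (simp only:)
      then have "v \<in> ?F p'" using v(1) by blast
      moreover have "n \<in> ?F p'" if n: "n \<in> ?F p" for n
      proof -
        have "(p n - n) - r (p n - n) \<in> N'" using n N'g(4) N'd(4)[OF PR[OF r(1)]] by blast
        then have "p' n - n \<in> N'" using p'[of n] n by (metis (lifting) mem_Collect_eq)
        then show ?thesis using n by blast
      qed
      ultimately show ?thesis by blast
    qed
    moreover have "finite (?F p')" using Nd(3) by simp
    ultimately have "card (insert v (?F p)) \<le> card (?F p')" by (intro card_mono) auto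
    moreover have "card (insert v (?F p)) = Suc (card (?F p))" using v Nd(3) by simp
    ultimately show False using p(2)[OF p'P] by simp
  qed
  then show ?thesis using p(1) by blast
qed

lemma annihilator_right:
  assumes "submod N" "p \<in> annihilator N N'" "r \<in> R"
  shows "p \<circ> r \<in> annihilator N N'"
  using assms R_comp submodD(4)[OF assms(1)] by (auto simp: annihilator_def)

text \<open>The delicate case is that the first annihilator is strictly inside the second. Then some
  \<open>q\<close> in the second is the identity on \<open>N/N'\<close>, so \<open>q - 1\<close>
  lies in the first and hence in the second; both \<open>q\<close> and \<open>q - 1\<close> would
  kill \<open>N1/N1'\<close>.\<close>

lemma annihilator_comaximal:
  assumes s: "simple_factor N N'" and s1: "simple_factor N1 N1'"
    and ne: "annihilator N N' \<noteq> annihilator N1 N1'"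
  shows "\<exists>p\<in>annihilator N N'. \<forall>n\<in>N1. p n - n \<in> N1'"
proof -
  let ?P = "annihilator N N'" and ?Q = "annihilator N1 N1'"
  have N: "submod N" "submod N'" "N' \<subset> N" and N1: "submod N1" "submod N1'" "N1' \<subset> N1"
    using s s1 by (auto simp: simple_factor_def)
  have one: "\<exists>p\<in>?P. \<forall>n\<in>N1. p n - n \<in> N1'" if "\<not> ?P \<subseteq> ?Q"
    by (rule ideal_contains_identity[OF s1 left_ideal_annihilator[OF N(1,2)] annihilator_right[OF N(1)]])
      (use that in \<open>auto simp: annihilator_def\<close>)
  show ?thesis
  proof (cases "?P \<subseteq> ?Q")
    case True
    then have "\<not> ?Q \<subseteq> ?P" using ne by blast
    then have "\<exists>q\<in>?Q. \<forall>n\<in>N. q n - n \<in> N'"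
      by (intro ideal_contains_identity[OF s left_ideal_annihilator[OF N1(1,2)] annihilator_right[OF N1(1)]])
        (auto simp: annihilator_def)
    then obtain q where q: "q \<in> ?Q" "\<forall>n\<in>N. q n - n \<in> N'" by blast
    obtain i where i: "i \<in> R" "\<forall>m\<in>M. i m = - m" using R_neg by blast
    obtain j where j: "j \<in> R" "\<forall>m\<in>M. j m = m" using R_one by blast
    have "(\<lambda>m. q m + i m) \<in> ?P"
      using R_plus[OF _ i(1), of q] q i(2) submodD(2)[OF N(1)] by (auto simp: annihilator_def subset_iff)
    then have qi: "(\<lambda>m. q m + i m) \<in> ?Q" using True by blast
    have "N1 \<subseteq> N1'"
    proof
      fix n assume n: "n \<in> N1"
      have "q n - (q n - n) \<in> N1'"
      proof (rule add_subgroupD(4)[OF submodD(1)[OF N1(2)]])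
        show "q n \<in> N1'" using q(1) n by (auto simp: annihilator_def)
        have "q n + i n \<in> N1'" using qi n by (auto simp: annihilator_def)
        then show "q n - n \<in> N1'" using i(2) n submodD(2)[OF N1(1)] by auto
      qed
      then show "n \<in> N1'" by simp
    qed
    then show ?thesis using N1(3) by blast
  qed (rule one)
qed

text \<open>A Chinese remainder argument: for each of the finitely many other annihilators there is
  an element in it that is the identity on \<open>V0\<close>, and the product of these elements is
  taken.\<close>

lemma ex_separating_element:
  assumes s1: "simple_factor V0 {0}"
  shows "\<exists>a\<in>R. (\<forall>v\<in>V0. a v = v) \<and>
    (\<forall>N N'. simple_factor N N' \<longrightarrow> annihilator N N' = annihilator V0 {0} \<or> a \<in> annihilator N N')"
proof -
  let ?Q = "annihilator V0 {0}"
  let ?\<P> = "{P. \<exists>N N'. simple_factor N N' \<and> P = annihilator N N' \<and> P \<noteq> ?Q}"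
  have V0: "submod V0" using s1 by (simp add: simple_factor_def)
  have "?\<P> \<subseteq> Pow R" by (auto simp: annihilator_def)
  then have fin: "finite ?\<P>" using R_finite by (meson finite_Pow_iff finite_subset)
  have "\<exists>a\<in>R. (\<forall>v\<in>V0. a v = v) \<and> (\<forall>P\<in>\<P>. a \<in> P)" if "finite \<P>" "\<P> \<subseteq> ?\<P>" for \<P>
    using that
  proof (induction \<P>)
    case empty
    then show ?case using R_one submodD(2)[OF V0] by blast
  next
    case (insert P \<P>)
    then obtain a where a: "a \<in> R" "\<forall>v\<in>V0. a v = v" "\<forall>P\<in>\<P>. a \<in> P" by auto
    obtain N N' where N: "simple_factor N N'" "P = annihilator N N'" "P \<noteq> ?Q" using insert.prems by auto
    obtain p where p: "p \<in> P" "\<forall>v\<in>V0. p v - v \<in> {0}"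
      using annihilator_comaximal[OF N(1) s1] N(2,3) by blast
    have pR: "p \<in> R" using p(1) N(2) by (simp add: annihilator_def)
    have "a \<circ> p \<in> P'" if "P' \<in> \<P>" for P'
    proof -
      have "P' \<in> ?\<P>" using insert.prems that by blast
      then obtain K K' where K: "simple_factor K K'" "P' = annihilator K K'" by blast
      then show ?thesis using annihilator_right[of K a K' p] a(3) that pR by (auto simp: simple_factor_def)
    qed
    moreover have "a \<circ> p \<in> P"
      using left_idealD(4)[OF left_ideal_annihilator a(1)] N p(1) by (auto simp: simple_factor_def)
    moreover have "\<forall>v\<in>V0. (a \<circ> p) v = v" using p(2) a(2) by auto
    ultimately show ?case using R_comp[OF a(1) pR] by blast
  qed
  from this[OF fin order_refl]
  obtain a where a: "a \<in> R" "\<forall>v\<in>V0. a v = v" "\<forall>P\<in>?\<P>. a \<in> P" by (elim bexE conjE)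
  have sep: "annihilator N N' = ?Q \<or> a \<in> annihilator N N'" if N: "simple_factor N N'" for N N'
  proof (rule disjCI)
    assume na: "a \<notin> annihilator N N'"
    have "annihilator N N' \<notin> ?\<P>"
    proof
      assume "annihilator N N' \<in> ?\<P>"
      from bspec[OF a(3) this] na show False by (rule notE[rotated])
    qed
    then show "annihilator N N' = ?Q" using N by blast
  qed
  show ?thesis
    by (rule bexI[OF _ a(1)], rule conjI[OF a(2)], rule allI, rule allI, rule impI, rule sep)
qed

text \<open>A left ideal \<open>J\<close> minimal above the common annihilator is a model for both
  modules. The maps \<open>p \<mapsto> p v\<close> and \<open>p \<mapsto> p n0\<close> have the same
  kernel on \<open>J\<close>, the second one modulo \<open>N'\<close>, so \<open>\<theta>\<close>
  may send \<open>p n0 + n\<close> to \<open>p v\<close>.\<close>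

lemma same_annihilator_hom:
  assumes s1: "simple_factor V0 {0}" and s: "simple_factor N N'"
    and same: "annihilator N N' = annihilator V0 {0}"
  shows "\<exists>\<theta>. additive_on N \<theta> \<and> \<theta> ` N = V0 \<and> {n \<in> N. \<theta> n = 0} = N' \<and> (\<forall>r\<in>R. \<forall>n\<in>N. \<theta> (r n) = r (\<theta> n))"
proof -
  let ?Q = "annihilator V0 {0}"
  have V0: "submod V0" "{0} \<subset> V0" and N: "submod N" "submod N'" "N' \<subset> N"
    using s1 s by (auto simp: simple_factor_def)
  note Nd = submodD[OF N(1)] and Vd = submodD[OF V0(1)]
  let ?good = "\<lambda>J. left_ideal J \<and> ?Q \<subset> J"
  have "?good R"
  proof
    obtain i where i: "i \<in> R" "\<forall>m\<in>M. i m = m" using R_one by blast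
    obtain v where "v \<in> V0" "v \<noteq> 0" using V0(2) by blast
    moreover from this have "i v \<noteq> 0" using i(2) Vd(2) by (metis subsetD)
    ultimately have "i \<notin> ?Q" by (auto simp: annihilator_def)
    then show "?Q \<subset> R" using i(1) by (auto simp: annihilator_def)
  qed (rule left_ideal_R)
  then obtain J where J: "?good J" and min: "\<And>J'. ?good J' \<Longrightarrow> card J \<le> card J'"
    using ex_has_least_nat[of ?good R card] by blast
  have fJ: "finite J" using J R_finite left_idealD(1) finite_subset by blast
  have Jid: "left_ideal J" using J by blast
  obtain j where j: "j \<in> J" "j \<notin> ?Q" using J by blast
  have jR: "p \<in> R" if "p \<in> J" for p using that left_idealD(1)[OF Jid] by blast
  obtain v where v: "v \<in> V0" "j v \<noteq> 0" using j jR by (auto simp: annihilator_def)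
  obtain n0 where n0: "n0 \<in> N" "j n0 \<notin> N'" using j jR same by (auto simp: annihilator_def)
  \<comment> \<open>By minimality of \<open>J\<close>: its elements sending \<open>w\<close> into
    \<open>K'\<close> form a left ideal that contains \<open>?Q\<close> but not \<open>j\<close>, so
    this left ideal is \<open>?Q\<close>.\<close>
  have kernel: "p \<in> ?Q" if "p \<in> J" "p w \<in> K'" "w \<in> K" "j w \<notin> K'" "submod K" "submod K'" "?Q = annihilator K K'" for p w K K'
  proof -
    let ?J = "{p \<in> J. p w \<in> K'}"
    have "left_ideal ?J"
      unfolding left_ideal_def
    proof (intro conjI ballI)
      show "?J \<subseteq> R" using jR by blast
      show "?J \<noteq> {}" using that(1,2) by blast
      show "(\<lambda>m. p m + q m) \<in> ?J" if "p \<in> ?J" "q \<in> ?J" for p q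
        using that left_idealD(3)[OF Jid] add_subgroupD(2)[OF submodD(1)[OF \<open>submod K'\<close>]] by auto
      show "r \<circ> p \<in> ?J" if "r \<in> R" "p \<in> ?J" for r p
        using that left_idealD(4)[OF Jid] submodD(4)[OF \<open>submod K'\<close>] by auto
    qed
    moreover have "?Q \<subseteq> ?J" using J that(3,7) by (auto simp: annihilator_def)
    moreover have "card ?J < card J" using fJ j(1) that(4) by (intro psubset_card_mono) auto
    ultimately have "?Q = ?J" using min[of ?J] by (auto simp: psubset_eq)
    then show ?thesis using that(1,2) by blast
  qed
  have kv: "p v = 0 \<longleftrightarrow> p \<in> ?Q" if "p \<in> J" for p
    using kernel[OF that, of v "{0}" V0] v V0 submod_zero by (auto simp: annihilator_def)
  have kn: "p n0 \<in> N' \<longleftrightarrow> p \<in> ?Q" if "p \<in> J" for p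
    using kernel[OF that, of n0 N' N] n0 N same by (auto simp: annihilator_def)
  have N_eq: "{p n0 + n | p n. p \<in> J \<and> n \<in> N'} = N" by (rule simple_factor_orbit[OF s Jid n0(1) j(1) n0(2)])
  have V_eq: "{p v + n | p n. p \<in> J \<and> n \<in> {0}} = V0"
    by (rule simple_factor_orbit[OF s1 Jid v(1) j(1)]) (use v in simp)
  define \<theta> where "\<theta> x = (SOME y. \<exists>p\<in>J. \<exists>n\<in>N'. x = p n0 + n \<and> y = p v)" for x
  have vM: "v \<in> M" and nM: "n0 \<in> M" using v n0 Vd Nd by auto
  have wd: "p v = q v" if pq: "p \<in> J" "q \<in> J" "n \<in> N'" "n' \<in> N'" "p n0 + n = q n0 + n'" for p q n n'
  proof -
    obtain q' where q': "q' \<in> J" "\<forall>m\<in>M. q' m = - q m" using left_ideal_neg[OF Jid pq(2)] by blast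
    have d: "(\<lambda>m. p m + q' m) \<in> J" using left_idealD(3)[OF Jid pq(1) q'(1)] .
    have "p n0 + q' n0 = n' - n" using pq(5) q'(2) nM by (simp add: algebra_simps)
    then have "p n0 + q' n0 \<in> N'" using add_subgroupD(4)[OF submodD(1)[OF N(2)] pq(4,3)] by simp
    then have "p v + q' v = 0" using kn[OF d] kv[OF d] by simp
    then show ?thesis using q'(2) vM by simp
  qed
  have \<theta>: "\<theta> (p n0 + n) = p v" if p: "p \<in> J" "n \<in> N'" for p n
    unfolding \<theta>_def
  proof (rule some_equality)
    show "\<exists>q\<in>J. \<exists>n'\<in>N'. p n0 + n = q n0 + n' \<and> p v = q v"
      using p by (intro bexI[of _ p] bexI[of _ n]) auto
    fix y assume "\<exists>q\<in>J. \<exists>n'\<in>N'. p n0 + n = q n0 + n' \<and> y = q v"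
    then obtain q n' where "q \<in> J" "n' \<in> N'" "p n0 + n = q n0 + n'" "y = q v" by (elim bexE conjE)
    then show "y = p v" using wd[OF p(1) _ p(2), of q n'] by simp
  qed
  have dec: "\<exists>p\<in>J. \<exists>n\<in>N'. x = p n0 + n" if "x \<in> N" for x using that N_eq by blast
  have N'g: "add_subgroup N'" by (rule submodD(1)[OF N(2)])
  have N'M: "n \<in> M" if "n \<in> N'" for n using that submodD(2)[OF N(2)] by blast
  show ?thesis
  proof (intro exI[of _ \<theta>] conjI ballI)
    show "additive_on N \<theta>"
    proof (rule additive_onI)
      fix x y assume "x \<in> N" "y \<in> N"
      then obtain p n q n' where pq: "p \<in> J" "n \<in> N'" "x = p n0 + n" "q \<in> J" "n' \<in> N'" "y = q n0 + n'"
        using dec by blast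
      have "x + y = (\<lambda>m. p m + q m) n0 + (n + n')" by (simp add: pq algebra_simps)
      then have "\<theta> (x + y) = p v + q v"
        using \<theta>[OF left_idealD(3)[OF Jid pq(1,4)] add_subgroupD(2)[OF N'g pq(2,5)]] by simp
      then show "\<theta> (x + y) = \<theta> x + \<theta> y" using \<theta> pq by simp
    qed
    show "\<theta> ` N = V0"
    proof
      show "\<theta> ` N \<subseteq> V0"
      proof clarify
        fix x assume "x \<in> N"
        then obtain p n where p: "p \<in> J" "n \<in> N'" "x = p n0 + n" using dec by blast
        then show "\<theta> x \<in> V0" using \<theta> Vd(4)[OF jR v(1)] by simp
      qed
      show "V0 \<subseteq> \<theta> ` N"
      proof
        fix y assume "y \<in> V0"
        then obtain p where p: "p \<in> J" "y = p v" using V_eq by auto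
        have "p n0 + 0 \<in> N" using N_eq p(1) add_subgroupD(1)[OF N'g] by blast
        moreover have "\<theta> (p n0 + 0) = y" using \<theta>[OF p(1) add_subgroupD(1)[OF N'g]] p(2) by simp
        ultimately show "y \<in> \<theta> ` N" by blast
      qed
    qed
    show "{n \<in> N. \<theta> n = 0} = N'"
    proof
      show "{n \<in> N. \<theta> n = 0} \<subseteq> N'"
      proof clarify
        fix x assume "x \<in> N" "\<theta> x = 0"
        then obtain p n where p: "p \<in> J" "n \<in> N'" "x = p n0 + n" using dec by blast
        then have "p n0 \<in> N'" using \<open>\<theta> x = 0\<close> \<theta> kv kn by simp
        then show "x \<in> N'" using p add_subgroupD(2)[OF N'g] by simp
      qed
      show "N' \<subseteq> {n \<in> N. \<theta> n = 0}"
      proof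
        fix n assume n: "n \<in> N'"
        obtain z where z: "z \<in> J" "\<forall>m\<in>M. z m = 0" using left_ideal_zero[OF Jid] by blast
        then have "\<theta> n = 0" using \<theta>[OF z(1) n] nM vM by simp
        then show "n \<in> {n \<in> N. \<theta> n = 0}" using n N(3) by blast
      qed
    qed
    fix r x assume r: "r \<in> R" and "x \<in> N"
    then obtain p n where p: "p \<in> J" "n \<in> N'" "x = p n0 + n" using dec by blast
    have "r x = (r \<circ> p) n0 + r n"
      using p R_lin(2)[OF r R_closed[OF jR[OF p(1)] nM] N'M[OF p(2)]] by simp
    then show "\<theta> (r x) = r (\<theta> x)"
      using \<theta>[OF left_idealD(4)[OF Jid r p(1)] submodD(4)[OF N(2) r p(2)]] \<theta>[OF p(1,2)] p(3) by simp
  qed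
qed

lemma ex_maximal_submod:
  assumes N: "submod N" and "N \<noteq> {0}"
  shows "\<exists>N'. simple_factor N N'"
proof -
  have fin: "finite N" and zero: "{0} \<subset> N"
    using submodD(3)[OF N] add_subgroupD(1)[OF submodD(1)[OF N]] assms(2) by auto
  let ?good = "\<lambda>K. submod K \<and> K \<subset> N"
  have "\<exists>K. ?good K \<and> (\<forall>K'. ?good K' \<longrightarrow> card K' \<le> card K)"
    by (rule ex_has_greatest_nat[where k = "{0}" and b = "card N"])
      (use zero submod_zero in \<open>auto intro!: psubset_card_mono fin\<close>)
  then obtain K where K: "?good K" and max: "\<And>K'. ?good K' \<Longrightarrow> card K' \<le> card K" by blast
  have "K' = K \<or> K' = N" if K': "submod K'" "K \<subseteq> K'" "K' \<subseteq> N" for K'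
  proof (rule ccontr)
    assume *: "\<not> (K' = K \<or> K' = N)"
    then have "card K' \<le> card K" using max K' by blast
    moreover have "card K < card K'"
      by (rule psubset_card_mono) (use * K' fin finite_subset in blast)+
    ultimately show False by simp
  qed
  then show ?thesis using N K by (auto simp: simple_factor_def)
qed

text \<open>Along a composition series, a factor isomorphic to \<open>V0\<close> contributes |V0| by
  \<open>fit_unipotent\<close>, and every other factor contributes 1 by
  \<open>fit_nilpotent\<close>.\<close>

lemma card_fit_power:
  assumes s1: "simple_factor V0 {0}" and a: "a \<in> R" "\<And>v. v \<in> V0 \<Longrightarrow> a v = v"
    and sep: "\<And>N N'. simple_factor N N' \<Longrightarrow> annihilator N N' = annihilator V0 {0} \<or> a \<in> annihilator N N'"
    and N: "submod N"
  shows "\<exists>k. card (fit a N) = card V0 ^ k"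
  using N
proof (induction "card N" arbitrary: N rule: less_induct)
  case less
  note Nd = submodD[OF less.prems]
  have aN: "a ` N \<subseteq> N" using Nd(4)[OF a(1)] by blast
  show ?case
  proof (cases "N = {0}")
    case True
    have "fit a N = {0}"
      using add_subgroupD(1)[OF add_subgroup_fit[OF Nd(3,1) additive_on_subset[OF R_additive[OF a(1)] Nd(2)] aN]]
        fit_subset[of a N] True by auto
    then show ?thesis by (intro exI[of _ 0]) simp
  next
    case False
    obtain N' where N': "simple_factor N N'" using ex_maximal_submod[OF less.prems False] by blast
    then have sub: "submod N'" "N' \<subset> N" by (auto simp: simple_factor_def)
    have "card N' < card N" using sub(2) Nd(3) by (rule psubset_card_mono[rotated])
    from less.hyps[OF this sub(1)] obtain k where k: "card (fit a N') = card V0 ^ k" by blast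
    show ?thesis
    proof (cases "a \<in> annihilator N N'")
      case True
      then have "fit a N = fit a N'"
        using sub(2) by (intro fit_nilpotent[OF Nd(3)]) (auto simp: annihilator_def)
      then show ?thesis using k by auto
    next
      case False
      then have same: "annihilator N N' = annihilator V0 {0}" using sep[OF N'] by blast
      obtain i where i: "i \<in> R" "\<forall>m\<in>M. i m = - m" using R_neg by blast
      have "(\<lambda>m. a m + i m) \<in> annihilator V0 {0}"
        using R_plus[OF a(1) i(1)] a(2) i(2) s1 submodD(2) by (auto simp: annihilator_def simple_factor_def subset_iff)
      then have "a n - n \<in> N'" if "n \<in> N" for n
        using that i(2) Nd(2) unfolding same[symmetric] by (auto simp: annihilator_def subset_iff)
      then have eq: "card (fit a N) * card N' = card (fit a N') * card N"
        using sub submodD(1)[OF sub(1)]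
        by (intro fit_unipotent[OF Nd(3,1) additive_on_subset[OF R_additive[OF a(1)] Nd(2)] aN]) auto
      obtain \<theta> where \<theta>: "additive_on N \<theta>" "\<theta> ` N = V0" "{n \<in> N. \<theta> n = 0} = N'"
        using same_annihilator_hom[OF s1 N' same] by blast
      have "card N = card V0 * card N'" using card_image_kernel[OF Nd(3,1) \<theta>(1)] \<theta>(2,3) by simp
      moreover have "card N' > 0"
        using submodD(3)[OF sub(1)] add_subgroupD(1)[OF submodD(1)[OF sub(1)]] by (auto simp: card_gt_0_iff)
      ultimately have "card (fit a N) = card V0 ^ Suc k" using eq k by simp
      then show ?thesis by blast
    qed
  qed
qed

section \<open>Jacobson density\<close>

primrec lspan :: "('v \<Rightarrow> 'v) set \<Rightarrow> 'v list \<Rightarrow> 'v set"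
  where "lspan L [] = {0}"
  | "lspan L (u # us) = {l u + w | l w. l \<in> L \<and> w \<in> lspan L us}"

text \<open>Induction on \<open>us\<close>. In the main case the annihilator \<open>I\<close> of
  \<open>us\<close> maps \<open>u\<close> onto all of \<open>V0\<close>. If every element of
  \<open>I\<close> killing \<open>u\<close> also killed \<open>v\<close>, then
  \<open>p u \<mapsto> p v\<close> would be well defined on \<open>V0\<close> and commute with
  \<open>R\<close>, hence agree with some \<open>l\<close>. Now \<open>I\<close> kills
  \<open>v - l u\<close>, so by induction this vector is in the span of \<open>us\<close>, and
  \<open>v\<close> is in the larger span.\<close>

lemma density:
  assumes s: "simple_factor V0 {0}"
    and L: "\<And>l. l \<in> L \<Longrightarrow> additive_on V0 l" "\<And>l v. l \<in> L \<Longrightarrow> v \<in> V0 \<Longrightarrow> l v \<in> V0"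
      "\<And>l r v. l \<in> L \<Longrightarrow> r \<in> R \<Longrightarrow> v \<in> V0 \<Longrightarrow> r (l v) = l (r v)" "\<exists>l\<in>L. \<forall>v\<in>V0. l v = 0"
    and commutant: "\<And>\<theta>. additive_on V0 \<theta> \<Longrightarrow> \<theta> ` V0 \<subseteq> V0 \<Longrightarrow> (\<And>r v. r \<in> R \<Longrightarrow> v \<in> V0 \<Longrightarrow> \<theta> (r v) = r (\<theta> v)) \<Longrightarrow>
      \<exists>l\<in>L. \<forall>v\<in>V0. \<theta> v = l v"
    and us: "set us \<subseteq> V0" and v: "v \<in> V0" "v \<notin> lspan L us"
  shows "\<exists>r\<in>R. (\<forall>u\<in>set us. r u = 0) \<and> r v \<noteq> 0"
  using us v
proof (induction us arbitrary: v)
  case Nil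
  have V0: "submod V0" using s by (simp add: simple_factor_def)
  obtain i where i: "i \<in> R" "\<forall>m\<in>M. i m = m" using R_one by blast
  have "i v \<noteq> 0" using i(2) Nil submodD(2)[OF V0] by (metis lspan.simps(1) singletonI subsetD)
  then show ?case using i(1) by auto
next
  case (Cons u us)
  have V0: "submod V0" using s by (simp add: simple_factor_def)
  note Vd = submodD[OF V0] and Vg = add_subgroupD[OF submodD(1)[OF V0]]
  have VM: "x \<in> M" if "x \<in> V0" for x using that Vd(2) by blast
  have u: "u \<in> V0" "set us \<subseteq> V0" using Cons.prems by auto
  obtain l0 where l0: "l0 \<in> L" "\<forall>v\<in>V0. l0 v = 0" using L(4) by blast
  have sub: "lspan L us \<subseteq> lspan L (u # us)"
  proof
    fix w assume "w \<in> lspan L us"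
    moreover have "w = l0 u + w" using l0 u(1) by simp
    ultimately show "w \<in> lspan L (u # us)" unfolding lspan.simps using l0(1) by blast
  qed
  have ker: "r w = 0" if r: "r \<in> R" "\<forall>u\<in>set us. r u = 0" and w: "w \<in> lspan L us" for r w
  proof -
    have "r w = 0 \<and> w \<in> V0" if "set us' \<subseteq> set us" "w \<in> lspan L us'" for us' w
      using that
    proof (induction us' arbitrary: w)
      case Nil
      then show ?case using R_lin(1)[OF r(1)] Vg(1) by simp
    next
      case (Cons u' us')
      then obtain l w' where l: "l \<in> L" "w' \<in> lspan L us'" "w = l u' + w'" by auto
      have u': "u' \<in> V0" "r u' = 0" using Cons.prems u(2) r(2) by auto
      have w': "r w' = 0" "w' \<in> V0" using Cons.IH[OF _ l(2)] Cons.prems by auto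
      have lu: "l u' \<in> V0" using L(2)[OF l(1) u'(1)] .
      have "r w = r (l u') + r w'" using R_lin(2)[OF r(1) VM[OF lu] VM[OF w'(2)]] l(3) by simp
      also have "r (l u') = l 0" using L(3)[OF l(1) r(1) u'(1)] u'(2) by simp
      also have "l 0 = 0" using additive_onD(1)[OF L(1)[OF l(1)] Vd(1)] .
      finally show ?case using w' lu Vg(2) l(3) by simp
    qed
    from this[OF subset_refl w] show ?thesis by simp
  qed
  show ?case
  proof (cases "u \<in> lspan L us")
    case True
    have "v \<notin> lspan L us" using Cons.prems(3) sub by blast
    from Cons.IH[OF u(2) Cons.prems(2) this] obtain r where r: "r \<in> R" "\<forall>u\<in>set us. r u = 0" "r v \<noteq> 0" by blast
    then show ?thesis using ker[OF r(1,2) True] by (intro bexI[of _ r]) auto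
  next
    case False
    let ?I = "{r \<in> R. \<forall>u\<in>set us. r u = 0}"
    from Cons.IH[OF u(2,1) False] obtain r0 where r0: "r0 \<in> ?I" "r0 u \<noteq> 0" by blast
    have I: "left_ideal ?I"
      unfolding left_ideal_def
      using r0(1) R_plus R_comp R_lin(1) by auto
    have IR: "p \<in> R" if "p \<in> ?I" for p using that by simp
    have orbit: "{p u + n | p n. p \<in> ?I \<and> n \<in> {0}} = V0"
      by (rule simple_factor_orbit[OF s I u(1) r0(1)]) (use r0 in simp)
    show ?thesis
    proof (rule ccontr)
      assume "\<not> ?thesis"
      then have none: "p v = 0" if "p \<in> ?I" "p u = 0" for p using that by auto
      have wd: "p v = q v" if pq: "p \<in> ?I" "q \<in> ?I" "p u = q u" for p q
      proof -
        obtain q' where q': "q' \<in> ?I" "\<forall>m\<in>M. q' m = - q m" using left_ideal_neg[OF I pq(2)] by blast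
        have "(\<lambda>m. p m + q' m) \<in> ?I" using left_idealD(3)[OF I pq(1) q'(1)] .
        moreover have "p u + q' u = 0" using q'(2) VM[OF u(1)] pq(3) by simp
        ultimately have "p v + q' v = 0" using none[of "\<lambda>m. p m + q' m"] by simp
        then show ?thesis using q'(2) VM[OF Cons.prems(2)] by simp
      qed
      define \<theta> where "\<theta> x = (SOME y. \<exists>p\<in>?I. x = p u \<and> y = p v)" for x
      have \<theta>: "\<theta> (p u) = p v" if "p \<in> ?I" for p
        unfolding \<theta>_def
      proof (rule some_equality)
        show "\<exists>q\<in>?I. p u = q u \<and> p v = q v" by (rule bexI[OF _ that]) simp
        fix y assume "\<exists>q\<in>?I. p u = q u \<and> y = q v"
        then obtain q where "q \<in> ?I" "p u = q u" "y = q v" by (elim bexE conjE)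
        then show "y = p v" using wd[OF that, of q] by simp
      qed
      have dec: "\<exists>p\<in>?I. x = p u" if "x \<in> V0" for x using that orbit by auto
      have "additive_on V0 \<theta>"
      proof (rule additive_onI)
        fix x y assume x: "x \<in> V0" and y: "y \<in> V0"
        obtain p where p: "p \<in> ?I" "x = p u" using dec[OF x] by (rule bexE)
        obtain q where q: "q \<in> ?I" "y = q u" using dec[OF y] by (rule bexE)
        note pq = p q
        show "\<theta> (x + y) = \<theta> x + \<theta> y"
          using \<theta>[OF left_idealD(3)[OF I pq(1,3)]] \<theta>[OF pq(1)] \<theta>[OF pq(3)] pq(2,4) by simp
      qed
      moreover have "\<theta> ` V0 \<subseteq> V0"
      proof clarify
        fix x assume "x \<in> V0"
        then obtain p where "p \<in> ?I" "x = p u" using dec by blast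
        then show "\<theta> x \<in> V0" using \<theta>[of p] Vd(4)[OF IR Cons.prems(2)] by simp
      qed
      moreover have "\<theta> (r x) = r (\<theta> x)" if r: "r \<in> R" and x: "x \<in> V0" for r x
      proof -
        obtain p where p: "p \<in> ?I" "x = p u" using dec[OF x] by blast
        show ?thesis using \<theta>[OF left_idealD(4)[OF I r p(1)]] \<theta>[OF p(1)] p(2) by simp
      qed
      ultimately obtain l where l: "l \<in> L" "\<forall>v\<in>V0. \<theta> v = l v" using commutant[of \<theta>] by blast
      let ?w = "v - l u"
      have lu: "l u \<in> V0" using L(2)[OF l(1) u(1)] .
      have w: "?w \<in> V0" using Vg(4)[OF Cons.prems(2) lu] .
      have "p ?w = 0" if p: "p \<in> ?I" for p
      proof -
        have "p ?w = p v - p (l u)" using R_lin(4)[OF IR[OF p] VM[OF Cons.prems(2)] VM[OF lu]] .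
        also have "p (l u) = l (p u)" using L(3)[OF l(1) IR[OF p] u(1)] .
        also have "l (p u) = p v" using \<theta>[OF p] l(2) Vd(4)[OF IR[OF p] u(1)] by simp
        finally show ?thesis by simp
      qed
      then have "?w \<in> lspan L us" using Cons.IH[OF u(2) w] by blast
      then have "l u + ?w \<in> lspan L (u # us)" unfolding lspan.simps using l(1) by blast
      then show False using Cons.prems(3) by simp
    qed
  qed
qed

end

section \<open>Symplectic representations\<close>

locale symplectic_rep = group_rep +
  fixes f :: "'b \<Rightarrow> 'b \<Rightarrow> 'a"
  assumes f_bilinear: "bilinear_on V V f"
    and f_alt: "v \<in> V \<Longrightarrow> f v v = 0"
    and f_nondeg: "v \<in> V \<Longrightarrow> (\<And>w. w \<in> V \<Longrightarrow> f v w = 0) \<Longrightarrow> v = 0"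
    and f_invariant: "g \<in> carrier G \<Longrightarrow> v \<in> V \<Longrightarrow> w \<in> V \<Longrightarrow> f (\<rho> g v) (\<rho> g w) = f v w"
    and odd_G: "odd (card (carrier G))"
    and two: "(2 :: 'a) \<noteq> 0"
begin

lemmas fD = bilinear_onD[OF f_bilinear] and f_zero = bilinear_on_zero[OF f_bilinear]
  and f_diff = bilinear_on_diff[OF f_bilinear V_subspace V_subspace]
  and V_add = subspace_add[OF V_subspace] and V_scale = subspace_scale[OF V_subspace]
  and V_0 = subspace_0[OF V_subspace] and V_neg = subspace_neg[OF V_subspace]
  and V_diff = subspace_diff[OF V_subspace]

lemma alternating_skew:
  assumes b: "bilinear_on W W b" and W: "subspace W" and alt: "\<And>w. w \<in> W \<Longrightarrow> b w w = 0"
    and v: "v \<in> W" and w: "w \<in> W"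
  shows "b v w = - b w v"
proof -
  have vw: "v + w \<in> W" using subspace_add[OF W v w] .
  have "b (v + w) (v + w) = b v (v + w) + b w (v + w)" using bilinear_onD(1)[OF b v w vw] .
  also have "\<dots> = b v v + b v w + (b w v + b w w)"
    using bilinear_onD(3)[OF b v v w] bilinear_onD(3)[OF b w v w] by simp
  finally have "b v w + b w v = 0" unfolding alt[OF vw] alt[OF v] alt[OF w] by simp
  then show ?thesis by (simp add: eq_neg_iff_add_eq_0)
qed

lemma f_skew: "v \<in> V \<Longrightarrow> w \<in> V \<Longrightarrow> f v w = - f w v"
  by (rule alternating_skew[OF f_bilinear V_subspace f_alt])

lemma f_move: "g \<in> carrier G \<Longrightarrow> v \<in> V \<Longrightarrow> w \<in> V \<Longrightarrow> f (\<rho> g v) w = f v (\<rho> (inv g) w)"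
  using f_invariant[of g v "\<rho> (inv g) w"] \<rho>_inv(2) \<rho>_closed by simp

definition perpV :: "'b set \<Rightarrow> 'b set"
  where "perpV S = {v \<in> V. \<forall>s\<in>S. f v s = 0}"

lemma subspace_perpV: "S \<subseteq> V \<Longrightarrow> subspace (perpV S)"
  unfolding perpV_def using subspace_annihilator[OF bilinear_on_swap[OF f_bilinear] V_subspace, of S] by simp

lemma perpV_subset: "perpV S \<subseteq> V"
  by (auto simp: perpV_def)

lemma perpV_sym: "S \<subseteq> V \<Longrightarrow> v \<in> V \<Longrightarrow> v \<in> perpV S \<longleftrightarrow> (\<forall>s\<in>S. f s v = 0)"
proof -
  assume S: "S \<subseteq> V" and v: "v \<in> V"
  have "f v s = 0 \<longleftrightarrow> f s v = 0" if "s \<in> S" for s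
  proof -
    have "f v s = - f s v" using f_skew[OF v] that S by blast
    then show ?thesis by simp
  qed
  then show ?thesis using v unfolding perpV_def by blast
qed

lemma card_perpV:
  assumes "subspace S" "S \<subseteq> V"
  shows "card S * card (perpV S) = card V"
proof -
  have fin: "finite S" using assms(2) V_finite by (rule finite_subset)
  have "card V * card {s \<in> S. \<forall>v\<in>V. f v s = 0} = card S * card {v \<in> V. \<forall>s\<in>S. f v s = 0}"
    by (rule pairing_card[OF bilinear_on_subset[OF f_bilinear subset_refl assms(2)] V_subspace V_finite assms(1) fin])
  moreover have "{s \<in> S. \<forall>v\<in>V. f v s = 0} = {0}"
  proof
    show "{s \<in> S. \<forall>v\<in>V. f v s = 0} \<subseteq> {0}"
    proof clarify
      fix s assume s: "s \<in> S" "\<forall>v\<in>V. f v s = 0"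
      have sV: "s \<in> V" using s(1) assms(2) by blast
      have "f s w = 0" if "w \<in> V" for w using s(2) that f_skew[OF sV that] by simp
      then show "s = 0" using f_nondeg sV by blast
    qed
    show "{0} \<subseteq> {s \<in> S. \<forall>v\<in>V. f v s = 0}" using subspace_0[OF assms(1)] f_zero(2) V_0 by auto
  qed
  ultimately show ?thesis by (simp add: perpV_def mult.commute)
qed

lemma perpV_perpV:
  assumes "subspace S" "S \<subseteq> V"
  shows "perpV (perpV S) = S"
proof (rule sym, rule card_subset_eq)
  have P: "perpV S \<subseteq> V" by (rule perpV_subset)
  show "finite (perpV (perpV S))" using perpV_subset V_finite by (rule finite_subset)
  show "S \<subseteq> perpV (perpV S)"
    using assms(2) perpV_sym[OF P] by (auto simp: perpV_def subset_iff)
  have "card S * card (perpV S) = card (perpV S) * card (perpV (perpV S))"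
    using card_perpV[OF assms] card_perpV[OF subspace_perpV[OF assms(2)] P] by simp
  moreover have "card (perpV S) > 0"
    using finite_subset[OF P V_finite] subspace_0[OF subspace_perpV[OF assms(2)]] by (auto simp: card_gt_0_iff)
  ultimately show "card S = card (perpV (perpV S))" by (simp add: mult.commute)
qed

definition stable :: "'c set \<Rightarrow> 'b set \<Rightarrow> bool"
  where "stable H S \<longleftrightarrow> (\<forall>h\<in>H. \<forall>s\<in>S. \<rho> h s \<in> S)"

lemma stable_perpV:
  assumes "subgroup H G" "stable H S" "S \<subseteq> V"
  shows "stable H (perpV S)"
  unfolding stable_def
proof (intro ballI)
  fix h v assume h: "h \<in> H" and v: "v \<in> perpV S"
  have hG: "h \<in> carrier G" using subgroup.mem_carrier[OF assms(1) h] .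
  have vV: "v \<in> V" using v by (simp add: perpV_def)
  have "f (\<rho> h v) s = 0" if "s \<in> S" for s
  proof -
    have "\<rho> (inv h) s \<in> S" using assms(2) that subgroup.m_inv_closed[OF assms(1) h] by (simp add: stable_def)
    then show ?thesis using f_move[OF hG vV, of s] v that assms(3) by (auto simp: perpV_def)
  qed
  then show "\<rho> h v \<in> perpV S" using \<rho>_closed[OF hG vV] by (simp add: perpV_def)
qed

text \<open>Self-perpendicular submodules inside the subset \<open>V\<close>. The group enters only
  as a set of elements, so restriction to a subgroup merely changes the argument.\<close>

definition hyp :: "'c set \<Rightarrow> bool"
  where "hyp H \<longleftrightarrow> (\<exists>S. subspace S \<and> S \<subseteq> V \<and> stable H S \<and> perpV S = S)"

text \<open>The involution of the group ring that inverts group elements. For coefficients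
  satisfying \<open>selfadj\<close> it gives the adjoint operator.\<close>

definition star :: "('c \<Rightarrow> 'b \<Rightarrow> 'b) \<Rightarrow> 'c \<Rightarrow> 'b \<Rightarrow> 'b"
  where "star a g = a (inv g)"

definition selfadj :: "('c \<Rightarrow> 'b \<Rightarrow> 'b) \<Rightarrow> bool"
  where "selfadj a \<longleftrightarrow> (\<forall>g\<in>carrier G. \<forall>v\<in>V. \<forall>w\<in>V. f (a g v) w = f v (a g w))"

lemma coef_star: "coef a \<Longrightarrow> coef (star a)"
  by (simp add: coef_def star_def)

end

section \<open>The invariant form on an induced module\<close>

locale induced = symplectic_rep +
  fixes H :: "'c set" and r :: nat and t :: "nat \<Rightarrow> 'c"
  assumes H: "subgroup H G" and t: "is_transversal H r t"
begin

lemmas Hc = subgroup.mem_carrier[OF H] and tc = transversal_closed[OF t]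

text \<open>For \<open>\<phi>\<close> and \<open>\<psi>\<close> in \<open>ind H\<close> each summand
  depends only on the coset of \<open>t i\<close>, because \<open>f\<close> is invariant. The sum is
  thus independent of the transversal.\<close>

definition sform :: "('c \<Rightarrow> 'b) \<Rightarrow> ('c \<Rightarrow> 'b) \<Rightarrow> 'a"
  where "sform \<phi> \<psi> = (\<Sum>i<r. f (\<phi> (t i)) (\<psi> (t i)))"

lemma sform_bilinear: "fn.bilinear_on (ind H) (ind H) sform"
  unfolding fn.bilinear_on_def
proof (intro conjI ballI allI)
  have at: "\<phi> (t i) \<in> V" if "\<phi> \<in> ind H" "i \<in> {..<r}" for \<phi> i
    using indD(1)[OF that(1) tc] that(2) by simp
  fix \<phi> \<psi> assume \<phi>: "\<phi> \<in> ind H" and \<psi>: "\<psi> \<in> ind H"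
  show "sform (\<lambda>x. scale c (\<phi> x)) \<psi> = c * sform \<phi> \<psi>" for c
    unfolding sform_def sum_distrib_left
    by (intro sum.cong refl fD(2) at[OF \<phi>] at[OF \<psi>])
  show "sform \<phi> (\<lambda>x. scale c (\<psi> x)) = c * sform \<phi> \<psi>" for c
    unfolding sform_def sum_distrib_left
    by (intro sum.cong refl fD(4) at[OF \<phi>] at[OF \<psi>])
  fix \<chi> assume \<chi>: "\<chi> \<in> ind H"
  show "sform (\<phi> + \<psi>) \<chi> = sform \<phi> \<chi> + sform \<psi> \<chi>"
    unfolding sform_def sum.distrib[symmetric] plus_fun_apply
    by (intro sum.cong refl fD(1) at[OF \<phi>] at[OF \<psi>] at[OF \<chi>])
  show "sform \<phi> (\<psi> + \<chi>) = sform \<phi> \<psi> + sform \<phi> \<chi>"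
    unfolding sform_def sum.distrib[symmetric] plus_fun_apply
    by (intro sum.cong refl fD(3) at[OF \<phi>] at[OF \<psi>] at[OF \<chi>])
qed

text \<open>Left translation permutes the left cosets of \<open>H\<close>, and \<open>u\<close> is
  constant on each of them.\<close>

lemma sum_coset_shift:
  assumes u: "\<And>x h. x \<in> carrier G \<Longrightarrow> h \<in> H \<Longrightarrow> u (x \<otimes> h) = (u x :: 'a)" and g: "g \<in> carrier G"
  shows "(\<Sum>i<r. u (g \<otimes> t i)) = (\<Sum>i<r. u (t i))"
proof -
  let ?\<sigma> = "coset_perm H r t"
  have p: "perm_rep r ?\<sigma>" by (rule coset_perm_rep[OF H t])
  have "u (g \<otimes> t i) = u (t (?\<sigma> g i))" if i: "i < r" for i
  proof -
    have gt: "g \<otimes> t i \<in> carrier G" using g tc[OF i] by simp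
    obtain h where "h \<in> H" "g \<otimes> t i = t (coset_index H r t (g \<otimes> t i)) \<otimes> h"
      using coset_decomp[OF H t gt] .
    then show ?thesis
      using u[OF tc[OF coset_index(1)[OF t gt]]] by (metis coset_perm_def)
  qed
  then have "(\<Sum>i<r. u (g \<otimes> t i)) = (\<Sum>i<r. u (t (?\<sigma> g i)))" by simp
  also have "\<dots> = (\<Sum>i<r. u (t i))"
  proof (rule sum.reindex_bij_witness[where i = "?\<sigma> (inv g)" and j = "?\<sigma> g"])
    fix i assume "i \<in> {..<r}"
    then have i: "i < r" by simp
    show "?\<sigma> (inv g) (?\<sigma> g i) = i" "?\<sigma> g (?\<sigma> (inv g) i) = i" "?\<sigma> g i \<in> {..<r}" "?\<sigma> (inv g) i \<in> {..<r}"
      using p g i unfolding perm_rep_def by (metis inv_closed l_inv r_inv lessThan_iff)+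
  qed simp
  finally show ?thesis .
qed

lemma sform_adjoint:
  assumes a: "coef a" and sa: "selfadj a" and \<phi>: "\<phi> \<in> ind H" and \<psi>: "\<psi> \<in> ind H"
  shows "sform (theta a \<phi>) \<psi> = sform \<phi> (theta (star a) \<psi>)"
proof -
  have sumL: "f (\<Sum>g\<in>A. v g) w = (\<Sum>g\<in>A. f (v g) w)"
    if "finite A" "\<And>g. g \<in> A \<Longrightarrow> v g \<in> V" "w \<in> V" for A and v :: "'c \<Rightarrow> 'b" and w
    using that
  proof (induction A)
    case empty
    then show ?case using f_zero(1)[OF V_0] by simp
  next
    case (insert x A)
    then have "(\<Sum>g\<in>A. v g) \<in> V" by (intro subspace_sum[OF V_subspace]) simp
    then show ?case using fD(1)[of "v x" "\<Sum>g\<in>A. v g" w] insert by simp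
  qed
  have sumR: "f w (\<Sum>g\<in>A. v g) = (\<Sum>g\<in>A. f w (v g))"
    if "finite A" "\<And>g. g \<in> A \<Longrightarrow> v g \<in> V" "w \<in> V" for A and v :: "'c \<Rightarrow> 'b" and w
    using that
  proof (induction A)
    case empty
    then show ?case using f_zero(2)[OF _ V_0] by simp
  next
    case (insert x A)
    then have "(\<Sum>g\<in>A. v g) \<in> V" by (intro subspace_sum[OF V_subspace]) simp
    then show ?case using fD(3)[of w "v x" "\<Sum>g\<in>A. v g"] insert by simp
  qed
  note \<phi>V = indD(1)[OF \<phi>] and \<psi>V = indD(1)[OF \<psi>]
  have "sform (theta a \<phi>) \<psi> = (\<Sum>i<r. \<Sum>g\<in>carrier G. f (\<phi> (inv g \<otimes> t i)) (a g (\<psi> (t i))))"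
    unfolding sform_def
  proof (intro sum.cong refl)
    fix i assume "i \<in> {..<r}"
    then have ti: "t i \<in> carrier G" using tc by simp
    have "f (theta a \<phi> (t i)) (\<psi> (t i)) = (\<Sum>g\<in>carrier G. f (a g (\<phi> (inv g \<otimes> t i))) (\<psi> (t i)))"
      using ti \<phi>V \<psi>V coefD(2)[OF a] by (simp add: theta_def sumL[OF fin_G])
    also have "\<dots> = (\<Sum>g\<in>carrier G. f (\<phi> (inv g \<otimes> t i)) (a g (\<psi> (t i))))"
      using ti \<phi>V \<psi>V sa by (intro sum.cong) (auto simp: selfadj_def)
    finally show "f (theta a \<phi> (t i)) (\<psi> (t i)) = \<dots>" .
  qed
  also have "\<dots> = (\<Sum>g\<in>carrier G. \<Sum>i<r. f (\<phi> (inv g \<otimes> t i)) (a g (\<psi> (t i))))"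
    by (rule sum.swap)
  also have "\<dots> = (\<Sum>g\<in>carrier G. \<Sum>i<r. f (\<phi> (t i)) (a g (\<psi> (g \<otimes> t i))))"
  proof (rule sum.cong[OF refl])
    fix g assume g: "g \<in> carrier G"
    let ?u = "\<lambda>x. f (\<phi> x) (a g (\<psi> (g \<otimes> x)))"
    have "(\<Sum>i<r. ?u (inv g \<otimes> t i)) = (\<Sum>i<r. ?u (t i))"
    proof (rule sum_coset_shift[where u = ?u])
      fix x h assume x: "x \<in> carrier G" and h: "h \<in> H"
      have "\<psi> (g \<otimes> (x \<otimes> h)) = \<rho> (inv h) (\<psi> (g \<otimes> x))"
        using indD(3)[OF \<psi> _ h, of "g \<otimes> x"] x g Hc[OF h] by (simp add: m_assoc)
      then show "?u (x \<otimes> h) = ?u x"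
        using indD(3)[OF \<phi> x h] x g Hc[OF h] \<phi>V \<psi>V coefD(2,3)[OF a g] f_invariant by simp
    next
      show "inv g \<in> carrier G" using g by simp
    qed
    moreover have "?u (inv g \<otimes> t i) = f (\<phi> (inv g \<otimes> t i)) (a g (\<psi> (t i)))" if "i < r" for i
      using g tc[OF that] by (simp add: m_assoc[symmetric])
    ultimately show "(\<Sum>i<r. f (\<phi> (inv g \<otimes> t i)) (a g (\<psi> (t i)))) = (\<Sum>i<r. ?u (t i))" by simp
  qed
  also have "\<dots> = (\<Sum>i<r. \<Sum>g\<in>carrier G. f (\<phi> (t i)) (a g (\<psi> (g \<otimes> t i))))"
    by (rule sum.swap)
  also have "\<dots> = sform \<phi> (theta (star a) \<psi>)"
    unfolding sform_def
  proof (intro sum.cong refl)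
    fix i assume "i \<in> {..<r}"
    then have ti: "t i \<in> carrier G" using tc by simp
    have "(\<Sum>g\<in>carrier G. f (\<phi> (t i)) (a g (\<psi> (g \<otimes> t i))))
      = (\<Sum>g\<in>carrier G. f (\<phi> (t i)) (star a g (\<psi> (inv g \<otimes> t i))))"
      by (rule sum.reindex_bij_witness[where i = "\<lambda>g. inv g" and j = "\<lambda>g. inv g"]) (auto simp: star_def)
    then show "(\<Sum>g\<in>carrier G. f (\<phi> (t i)) (a g (\<psi> (g \<otimes> t i)))) = f (\<phi> (t i)) (theta (star a) \<psi> (t i))"
      using ti \<phi>V \<psi>V coefD(2)[OF coef_star[OF a]] by (simp add: theta_def sumR[OF fin_G])
  qed
  finally show ?thesis .
qed

text \<open>For \<open>v\<close> in \<open>V\<close>, the element of the induced module that is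
  supported on the left coset of \<open>x\<close> and has the value \<open>v\<close> at
  \<open>x\<close>. Pairing with it is evaluation at \<open>x\<close>, which yields nondegeneracy
  and perpendicular spaces.\<close>

definition bump :: "'c \<Rightarrow> 'b \<Rightarrow> 'c \<Rightarrow> 'b"
  where "bump x v y = (if y \<in> carrier G \<and> inv x \<otimes> y \<in> H then \<rho> (inv y \<otimes> x) v else 0)"

lemma bump_ind:
  assumes x: "x \<in> carrier G" and v: "v \<in> V"
  shows "bump x v \<in> ind H"
  unfolding ind_def
proof (intro CollectI conjI ballI allI impI)
  show "bump x v y \<in> V" if "y \<in> carrier G" for y
    using that x v \<rho>_closed V_0 by (simp add: bump_def)
  show "bump x v y = 0" if "y \<notin> carrier G" for y using that by (simp add: bump_def)
  fix y h assume y: "y \<in> carrier G" and h: "h \<in> H"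
  note hc = Hc[OF h]
  have "inv x \<otimes> (y \<otimes> h) \<in> H \<longleftrightarrow> inv x \<otimes> y \<in> H"
  proof
    show "inv x \<otimes> (y \<otimes> h) \<in> H" if "inv x \<otimes> y \<in> H"
      using subgroup.m_closed[OF H that h] x y hc by (simp add: m_assoc)
    show "inv x \<otimes> y \<in> H" if "inv x \<otimes> (y \<otimes> h) \<in> H"
      using subgroup.m_closed[OF H that subgroup.m_inv_closed[OF H h]] x y hc by (simp add: m_assoc)
  qed
  moreover have "\<rho> (inv (y \<otimes> h) \<otimes> x) v = \<rho> (inv h) (\<rho> (inv y \<otimes> x) v)"
    using x y hc v by (simp add: \<rho>_mult[symmetric] inv_mult_group m_assoc)
  ultimately show "bump x v (y \<otimes> h) = \<rho> (inv h) (bump x v y)"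
    using y hc linear_on_more(1)[OF \<rho>_linear V_subspace] by (simp add: bump_def)
qed

lemma sform_bump:
  assumes x: "x \<in> carrier G" and v: "v \<in> V" and \<phi>: "\<phi> \<in> ind H"
  shows "sform \<phi> (bump x v) = f (\<phi> x) v"
proof -
  let ?l = "coset_index H r t x"
  note l = coset_index[OF t x]
  let ?h = "inv (t ?l) \<otimes> x"
  have iff: "inv x \<otimes> t i \<in> H \<longleftrightarrow> i = ?l" if i: "i < r" for i
  proof -
    have "inv x \<otimes> t i \<in> H \<longleftrightarrow> inv (t i) \<otimes> x \<in> H"
      using subgroup.m_inv_closed[OF H] x tc[OF i]
      by (metis inv_closed inv_inv inv_mult_group)
    then show ?thesis using l(3)[OF i] by metis
  qed
  have "sform \<phi> (bump x v) = (\<Sum>i<r. if i = ?l then f (\<phi> (t ?l)) (\<rho> ?h v) else 0)"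
    unfolding sform_def bump_def using iff tc indD(1)[OF \<phi>] f_zero(2)[OF _ v] by (intro sum.cong) auto
  also have "\<dots> = f (\<phi> (t ?l)) (\<rho> ?h v)" using l(1) by simp
  also have "\<dots> = f (\<rho> (inv ?h) (\<phi> (t ?l))) v"
    using f_move[of "inv ?h" "\<phi> (t ?l)" v] x tc[OF l(1)] indD(1)[OF \<phi>] v by simp
  also have "\<rho> (inv ?h) (\<phi> (t ?l)) = \<phi> x"
    using indD(3)[OF \<phi> tc[OF l(1)] l(2)] x tc[OF l(1)] by (simp add: m_assoc[symmetric])
  finally show ?thesis .
qed

lemma sform_skew: "\<phi> \<in> ind H \<Longrightarrow> \<psi> \<in> ind H \<Longrightarrow> sform \<phi> \<psi> = - sform \<psi> \<phi>"
proof -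
  assume \<phi>: "\<phi> \<in> ind H" and \<psi>: "\<psi> \<in> ind H"
  have "sform \<phi> \<psi> = (\<Sum>i<r. - f (\<psi> (t i)) (\<phi> (t i)))"
    unfolding sform_def
    by (intro sum.cong refl f_skew indD(1)[OF \<phi>] indD(1)[OF \<psi>] tc) simp_all
  then show ?thesis by (simp add: sform_def sum_negf)
qed

lemma sform_nondeg:
  assumes \<psi>: "\<psi> \<in> ind H" and z: "\<And>\<phi>. \<phi> \<in> ind H \<Longrightarrow> sform \<phi> \<psi> = 0"
  shows "\<psi> = 0"
proof
  fix x
  show "\<psi> x = 0 x"
  proof (cases "x \<in> carrier G")
    case True
    have "f (\<psi> x) v = 0" if "v \<in> V" for v
      using sform_bump[OF True that \<psi>] sform_skew[OF \<psi> bump_ind[OF True that]] z[OF bump_ind[OF True that]] by simp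
    then show ?thesis using f_nondeg indD(1)[OF \<psi> True] by simp
  next
    case False
    then show ?thesis using indD(2)[OF \<psi>] by simp
  qed
qed

definition sub_ind :: "'b set \<Rightarrow> ('c \<Rightarrow> 'b) set"
  where "sub_ind S = {\<phi> \<in> ind H. \<forall>x\<in>carrier G. \<phi> x \<in> S}"

lemma subspace_sub_ind: "subspace S \<Longrightarrow> fn.subspace (sub_ind S)"
  using subspace_ind[OF H] subspace_0 subspace_add subspace_scale
  unfolding fn.subspace_def sub_ind_def by auto

lemma theta_sub_ind:
  assumes a: "coef a" and S: "subspace S" and aS: "\<And>g s. g \<in> carrier G \<Longrightarrow> s \<in> S \<Longrightarrow> a g s \<in> S"
  shows "theta a ` sub_ind S \<subseteq> sub_ind S"
proof clarify
  fix \<phi> assume \<phi>: "\<phi> \<in> sub_ind S"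
  have "theta a \<phi> x \<in> S" if "x \<in> carrier G" for x
    using that \<phi> aS by (auto simp: theta_def sub_ind_def intro!: subspace_sum[OF S])
  then show "theta a \<phi> \<in> sub_ind S"
    using \<phi> fn.linear_onD(1)[OF linear_on_theta[OF a H]] by (simp add: sub_ind_def)
qed

text \<open>Testing with the functions \<open>bump x s\<close> forces the values of an orthogonal
  function into \<open>perpV S\<close>.\<close>

lemma sub_ind_perp:
  assumes S: "S \<subseteq> V" "subspace S" and st: "stable H S"
  shows "{\<phi> \<in> ind H. \<forall>\<psi>\<in>sub_ind S. sform \<phi> \<psi> = 0} = sub_ind (perpV S)"
proof
  show "{\<phi> \<in> ind H. \<forall>\<psi>\<in>sub_ind S. sform \<phi> \<psi> = 0} \<subseteq> sub_ind (perpV S)"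
  proof clarify
    fix \<phi> assume \<phi>: "\<phi> \<in> ind H" "\<forall>\<psi>\<in>sub_ind S. sform \<phi> \<psi> = 0"
    have "\<phi> x \<in> perpV S" if x: "x \<in> carrier G" for x
      unfolding perpV_def
    proof (intro CollectI conjI ballI)
      show "\<phi> x \<in> V" by (rule indD(1)[OF \<phi>(1) x])
      fix s assume s: "s \<in> S"
      have "bump x s \<in> sub_ind S"
        unfolding sub_ind_def
      proof (intro CollectI conjI ballI)
        show "bump x s \<in> ind H" using bump_ind[OF x] s S(1) by blast
        fix y assume y: "y \<in> carrier G"
        have "inv y \<otimes> x \<in> H" if "inv x \<otimes> y \<in> H"
          using subgroup.m_inv_closed[OF H that] x y by (simp add: inv_mult_group)
        then show "bump x s y \<in> S"
          using st s subspace_0[OF S(2)] by (auto simp: bump_def stable_def)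
      qed
      moreover have "s \<in> V" using S(1) s by (rule subsetD)
      ultimately show "f (\<phi> x) s = 0" using \<phi>(2) sform_bump[OF x _ \<phi>(1), of s] by simp
    qed
    then show "\<phi> \<in> sub_ind (perpV S)" using \<phi>(1) by (simp add: sub_ind_def)
  qed
  show "sub_ind (perpV S) \<subseteq> {\<phi> \<in> ind H. \<forall>\<psi>\<in>sub_ind S. sform \<phi> \<psi> = 0}"
  proof clarify
    fix \<phi> assume \<phi>: "\<phi> \<in> sub_ind (perpV S)"
    have "sform \<phi> \<psi> = 0" if "\<psi> \<in> sub_ind S" for \<psi>
      unfolding sform_def using that \<phi> tc by (intro sum.neutral) (auto simp: sub_ind_def perpV_def)
    then show "\<phi> \<in> ind H \<and> (\<forall>\<psi>\<in>sub_ind S. sform \<phi> \<psi> = 0)" using \<phi> by (simp add: sub_ind_def)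
  qed
qed

lemma sub_ind_V: "sub_ind V = ind H"
  using indD(1) by (auto simp: sub_ind_def)

text \<open>An instance of \<open>fit_dual\<close> for the submodule induced from \<open>S\<close>.
  If \<open>S\<close> is self-perpendicular and \<open>a = a'\<close>, the right-hand side is a
  square; in this way hyperbolic restrictions produce even multiplicities.\<close>

lemma card_fit_ind:
  assumes a: "coef a" "coef a'"
    and adj: "\<And>\<phi> \<psi>. \<phi> \<in> ind H \<Longrightarrow> \<psi> \<in> ind H \<Longrightarrow> sform (theta a \<phi>) \<psi> = sform \<phi> (theta a' \<psi>)"
    and S: "S \<subseteq> V" "subspace S" and st: "stable H S"
    and aS: "\<And>g s. g \<in> carrier G \<Longrightarrow> s \<in> S \<Longrightarrow> a' g s \<in> S"
  shows "card (fit (theta a) (ind H)) = card (fit (theta a) (sub_ind (perpV S))) * card (fit (theta a') (sub_ind S))"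
proof -
  have "sub_ind S \<subseteq> ind H" by (auto simp: sub_ind_def)
  from fn.fit_dual[where M = "ind H" and f = sform and T = "theta a" and T' = "theta a'" and N = "sub_ind S",
      OF subspace_ind[OF H] finite_ind sform_bilinear _ linear_on_theta[OF a(1) H] linear_on_theta[OF a(2) H]
        _ subspace_sub_ind[OF S(2)] this theta_sub_ind[OF a(2) S(2)]]
  show ?thesis
    unfolding sub_ind_perp[OF S st] using sform_nondeg adj aS by blast
qed

end

section \<open>Alternating forms over a field of operators\<close>

text \<open>\<open>\<Lambda>\<close> acts on \<open>W\<close> as a finite field of order
  \<open>k\<close>. Members of \<open>\<Lambda>\<close> may differ outside \<open>W\<close>, so
  \<open>k\<close> is defined through orbits. Dimensions over this field appear as exponents of
  \<open>k\<close>.\<close>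

locale field_action = finite_field_space scale
  for scale :: "'f::{field,finite} \<Rightarrow> 'v::ab_group_add \<Rightarrow> 'v" +
  fixes W :: "'v set" and \<Lambda> :: "('v \<Rightarrow> 'v) set" and k :: nat
  assumes W_subspace: "subspace W" and W_finite: "finite W"
    and \<Lambda>_linear: "l \<in> \<Lambda> \<Longrightarrow> linear_on W l"
    and \<Lambda>_comm: "l \<in> \<Lambda> \<Longrightarrow> m \<in> \<Lambda> \<Longrightarrow> w \<in> W \<Longrightarrow> l (m w) = m (l w)"
    and \<Lambda>_plus: "l \<in> \<Lambda> \<Longrightarrow> m \<in> \<Lambda> \<Longrightarrow> \<exists>n\<in>\<Lambda>. \<forall>w\<in>W. n w = l w + m w"
    and \<Lambda>_comp: "l \<in> \<Lambda> \<Longrightarrow> m \<in> \<Lambda> \<Longrightarrow> \<exists>n\<in>\<Lambda>. \<forall>w\<in>W. n w = l (m w)"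
    and \<Lambda>_scalar: "\<exists>l\<in>\<Lambda>. \<forall>w\<in>W. l w = scale c w"
    and \<Lambda>_inj: "l \<in> \<Lambda> \<Longrightarrow> (\<forall>w\<in>W. l w = 0) \<or> inj_on l W"
    and \<Lambda>_card: "w \<in> W \<Longrightarrow> w \<noteq> 0 \<Longrightarrow> card ((\<lambda>l. l w) ` \<Lambda>) = k"
begin

definition line :: "'v \<Rightarrow> 'v set"
  where "line w = (\<lambda>l. l w) ` \<Lambda>"

definition inv_sub :: "'v set \<Rightarrow> bool"
  where "inv_sub K \<longleftrightarrow> subspace K \<and> K \<subseteq> W \<and> (\<forall>l\<in>\<Lambda>. l ` K \<subseteq> K)"

lemma inv_subD:
  assumes "inv_sub K"
  shows "subspace K" "K \<subseteq> W" "\<And>l x. l \<in> \<Lambda> \<Longrightarrow> x \<in> K \<Longrightarrow> l x \<in> K" "finite K"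
  using assms finite_subset[OF _ W_finite] unfolding inv_sub_def by blast+

lemma inv_sub_line:
  assumes w: "w \<in> W"
  shows "inv_sub (line w)" "w \<in> line w"
proof -
  obtain l where "l \<in> \<Lambda>" "l w = scale 1 w" using \<Lambda>_scalar[of 1] w by blast
  then show "w \<in> line w" unfolding line_def by (intro image_eqI[of _ _ l]) simp_all
  have "subspace (line w)"
    unfolding subspace_def
  proof (intro conjI ballI allI)
    show "0 \<in> line w" using \<Lambda>_scalar[of 0] w by (force simp: line_def)
    fix x assume "x \<in> line w"
    then obtain l where l: "l \<in> \<Lambda>" "x = l w" by (auto simp: line_def)
    show "scale c x \<in> line w" for c
    proof -
      obtain m where m: "m \<in> \<Lambda>" "\<forall>w\<in>W. m w = scale c w" using \<Lambda>_scalar by blast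
      obtain n where n: "n \<in> \<Lambda>" "\<forall>w\<in>W. n w = m (l w)" using \<Lambda>_comp[OF m(1) l(1)] by blast
      have "n w = scale c x" using n(2) m(2) linear_onD(1)[OF \<Lambda>_linear[OF l(1)] w] w l(2) by simp
      then show ?thesis using n(1) unfolding line_def by (metis imageI)
    qed
    fix y assume "y \<in> line w"
    then obtain m where m: "m \<in> \<Lambda>" "y = m w" by (auto simp: line_def)
    obtain n where n: "n \<in> \<Lambda>" "\<forall>w\<in>W. n w = l w + m w" using \<Lambda>_plus[OF l(1) m(1)] by blast
    then have "x + y = n w" using l m w by simp
    then show "x + y \<in> line w" using n(1) unfolding line_def by (metis imageI)
  qed
  moreover have "line w \<subseteq> W" using linear_onD(1)[OF \<Lambda>_linear] w by (auto simp: line_def)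
  moreover have "l x \<in> line w" if l: "l \<in> \<Lambda>" and x: "x \<in> line w" for l x
  proof -
    obtain m where m: "m \<in> \<Lambda>" "x = m w" using x by (auto simp: line_def)
    obtain n where n: "n \<in> \<Lambda>" "\<forall>w\<in>W. n w = l (m w)" using \<Lambda>_comp[OF l m(1)] by blast
    then have "l x = n w" using m w by simp
    then show ?thesis using n(1) unfolding line_def by (metis imageI)
  qed
  ultimately show "inv_sub (line w)" unfolding inv_sub_def by blast
qed

lemma extend_line:
  assumes K: "inv_sub K" and w: "w \<in> W" "w \<notin> K"
  defines "N \<equiv> {x + y | x y. x \<in> K \<and> y \<in> line w}"
  shows "inv_sub N" "card N = k * card K" "K \<subseteq> N" "w \<in> N" "\<And>P. subspace P \<Longrightarrow> K \<subseteq> P \<Longrightarrow> line w \<subseteq> P \<Longrightarrow> N \<subseteq> P"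
proof -
  note Kd = inv_subD[OF K] and Ld = inv_subD[OF inv_sub_line(1)[OF w(1)]]
  have subN: "subspace N" unfolding N_def by (rule subspace_sums[OF Kd(1) Ld(1)])
  have NW: "N \<subseteq> W" unfolding N_def using subspace_add[OF W_subspace] Kd(2) Ld(2) by blast
  have "l z \<in> N" if l: "l \<in> \<Lambda>" and z: "z \<in> N" for l z
  proof -
    obtain x y where xy: "x \<in> K" "y \<in> line w" "z = x + y" using z by (auto simp: N_def)
    then have "l z = l x + l y" using linear_onD(4)[OF \<Lambda>_linear[OF l]] Kd(2) Ld(2) by blast
    then show ?thesis using Kd(3)[OF l xy(1)] Ld(3)[OF l xy(2)] unfolding N_def by blast
  qed
  then show "inv_sub N" using subN NW unfolding inv_sub_def by blast
  have KN: "x \<in> N" if "x \<in> K" for x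
    unfolding N_def using that subspace_0[OF Ld(1)] by (intro CollectI exI[of _ x] exI[of _ 0]) simp
  have LN: "y \<in> N" if "y \<in> line w" for y
    unfolding N_def using that subspace_0[OF Kd(1)] by (intro CollectI exI[of _ 0] exI[of _ y]) simp
  show "K \<subseteq> N" using KN by blast
  show "w \<in> N" using LN inv_sub_line(2)[OF w(1)] by blast
  show "N \<subseteq> P" if "subspace P" "K \<subseteq> P" "line w \<subseteq> P" for P
    unfolding N_def using subspace_add[OF that(1)] that(2,3) by blast
  \<comment> \<open>If \<open>l w\<close> is in \<open>K\<close> and \<open>l\<close> is injective,
    then \<open>l\<close> permutes the finite set \<open>K\<close>, so \<open>w\<close> itself would
    be in \<open>K\<close>.\<close>
  have inter: "K \<inter> line w = {0}"
  proof
    show "{0} \<subseteq> K \<inter> line w" using subspace_0[OF Kd(1)] subspace_0[OF Ld(1)] by simp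
    show "K \<inter> line w \<subseteq> {0}"
    proof
      fix x assume x: "x \<in> K \<inter> line w"
      then obtain l where l: "l \<in> \<Lambda>" "x = l w" by (auto simp: line_def)
      from \<Lambda>_inj[OF l(1)] show "x \<in> {0}"
      proof
        assume "\<forall>w\<in>W. l w = 0" then show ?thesis using l(2) w(1) by simp
      next
        assume inj: "inj_on l W"
        have "inj_on l K" using inj Kd(2) by (rule inj_on_subset)
        moreover have "l ` K \<subseteq> K" using Kd(3)[OF l(1)] by blast
        ultimately have "l ` K = K" using Kd(4) by (metis endo_inj_surj)
        then obtain x' where x': "x' \<in> K" "l w = l x'" using x l(2) by blast
        then have "w = x'" using inj w(1) Kd(2) by (meson inj_onD subsetD)
        then show ?thesis using x'(1) w(2) by simp
      qed
    qed
  qed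
  have "card N * card (K \<inter> line w) = card K * card (line w)"
  proof (rule card_sum_inter)
    show "finite N" using NW W_finite by (rule finite_subset)
    show "\<exists>a\<in>K. \<exists>b\<in>line w. n = a + b" if "n \<in> N" for n using that by (auto simp: N_def)
  qed (use subN Kd(1) Ld(1) subspace_add_subgroup KN LN in auto)
  moreover have "w \<noteq> 0" using w(2) subspace_0[OF Kd(1)] by auto
  ultimately show "card N = k * card K"
    using \<Lambda>_card[OF w(1)] inter by (simp add: line_def mult.commute)
qed

lemma k_gt_1:
  assumes "w \<in> W" "w \<noteq> 0"
  shows "k > 1"
proof -
  have "{0, w} \<subseteq> line w" using inv_sub_line[OF assms(1)] subspace_0 inv_subD(1) by blast
  moreover have "finite (line w)" using inv_subD(4)[OF inv_sub_line(1)[OF assms(1)]] .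
  ultimately have "card {0, w} \<le> card (line w)" by (rule card_mono[rotated])
  then show ?thesis using assms(2) \<Lambda>_card[OF assms] by (simp add: line_def)
qed

lemma card_power:
  assumes K: "inv_sub K" and N: "inv_sub N" and KN: "K \<subseteq> N"
  shows "\<exists>j. card N = card K * k ^ j"
proof -
  note Nd = inv_subD[OF N]
  let ?good = "\<lambda>S. inv_sub S \<and> K \<subseteq> S \<and> S \<subseteq> N \<and> (\<exists>j. card S = card K * k ^ j)"
  have "?good K" using K KN by (auto intro: exI[of _ 0])
  then have "\<exists>S. ?good S \<and> (\<forall>S'. ?good S' \<longrightarrow> card S' \<le> card S)"
    by (rule ex_has_greatest_nat[where b = "Suc (card N)"]) (auto simp: less_Suc_eq_le intro: card_mono[OF Nd(4)])
  then obtain S where S: "?good S" and max: "\<And>S'. ?good S' \<Longrightarrow> card S' \<le> card S" by blast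
  have "S = N"
  proof (rule ccontr)
    assume "S \<noteq> N"
    then obtain w where w: "w \<in> N" "w \<notin> S" using S by blast
    have wW: "w \<in> W" using w(1) Nd(2) by blast
    have S1: "inv_sub S" using S by blast
    let ?S = "{x + y | x y. x \<in> S \<and> y \<in> line w}"
    note e = extend_line[OF S1 wW w(2)]
    have lN: "line w \<subseteq> N" using Nd(3) w(1) by (auto simp: line_def)
    obtain j where "card S = card K * k ^ j" using S by blast
    then have "card ?S = card K * k ^ Suc j" using e(2) by simp
    then have "?good ?S" using e(1,3) e(5)[OF Nd(1) _ lN] S by blast
    from max[OF this] have "k * card S \<le> card S" using e(2) by simp
    moreover have "card S > 0" using inv_subD[OF S1] subspace_0 by (auto simp: card_gt_0_iff)
    moreover have "w \<noteq> 0" using w(2) subspace_0[OF inv_subD(1)[OF S1]] by auto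
    ultimately show False using k_gt_1[OF wW] by simp
  qed
  then show ?thesis using S by blast
qed

text \<open>A maximal isotropic \<open>\<Lambda>\<close>-subspace containing the radical is its own
  perpendicular space, so |N| times |rad| is the square of its order. The rank over the field is
  therefore even. Cardinalities take the place of a symplectic basis.\<close>

lemma card_alternating:
  assumes two: "(2 :: 'f) \<noteq> 0" and N: "inv_sub N" and b: "bilinear_on N N \<beta>"
    and alt: "\<And>w. w \<in> N \<Longrightarrow> \<beta> w w = 0"
    and sa: "\<And>l v w. l \<in> \<Lambda> \<Longrightarrow> v \<in> N \<Longrightarrow> w \<in> N \<Longrightarrow> \<beta> (l v) w = \<beta> v (l w)"
    and rad: "rad = {w \<in> N. \<forall>v\<in>N. \<beta> v w = 0}"
  shows "\<exists>j. card N = card rad * k ^ (2 * j)"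
proof -
  note Nd = inv_subD[OF N] and bd = bilinear_onD[OF b]
  have skew: "\<beta> v w = - \<beta> w v" if "v \<in> N" "w \<in> N" for v w
  proof -
    have vw: "v + w \<in> N" using subspace_add[OF Nd(1) that] .
    have "\<beta> (v + w) (v + w) = \<beta> v (v + w) + \<beta> w (v + w)" using bd(1)[OF that vw] .
    also have "\<dots> = \<beta> v v + \<beta> v w + (\<beta> w v + \<beta> w w)"
      using bd(3)[OF that(1) that] bd(3)[OF that(2) that] by simp
    finally have "\<beta> v w + \<beta> w v = 0" unfolding alt[OF vw] alt[OF that(1)] alt[OF that(2)] by simp
    then show ?thesis by (simp add: eq_neg_iff_add_eq_0)
  qed
  have self: "\<beta> w (l w) = 0" if l: "l \<in> \<Lambda>" and w: "w \<in> N" for l w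
  proof -
    have "\<beta> w (l w) = - \<beta> w (l w)" using skew[OF w Nd(3)[OF l w]] sa[OF l w w] by simp
    then have "2 * \<beta> w (l w) = 0" by (simp add: eq_neg_iff_add_eq_0)
    then show ?thesis using two by simp
  qed
  let ?iso = "\<lambda>P. \<forall>v\<in>P. \<forall>w\<in>P. \<beta> v w = 0"
  let ?good = "\<lambda>P. inv_sub P \<and> rad \<subseteq> P \<and> P \<subseteq> N \<and> ?iso P"
  have radN: "rad \<subseteq> N" using rad by blast
  have inv_rad: "inv_sub rad"
    unfolding inv_sub_def
  proof (intro conjI ballI)
    show "subspace rad" unfolding rad by (rule subspace_annihilator[OF b Nd(1) subset_refl])
    show "rad \<subseteq> W" using radN Nd(2) by blast
    fix l assume l: "l \<in> \<Lambda>"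
    show "l ` rad \<subseteq> rad"
    proof clarify
      fix w assume w: "w \<in> rad"
      then have wN: "w \<in> N" using radN by blast
      have "\<beta> v (l w) = 0" if "v \<in> N" for v
      proof -
        have "\<beta> v (l w) = \<beta> (l v) w" using sa[OF l that wN] by simp
        then show ?thesis using w Nd(3)[OF l that] unfolding rad by simp
      qed
      then show "l w \<in> rad" using Nd(3)[OF l wN] unfolding rad by simp
    qed
  qed
  have "?good rad" using inv_rad radN rad by blast
  then have "\<exists>P. ?good P \<and> (\<forall>P'. ?good P' \<longrightarrow> card P' \<le> card P)"
    by (rule ex_has_greatest_nat[where b = "Suc (card N)"]) (auto simp: less_Suc_eq_le intro: card_mono[OF Nd(4)])
  then obtain P where P: "?good P" and max: "\<And>P'. ?good P' \<Longrightarrow> card P' \<le> card P" by blast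
  have iP: "inv_sub P" and PN: "P \<subseteq> N" and isoP: "?iso P" using P by blast+
  note Pd = inv_subD[OF iP]
  have perp: "{w \<in> N. \<forall>v\<in>P. \<beta> v w = 0} = P"
  proof (rule ccontr)
    assume "{w \<in> N. \<forall>v\<in>P. \<beta> v w = 0} \<noteq> P"
    then obtain w where w: "w \<in> N" "w \<notin> P" "\<forall>v\<in>P. \<beta> v w = 0" using PN isoP by blast
    have wW: "w \<in> W" using w(1) Nd(2) by blast
    let ?P = "{x + y | x y. x \<in> P \<and> y \<in> line w}"
    note e = extend_line[OF iP wW w(2)]
    have lN: "line w \<subseteq> N" using Nd(3) w(1) by (auto simp: line_def)
    have PP: "?P \<subseteq> N" by (rule e(5)[OF Nd(1) PN lN])
    have "?iso ?P"
    proof (intro ballI)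
      fix v v' assume "v \<in> ?P" "v' \<in> ?P"
      then obtain x l x' l' where x: "x \<in> P" "l \<in> \<Lambda>" "v = x + l w" "x' \<in> P" "l' \<in> \<Lambda>" "v' = x' + l' w"
        by (auto simp: line_def)
      have xN: "x \<in> N" "x' \<in> N" "l w \<in> N" "l' w \<in> N" using x PN lN by (auto simp: line_def)
      have 1: "\<beta> x x' = 0" using isoP x by blast
      have 2: "\<beta> x (l' w) = 0" using sa[OF x(5) xN(1) w(1)] w(3) Pd(3)[OF x(5,1)] by simp
      have 3: "\<beta> (l w) x' = 0"
        using skew[OF xN(3,2)] sa[OF x(2) xN(2) w(1)] w(3) Pd(3)[OF x(2,4)] by simp
      have 4: "\<beta> (l w) (l' w) = 0"
      proof -
        obtain n where n: "n \<in> \<Lambda>" "\<forall>w\<in>W. n w = l (l' w)" using \<Lambda>_comp[OF x(2,5)] by blast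
        have "\<beta> (l w) (l' w) = \<beta> w (n w)" using sa[OF x(2) w(1) xN(4)] n(2) wW by simp
        then show ?thesis using self[OF n(1) w(1)] by simp
      qed
      have "\<beta> v v' = \<beta> x v' + \<beta> (l w) v'"
        using bd(1)[OF xN(1,3)] subspace_add[OF Nd(1) xN(2,4)] x(3,6) by simp
      also have "\<dots> = 0" using bd(3)[OF xN(1) xN(2,4)] bd(3)[OF xN(3) xN(2,4)] 1 2 3 4 x(6) by simp
      finally show "\<beta> v v' = 0" .
    qed
    then have "?good ?P" using e(1,3) PP P by blast
    from max[OF this] have "k * card P \<le> card P" using e(2) by simp
    moreover have "card P > 0" using Pd subspace_0 by (auto simp: card_gt_0_iff)
    moreover have "w \<noteq> 0" using w(2) subspace_0[OF Pd(1)] by auto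
    ultimately show False using k_gt_1[OF wW] by simp
  qed
  have "card N * card {v \<in> P. \<forall>w\<in>N. \<beta> v w = 0} = card P * card {w \<in> N. \<forall>v\<in>P. \<beta> v w = 0}"
    using pairing_card[OF bilinear_on_subset[OF b PN subset_refl] Pd(1,4) Nd(1,4)] by simp
  moreover have "{v \<in> P. \<forall>w\<in>N. \<beta> v w = 0} = rad"
  proof -
    have "(\<forall>w\<in>N. \<beta> v w = 0) \<longleftrightarrow> (\<forall>w\<in>N. \<beta> w v = 0)" if "v \<in> N" for v
    proof -
      have "\<beta> v w = 0 \<longleftrightarrow> \<beta> w v = 0" if "w \<in> N" for w using skew[OF \<open>v \<in> N\<close> that] by simp
      then show ?thesis by blast
    qed
    then show ?thesis using P unfolding rad by blast
  qed
  ultimately have eq: "card N * card rad = card P * card P" using perp by simp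
  obtain j where j: "card P = card rad * k ^ j" using card_power[OF inv_rad iP] P by blast
  have "card rad > 0" using inv_subD[OF inv_rad] subspace_0 by (auto simp: card_gt_0_iff)
  then have "card N = card rad * k ^ (2 * j)"
    using eq unfolding j by (simp add: power_mult power2_eq_square algebra_simps power_mult_distrib mult_2)
  then show ?thesis by blast
qed

end

section \<open>Self-adjoint coefficients\<close>

text \<open>This locale is used twice: with \<open>L\<close> the scalars, to compare composition
  factors, and with \<open>L\<close> a field of endomorphisms fixed by the adjunction.\<close>

locale coef_ring = symplectic_rep +
  fixes L :: "('b \<Rightarrow> 'b) set"
  assumes L_finite: "finite L"
    and L_linear: "l \<in> L \<Longrightarrow> linear_on V l"
    and L_\<rho>: "l \<in> L \<Longrightarrow> h \<in> carrier G \<Longrightarrow> v \<in> V \<Longrightarrow> l (\<rho> h v) = \<rho> h (l v)"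
    and L_selfadj: "l \<in> L \<Longrightarrow> v \<in> V \<Longrightarrow> w \<in> V \<Longrightarrow> f (l v) w = f v (l w)"
    and L_comm: "l \<in> L \<Longrightarrow> m \<in> L \<Longrightarrow> v \<in> V \<Longrightarrow> l (m v) = m (l v)"
    and L_plus: "l \<in> L \<Longrightarrow> m \<in> L \<Longrightarrow> (\<lambda>v. l v + m v) \<in> L"
    and L_neg: "l \<in> L \<Longrightarrow> (\<lambda>v. - l v) \<in> L"
    and L_comp: "l \<in> L \<Longrightarrow> m \<in> L \<Longrightarrow> (\<lambda>v. l (m v)) \<in> L"
    and L_zero: "(\<lambda>v. 0) \<in> L"
    and L_scalar: "\<exists>l\<in>L. \<forall>v\<in>V. l v = scale c v"
begin

text \<open>The group ring over \<open>L\<close>. Values outside the carrier are arbitrary and are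
  ignored by \<open>theta\<close>.\<close>

definition fam :: "('c \<Rightarrow> 'b \<Rightarrow> 'b) set"
  where "fam = {a. \<forall>g\<in>carrier G. a g \<in> L}"

lemma fam_coef: "a \<in> fam \<Longrightarrow> coef a"
  using L_linear L_\<rho> by (simp add: fam_def coef_def)

lemma fam_selfadj: "a \<in> fam \<Longrightarrow> selfadj a"
  using L_selfadj by (simp add: fam_def selfadj_def)

lemma fam_star: "a \<in> fam \<Longrightarrow> star a \<in> fam"
  by (simp add: fam_def star_def)

lemma L_sum: "finite A \<Longrightarrow> (\<And>x. x \<in> A \<Longrightarrow> l x \<in> L) \<Longrightarrow> (\<lambda>v. \<Sum>x\<in>A. l x v) \<in> L"
  by (induction A rule: finite_induct) (auto intro: L_zero L_plus)

lemma fam_conv: "a \<in> fam \<Longrightarrow> b \<in> fam \<Longrightarrow> conv_op a b \<in> fam"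
proof -
  assume a: "a \<in> fam" and b: "b \<in> fam"
  have "(\<lambda>v. \<Sum>g\<in>carrier G. a g (b (inv g \<otimes> w) v)) \<in> L" if w: "w \<in> carrier G" for w
    by (rule L_sum[OF fin_G], rule L_comp) (use a b w in \<open>simp_all add: fam_def\<close>)
  then show ?thesis by (simp add: fam_def conv_op_def[abs_def])
qed

lemma fam_plus: "a \<in> fam \<Longrightarrow> b \<in> fam \<Longrightarrow> (\<lambda>g v. a g v + b g v) \<in> fam"
  by (simp add: fam_def L_plus)

lemma fam_neg: "a \<in> fam \<Longrightarrow> (\<lambda>g v. - a g v) \<in> fam"
  by (simp add: fam_def L_neg)

definition single :: "'c \<Rightarrow> ('b \<Rightarrow> 'b) \<Rightarrow> 'c \<Rightarrow> 'b \<Rightarrow> 'b"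
  where "single g l h = (if h = g then l else (\<lambda>v. 0))"

lemma fam_single: "l \<in> L \<Longrightarrow> single g l \<in> fam"
  by (simp add: fam_def single_def L_zero)

lemma theta_single:
  assumes "l \<in> L" "g \<in> carrier G" "x \<in> carrier G"
  shows "theta (single g l) \<phi> x = l (\<phi> (inv g \<otimes> x))"
proof -
  have "theta (single g l) \<phi> x = (\<Sum>h\<in>carrier G. if h = g then l (\<phi> (inv g \<otimes> x)) else 0)"
    using assms(3) by (auto simp: theta_def single_def intro!: sum.cong)
  then show ?thesis using fin_G assms(2) by simp
qed

abbreviation M :: "('c \<Rightarrow> 'b) set"
  where "M \<equiv> ind {\<one>}"

text \<open>Cut off outside \<open>M\<close>, since the product rule \<open>theta_conv_op\<close>
  holds on \<open>M\<close> while \<open>op_ring\<close> asks that a composite, as a function on the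
  whole type, be again a member of the ring.\<close>

definition ext :: "('c \<Rightarrow> 'b \<Rightarrow> 'b) \<Rightarrow> ('c \<Rightarrow> 'b) \<Rightarrow> 'c \<Rightarrow> 'b"
  where "ext a \<phi> = (if \<phi> \<in> M then theta a \<phi> else 0)"

lemma ext_eq: "\<phi> \<in> M \<Longrightarrow> ext a \<phi> = theta a \<phi>"
  by (simp add: ext_def)

lemma theta_M: "a \<in> fam \<Longrightarrow> \<phi> \<in> M \<Longrightarrow> theta a \<phi> \<in> M"
  using fn.linear_onD(1)[OF linear_on_theta[OF fam_coef trivial_subgroup]] .

lemma theta_plus: "theta (\<lambda>g v. a g v + b g v) \<phi> = theta a \<phi> + theta b \<phi>"
  by (auto simp: theta_def fun_eq_iff sum.distrib)

lemma M_zero: "0 \<in> M"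
  using fn.subspace_0[OF subspace_ind[OF trivial_subgroup]] .

sublocale op: op_ring M "ext ` fam"
proof
  show "add_subgroup M" using fn.subspace_add_subgroup[OF subspace_ind[OF trivial_subgroup]] .
  show "finite M" by (rule finite_ind)
  have "ext ` fam \<subseteq> ext ` PiE (carrier G) (\<lambda>_. L)"
  proof clarify
    fix a assume a: "a \<in> fam"
    have "theta (restrict a (carrier G)) = theta a" by (auto simp: theta_def fun_eq_iff)
    then have "ext a = ext (restrict a (carrier G))" by (simp add: ext_def fun_eq_iff)
    moreover have "restrict a (carrier G) \<in> PiE (carrier G) (\<lambda>_. L)" using a by (auto simp: fam_def)
    ultimately show "ext a \<in> ext ` PiE (carrier G) (\<lambda>_. L)" by blast
  qed
  then show "finite (ext ` fam)" using finite_PiE[OF fin_G] L_finite by (meson finite_imageI finite_subset)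
  show "r m \<in> M" if "r \<in> ext ` fam" "m \<in> M" for r m
    using that theta_M by (auto simp: ext_def)
  show "additive_on M r" if r: "r \<in> ext ` fam" for r
  proof -
    obtain a where a: "a \<in> fam" "r = ext a" using r by blast
    have lin: "fn.linear_on M (theta a)" by (rule linear_on_theta[OF fam_coef[OF a(1)] trivial_subgroup])
    have "\<phi> + \<psi> \<in> M" if "\<phi> \<in> M" "\<psi> \<in> M" for \<phi> \<psi>
      using fn.subspace_add[OF subspace_ind[OF trivial_subgroup] that] .
    then show ?thesis using fn.linear_onD(4)[OF lin] a(2) by (simp add: additive_on_def ext_def)
  qed
  show "(\<lambda>m. r m + s m) \<in> ext ` fam" if rs: "r \<in> ext ` fam" "s \<in> ext ` fam" for r s
  proof -
    obtain a b where a: "a \<in> fam" "r = ext a" "b \<in> fam" "s = ext b" using rs by blast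
    have "(\<lambda>m. r m + s m) = ext (\<lambda>g v. a g v + b g v)"
      by (auto simp: a ext_def theta_plus fun_eq_iff)
    then show ?thesis using fam_plus[OF a(1,3)] by blast
  qed
  show "r \<circ> s \<in> ext ` fam" if rs: "r \<in> ext ` fam" "s \<in> ext ` fam" for r s
  proof -
    obtain a b where a: "a \<in> fam" "r = ext a" "b \<in> fam" "s = ext b" using rs by blast
    have z: "theta a 0 = 0"
      using fn.linear_on_more(1)[OF linear_on_theta[OF fam_coef[OF a(1)] trivial_subgroup] subspace_ind[OF trivial_subgroup]] .
    have "r \<circ> s = ext (conv_op a b)"
    proof
      fix \<phi>
      show "(r \<circ> s) \<phi> = ext (conv_op a b) \<phi>"
        using theta_conv_op[OF fam_coef[OF a(1)] fam_coef[OF a(3)]] theta_M[OF a(3)] M_zero z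
        by (simp add: a ext_def)
    qed
    then show ?thesis using fam_conv[OF a(1,3)] by blast
  qed
  have scal: "\<exists>i\<in>ext ` fam. \<forall>m\<in>M. i m = (\<lambda>x. scale c (m x))" for c
  proof -
    obtain l where l: "l \<in> L" "\<forall>v\<in>V. l v = scale c v" using L_scalar by blast
    have "ext (single \<one> l) m = (\<lambda>x. scale c (m x))" if m: "m \<in> M" for m
    proof
      fix x
      show "ext (single \<one> l) m x = scale c (m x)"
      proof (cases "x \<in> carrier G")
        case True
        then show ?thesis using theta_single[OF l(1) one_closed True] l(2) indD(1)[OF m True] m by (simp add: ext_def)
      next
        case False
        then show ?thesis using indD(2)[OF m False] m by (simp add: ext_def theta_def)
      qed
    qed
    then show ?thesis using fam_single[OF l(1)] by blast
  qed
  show "\<exists>i\<in>ext ` fam. \<forall>m\<in>M. i m = m" using scal[of 1] by simp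
  show "\<exists>i\<in>ext ` fam. \<forall>m\<in>M. i m = - m" using scal[of "-1"] by (auto simp: fun_eq_iff)
qed

section \<open>Group ring operators on the module itself\<close>

definition act :: "('c \<Rightarrow> 'b \<Rightarrow> 'b) \<Rightarrow> 'b \<Rightarrow> 'b"
  where "act a v = (\<Sum>g\<in>carrier G. a g (\<rho> g v))"

text \<open>The isomorphism of \<open>V\<close> with the module induced from the whole group. It
  turns \<open>act a\<close> into \<open>theta a\<close>, and evaluation at \<open>\<one>\<close> is
  its inverse.\<close>

definition iota :: "'b \<Rightarrow> 'c \<Rightarrow> 'b"
  where "iota v x = (if x \<in> carrier G then \<rho> (inv x) v else 0)"

lemma iota_one: "v \<in> V \<Longrightarrow> iota v \<one> = v"
  by (simp add: iota_def \<rho>_one)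

lemma iota_ind: "v \<in> V \<Longrightarrow> iota v \<in> ind (carrier G)"
  by (auto simp: ind_def iota_def \<rho>_closed inv_mult_group \<rho>_mult)

lemma ind_G_iota:
  assumes "\<phi> \<in> ind (carrier G)"
  shows "\<phi> = iota (\<phi> \<one>)" "\<phi> \<one> \<in> V"
proof -
  show "\<phi> \<one> \<in> V" using indD(1)[OF assms] by simp
  have "\<phi> x = iota (\<phi> \<one>) x" for x
    using indD(3)[OF assms one_closed, of x] indD(2)[OF assms, of x] by (simp add: iota_def)
  then show "\<phi> = iota (\<phi> \<one>)" by (rule HOL.ext)
qed

lemma iota_image: "iota ` V = ind (carrier G)"
proof
  show "iota ` V \<subseteq> ind (carrier G)" using iota_ind by blast
  show "ind (carrier G) \<subseteq> iota ` V"
  proof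
    fix \<phi> assume \<phi>: "\<phi> \<in> ind (carrier G)"
    show "\<phi> \<in> iota ` V" by (rule image_eqI[of _ iota "\<phi> \<one>"]) (rule ind_G_iota[OF \<phi>])+
  qed
qed

lemma iota_linear:
  assumes "v \<in> V" "w \<in> V"
  shows "iota (v + w) = iota v + iota w" "iota (scale c v) = (\<lambda>x. scale c (iota v x))"
  using assms linear_onD(3,4)[OF \<rho>_linear] by (auto simp: iota_def fun_eq_iff)

lemma iota_zero: "iota 0 = 0"
  using linear_on_more(1)[OF \<rho>_linear V_subspace] by (auto simp: iota_def fun_eq_iff)

lemma iota_inj: "inj_on iota V"
proof (rule inj_onI)
  fix v w assume vw: "v \<in> V" "w \<in> V" "iota v = iota w"
  from fun_cong[OF vw(3), of \<one>] show "v = w" using iota_one vw(1,2) by simp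
qed

lemma ind_G_M: "ind (carrier G) \<subseteq> M"
  by (rule ind_subset_ind_one[OF subgroup_self])

lemma iota_M: "v \<in> V \<Longrightarrow> iota v \<in> M"
  using iota_ind ind_G_M by blast

lemma act_closed: "a \<in> fam \<Longrightarrow> v \<in> V \<Longrightarrow> act a v \<in> V"
  unfolding act_def using coefD(2)[OF fam_coef] \<rho>_closed by (intro subspace_sum[OF V_subspace]) blast

lemma theta_iota:
  assumes a: "a \<in> fam" and v: "v \<in> V"
  shows "theta a (iota v) = iota (act a v)"
proof
  fix x
  show "theta a (iota v) x = iota (act a v) x"
  proof (cases "x \<in> carrier G")
    case x: True
    note ac = fam_coef[OF a]
    have "theta a (iota v) x = (\<Sum>g\<in>carrier G. \<rho> (inv x) (a g (\<rho> g v)))"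
      using x v coefD(3)[OF ac] \<rho>_closed
      by (auto simp: theta_def iota_def inv_mult_group \<rho>_mult intro!: sum.cong)
    also have "\<dots> = \<rho> (inv x) (act a v)"
      using linear_on_sum[OF \<rho>_linear[of "inv x"] V_subspace fin_G, of "\<lambda>g. a g (\<rho> g v)" "\<lambda>_. 1"]
        x v coefD(2)[OF ac] \<rho>_closed by (simp add: act_def)
    finally show ?thesis using x by (simp add: iota_def)
  qed (simp add: theta_def iota_def)
qed

lemma act_eqI: "v \<in> V \<Longrightarrow> w \<in> V \<Longrightarrow> iota v = iota w \<Longrightarrow> v = w"
  using iota_inj by (simp add: inj_on_def)

lemma act_conv:
  assumes "a \<in> fam" "b \<in> fam" "v \<in> V"
  shows "act (conv_op a b) v = act a (act b v)"
proof (rule act_eqI)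
  show "act (conv_op a b) v \<in> V" "act a (act b v) \<in> V"
    using assms act_closed fam_conv by simp_all
  have "iota (act (conv_op a b) v) = theta (conv_op a b) (iota v)"
    using theta_iota[OF fam_conv[OF assms(1,2)] assms(3)] by simp
  also have "\<dots> = theta a (theta b (iota v))"
    using theta_conv_op[OF fam_coef[OF assms(1)] fam_coef[OF assms(2)] iota_M[OF assms(3)]] by simp
  also have "\<dots> = iota (act a (act b v))"
    using theta_iota assms act_closed by simp
  finally show "iota (act (conv_op a b) v) = iota (act a (act b v))" .
qed

lemma act_linear:
  assumes a: "a \<in> fam"
  shows "linear_on V (act a)"
proof (rule linear_onI)
  note ac = linear_onD[OF coefD(1)[OF fam_coef[OF a]]] and r = linear_onD[OF \<rho>_linear]
  show "act a v \<in> V" if "v \<in> V" for v using act_closed[OF a that] .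
  show "act a (v + w) = act a v + act a w" if "v \<in> V" "w \<in> V" for v w
    unfolding act_def sum.distrib[symmetric]
    using that ac(4) r(1,4) by (intro sum.cong) auto
  show "act a (scale c v) = scale c (act a v)" if "v \<in> V" for c v
    unfolding act_def scale_sum_right
    using that ac(3) r(1,3) by (intro sum.cong) auto
qed

lemma act_single:
  assumes "l \<in> L" "g \<in> carrier G"
  shows "act (single g l) v = l (\<rho> g v)"
proof -
  have "act (single g l) v = (\<Sum>h\<in>carrier G. if h = g then l (\<rho> g v) else 0)"
    by (auto simp: act_def single_def intro!: sum.cong)
  then show ?thesis using fin_G assms(2) by simp
qed

lemma f_sum_left:
  assumes "finite A" "\<And>x. x \<in> A \<Longrightarrow> v x \<in> V" "w \<in> V"
  shows "f (\<Sum>x\<in>A. v x) w = (\<Sum>x\<in>A. f (v x) w)"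
  using assms
proof (induction A)
  case empty
  then show ?case using f_zero(1)[OF V_0] by simp
next
  case (insert x A)
  then have "(\<Sum>x\<in>A. v x) \<in> V" by (intro subspace_sum[OF V_subspace]) simp
  then show ?case using fD(1)[of "v x" "\<Sum>x\<in>A. v x" w] insert by simp
qed

lemma f_sum_right:
  assumes "finite A" "\<And>x. x \<in> A \<Longrightarrow> v x \<in> V" "w \<in> V"
  shows "f w (\<Sum>x\<in>A. v x) = (\<Sum>x\<in>A. f w (v x))"
  using assms
proof (induction A)
  case empty
  then show ?case using f_zero(2)[OF _ V_0] by simp
next
  case (insert x A)
  then have "(\<Sum>x\<in>A. v x) \<in> V" by (intro subspace_sum[OF V_subspace]) simp
  then show ?case using fD(3)[of w "v x" "\<Sum>x\<in>A. v x"] insert by simp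
qed

lemma act_adjoint:
  assumes a: "a \<in> fam" and v: "v \<in> V" and w: "w \<in> V"
  shows "f (act a v) w = f v (act (star a) w)"
proof -
  note ac = coefD(2,3)[OF fam_coef[OF a]]
  have "f (act a v) w = (\<Sum>g\<in>carrier G. f (a g (\<rho> g v)) w)"
    unfolding act_def using ac(1) \<rho>_closed v w by (intro f_sum_left[OF fin_G]) auto
  also have "\<dots> = (\<Sum>g\<in>carrier G. f v (a g (\<rho> (inv g) w)))"
  proof (intro sum.cong refl)
    fix g assume g: "g \<in> carrier G"
    have "f (a g (\<rho> g v)) w = f (\<rho> g v) (a g w)"
      using fam_selfadj[OF a] g v w \<rho>_closed by (simp add: selfadj_def)
    also have "\<dots> = f v (\<rho> (inv g) (a g w))" using f_move[OF g v] ac(1)[OF g w] by simp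
    also have "\<rho> (inv g) (a g w) = a g (\<rho> (inv g) w)" using ac(2)[OF g _ w, of "inv g"] g by simp
    finally show "f (a g (\<rho> g v)) w = f v (a g (\<rho> (inv g) w))" .
  qed
  also have "\<dots> = (\<Sum>g\<in>carrier G. f v (star a g (\<rho> g w)))"
    by (rule sum.reindex_bij_witness[where i = "\<lambda>g. inv g" and j = "\<lambda>g. inv g"]) (auto simp: star_def)
  also have "\<dots> = f v (act (star a) w)"
    unfolding act_def using coefD(2)[OF fam_coef[OF fam_star[OF a]]] \<rho>_closed v w
    by (intro f_sum_right[OF fin_G, symmetric]) auto
  finally show ?thesis .
qed

lemma submod_iota:
  assumes S: "subspace S" "S \<subseteq> V" and a: "\<And>a v. a \<in> fam \<Longrightarrow> v \<in> S \<Longrightarrow> act a v \<in> S"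
  shows "op.submod (iota ` S)"
proof (rule op.submodI)
  show "add_subgroup (iota ` S)"
    by (rule add_subgroup_image[OF subspace_add_subgroup[OF S(1)]])
      (use S(2) iota_linear(1) in \<open>auto intro!: additive_onI simp: subset_iff\<close>)
  show "iota ` S \<subseteq> M" using S(2) iota_M by blast
  show "r n \<in> iota ` S" if r: "r \<in> ext ` fam" and n: "n \<in> iota ` S" for r n
  proof -
    obtain b v where b: "b \<in> fam" "r = ext b" "v \<in> S" "n = iota v" using r n by blast
    have vV: "v \<in> V" using b(3) S(2) by blast
    have "r n = iota (act b v)" using theta_iota[OF b(1) vV] iota_M[OF vV] b(2,4) by (simp add: ext_def)
    then show ?thesis using a[OF b(1,3)] by blast
  qed
qed

lemma act_stable:
  assumes S: "subspace S" "stable (carrier G) S" and L: "\<And>l v. l \<in> L \<Longrightarrow> v \<in> S \<Longrightarrow> l v \<in> S"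
    and "a \<in> fam" "v \<in> S"
  shows "act a v \<in> S"
  unfolding act_def using assms by (intro subspace_sum[OF S(1)]) (auto simp: fam_def stable_def)

lemma submod_pullback:
  assumes K: "op.submod K"
  defines "S \<equiv> {v \<in> V. iota v \<in> K}"
  shows "subspace S" "stable (carrier G) S" "K \<subseteq> ind (carrier G) \<Longrightarrow> iota ` S = K"
proof -
  note Kd = op.submodD[OF K] and Kg = add_subgroupD[OF op.submodD(1)[OF K]]
  have actS: "act a v \<in> S" if "a \<in> fam" "v \<in> S" for a v
  proof -
    have v: "v \<in> V" "iota v \<in> K" using that(2) by (auto simp: S_def)
    have "ext a (iota v) \<in> K" using Kd(4)[OF imageI[OF that(1)] v(2)] .
    then show ?thesis using theta_iota[OF that(1) v(1)] iota_M[OF v(1)] act_closed[OF that(1) v(1)] by (simp add: S_def ext_def)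
  qed
  show "subspace S"
    unfolding subspace_def
  proof (intro conjI ballI allI)
    show "0 \<in> S" using Kg(1) iota_zero V_0 by (simp add: S_def)
    show "x + y \<in> S" if "x \<in> S" "y \<in> S" for x y
      using that Kg(2) V_add iota_linear(1) by (simp add: S_def)
    show "scale c x \<in> S" if x: "x \<in> S" for c x
    proof -
      have xV: "x \<in> V" using x by (simp add: S_def)
      obtain l where l: "l \<in> L" "\<forall>v\<in>V. l v = scale c v" using L_scalar by blast
      have "act (single \<one> l) x = scale c x" using act_single[OF l(1) one_closed] \<rho>_one[OF xV] l(2) xV by simp
      then show ?thesis using actS[OF fam_single[OF l(1)] x] by metis
    qed
  qed
  show "stable (carrier G) S"
    unfolding stable_def
  proof (intro ballI)
    fix g v assume g: "g \<in> carrier G" and v: "v \<in> S"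
    have vV: "v \<in> V" using v by (simp add: S_def)
    obtain l where l: "l \<in> L" "\<forall>v\<in>V. l v = scale 1 v" using L_scalar by blast
    have "act (single g l) v = \<rho> g v" using act_single[OF l(1) g] l(2) \<rho>_closed[OF g vV] by simp
    then show "\<rho> g v \<in> S" using actS[OF fam_single[OF l(1)] v] by metis
  qed
  show "iota ` S = K" if sub: "K \<subseteq> ind (carrier G)"
  proof
    show "iota ` S \<subseteq> K" by (auto simp: S_def)
    show "K \<subseteq> iota ` S"
    proof
      fix \<phi> assume \<phi>: "\<phi> \<in> K"
      then have "\<phi> \<in> ind (carrier G)" using sub by blast
      from ind_G_iota[OF this] \<phi> show "\<phi> \<in> iota ` S" by (metis (mono_tags, lifting) S_def image_eqI mem_Collect_eq)
    qed
  qed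
qed

text \<open>The group elements and the scalars are among the operators, so an operator submodule
  pulls back to a stable subspace, to which irreducibility applies.\<close>

lemma simple_factor_iota:
  assumes S: "subspace S" "S \<subseteq> V" "S \<noteq> {0}" "stable (carrier G) S" and LS: "\<And>l v. l \<in> L \<Longrightarrow> v \<in> S \<Longrightarrow> l v \<in> S"
    and irr: "\<And>U. subspace U \<Longrightarrow> U \<subseteq> S \<Longrightarrow> stable (carrier G) U \<Longrightarrow> U = {0} \<or> U = S"
  shows "op.simple_factor (iota ` S) {0}"
  unfolding op.simple_factor_def
proof (intro conjI allI impI)
  show sm: "op.submod (iota ` S)"
  proof (rule submod_iota[OF S(1,2)])
    show "act a v \<in> S" if "a \<in> fam" "v \<in> S" for a v
      using act_stable[OF S(1,4) _ that] LS by blast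
  qed
  show "op.submod {0}" by (rule op.submod_zero)
  obtain v where v: "v \<in> S" "v \<noteq> 0" using S(3) subspace_0[OF S(1)] by blast
  then have "iota v \<noteq> 0" using S(2) V_0 act_eqI[of v 0] iota_zero by auto
  then show "{0} \<subset> iota ` S" using v(1) subspace_0[OF S(1)] iota_zero by force
  fix K assume K: "op.submod K" "{0} \<subseteq> K" "K \<subseteq> iota ` S"
  let ?U = "{v \<in> V. iota v \<in> K}"
  have KG: "K \<subseteq> ind (carrier G)" using K(3) S(2) iota_ind by blast
  have "?U \<subseteq> S"
  proof clarify
    fix v assume v: "v \<in> V" "iota v \<in> K"
    then obtain s where "s \<in> S" "iota v = iota s" using K(3) by blast
    then show "v \<in> S" using act_eqI[OF v(1)] S(2) by blast
  qed
  from irr[OF submod_pullback(1)[OF K(1)] this submod_pullback(2)[OF K(1)]]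
  show "K = {0} \<or> K = iota ` S"
    using submod_pullback(3)[OF K(1) KG] iota_zero by auto
qed

end

section \<open>Irreducible modules over a coefficient field equal to its commutant\<close>

text \<open>The situation that turns out to be contradictory. By the last condition the commutant of
  \<open>L\<close> and the group is \<open>L\<close> itself, so \<open>V\<close> is absolutely
  irreducible over the field by which \<open>L\<close> acts.\<close>

locale simple_coef_ring = coef_ring +
  assumes V_nonzero: "V \<noteq> {0}"
    and irreducible: "\<And>U. subspace U \<Longrightarrow> U \<subseteq> V \<Longrightarrow> stable (carrier G) U \<Longrightarrow> U = {0} \<or> U = V"
    and commutant: "\<And>\<theta>. linear_on V \<theta> \<Longrightarrow> (\<And>g v. g \<in> carrier G \<Longrightarrow> v \<in> V \<Longrightarrow> \<theta> (\<rho> g v) = \<rho> g (\<theta> v)) \<Longrightarrow>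
      (\<And>l v. l \<in> L \<Longrightarrow> v \<in> V \<Longrightarrow> \<theta> (l v) = l (\<theta> v)) \<Longrightarrow> \<exists>l\<in>L. \<forall>v\<in>V. \<theta> v = l v"
begin

text \<open>Restriction identifies members of \<open>L\<close> that differ only outside
  \<open>V\<close>, so this is the order of the field.\<close>

definition k :: nat
  where "k = card ((\<lambda>l. restrict l V) ` L)"

lemma L_closed: "l \<in> L \<Longrightarrow> v \<in> V \<Longrightarrow> l v \<in> V"
  using linear_onD(1)[OF L_linear] .

lemma L_injective:
  assumes l: "l \<in> L"
  shows "(\<forall>v\<in>V. l v = 0) \<or> (\<forall>v\<in>V. l v = 0 \<longrightarrow> v = 0)"
proof -
  let ?U = "{v \<in> V. l v = 0}"
  note ll = linear_onD[OF L_linear[OF l]] and lm = linear_on_more[OF L_linear[OF l] V_subspace]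
  have "subspace ?U"
    unfolding subspace_def using V_0 V_add V_scale ll(3,4) lm(1) by auto
  moreover have "stable (carrier G) ?U"
    unfolding stable_def using L_\<rho>[OF l] \<rho>_closed linear_on_more(1)[OF \<rho>_linear V_subspace] by auto
  ultimately have "?U = {0} \<or> ?U = V" using irreducible[of ?U] by blast
  then show ?thesis by blast
qed

lemma L_inj_on: "l \<in> L \<Longrightarrow> (\<forall>v\<in>V. l v = 0) \<or> inj_on l V"
  using L_injective additive_on_inj[OF subspace_add_subgroup[OF V_subspace] linear_onD(2)[OF L_linear]] by metis

lemma L_eqI:
  assumes "l \<in> L" "m \<in> L" "v \<in> V" "v \<noteq> 0" "l v = m v" "w \<in> V"
  shows "l w = m w"
proof -
  have d: "(\<lambda>v. l v + - m v) \<in> L" using L_plus[OF assms(1) L_neg[OF assms(2)]] .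
  from L_injective[OF d] assms(3-6) show ?thesis by auto
qed

lemma card_L_orbit:
  assumes v: "v \<in> V" "v \<noteq> 0"
  shows "card ((\<lambda>l. l v) ` L) = k"
proof -
  have "(\<lambda>l. l v) ` L = (\<lambda>r. r v) ` ((\<lambda>l. restrict l V) ` L)" using v(1) by (auto simp: image_image)
  moreover have "inj_on (\<lambda>r. r v) ((\<lambda>l. restrict l V) ` L)"
  proof (rule inj_onI, clarify)
    fix l m assume lm: "l \<in> L" "m \<in> L" "restrict l V v = restrict m V v"
    then have "l v = m v" using v(1) by simp
    then show "restrict l V = restrict m V" using L_eqI[OF lm(1,2) v] by (auto simp: restrict_def fun_eq_iff)
  qed
  ultimately show ?thesis by (simp add: k_def card_image)
qed

sublocale fv: field_action scale V L k
proof
  show "subspace V" "finite V" by (rule V_subspace, rule V_finite)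
  show "\<exists>n\<in>L. \<forall>w\<in>V. n w = l w + m w" if "l \<in> L" "m \<in> L" for l m
    using L_plus[OF that] by (intro bexI[of _ "\<lambda>v. l v + m v"]) auto
  show "\<exists>n\<in>L. \<forall>w\<in>V. n w = l (m w)" if "l \<in> L" "m \<in> L" for l m
    using L_comp[OF that] by (intro bexI[of _ "\<lambda>v. l (m v)"]) auto
qed (fact L_linear L_comm L_scalar L_inj_on card_L_orbit | erule L_linear L_comm L_inj_on card_L_orbit; assumption)+

definition lift :: "('b \<Rightarrow> 'b) \<Rightarrow> ('c \<Rightarrow> 'b) \<Rightarrow> 'c \<Rightarrow> 'b"
  where "lift l \<phi> = (\<lambda>x. l (\<phi> x))"

lemma L_0: "l \<in> L \<Longrightarrow> l 0 = 0"
  using linear_on_more(1)[OF L_linear V_subspace] .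

lemma M_V: "\<phi> \<in> M \<Longrightarrow> \<phi> x \<in> V"
  using indD(1,2)[of \<phi> "{\<one>}" x] V_0 by (cases "x \<in> carrier G") auto

lemma lift_ind:
  assumes l: "l \<in> L" and H: "subgroup H G" and \<phi>: "\<phi> \<in> ind H"
  shows "lift l \<phi> \<in> ind H"
  using indD[OF \<phi>] L_closed[OF l] L_0[OF l] L_\<rho>[OF l] subgroup.mem_carrier[OF H]
  by (auto simp: ind_def lift_def)

lemma lift_linear: "l \<in> L \<Longrightarrow> fn.linear_on M (lift l)"
proof (rule fn.linear_onI)
  assume l: "l \<in> L"
  show "lift l \<phi> \<in> M" if "\<phi> \<in> M" for \<phi> using lift_ind[OF l trivial_subgroup that] .
  show "lift l (\<phi> + \<psi>) = lift l \<phi> + lift l \<psi>" if "\<phi> \<in> M" "\<psi> \<in> M" for \<phi> \<psi>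
    using linear_onD(4)[OF L_linear[OF l]] M_V[OF that(1)] M_V[OF that(2)] by (simp add: lift_def fun_eq_iff)
  show "lift l (\<lambda>x. scale c (\<phi> x)) = (\<lambda>x. scale c (lift l \<phi> x))" if "\<phi> \<in> M" for c \<phi>
    using linear_onD(3)[OF L_linear[OF l]] M_V[OF that] by (simp add: lift_def fun_eq_iff)
qed

lemma lift_theta:
  assumes l: "l \<in> L" and a: "a \<in> fam" and \<phi>: "\<phi> \<in> M"
  shows "theta a (lift l \<phi>) = lift l (theta a \<phi>)"
proof
  fix x
  show "theta a (lift l \<phi>) x = lift l (theta a \<phi>) x"
  proof (cases "x \<in> carrier G")
    case x: True
    have "theta a (lift l \<phi>) x = (\<Sum>g\<in>carrier G. l (a g (\<phi> (inv g \<otimes> x))))"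
      using x a L_comm[OF l] M_V[OF \<phi>] by (auto simp: theta_def lift_def fam_def intro!: sum.cong)
    also have "\<dots> = l (theta a \<phi> x)"
      using linear_on_sum[OF L_linear[OF l] V_subspace fin_G, of "\<lambda>g. a g (\<phi> (inv g \<otimes> x))" "\<lambda>_. 1"]
        x coefD(2)[OF fam_coef[OF a]] M_V[OF \<phi>] by (simp add: theta_def)
    finally show ?thesis by (simp add: lift_def)
  qed (simp add: theta_def lift_def L_0[OF l])
qed

lemma card_lift_orbit:
  assumes \<phi>: "\<phi> \<in> M" "\<phi> \<noteq> 0"
  shows "card ((\<lambda>l. l \<phi>) ` (lift ` L)) = k"
proof -
  obtain x where x: "\<phi> x \<noteq> 0" using \<phi>(2) by (auto simp: fun_eq_iff)
  have "(\<lambda>l. l \<phi>) ` (lift ` L) = (\<lambda>r x. r (\<phi> x)) ` ((\<lambda>l. restrict l V) ` L)"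
    using M_V[OF \<phi>(1)] by (auto simp: image_image lift_def)
  moreover have "inj_on (\<lambda>r x. r (\<phi> x)) ((\<lambda>l. restrict l V) ` L)"
  proof (rule inj_onI, clarify)
    fix l m assume lm: "l \<in> L" "m \<in> L" "(\<lambda>x. restrict l V (\<phi> x)) = (\<lambda>x. restrict m V (\<phi> x))"
    from fun_cong[OF lm(3), of x] have "l (\<phi> x) = m (\<phi> x)" using M_V[OF \<phi>(1)] by simp
    then show "restrict l V = restrict m V"
      using L_eqI[OF lm(1,2) M_V[OF \<phi>(1)] x] by (auto simp: restrict_def fun_eq_iff)
  qed
  ultimately show ?thesis by (simp add: k_def card_image)
qed

sublocale ff: field_action "\<lambda>c (\<phi> :: 'c \<Rightarrow> 'b) x. scale c (\<phi> x)" M "lift ` L" k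
proof
  show "fn.subspace M" by (rule subspace_ind[OF trivial_subgroup])
  show "finite M" by (rule finite_ind)
  show "fn.linear_on M l" if "l \<in> lift ` L" for l using that lift_linear by blast
  show "l (m w) = m (l w)" if lmw: "l \<in> lift ` L" "m \<in> lift ` L" "w \<in> M" for l m w
  proof -
    obtain l' m' where lm: "l' \<in> L" "m' \<in> L" "l = lift l'" "m = lift m'" using lmw(1,2) by auto
    show ?thesis using L_comm[OF lm(1,2) M_V[OF lmw(3)]] by (simp add: lm(3,4) lift_def)
  qed
  show "\<exists>n\<in>lift ` L. \<forall>w\<in>M. n w = l w + m w" if lm': "l \<in> lift ` L" "m \<in> lift ` L" for l m
  proof -
    obtain l' m' where lm: "l' \<in> L" "m' \<in> L" "l = lift l'" "m = lift m'" using lm' by auto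
    have "\<forall>w\<in>M. lift (\<lambda>v. l' v + m' v) w = l w + m w" by (simp add: lm(3,4) lift_def fun_eq_iff)
    then show ?thesis using L_plus[OF lm(1,2)] by blast
  qed
  show "\<exists>n\<in>lift ` L. \<forall>w\<in>M. n w = l (m w)" if lm': "l \<in> lift ` L" "m \<in> lift ` L" for l m
  proof -
    obtain l' m' where lm: "l' \<in> L" "m' \<in> L" "l = lift l'" "m = lift m'" using lm' by auto
    have "\<forall>w\<in>M. lift (\<lambda>v. l' (m' v)) w = l (m w)" by (simp add: lm(3,4) lift_def)
    then show ?thesis using L_comp[OF lm(1,2)] by blast
  qed
  show "\<exists>l\<in>lift ` L. \<forall>w\<in>M. l w = (\<lambda>x. scale c (w x))" for c
  proof -
    obtain l where l: "l \<in> L" "\<forall>v\<in>V. l v = scale c v" using L_scalar by blast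
    have "\<forall>w\<in>M. lift l w = (\<lambda>x. scale c (w x))" using l(2) M_V by (simp add: lift_def)
    then show ?thesis using l(1) by blast
  qed
  show "(\<forall>w\<in>M. l w = 0) \<or> inj_on l M" if "l \<in> lift ` L" for l
  proof -
    obtain l' where l: "l' \<in> L" "l = lift l'" using \<open>l \<in> lift ` L\<close> by auto
    from L_inj_on[OF l(1)] show ?thesis
    proof
      assume "\<forall>v\<in>V. l' v = 0"
      then have "\<forall>w\<in>M. l w = 0" using M_V by (simp add: l(2) lift_def fun_eq_iff)
      then show ?thesis ..
    next
      assume inj: "inj_on l' V"
      have "inj_on l M"
      proof (rule inj_onI)
        fix \<phi> \<psi> assume \<phi>: "\<phi> \<in> M" "\<psi> \<in> M" "l \<phi> = l \<psi>"
        have "\<phi> x = \<psi> x" for x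
          using fun_cong[OF \<phi>(3), of x] inj_onD[OF inj _ M_V[OF \<phi>(1)] M_V[OF \<phi>(2)]] by (simp add: l(2) lift_def)
        then show "\<phi> = \<psi>" by (rule HOL.ext)
      qed
      then show ?thesis ..
    qed
  qed
  show "card ((\<lambda>l. l w) ` (lift ` L)) = k" if "w \<in> M" "w \<noteq> 0" for w by (rule card_lift_orbit[OF that])
qed

lemma simple_V: "op.simple_factor (iota ` V) {0}"
  by (rule simple_factor_iota[OF V_subspace subset_refl V_nonzero])
    (use \<rho>_closed L_closed irreducible in \<open>auto simp: stable_def\<close>)

lemma lift_iota: "l \<in> L \<Longrightarrow> v \<in> V \<Longrightarrow> lift l (iota v) = iota (l v)"
  using L_\<rho> L_0 by (auto simp: lift_def iota_def fun_eq_iff)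

lemma lspan_iota:
  assumes "fv.inv_sub U" "set us \<subseteq> U"
  shows "op.lspan (lift ` L) (map iota us) \<subseteq> iota ` U"
  using assms(2)
proof (induction us)
  case Nil
  then show ?case using subspace_0[OF fv.inv_subD(1)[OF assms(1)]] iota_zero by force
next
  case (Cons u us)
  note Ud = fv.inv_subD[OF assms(1)]
  show ?case
  proof
    fix \<phi> assume "\<phi> \<in> op.lspan (lift ` L) (map iota (u # us))"
    then obtain l w where l: "l \<in> L" "w \<in> op.lspan (lift ` L) (map iota us)" "\<phi> = lift l (iota u) + w" by auto
    then obtain w' where w': "w' \<in> U" "w = iota w'" using Cons by auto
    have u: "u \<in> U" "u \<in> V" "w' \<in> V" using Cons.prems Ud(2) w'(1) by auto
    have "\<phi> = iota (l u + w')"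
      using l(3) w'(2) lift_iota[OF l(1) u(2)] iota_linear(1)[OF L_closed[OF l(1) u(2)] u(3)] by simp
    moreover have "l u + w' \<in> U" using Ud(3)[OF l(1) u(1)] w'(1) subspace_add[OF Ud(1)] by blast
    ultimately show "\<phi> \<in> iota ` U" by blast
  qed
qed

text \<open>Density, applied to the copy of \<open>V\<close> inside \<open>M\<close>. An operator
  commuting with the ring on that copy is brought back to \<open>V\<close> by evaluation at
  \<open>\<one>\<close>, where \<open>commutant\<close> applies.\<close>

lemma ex_annihilating:
  assumes U: "fv.inv_sub U" and w: "w \<in> V" "w \<notin> U"
  shows "\<exists>z\<in>fam. (\<forall>u\<in>U. act z u = 0) \<and> act z w \<noteq> 0"
proof -
  note Ud = fv.inv_subD[OF U]
  obtain us where us: "set us = U" using finite_list[OF Ud(4)] by blast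
  have fac: "op.submod (iota ` V)" using simple_V by (simp add: op.simple_factor_def)
  have th: "ext a (iota v) = iota (act a v)" if "a \<in> fam" "v \<in> V" for a v
    using theta_iota[OF that] iota_M[OF that(2)] by (simp add: ext_def)
  have "\<exists>r\<in>ext ` fam. (\<forall>u\<in>set (map iota us). r u = 0) \<and> r (iota w) \<noteq> 0"
  proof (rule op.density[OF simple_V, where L = "lift ` L"])
    show "additive_on (iota ` V) l" if "l \<in> lift ` L" for l
      using fn.linear_onD(2)[OF ff.\<Lambda>_linear[OF that]] by (rule additive_on_subset) (use iota_M in blast)
    show "l v \<in> iota ` V" if "l \<in> lift ` L" "v \<in> iota ` V" for l v
      using that lift_iota L_closed by auto
    show "r (l v) = l (r v)" if lrv: "l \<in> lift ` L" "r \<in> ext ` fam" "v \<in> iota ` V" for l r v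
    proof -
      obtain l' a v' where *: "l' \<in> L" "l = lift l'" "a \<in> fam" "r = ext a" "v' \<in> V" "v = iota v'" using lrv by auto
      have vM: "v \<in> M" using *(5,6) iota_M by blast
      then show ?thesis
        using lift_theta[OF *(1,3) vM] lift_ind[OF *(1) trivial_subgroup vM] *(2,4) by (simp add: ext_def)
    qed
    obtain l0 where "l0 \<in> L" "\<forall>v\<in>V. l0 v = 0" using L_zero by blast
    then have "\<forall>v\<in>iota ` V. lift l0 v = 0" using lift_iota iota_zero by auto
    then show "\<exists>l\<in>lift ` L. \<forall>v\<in>iota ` V. l v = 0" using \<open>l0 \<in> L\<close> by blast
    show "set (map iota us) \<subseteq> iota ` V" using us Ud(2) by auto
    show "iota w \<in> iota ` V" using w(1) by blast
    show "iota w \<notin> op.lspan (lift ` L) (map iota us)"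
    proof
      assume "iota w \<in> op.lspan (lift ` L) (map iota us)"
      then obtain u where "u \<in> U" "iota w = iota u" using lspan_iota[OF U] us by blast
      then show False using act_eqI[OF w(1)] Ud(2) w(2) by blast
    qed
    fix \<theta> assume \<theta>: "additive_on (iota ` V) \<theta>" "\<theta> ` iota ` V \<subseteq> iota ` V"
      "\<And>r v. r \<in> ext ` fam \<Longrightarrow> v \<in> iota ` V \<Longrightarrow> \<theta> (r v) = r (\<theta> v)"
    define \<theta>' where "\<theta>' v = \<theta> (iota v) \<one>" for v
    have \<theta>': "\<theta> (iota v) = iota (\<theta>' v)" "\<theta>' v \<in> V" if v: "v \<in> V" for v
    proof -
      obtain v' where v': "v' \<in> V" "\<theta> (iota v) = iota v'" using \<theta>(2) v by blast
      then have "\<theta>' v = v'" by (simp add: \<theta>'_def iota_one)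
      then show "\<theta> (iota v) = iota (\<theta>' v)" "\<theta>' v \<in> V" using v' by auto
    qed
    have \<theta>act: "\<theta>' (act a v) = act a (\<theta>' v)" if a: "a \<in> fam" and v: "v \<in> V" for a v
    proof (rule act_eqI)
      show "\<theta>' (act a v) \<in> V" "act a (\<theta>' v) \<in> V" using \<theta>'(2) act_closed a v by simp_all
      have "iota (\<theta>' (act a v)) = \<theta> (ext a (iota v))" using \<theta>'(1) act_closed[OF a v] th[OF a v] by simp
      also have "\<dots> = ext a (iota (\<theta>' v))" using \<theta>(3)[of "ext a" "iota v"] a v \<theta>'(1)[OF v] by simp
      finally show "iota (\<theta>' (act a v)) = iota (act a (\<theta>' v))" using th[OF a \<theta>'(2)[OF v]] by simp
    qed
    have single: "\<theta>' (l (\<rho> g v)) = l (\<rho> g (\<theta>' v))" if "l \<in> L" "g \<in> carrier G" "v \<in> V" for l g v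
      using \<theta>act[OF fam_single[OF that(1)] that(3), of g] act_single[OF that(1,2)] by simp
    obtain l1 where l1: "l1 \<in> L" "\<forall>v\<in>V. l1 v = scale 1 v" using L_scalar by blast
    have "\<exists>l\<in>L. \<forall>v\<in>V. \<theta>' v = l v"
    proof (rule commutant)
      show "\<theta>' (\<rho> g v) = \<rho> g (\<theta>' v)" if "g \<in> carrier G" "v \<in> V" for g v
        using single[OF l1(1) that] l1(2) \<rho>_closed that \<theta>'(2) by simp
      show L: "\<theta>' (l v) = l (\<theta>' v)" if "l \<in> L" "v \<in> V" for l v
        using single[OF that(1) one_closed that(2)] \<rho>_one \<theta>'(2) that(2) by simp
      show "linear_on V \<theta>'"
      proof (rule linear_onI)
        show "\<theta>' v \<in> V" if "v \<in> V" for v using \<theta>'(2)[OF that] .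
        show "\<theta>' (v + v') = \<theta>' v + \<theta>' v'" if "v \<in> V" "v' \<in> V" for v v'
          using \<theta>(1) that iota_linear(1)[OF that] by (simp add: \<theta>'_def additive_on_def)
        show "\<theta>' (scale c v) = scale c (\<theta>' v)" if "v \<in> V" for c v
        proof -
          obtain l where "l \<in> L" "\<forall>v\<in>V. l v = scale c v" using L_scalar by blast
          then show ?thesis using L[of l v] that \<theta>'(2)[OF that] by simp
        qed
      qed
    qed
    then obtain l where l: "l \<in> L" "\<forall>v\<in>V. \<theta>' v = l v" by blast
    have "\<forall>v\<in>iota ` V. \<theta> v = lift l v" using \<theta>'(1) l lift_iota by auto
    then show "\<exists>l\<in>lift ` L. \<forall>v\<in>iota ` V. \<theta> v = l v" using l(1) by blast
  qed
  then obtain z where z: "z \<in> fam" "\<forall>u\<in>set (map iota us). ext z u = 0" "ext z (iota w) \<noteq> 0" by blast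
  have "act z u = 0" if "u \<in> U" for u
  proof (rule act_eqI)
    have uV: "u \<in> V" using that Ud(2) by blast
    show "act z u \<in> V" "0 \<in> V" using act_closed[OF z(1) uV] V_0 by auto
    show "iota (act z u) = iota 0" using z(2) that us th[OF z(1) uV] iota_zero by simp
  qed
  moreover have "act z w \<noteq> 0" using z(3) th[OF z(1) w(1)] iota_zero by metis
  ultimately show ?thesis using z(1) by blast
qed

lemma ex_act:
  assumes w: "w \<in> V" "w \<noteq> 0" and u: "u \<in> V"
  shows "\<exists>a\<in>fam. act a w = u"
proof -
  let ?U = "(\<lambda>a. act a w) ` fam"
  obtain l1 where l1: "l1 \<in> L" "\<forall>v\<in>V. l1 v = scale 1 v" using L_scalar by blast
  have UV: "?U \<subseteq> V" using act_closed w(1) by blast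
  have wU: "w \<in> ?U"
    using act_single[OF l1(1) one_closed, of w] l1(2) w(1) \<rho>_one[OF w(1)] fam_single[OF l1(1), of \<one>]
    by (intro image_eqI[of _ _ "single \<one> l1"]) auto
  have conv: "act b x \<in> ?U" if "b \<in> fam" "x \<in> ?U" for b x
  proof -
    obtain a where "a \<in> fam" "x = act a w" using \<open>x \<in> ?U\<close> by blast
    then show ?thesis using act_conv[OF that(1) _ w(1)] fam_conv[OF that(1)] by (metis imageI)
  qed
  have "subspace ?U"
    unfolding subspace_def
  proof (intro conjI ballI allI)
    have "act (\<lambda>g v. 0) w = 0" by (simp add: act_def)
    moreover have "(\<lambda>g v. 0) \<in> fam" by (simp add: fam_def L_zero)
    ultimately show "0 \<in> ?U" by (metis imageI)
    fix x assume x: "x \<in> ?U"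
    show "scale c x \<in> ?U" for c
    proof -
      obtain l where l: "l \<in> L" "\<forall>v\<in>V. l v = scale c v" using L_scalar by blast
      have xV: "x \<in> V" using x UV by blast
      have "act (single \<one> l) x = scale c x" using act_single[OF l(1) one_closed] \<rho>_one[OF xV] l(2) xV by simp
      then show ?thesis using conv[OF fam_single[OF l(1)] x] by metis
    qed
    fix y assume y: "y \<in> ?U"
    obtain a b where ab: "a \<in> fam" "x = act a w" "b \<in> fam" "y = act b w" using x y by blast
    have "x + y = act (\<lambda>g v. a g v + b g v) w" by (simp add: ab act_def sum.distrib)
    then show "x + y \<in> ?U" using fam_plus[OF ab(1,3)] by blast
  qed
  moreover have "stable (carrier G) ?U"
    unfolding stable_def
  proof (intro ballI)
    fix g x assume g: "g \<in> carrier G" and x: "x \<in> ?U"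
    have "act (single g l1) x = \<rho> g x"
      using act_single[OF l1(1) g] l1(2) \<rho>_closed[OF g] x UV by auto
    then show "\<rho> g x \<in> ?U" using conv[OF fam_single[OF l1(1)] x] by metis
  qed
  ultimately have "?U = V" using irreducible[OF _ UV] wU w(2) by blast
  then show ?thesis using u by blast
qed

text \<open>Density provides \<open>z\<close> sending \<open>w\<close> to \<open>u\<close> and
  killing the hyperplane perpendicular to the line of \<open>u\<close>, so its image is that line.
  The image of the adjoint is perpendicular to this hyperplane, hence in the same line, and the
  difference of \<open>z\<close> and its adjoint is skew with image in the line.\<close>

lemma ex_skew_rank_one:
  assumes u: "u \<in> V" and w: "w \<in> V" and uw: "f u w \<noteq> 0"
  shows "\<exists>x\<in>fam. (\<forall>g\<in>carrier G. \<forall>v\<in>V. star x g v = - x g v) \<and> (\<forall>v\<in>V. act x v \<in> fv.line u) \<and> act x w \<noteq> 0"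
proof -
  note lu = fv.inv_sub_line[OF u] and ld = fv.inv_subD[OF fv.inv_sub_line(1)[OF u]]
  let ?U = "perpV (fv.line u)"
  have u0: "u \<noteq> 0" and w0: "w \<noteq> 0" using uw f_zero(1,2)[OF u w] by auto
  have U: "fv.inv_sub ?U"
    unfolding fv.inv_sub_def
  proof (intro conjI ballI)
    show "subspace ?U" by (rule subspace_perpV[OF ld(2)])
    show "?U \<subseteq> V" by (rule perpV_subset)
    fix l assume l: "l \<in> L"
    show "l ` ?U \<subseteq> ?U"
    proof clarify
      fix v assume v: "v \<in> ?U"
      then have vV: "v \<in> V" by (simp add: perpV_def)
      have "f (l v) s = 0" if "s \<in> fv.line u" for s
        using L_selfadj[OF l vV, of s] that ld(2) ld(3)[OF l that] v by (auto simp: perpV_def)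
      then show "l v \<in> ?U" using L_closed[OF l vV] by (simp add: perpV_def)
    qed
  qed
  have "f w u \<noteq> 0" using f_skew[OF w u] uw by simp
  then have wU: "w \<notin> ?U" using lu(2) unfolding perpV_def by blast
  obtain z1 where z1: "z1 \<in> fam" "\<forall>v\<in>?U. act z1 v = 0" "act z1 w \<noteq> 0" using ex_annihilating[OF U w wU] by blast
  obtain z2 where z2: "z2 \<in> fam" "act z2 (act z1 w) = u" using ex_act[OF act_closed[OF z1(1) w] z1(3) u] by blast
  define z where "z = conv_op z2 z1"
  have z: "z \<in> fam" unfolding z_def by (rule fam_conv[OF z2(1) z1(1)])
  have zU: "act z v = 0" if "v \<in> ?U" for v
  proof -
    have vV: "v \<in> V" using that by (simp add: perpV_def)
    show ?thesis using act_conv[OF z2(1) z1(1) vV] z1(2) that linear_on_more(1)[OF act_linear[OF z2(1)] V_subspace]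
      by (simp add: z_def)
  qed
  have zw: "act z w = u" using act_conv[OF z2(1) z1(1) w] z2(2) by (simp add: z_def)
  have act_L: "act z (l v) = l (act z v)" if l: "l \<in> L" and v: "v \<in> V" for l v
  proof (rule act_eqI)
    show "act z (l v) \<in> V" "l (act z v) \<in> V" using l v L_closed act_closed[OF z] by simp_all
    have "iota (act z (l v)) = theta z (lift l (iota v))"
      using theta_iota[OF z L_closed[OF l v]] lift_iota[OF l v] by simp
    also have "\<dots> = lift l (iota (act z v))" using lift_theta[OF l z iota_M[OF v]] theta_iota[OF z v] by simp
    also have "\<dots> = iota (l (act z v))" using lift_iota[OF l act_closed[OF z v]] .
    finally show "iota (act z (l v)) = iota (l (act z v))" .
  qed
  \<comment> \<open>\<open>?U\<close> is a hyperplane over the field: \<open>k\<close> times its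
    order is |V|. Adding the line of \<open>w\<close> therefore fills \<open>V\<close>.\<close>
  have dec: "\<exists>v1\<in>?U. \<exists>l\<in>L. v = v1 + l w" if v: "v \<in> V" for v
  proof -
    let ?N = "{x + y | x y. x \<in> ?U \<and> y \<in> fv.line w}"
    note e = fv.extend_line[OF U w wU]
    have "card ?N = k * card ?U" by (rule e(2))
    also have "\<dots> = card V"
      using card_perpV[OF ld(1,2)] fv.\<Lambda>_card[OF u u0] by (simp add: fv.line_def)
    finally have "?N = V" using e(5)[OF V_subspace perpV_subset fv.inv_subD(2)[OF fv.inv_sub_line(1)[OF w]]] V_finite
      by (intro card_subset_eq) auto
    then have "v \<in> ?N" using v by (simp only:)
    then obtain x y where xy: "v = x + y" "x \<in> ?U" "y \<in> fv.line w" by blast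
    then obtain l where "l \<in> L" "y = l w" unfolding fv.line_def by blast
    then show ?thesis using xy by blast
  qed
  have z_line: "act z v \<in> fv.line u" if v: "v \<in> V" for v
  proof -
    obtain v1 l where v1: "v1 \<in> ?U" "l \<in> L" "v = v1 + l w" using dec[OF v] by blast
    have "act z v = l u"
      using linear_onD(4)[OF act_linear[OF z]] v1 perpV_subset L_closed[OF v1(2) w] zU act_L[OF v1(2) w] zw by (simp add: subset_iff)
    then show ?thesis using v1(2) by (simp add: fv.line_def)
  qed
  have star_line: "act (star z) v \<in> fv.line u" if v: "v \<in> V" for v
  proof -
    have "f (act (star z) v) s = 0" if s: "s \<in> ?U" for s
    proof -
      have sV: "s \<in> V" using s by (simp add: perpV_def)
      have "f (act (star z) v) s = - f s (act (star z) v)"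
        using f_skew[OF act_closed[OF fam_star[OF z] v] sV] .
      also have "\<dots> = - f (act z s) v" using act_adjoint[OF z sV v] by simp
      also have "\<dots> = 0" using zU[OF s] f_zero(1)[OF V_0 v] by simp
      finally show ?thesis .
    qed
    then have "act (star z) v \<in> perpV ?U" using act_closed[OF fam_star[OF z] v] by (simp add: perpV_def)
    then show ?thesis using perpV_perpV[OF ld(1,2)] by simp
  qed
  define x where "x = (\<lambda>g v. z g v + - star z g v)"
  have x: "x \<in> fam" unfolding x_def by (rule fam_plus[OF z fam_neg[OF fam_star[OF z]]])
  have act_x: "act x v = act z v - act (star z) v" for v
    by (simp add: x_def act_def sum_subtractf)
  have "act x w \<noteq> 0"
  proof
    assume "act x w = 0"
    then have eq: "act (star z) w = u" using act_x[of w] zw by simp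
    \<comment> \<open>If \<open>z\<close> and its adjoint agreed on \<open>w\<close>, moving
      \<open>l\<close> and \<open>z\<close> across the form would equate this value with its
      negative. For \<open>l\<close> the identity the result contradicts \<open>uw\<close>.\<close>
    have lz: "f u (l w) = 0" if l: "l \<in> L" for l
    proof -
      note lw = L_closed[OF l w] and lu' = L_closed[OF l u]
      have "f u (l w) = - f (l w) u" by (rule f_skew[OF u lw])
      also have "f (l w) u = f w (l u)" by (rule L_selfadj[OF l w u])
      also have "f w (l u) = f w (act z (l w))" using act_L[OF l w] zw by simp
      also have "\<dots> = - f (act z (l w)) w" by (rule f_skew[OF w act_closed[OF z lw]])
      also have "f (act z (l w)) w = f (l w) (act (star z) w)" by (rule act_adjoint[OF z lw w])
      also have "\<dots> = f (l w) u" using eq by simp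
      also have "\<dots> = - f u (l w)" by (rule f_skew[OF lw u])
      finally have "f u (l w) = - f u (l w)" by simp
      then have "2 * f u (l w) = 0" by (simp add: eq_neg_iff_add_eq_0)
      then show ?thesis using two by simp
    qed
    obtain l1 where "l1 \<in> L" "\<forall>v\<in>V. l1 v = scale 1 v" using L_scalar by blast
    then show False using lz[of l1] w uw by simp
  qed
  moreover have "act x v \<in> fv.line u" if v: "v \<in> V" for v
    using act_x subspace_diff[OF ld(1) z_line[OF v] star_line[OF v]] by simp
  moreover have "\<forall>g\<in>carrier G. \<forall>v\<in>V. star x g v = - x g v" by (simp add: x_def star_def)
  ultimately show ?thesis using x by blast
qed

end

section \<open>Even rank on modules induced from cyclic subgroups\<close>

text \<open>The exponent is half of |G| + 1.\<close>

lemma (in group) square_generates: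
  assumes "finite (carrier G)" "odd (card (carrier G))" and c: "c \<in> carrier G"
  shows "\<exists>j::nat. (c \<otimes> c) [^] j = c"
proof -
  let ?n = "card (carrier G)"
  obtain j where j: "Suc ?n = 2 * j" using assms(2) by (metis even_Suc evenE)
  have "c [^] ?n = \<one>" using pow_order_eq_1[OF c] unfolding Coset.order_def .
  then have "c [^] (2 * j) = c" using c unfolding j[symmetric] by simp
  moreover have "(c \<otimes> c) [^] j = c [^] (2 * j)"
    using c nat_pow_pow[OF c, of 2 j] by (simp add: numeral_2_eq_2)
  ultimately show ?thesis by metis
qed

lemma (in coef_ring) card_fit_act:
  assumes a: "a \<in> fam"
  shows "card (fit (theta a) (ind (carrier G))) = card (fit (act a) V)"
proof -
  have stab: "act a ` V \<subseteq> V" using act_closed[OF a] by blast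
  have pow: "iota ((act a ^^ n) v) = (theta a ^^ n) (iota v)" if "v \<in> V" for n v
  proof (induction n)
    case (Suc n)
    then show ?case using theta_iota[OF a funpow_maps[OF stab that], of n] by simp
  qed simp
  have st2: "theta a ` ind (carrier G) \<subseteq> ind (carrier G)"
    using fn.linear_on_image[OF linear_on_theta[OF fam_coef[OF a] subgroup_self]] .
  obtain K where K: "\<forall>j\<ge>K. (act a ^^ j) ` V = fit (act a) V" using fit_eventually[OF V_finite stab] by blast
  obtain J where J: "\<forall>j\<ge>J. (theta a ^^ j) ` ind (carrier G) = fit (theta a) (ind (carrier G))"
    using fit_eventually[OF finite_ind st2] by blast
  let ?n = "max J K"
  have "iota ` fit (act a) V = iota ` ((act a ^^ ?n) ` V)" using K by simp
  also have "\<dots> = (theta a ^^ ?n) ` (iota ` V)" using pow by (simp add: image_image)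
  also have "\<dots> = fit (theta a) (ind (carrier G))" using J by (simp add: iota_image)
  finally have "iota ` fit (act a) V = fit (theta a) (ind (carrier G))" .
  moreover have "inj_on iota (fit (act a) V)" using iota_inj fit_subset by (rule inj_on_subset)
  ultimately show ?thesis by (metis card_image)
qed

context simple_coef_ring
begin

lemma inv_sub_fit:
  assumes a: "\<And>\<phi>. \<phi> \<in> N \<Longrightarrow> T \<phi> \<in> N" and N: "ff.inv_sub N" and T: "fn.linear_on N T"
    and comm: "\<And>l \<phi>. l \<in> L \<Longrightarrow> \<phi> \<in> N \<Longrightarrow> T (lift l \<phi>) = lift l (T \<phi>)"
  shows "ff.inv_sub (fit T N)"
  unfolding ff.inv_sub_def
proof (intro conjI ballI)
  note Nd = ff.inv_subD[OF N]
  show "fn.subspace (fit T N)" by (rule fn.subspace_fit[OF Nd(4,1) T])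
  show "fit T N \<subseteq> M" using fit_subset[of T N] Nd(2) by blast
  fix l' assume "l' \<in> lift ` L"
  then obtain l where l: "l \<in> L" "l' = lift l" by blast
  have TN: "T ` N \<subseteq> N" using a by blast
  obtain K where K: "\<forall>j\<ge>K. (T ^^ j) ` N = fit T N" using fit_eventually[OF Nd(4) TN] by blast
  have c: "lift l ((T ^^ j) \<phi>) = (T ^^ j) (lift l \<phi>)" if "\<phi> \<in> N" for j \<phi>
  proof (induction j)
    case (Suc j)
    then show ?case using comm[OF l(1) funpow_maps[OF TN that], of j] by simp
  qed simp
  show "l' ` fit T N \<subseteq> fit T N"
  proof clarify
    fix \<phi> assume "\<phi> \<in> fit T N"
    then obtain \<psi> where \<psi>: "\<psi> \<in> N" "\<phi> = (T ^^ K) \<psi>" using K by blast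
    have "l' \<phi> = (T ^^ K) (lift l \<psi>)" using c[OF \<psi>(1)] \<psi>(2) l(2) by simp
    moreover have "lift l \<psi> \<in> N" using Nd(3)[OF imageI[OF l(1)] \<psi>(1)] .
    ultimately show "l' \<phi> \<in> fit T N" using K by blast
  qed
qed

text \<open>Let \<open>S\<close> be maximal among the isotropic \<open>L\<close>-subspaces stable
  under \<open>c\<close>, with perpendicular space \<open>P\<close>. The rank on the induced module
  is the rank on the part induced from \<open>P\<close> plus that on the part induced from
  \<open>S\<close>. Their difference is the rank of an alternating form on the first part whose
  radical is the second, hence even; so the total is even.\<close>

lemma card_fit_cyclic:
  assumes c: "c \<in> carrier G" and x: "x \<in> fam" and y: "y \<in> fam"
    and skx: "\<And>g v. g \<in> carrier G \<Longrightarrow> v \<in> V \<Longrightarrow> star x g v = - x g v"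
    and sky: "\<And>g v. g \<in> carrier G \<Longrightarrow> v \<in> V \<Longrightarrow> star y g v = - y g v"
  shows "\<exists>j. card (fit (theta (conv_op x y)) (ind (generate G {c}))) = k ^ (2 * j)"
proof -
  let ?C = "generate G {c}"
  have C: "subgroup ?C G" using c by (intro generate_is_subgroup) auto
  have CG: "?C \<subseteq> carrier G" using subgroup.subset[OF C] .
  obtain r t where rt: "is_transversal ?C r t" using ex_transversal[OF fin_G C] unfolding is_transversal_def by blast
  interpret I: induced scale G V \<rho> f ?C r t
    by (intro induced.intro induced_axioms.intro symplectic_rep_axioms C rt)
  let ?good = "\<lambda>S. fv.inv_sub S \<and> (\<forall>s\<in>S. \<rho> c s \<in> S) \<and> S \<subseteq> perpV S"
  have "?good {0}"
    using linear_on_more(1)[OF \<rho>_linear[OF c] V_subspace] V_0 f_zero(1)[OF V_0 V_0] subspace_single_0 L_0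
    by (auto simp: fv.inv_sub_def perpV_def)
  then have "\<exists>S. ?good S \<and> (\<forall>S'. ?good S' \<longrightarrow> card S' \<le> card S)"
    by (rule ex_has_greatest_nat[where b = "Suc (card V)"])
      (auto simp: less_Suc_eq_le intro: card_mono[OF V_finite] dest: fv.inv_subD(2))
  then obtain S where S: "?good S" and max: "\<And>S'. ?good S' \<Longrightarrow> card S' \<le> card S" by blast
  have iS: "fv.inv_sub S" and cS: "\<And>s. s \<in> S \<Longrightarrow> \<rho> c s \<in> S" and SP: "S \<subseteq> perpV S" using S by blast+
  note Sd = fv.inv_subD[OF iS]
  have powS: "\<rho> (c [^] n) s \<in> S" if "s \<in> S" for n :: nat and s
  proof (induction n)
    case 0
    then show ?case using \<rho>_one that Sd(2) by auto
  next
    case (Suc n)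
    have "\<rho> (c [^] Suc n) s = \<rho> c (\<rho> (c [^] n) s)"
      using \<rho>_mult[OF c nat_pow_closed[OF c], of s n] nat_pow_Suc2[OF c, of n] that Sd(2) by (simp add: subset_iff)
    then show ?case using cS[OF Suc] by simp
  qed
  have stS: "stable ?C S"
  proof -
    have "?C = {c [^] n | n::nat. n \<in> UNIV}" using generate_pow_on_finite_carrier[OF fin_G c] by auto
    then show ?thesis unfolding stable_def using powS by auto
  qed
  let ?P = "perpV S"
  have iP: "fv.inv_sub ?P"
    unfolding fv.inv_sub_def
  proof (intro conjI ballI)
    show "subspace ?P" by (rule subspace_perpV[OF Sd(2)])
    show "?P \<subseteq> V" by (rule perpV_subset)
    fix l assume l: "l \<in> L"
    show "l ` ?P \<subseteq> ?P"
    proof clarify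
      fix v assume v: "v \<in> ?P"
      then have vV: "v \<in> V" by (simp add: perpV_def)
      have "f (l v) s = 0" if "s \<in> S" for s
        using L_selfadj[OF l vV, of s] that Sd(2) Sd(3)[OF l that] v by (auto simp: perpV_def)
      then show "l v \<in> ?P" using L_closed[OF l vV] by (simp add: perpV_def)
    qed
  qed
  note Pd = fv.inv_subD[OF iP]
  have stP: "stable ?C ?P" by (rule stable_perpV[OF C stS Sd(2)])
  have cC: "c \<in> ?C" using generate.incl[of c "{c}"] by simp
  \<comment> \<open>\<open>c\<close> has no nonzero fixed vector on \<open>P/S\<close>. The
    \<open>L\<close>-line of such a vector would be isotropic, because \<open>L\<close> is
    self-adjoint and 2 is invertible, and it could be added to \<open>S\<close>.\<close>
  have maximal: "v \<in> S" if v: "v \<in> ?P" "\<rho> c v - v \<in> S" for v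
  proof (rule ccontr)
    assume nv: "v \<notin> S"
    have vV: "v \<in> V" using v(1) Pd(2) by blast
    let ?S = "{s + w | s w. s \<in> S \<and> w \<in> fv.line v}"
    note e = fv.extend_line[OF iS vV nv]
    have "\<rho> c z \<in> ?S" if "z \<in> ?S" for z
    proof -
      obtain s l where z: "s \<in> S" "l \<in> L" "z = s + l v" using \<open>z \<in> ?S\<close> by (auto simp: fv.line_def)
      have m: "s \<in> V" "l v \<in> V" "\<rho> c v \<in> V" using z Sd(2) L_closed[OF z(2) vV] \<rho>_closed[OF c vV] by auto
      have "\<rho> c z = \<rho> c s + l (\<rho> c v)" using linear_onD(4)[OF \<rho>_linear[OF c] m(1,2)] L_\<rho>[OF z(2) c vV] z(3) by simp
      also have "l (\<rho> c v) = l (\<rho> c v - v) + l v" using linear_on_more(3)[OF L_linear[OF z(2)] V_subspace m(3) vV] by simp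
      finally have "\<rho> c z = (\<rho> c s + l (\<rho> c v - v)) + l v" by (simp add: add.assoc)
      moreover have "\<rho> c s + l (\<rho> c v - v) \<in> S" using cS[OF z(1)] Sd(3)[OF z(2) v(2)] subspace_add[OF Sd(1)] by blast
      ultimately show ?thesis using z(2) by (auto simp: fv.line_def)
    qed
    moreover have "?S \<subseteq> perpV ?S"
    proof
      fix z assume z: "z \<in> ?S"
      have zV: "z \<in> V" using z fv.inv_subD(2)[OF e(1)] by blast
      have "f z z' = 0" if z': "z' \<in> ?S" for z'
      proof -
        obtain s l where zz: "s \<in> S" "l \<in> L" "z = s + l v" using z by (auto simp: fv.line_def)
        obtain s' l' where zz': "s' \<in> S" "l' \<in> L" "z' = s' + l' v" using z' by (auto simp: fv.line_def)
        have m: "s \<in> V" "l v \<in> V" "s' \<in> V" "l' v \<in> V" using zz zz' Sd(2) L_closed vV by auto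
        have 1: "f s s' = 0" using SP zz(1) zz'(1) by (auto simp: perpV_def)
        have 2: "f (l v) s' = 0" using Pd(3)[OF zz(2) v(1)] zz'(1) by (simp add: perpV_def)
        have 3: "f s (l' v) = 0"
          using f_skew[OF m(1,4)] Pd(3)[OF zz'(2) v(1)] zz(1) by (simp add: perpV_def)
        have 4: "f (l v) (l' v) = 0"
        proof -
          have n: "(\<lambda>v. l (l' v)) \<in> L" by (rule L_comp[OF zz(2) zz'(2)])
          have e1: "f (l v) (l' v) = f v (l (l' v))" using L_selfadj[OF zz(2) vV m(4)] .
          have "f v (l (l' v)) = f (l (l' v)) v" using L_selfadj[OF n vV vV] by (rule sym)
          also have "\<dots> = - f v (l (l' v))" using f_skew[OF L_closed[OF n vV] vV] .
          finally have "2 * f v (l (l' v)) = 0" by (simp add: eq_neg_iff_add_eq_0)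
          then have "2 * f (l v) (l' v) = 0" by (simp only: e1)
          then show ?thesis using two by simp
        qed
        have "f z z' = f s z' + f (l v) z'" using fD(1)[OF m(1,2)] V_add[OF m(3,4)] zz(3) zz'(3) by simp
        also have "\<dots> = 0" using fD(3)[OF m(1,3,4)] fD(3)[OF m(2,3,4)] 1 2 3 4 zz'(3) by simp
        finally show ?thesis .
      qed
      then show "z \<in> perpV ?S" using zV by (simp add: perpV_def)
    qed
    ultimately have "?good ?S" using e(1) by blast
    from max[OF this] have "k * card S \<le> card S" using e(2) by simp
    moreover have "card S > 0" using Sd subspace_0 by (auto simp: card_gt_0_iff)
    moreover have "v \<noteq> 0" using nv subspace_0[OF Sd(1)] by auto
    ultimately show False using fv.k_gt_1[OF vV] by simp
  qed
  \<comment> \<open>A vector fixed modulo \<open>S\<close> by the square of \<open>c\<close> is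
    fixed by all powers of the square, and \<open>c\<close> is one of them.\<close>
  have maximal2: "v \<in> S" if v: "v \<in> ?P" "\<rho> (c \<otimes> c) v - v \<in> S" for v
  proof (rule maximal[OF v(1)])
    have vV: "v \<in> V" using v(1) Pd(2) by blast
    have "\<rho> ((c \<otimes> c) [^] n) v - v \<in> S" for n :: nat
    proof (induction n)
      case 0
      then show ?case using \<rho>_one[OF vV] subspace_0[OF Sd(1)] by simp
    next
      case (Suc n)
      let ?d = "c \<otimes> c" and ?w = "\<rho> ((c \<otimes> c) [^] n) v"
      have d: "?d \<in> carrier G" "?d [^] n \<in> carrier G" using c by auto
      have wV: "?w \<in> V" using \<rho>_closed[OF d(2) vV] .
      have "\<rho> (?d [^] Suc n) v = \<rho> ?d ?w"
        using \<rho>_mult[OF d vV] nat_pow_Suc2[OF d(1), of n] by simp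
      then have "\<rho> (?d [^] Suc n) v - v = \<rho> ?d (?w - v) + (\<rho> ?d v - v)"
        using linear_on_more(3)[OF \<rho>_linear[OF d(1)] V_subspace wV vV] by simp
      moreover have "\<rho> ?d (?w - v) \<in> S"
      proof -
        have "\<rho> ?d (?w - v) = \<rho> c (\<rho> c (?w - v))" using \<rho>_mult[OF c c V_diff[OF wV vV]] .
        then show ?thesis using cS[OF cS[OF Suc]] by simp
      qed
      ultimately show ?case using subspace_add[OF Sd(1) _ v(2)] by (simp add: add_diff_eq)
    qed
    moreover obtain j :: nat where "(c \<otimes> c) [^] j = c" using square_generates[OF fin_G odd_G c] by blast
    ultimately show "\<rho> c v - v \<in> S" by metis
  qed
  let ?a = "conv_op x y" and ?a' = "conv_op y x"
  have afam: "?a \<in> fam" "?a' \<in> fam" using fam_conv x y by auto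
  let ?IC = "ind ?C"
  have ICM: "?IC \<subseteq> M" by (rule ind_subset_ind_one[OF C])
  have th_closed: "theta b \<phi> \<in> ?IC" if "b \<in> fam" "\<phi> \<in> ?IC" for b \<phi>
    using fn.linear_onD(1)[OF linear_on_theta[OF fam_coef[OF that(1)] C] that(2)] .
  have th_a: "theta ?a \<phi> = theta x (theta y \<phi>)" "theta ?a' \<phi> = theta y (theta x \<phi>)" if "\<phi> \<in> ?IC" for \<phi>
    using theta_conv_op[OF fam_coef[OF x] fam_coef[OF y], of \<phi>] theta_conv_op[OF fam_coef[OF y] fam_coef[OF x], of \<phi>] that ICM by auto
  have skew: "I.sform (theta b \<phi>) \<psi> = - I.sform \<phi> (theta b \<psi>)"
    if b: "b \<in> fam" and sk: "\<And>g v. g \<in> carrier G \<Longrightarrow> v \<in> V \<Longrightarrow> star b g v = - b g v" and "\<phi> \<in> ?IC" "\<psi> \<in> ?IC" for b \<phi> \<psi>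
  proof -
    have "theta (star b) \<psi> = - theta b \<psi>"
      using sk indD(1)[OF that(4)] by (auto simp: theta_def fun_eq_iff sum_negf[symmetric] intro!: sum.cong)
    moreover have "I.sform \<phi> (- theta b \<psi>) = - I.sform \<phi> (theta b \<psi>)"
      using fn.bilinear_on_zero(4)[OF I.sform_bilinear that(3) th_closed[OF b that(4)]] .
    ultimately show ?thesis
      using I.sform_adjoint[OF fam_coef[OF b] fam_selfadj[OF b] that(3,4)] by simp
  qed
  \<comment> \<open>Both factors are skew-adjoint: the two signs cancel and the order of the factors
    is reversed.\<close>
  have adj: "I.sform (theta ?a \<phi>) \<psi> = I.sform \<phi> (theta ?a' \<psi>)" if "\<phi> \<in> ?IC" "\<psi> \<in> ?IC" for \<phi> \<psi>
    using skew[OF x skx th_closed[OF y that(1)] that(2)] skew[OF y sky that(1) th_closed[OF x that(2)]]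
      th_a that by simp
  let ?N = "I.sub_ind S" and ?Q = "I.sub_ind ?P"
  have fam_stable: "b g s \<in> U" if "b \<in> fam" "fv.inv_sub U" "g \<in> carrier G" "s \<in> U" for b g s U
    using that fv.inv_subD(3)[OF that(2)] by (simp add: fam_def)
  have card1: "card (fit (theta ?a) ?IC) = card (fit (theta ?a) ?Q) * card (fit (theta ?a') ?N)"
    by (rule I.card_fit_ind[OF fam_coef[OF afam(1)] fam_coef[OF afam(2)] adj Sd(2,1) stS])
      (use fam_stable[OF afam(2) iS] in auto)
  have subI: "I.sub_ind U \<subseteq> ?IC" for U by (auto simp: I.sub_ind_def)
  have inv_sub_ind: "ff.inv_sub (I.sub_ind U)" if U: "fv.inv_sub U" for U
    unfolding ff.inv_sub_def
  proof (intro conjI ballI)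
    show "fn.subspace (I.sub_ind U)" by (rule I.subspace_sub_ind[OF fv.inv_subD(1)[OF U]])
    show "I.sub_ind U \<subseteq> M" using subI ICM by blast
    fix l' assume "l' \<in> lift ` L"
    then obtain l where l: "l \<in> L" "l' = lift l" by blast
    show "l' ` I.sub_ind U \<subseteq> I.sub_ind U"
      using lift_ind[OF l(1) C] fv.inv_subD(3)[OF U l(1)] by (auto simp: l(2) I.sub_ind_def lift_def)
  qed
  have thU: "theta b ` I.sub_ind U \<subseteq> I.sub_ind U" if "b \<in> fam" "fv.inv_sub U" for b U
    by (rule I.theta_sub_ind[OF fam_coef[OF that(1)] fv.inv_subD(1)[OF that(2)]]) (rule fam_stable[OF that])
  have linU: "fn.linear_on (I.sub_ind U) (theta b)" if "b \<in> fam" "fv.inv_sub U" for b U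
    by (rule fn.linear_on_sub[OF linear_on_theta[OF fam_coef[OF that(1)] C] subI]) (use thU[OF that] in blast)
  have inv_fit: "ff.inv_sub (fit (theta ?a) (I.sub_ind U))" if U: "fv.inv_sub U" for U
  proof (rule inv_sub_fit[OF _ inv_sub_ind[OF U] linU[OF afam(1) U]])
    show "theta ?a \<phi> \<in> I.sub_ind U" if "\<phi> \<in> I.sub_ind U" for \<phi> using thU[OF afam(1) U] that by blast
    show "theta ?a (lift l \<phi>) = lift l (theta ?a \<phi>)" if "l \<in> L" "\<phi> \<in> I.sub_ind U" for l \<phi>
      using lift_theta[OF that(1) afam(1)] that(2) subI ICM by blast
  qed
  have swap: "card (fit (theta ?a') ?N) = card (fit (theta ?a) ?N)"
  proof -
    have "fit (theta ?a) ?N = fit (theta x \<circ> theta y) ?N"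
      by (rule fit_cong[OF thU[OF afam(1) iS]]) (use th_a(1) subI in auto)
    moreover have "fit (theta ?a') ?N = fit (theta y \<circ> theta x) ?N"
      by (rule fit_cong[OF thU[OF afam(2) iS]]) (use th_a(2) subI in auto)
    ultimately show ?thesis
      using fit_swap(2)[OF _ thU[OF x iS] thU[OF y iS]] finite_subset[OF subI finite_ind] by simp
  qed
  have "ff.inv_sub {0}" using M_zero fn.subspace_single_0 L_0 by (auto simp: ff.inv_sub_def lift_def fun_eq_iff)
  moreover have "{0} \<subseteq> fit (theta ?a) ?N" using fn.subspace_0[OF ff.inv_subD(1)[OF inv_fit[OF iS]]] by simp
  ultimately obtain i where i: "card (fit (theta ?a) ?N) = k ^ i"
    using ff.card_power[OF _ inv_fit[OF iS]] by (metis card.empty card_insert_disjoint empty_iff finite.emptyI mult_1 One_nat_def)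
  \<comment> \<open>The element \<open>d\<close> acts on values. This preserves the induced module
    because the cyclic group is commutative, and it commutes with \<open>theta b\<close>, which
    translates arguments and has coefficients commuting with the group.\<close>
  define \<gamma> where "\<gamma> d \<phi> = (\<lambda>x. if x \<in> carrier G then \<rho> d (\<phi> x) else 0)" for d and \<phi> :: "'c \<Rightarrow> 'b"
  have \<gamma>_ind: "\<gamma> d \<phi> \<in> I.sub_ind U" if d: "d \<in> ?C" and U: "stable ?C U" and \<phi>: "\<phi> \<in> I.sub_ind U" for d U \<phi>
  proof -
    have dG: "d \<in> carrier G" using CG d by blast
    have \<phi>I: "\<phi> \<in> ?IC" using \<phi> subI by blast
    have "\<rho> d (\<rho> (inv h) v) = \<rho> (inv h) (\<rho> d v)" if h: "h \<in> ?C" and v: "v \<in> V" for h v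
    proof -
      obtain m n :: int where "d = c [^] m" "inv h = c [^] n"
        using d subgroup.m_inv_closed[OF C h] generate_pow[OF c] by blast
      then have "d \<otimes> inv h = inv h \<otimes> d" using int_pow_mult[OF c] by (metis add.commute)
      then show ?thesis using \<rho>_mult[OF dG _ v] \<rho>_mult[OF _ dG v] h CG by (metis inv_closed subsetD)
    qed
    then have "\<gamma> d \<phi> \<in> ?IC"
      using indD[OF \<phi>I] \<rho>_closed[OF dG] CG by (auto simp: ind_def \<gamma>_def subset_iff)
    then show ?thesis using \<phi> U d by (auto simp: I.sub_ind_def \<gamma>_def stable_def)
  qed
  have \<gamma>_IC: "\<gamma> d \<phi> \<in> ?IC" if "d \<in> ?C" "\<phi> \<in> ?IC" for d \<phi>
    using \<gamma>_ind[OF that(1), of V \<phi>] that(2) \<rho>_closed CG by (auto simp: I.sub_ind_V stable_def subset_iff)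
  have \<gamma>_inv: "\<gamma> d (\<gamma> (inv d) \<phi>) = \<phi>" "\<gamma> (inv d) (\<gamma> d \<phi>) = \<phi>" if "d \<in> ?C" "\<phi> \<in> ?IC" for d \<phi>
  proof -
    have "d \<in> carrier G" using that(1) CG by blast
    then show "\<gamma> d (\<gamma> (inv d) \<phi>) = \<phi>" "\<gamma> (inv d) (\<gamma> d \<phi>) = \<phi>"
      using \<rho>_inv indD(1,2)[OF that(2)] by (auto simp: \<gamma>_def fun_eq_iff)
  qed
  have \<gamma>_lin: "\<gamma> d (\<phi> + \<psi>) = \<gamma> d \<phi> + \<gamma> d \<psi>" "\<gamma> d (\<lambda>x. scale e (\<phi> x)) = (\<lambda>x. scale e (\<gamma> d \<phi> x))"
    if "d \<in> ?C" "\<phi> \<in> ?IC" "\<psi> \<in> ?IC" for d e \<phi> \<psi>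
    using linear_onD(3,4)[OF \<rho>_linear] indD(1)[OF that(2)] indD(1)[OF that(3)] that(1) CG
    by (auto simp: \<gamma>_def fun_eq_iff)
  have \<gamma>_theta: "theta b (\<gamma> d \<phi>) = \<gamma> d (theta b \<phi>)" if d: "d \<in> ?C" and b: "b \<in> fam" and \<phi>: "\<phi> \<in> ?IC" for d b \<phi>
  proof
    fix z
    have dG: "d \<in> carrier G" using d CG by blast
    show "theta b (\<gamma> d \<phi>) z = \<gamma> d (theta b \<phi>) z"
    proof (cases "z \<in> carrier G")
      case z: True
      have "theta b (\<gamma> d \<phi>) z = (\<Sum>g\<in>carrier G. \<rho> d (b g (\<phi> (inv g \<otimes> z))))"
        using z coefD(3)[OF fam_coef[OF b] _ dG] indD(1)[OF \<phi>] by (auto simp: theta_def \<gamma>_def intro!: sum.cong)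
      also have "\<dots> = \<rho> d (theta b \<phi> z)"
        using linear_on_sum[OF \<rho>_linear[OF dG] V_subspace fin_G, of "\<lambda>g. b g (\<phi> (inv g \<otimes> z))" "\<lambda>_. 1"]
          z coefD(2)[OF fam_coef[OF b]] indD(1)[OF \<phi>] by (simp add: theta_def)
      finally show ?thesis using z by (simp add: \<gamma>_def)
    qed (simp add: theta_def \<gamma>_def)
  qed
  have \<gamma>_form: "I.sform (\<gamma> d \<phi>) (\<gamma> d \<psi>) = I.sform \<phi> \<psi>" if d: "d \<in> ?C" and "\<phi> \<in> ?IC" "\<psi> \<in> ?IC" for d \<phi> \<psi>
    unfolding I.sform_def using that CG indD(1) I.tc f_invariant by (intro sum.cong refl) (auto simp: \<gamma>_def)
  have \<gamma>_lift: "\<gamma> d (lift l \<phi>) = lift l (\<gamma> d \<phi>)" if "d \<in> ?C" "l \<in> L" "\<phi> \<in> ?IC" for d l \<phi>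
    using L_\<rho>[OF that(2)] L_0[OF that(2)] indD(1)[OF that(3)] that(1) CG by (auto simp: \<gamma>_def lift_def fun_eq_iff)
  have ciC: "inv c \<in> ?C" by (rule subgroup.m_inv_closed[OF C cC])
  \<comment> \<open>The operator \<open>c - c\<inverse>\<close>. In
    \<open>\<beta> \<phi> \<phi>\<close> below its two terms give equal values of the form, since
    \<open>c\<close> is an isometry and commutes with the skew-adjoint \<open>theta y\<close>; this
    makes \<open>\<beta>\<close> alternating.\<close>
  define \<delta> where "\<delta> \<phi> = \<gamma> c \<phi> - \<gamma> (inv c) \<phi>" for \<phi>
  have IC_diff: "\<phi> - \<psi> \<in> ?IC" if "\<phi> \<in> ?IC" "\<psi> \<in> ?IC" for \<phi> \<psi>
    using fn.subspace_diff[OF subspace_ind[OF C] that] .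
  have \<delta>_IC: "\<delta> \<phi> \<in> ?IC" if "\<phi> \<in> ?IC" for \<phi>
    unfolding \<delta>_def using IC_diff \<gamma>_IC[OF cC that] \<gamma>_IC[OF ciC that] .
  have \<delta>_theta: "theta b (\<delta> \<phi>) = \<delta> (theta b \<phi>)" if "b \<in> fam" "\<phi> \<in> ?IC" for b \<phi>
    using fn.linear_on_more(3)[OF linear_on_theta[OF fam_coef[OF that(1)] C] subspace_ind[OF C]
        \<gamma>_IC[OF cC that(2)] \<gamma>_IC[OF ciC that(2)]]
      \<gamma>_theta[OF cC that] \<gamma>_theta[OF ciC that] by (simp add: \<delta>_def)
  have \<delta>_sub: "\<delta> \<phi> \<in> I.sub_ind U" if "fv.inv_sub U" "stable ?C U" "\<phi> \<in> I.sub_ind U" for U \<phi>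
    unfolding \<delta>_def
    using fn.subspace_diff[OF I.subspace_sub_ind[OF fv.inv_subD(1)[OF that(1)]] \<gamma>_ind[OF cC that(2,3)] \<gamma>_ind[OF ciC that(2,3)]] .
  define \<beta> where "\<beta> \<phi> \<psi> = I.sform \<phi> (theta y (\<delta> \<psi>))" for \<phi> \<psi>
  let ?W = "fit (theta ?a) ?Q"
  have WQ: "?W \<subseteq> ?Q" by (rule fit_subset)
  have WI: "?W \<subseteq> ?IC" using WQ subI by blast
  note sfD = fn.bilinear_onD[OF I.sform_bilinear]
  have bil: "fn.bilinear_on ?IC ?IC \<beta>"
    unfolding fn.bilinear_on_def
  proof (intro conjI ballI allI)
    note ly = fn.linear_onD[OF linear_on_theta[OF fam_coef[OF y] C]]
    fix \<phi> \<psi> assume \<phi>: "\<phi> \<in> ?IC" and \<psi>: "\<psi> \<in> ?IC"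
    show "\<beta> (\<lambda>x. scale e (\<phi> x)) \<psi> = e * \<beta> \<phi> \<psi>" for e
      unfolding \<beta>_def using sfD(2)[OF \<phi> ly(1)[OF \<delta>_IC[OF \<psi>]]] .
    have "\<delta> (\<lambda>x. scale e (\<psi> x)) = (\<lambda>x. scale e (\<delta> \<psi> x))" for e
      using \<gamma>_lin(2)[OF cC \<psi> \<psi>] \<gamma>_lin(2)[OF ciC \<psi> \<psi>] by (simp add: \<delta>_def fun_eq_iff scale_right_diff_distrib)
    then show "\<beta> \<phi> (\<lambda>x. scale e (\<psi> x)) = e * \<beta> \<phi> \<psi>" for e
      unfolding \<beta>_def using sfD(4)[OF \<phi> ly(1)[OF \<delta>_IC[OF \<psi>]]] ly(3)[OF \<delta>_IC[OF \<psi>]] by simp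
    fix \<chi> assume \<chi>: "\<chi> \<in> ?IC"
    show "\<beta> (\<phi> + \<psi>) \<chi> = \<beta> \<phi> \<chi> + \<beta> \<psi> \<chi>"
      unfolding \<beta>_def using sfD(1)[OF \<phi> \<psi> ly(1)[OF \<delta>_IC[OF \<chi>]]] .
    have "\<delta> (\<psi> + \<chi>) = \<delta> \<psi> + \<delta> \<chi>"
      using \<gamma>_lin(1)[OF cC \<psi> \<chi>] \<gamma>_lin(1)[OF ciC \<psi> \<chi>] by (simp add: \<delta>_def)
    then show "\<beta> \<phi> (\<psi> + \<chi>) = \<beta> \<phi> \<psi> + \<beta> \<phi> \<chi>"
      unfolding \<beta>_def using sfD(3)[OF \<phi> ly(1)[OF \<delta>_IC[OF \<psi>]] ly(1)[OF \<delta>_IC[OF \<chi>]]]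
        ly(4)[OF \<delta>_IC[OF \<psi>] \<delta>_IC[OF \<chi>]] by simp
  qed
  have alt: "\<beta> \<phi> \<phi> = 0" if \<phi>: "\<phi> \<in> ?IC" for \<phi>
  proof -
    note g1 = \<gamma>_IC[OF cC \<phi>] and g2 = \<gamma>_IC[OF ciC \<phi>]
    have "theta y (\<delta> \<phi>) = theta y (\<gamma> c \<phi>) - theta y (\<gamma> (inv c) \<phi>)"
      using fn.linear_on_more(3)[OF linear_on_theta[OF fam_coef[OF y] C] subspace_ind[OF C] g1 g2] by (simp add: \<delta>_def)
    then have "\<beta> \<phi> \<phi> = I.sform \<phi> (theta y (\<gamma> c \<phi>)) - I.sform \<phi> (theta y (\<gamma> (inv c) \<phi>))"
      unfolding \<beta>_def
      using fn.bilinear_on_diff(2)[OF I.sform_bilinear subspace_ind[OF C] subspace_ind[OF C] \<phi> th_closed[OF y g1] th_closed[OF y g2]]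
      by simp
    also have "I.sform \<phi> (theta y (\<gamma> (inv c) \<phi>)) = I.sform (\<gamma> c \<phi>) (\<gamma> c (theta y (\<gamma> (inv c) \<phi>)))"
      using \<gamma>_form[OF cC \<phi> th_closed[OF y g2]] by simp
    also have "\<gamma> c (theta y (\<gamma> (inv c) \<phi>)) = theta y \<phi>"
      using \<gamma>_theta[OF cC y g2] \<gamma>_inv(1)[OF cC \<phi>] by simp
    also have "I.sform (\<gamma> c \<phi>) (theta y \<phi>) = - I.sform (theta y \<phi>) (\<gamma> c \<phi>)"
      by (rule I.sform_skew[OF g1 th_closed[OF y \<phi>]])
    also have "I.sform (theta y \<phi>) (\<gamma> c \<phi>) = - I.sform \<phi> (theta y (\<gamma> c \<phi>))"
      by (rule skew[OF y sky \<phi> g1])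
    finally show ?thesis by simp
  qed
  have selfadj: "\<beta> (l \<phi>) \<psi> = \<beta> \<phi> (l \<psi>)" if l': "l \<in> lift ` L" and \<phi>: "\<phi> \<in> ?IC" and \<psi>: "\<psi> \<in> ?IC" for l \<phi> \<psi>
  proof -
    obtain l0 where l: "l0 \<in> L" "l = lift l0" using l' by blast
    have sf: "I.sform (lift l0 \<phi>) \<chi> = I.sform \<phi> (lift l0 \<chi>)" if "\<chi> \<in> ?IC" for \<chi>
      unfolding I.sform_def lift_def using L_selfadj[OF l(1)] indD(1)[OF \<phi>] indD(1)[OF that] I.tc
      by (intro sum.cong refl) auto
    have d1: "lift l0 (\<delta> \<psi>) = \<delta> (lift l0 \<psi>)"
    proof -
      have "lift l0 (\<gamma> c \<psi> - \<gamma> (inv c) \<psi>) = lift l0 (\<gamma> c \<psi>) - lift l0 (\<gamma> (inv c) \<psi>)"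
        using fn.linear_on_more(3)[OF lift_linear[OF l(1)] subspace_ind[OF trivial_subgroup]] \<gamma>_IC[OF cC \<psi>] \<gamma>_IC[OF ciC \<psi>] ICM by blast
      then show ?thesis using \<gamma>_lift[OF cC l(1) \<psi>] \<gamma>_lift[OF ciC l(1) \<psi>] by (simp add: \<delta>_def)
    qed
    have "lift l0 (theta y (\<delta> \<psi>)) = theta y (\<delta> (lift l0 \<psi>))"
      using lift_theta[OF l(1) y, of "\<delta> \<psi>"] \<delta>_IC[OF \<psi>] ICM d1 by auto
    then show ?thesis using sf[OF th_closed[OF y \<delta>_IC[OF \<psi>]]] by (simp add: \<beta>_def l(2))
  qed
  \<comment> \<open>The inclusion from right to left is the core. For \<open>\<psi>\<close> in the
    radical, \<open>y \<delta> \<psi>\<close> is in the Fitting component of \<open>yx\<close> and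
    orthogonal to that of \<open>xy\<close>, hence orthogonal to all of \<open>?Q\<close>, so its
    values lie in \<open>S\<close>. Applying \<open>x\<close> and inverting \<open>xy\<close> on
    Fitting components puts the values of \<open>\<delta> \<psi>\<close> into \<open>S\<close>. Then
    the square of \<open>c\<close> fixes the values of \<open>\<psi>\<close> modulo
    \<open>S\<close>, and \<open>maximal2\<close> applies.\<close>
  have rad: "fit (theta ?a) ?N = {\<psi> \<in> ?W. \<forall>\<phi>\<in>?W. \<beta> \<phi> \<psi> = 0}"
  proof
    have NQ: "?N \<subseteq> ?Q" using SP by (auto simp: I.sub_ind_def)
    have fQ: "finite ?Q" using finite_subset[OF subI finite_ind] .
    have fN: "fit (theta ?a) ?N = ?W \<inter> ?N"
      by (rule fit_sub[OF fQ thU[OF afam(1) iP] NQ thU[OF afam(1) iS]])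
    show "fit (theta ?a) ?N \<subseteq> {\<psi> \<in> ?W. \<forall>\<phi>\<in>?W. \<beta> \<phi> \<psi> = 0}"
    proof clarify
      fix \<psi> assume \<psi>: "\<psi> \<in> fit (theta ?a) ?N"
      then have \<psi>N: "\<psi> \<in> ?N" "\<psi> \<in> ?W" using fN by auto
      have "theta y (\<delta> \<psi>) \<in> ?N" using thU[OF y iS] \<delta>_sub[OF iS stS \<psi>N(1)] by blast
      then have "\<beta> \<phi> \<psi> = 0" if "\<phi> \<in> ?W" for \<phi>
        using that WQ I.sub_ind_perp[OF Sd(2,1) stS] unfolding \<beta>_def by blast
      then show "\<psi> \<in> ?W \<and> (\<forall>\<phi>\<in>?W. \<beta> \<phi> \<psi> = 0)" using \<psi>N(2) by blast
    qed
    show "{\<psi> \<in> ?W. \<forall>\<phi>\<in>?W. \<beta> \<phi> \<psi> = 0} \<subseteq> fit (theta ?a) ?N"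
    proof clarify
      fix \<psi> assume \<psi>: "\<psi> \<in> ?W" "\<forall>\<phi>\<in>?W. \<beta> \<phi> \<psi> = 0"
      have \<psi>I: "\<psi> \<in> ?IC" and \<psi>Q: "\<psi> \<in> ?Q" using \<psi>(1) WI WQ by auto
      let ?n = "theta y (\<delta> \<psi>)"
      have \<delta>Q: "\<delta> \<psi> \<in> ?Q" by (rule \<delta>_sub[OF iP stP \<psi>Q])
      have W_img: "theta ?a ` ?W = ?W" by (rule fit_image[OF fQ thU[OF afam(1) iP]])
      have \<delta>W: "\<delta> ` ?W \<subseteq> ?W"
      proof -
        obtain K where K: "\<forall>j\<ge>K. (theta ?a ^^ j) ` ?Q = ?W"
          using fit_eventually[OF fQ thU[OF afam(1) iP]] by blast
        have "(theta ?a ^^ j) (\<delta> \<phi>) = \<delta> ((theta ?a ^^ j) \<phi>)" if "\<phi> \<in> ?Q" for j \<phi>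
        proof (induction j)
          case (Suc j)
          have "(theta ?a ^^ j) \<phi> \<in> ?IC" using funpow_maps[OF thU[OF afam(1) iP] that, of j] subI by blast
          then show ?case using \<delta>_theta[OF afam(1)] Suc by simp
        qed simp
        then have "\<delta> ` ((theta ?a ^^ K) ` ?Q) \<subseteq> (theta ?a ^^ K) ` ?Q"
          using \<delta>_sub[OF iP stP] by (smt (verit) imageE imageI image_subsetI)
        then show ?thesis using K by simp
      qed
      have \<delta>\<psi>W: "\<delta> \<psi> \<in> ?W" using \<delta>W \<psi>(1) by blast
      have nfit: "?n \<in> fit (theta ?a') ?Q"
      proof -
        have "fit (theta ?a) ?Q = fit (theta x \<circ> theta y) ?Q"
          by (rule fit_cong[OF thU[OF afam(1) iP]]) (use th_a(1) subI in auto)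
        moreover have "fit (theta ?a') ?Q = fit (theta y \<circ> theta x) ?Q"
          by (rule fit_cong[OF thU[OF afam(2) iP]]) (use th_a(2) subI in auto)
        ultimately have "theta y ` ?W = fit (theta ?a') ?Q"
          using fit_swap(1)[OF fQ thU[OF x iP] thU[OF y iP]] by simp
        then show ?thesis using \<delta>\<psi>W by blast
      qed
      have "I.sform \<phi> ?n = 0" if \<phi>: "\<phi> \<in> ?Q" for \<phi>
      proof -
        have "I.sform \<phi>' ?n = 0" if "\<phi>' \<in> ?W" for \<phi>' using \<psi>(2) that unfolding \<beta>_def by blast
        moreover have "I.sform m' (theta ?a' m) = I.sform (theta ?a m') m" if "m \<in> ?Q" "m' \<in> ?Q" for m m'
          using adj[of m' m] that subI by (simp add: subset_iff)
        ultimately show ?thesis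
          using fn.fit_orthogonal[where A = ?Q and B = ?Q and T = "theta ?a'" and T' = "theta ?a" and f = "\<lambda>u v. I.sform v u" and z = ?n and b = \<phi>]
            fQ thU[OF afam(2) iP] thU[OF afam(1) iP] nfit \<phi> by simp
      qed
      then have "?n \<in> {\<chi> \<in> ?IC. \<forall>\<phi>\<in>?Q. I.sform \<chi> \<phi> = 0}"
        using th_closed[OF y \<delta>_IC[OF \<psi>I]] I.sform_skew[OF th_closed[OF y \<delta>_IC[OF \<psi>I]] subsetD[OF subI[of ?P]]] by auto
      then have nN: "?n \<in> ?N"
        using I.sub_ind_perp[OF Pd(2,1) stP] perpV_perpV[OF Sd(1,2)] by simp
      have "theta ?a (\<delta> \<psi>) \<in> ?N" using th_a(1)[OF \<delta>_IC[OF \<psi>I]] thU[OF x iS] nN by auto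
      moreover have "theta ?a (\<delta> \<psi>) \<in> ?W" using W_img \<delta>\<psi>W by blast
      ultimately have "theta ?a (\<delta> \<psi>) \<in> fit (theta ?a) ?N" using fN by blast
      moreover have "theta ?a ` fit (theta ?a) ?N = fit (theta ?a) ?N"
        by (rule fit_image[OF finite_subset[OF subI finite_ind] thU[OF afam(1) iS]])
      ultimately obtain \<chi> where \<chi>: "\<chi> \<in> fit (theta ?a) ?N" "theta ?a \<chi> = theta ?a (\<delta> \<psi>)" by (metis imageE)
      have "\<chi> = \<delta> \<psi>"
        by (rule inj_onD[OF fit_inj[OF fQ thU[OF afam(1) iP]]]) (use \<chi> fN \<delta>\<psi>W in auto)
      then have \<delta>N: "\<delta> \<psi> \<in> ?N" using \<chi>(1) fN by blast
      have "\<psi> z \<in> S" if z: "z \<in> carrier G" for z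
      proof (rule maximal2)
        show vP: "\<psi> z \<in> ?P" using \<psi>Q z by (simp add: I.sub_ind_def)
        then have vV: "\<psi> z \<in> V" using Pd(2) by blast
        have "\<rho> c (\<psi> z) - \<rho> (inv c) (\<psi> z) \<in> S" using \<delta>N z by (simp add: I.sub_ind_def \<delta>_def \<gamma>_def)
        then have "\<rho> c (\<rho> c (\<psi> z) - \<rho> (inv c) (\<psi> z)) \<in> S" by (rule cS)
        moreover have "\<rho> c (\<rho> c (\<psi> z) - \<rho> (inv c) (\<psi> z)) = \<rho> (c \<otimes> c) (\<psi> z) - \<psi> z"
          using linear_on_more(3)[OF \<rho>_linear[OF c] V_subspace] \<rho>_closed c vV \<rho>_inv(2)[OF c vV] \<rho>_mult[OF c c vV] by simp
        ultimately show "\<rho> (c \<otimes> c) (\<psi> z) - \<psi> z \<in> S" by simp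
      qed
      then have "\<psi> \<in> ?N" using \<psi>I by (simp add: I.sub_ind_def)
      then show "\<psi> \<in> fit (theta ?a) ?N" using fN \<psi>(1) by blast
    qed
  qed
  have "\<exists>j. card ?W = card (fit (theta ?a) ?N) * k ^ (2 * j)"
    by (rule ff.card_alternating[OF two inv_fit[OF iP] fn.bilinear_on_subset[OF bil WI WI] _ _ rad])
      (use alt selfadj WI in \<open>auto simp: subset_iff\<close>)
  then obtain j where "card ?W = card (fit (theta ?a) ?N) * k ^ (2 * j)" by blast
  \<comment> \<open>The radical and the part induced from \<open>S\<close> contribute one factor
    \<open>k ^ i\<close> each.\<close>
  then have "card (fit (theta ?a) ?IC) = k ^ (2 * (i + j))"
    using card1 swap i by (simp add: power_add algebra_simps mult_2 power_mult power2_eq_square)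
  then show ?thesis by blast
qed

text \<open>The operator \<open>x y\<close> maps \<open>V\<close> into the line of \<open>u\<close>
  and is injective on that line, so its Fitting component has order \<open>k\<close>. Writing
  \<open>k\<close> as q^n, with q the order of the scalar field, the transfer from cyclic subgroups
  with \<open>D\<close> equal to 2 n makes n |G| a multiple of 2 n.\<close>

lemma no_selfadj_commutant: False
proof -
  obtain u where u: "u \<in> V" "u \<noteq> 0" using V_nonzero V_0 by blast
  obtain w where w: "w \<in> V" "f u w \<noteq> 0" using f_nondeg[OF u(1)] u(2) by blast
  have wu: "f w u \<noteq> 0" using f_skew[OF w(1) u(1)] w(2) by simp
  obtain x where x: "x \<in> fam" "\<forall>g\<in>carrier G. \<forall>v\<in>V. star x g v = - x g v"
    "\<forall>v\<in>V. act x v \<in> fv.line u" "act x w \<noteq> 0" using ex_skew_rank_one[OF u(1) w] by blast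
  obtain y where y: "y \<in> fam" "\<forall>g\<in>carrier G. \<forall>v\<in>V. star y g v = - y g v"
    "\<forall>v\<in>V. act y v \<in> fv.line w" "act y u \<noteq> 0" using ex_skew_rank_one[OF w(1) u(1) wu] by blast
  let ?a = "conv_op x y" and ?q = "card (UNIV :: 'a set)"
  have a: "?a \<in> fam" by (rule fam_conv[OF x(1) y(1)])
  note ld = fv.inv_subD[OF fv.inv_sub_line(1)[OF u(1)]]
  have act_L: "act b (l v) = l (act b v)" if b: "b \<in> fam" and l: "l \<in> L" and v: "v \<in> V" for b l v
  proof (rule act_eqI)
    show "act b (l v) \<in> V" "l (act b v) \<in> V" using l v L_closed act_closed[OF b] by simp_all
    have "iota (act b (l v)) = theta b (lift l (iota v))"
      using theta_iota[OF b L_closed[OF l v]] lift_iota[OF l v] by simp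
    also have "\<dots> = lift l (iota (act b v))" using lift_theta[OF l b iota_M[OF v]] theta_iota[OF b v] by simp
    also have "\<dots> = iota (l (act b v))" using lift_iota[OF l act_closed[OF b v]] .
    finally show "iota (act b (l v)) = iota (l (act b v))" .
  qed
  have inj: "l v = 0 \<Longrightarrow> v = 0" if "l \<in> L" "v' \<in> V" "l v' \<noteq> 0" "v \<in> V" for l v v'
    using L_injective[OF that(1)] that(2-4) by blast
  have act_a: "act ?a v = act x (act y v)" if "v \<in> V" for v by (rule act_conv[OF x(1) y(1) that])
  have a_line: "act ?a v \<in> fv.line u" if "v \<in> V" for v
    using act_a[OF that] x(3) act_closed[OF y(1) that] by simp
  have a_u: "act ?a u \<noteq> 0"
  proof -
    obtain l where l: "l \<in> L" "act y u = l w" using y(3) u(1) by (auto simp: fv.line_def)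
    have "act ?a u = l (act x w)" using act_a[OF u(1)] l act_L[OF x(1) l(1) w(1)] by simp
    then show ?thesis using inj[OF l(1) w(1) _ act_closed[OF x(1) w(1)]] l(2) y(4) x(4) by auto
  qed
  have inj_line: "v = 0" if v: "v \<in> fv.line u" "act ?a v = 0" for v
  proof -
    obtain l where l: "l \<in> L" "v = l u" using v(1) by (auto simp: fv.line_def)
    have "l (act ?a u) = 0" using act_L[OF a l(1) u(1)] v(2) l(2) by simp
    then show ?thesis using inj[OF l(1) u(1) _ act_closed[OF a u(1)]] a_u l(2) by blast
  qed
  have fit: "fit (act ?a) V = fv.line u"
  proof
    have stab: "act ?a ` V \<subseteq> V" using act_closed[OF a] by blast
    have img: "act ?a ` fit (act ?a) V = fit (act ?a) V" by (rule fit_image[OF V_finite stab])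
    have "act ?a ` fit (act ?a) V \<subseteq> fv.line u" using a_line fit_subset[of "act ?a" V] by blast
    then show "fit (act ?a) V \<subseteq> fv.line u" unfolding img .
    have ll: "act ?a ` fv.line u \<subseteq> fv.line u" using a_line ld(2) by blast
    have "inj_on (act ?a) (fv.line u)"
      by (rule additive_on_inj[OF subspace_add_subgroup[OF ld(1)] additive_on_subset[OF linear_onD(2)[OF act_linear[OF a]] ld(2)] inj_line])
    then have eq: "act ?a ` fv.line u = fv.line u" using ll ld(4) by (metis endo_inj_surj)
    have "(act ?a ^^ n) ` fv.line u = fv.line u" for n
    proof (induction n)
      case (Suc n)
      have "(act ?a ^^ Suc n) ` fv.line u = act ?a ` ((act ?a ^^ n) ` fv.line u)" by (simp add: image_image)
      then show ?case using Suc eq by simp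
    qed simp
    then show "fv.line u \<subseteq> fit (act ?a) V" unfolding fit_def using ld(2) by blast
  qed
  have cardG: "card (fit (theta ?a) (ind (carrier G))) = k"
    using card_fit_act[OF a] fit fv.\<Lambda>_card[OF u] by (simp add: fv.line_def)
  obtain n b \<kappa> where "coords (fv.line u) n b \<kappa>" using ex_coords[OF ld(1,4)] by blast
  from card_coords[OF this ld(1)] have kq: "k = ?q ^ n" using fv.\<Lambda>_card[OF u] by (simp add: fv.line_def)
  have q1: "?q > 1"
  proof -
    have "card {0, 1 :: 'a} \<le> ?q" by (rule card_mono) auto
    then show ?thesis by simp
  qed
  have n0: "n > 0" using fv.k_gt_1[OF u] kq by (cases n) auto
  have "\<exists>m. card (fit (theta ?a) (ind (carrier G))) ^ card (carrier G) = ?q ^ (2 * n * m)"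
  proof (rule fit_exponent[OF fam_coef[OF a]])
    fix c assume c: "c \<in> carrier G"
    obtain j where "card (fit (theta ?a) (ind (generate G {c}))) = k ^ (2 * j)"
      using card_fit_cyclic[OF c x(1) y(1)] x(2) y(2) by blast
    then have "card (fit (theta ?a) (ind (generate G {c}))) = ?q ^ (2 * n * j)"
      using kq by (simp add: power_mult[symmetric] algebra_simps)
    then show "\<exists>m. card (fit (theta ?a) (ind (generate G {c}))) = ?q ^ (2 * n * m)" by blast
  qed
  then obtain m where "?q ^ (n * card (carrier G)) = ?q ^ (2 * n * m)"
    using cardG kq by (auto simp: power_mult[symmetric])
  then have "n * card (carrier G) = 2 * n * m" using q1 by simp
  then have "card (carrier G) = 2 * m" using n0 by simp
  then show False using odd_G by simp
qed

end

section \<open>Adjoints of endomorphisms\<close>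

text \<open>Counting: \<open>sq\<close> is at most two-to-one, and the fibre through
  \<open>z\<close> is a single point, so \<open>sq\<close> takes more than |K|/2 values. Two subsets
  of \<open>K\<close> of this size meet. The abstract form is meant for a field that is given as a
  set of operators.\<close>

lemma ex_common_value:
  fixes K :: "'x set"
  assumes K: "finite K" "z \<in> K" "neg z = z"
    and sq: "\<And>x y. x \<in> K \<Longrightarrow> y \<in> K \<Longrightarrow> sq x = sq y \<Longrightarrow> y = x \<or> y = neg x"
    and sqK: "\<And>x. x \<in> K \<Longrightarrow> sq x \<in> K" and gK: "\<And>x. x \<in> K \<Longrightarrow> g (sq x) \<in> K" and inj: "inj_on g (sq ` K)"
  shows "\<exists>x\<in>K. \<exists>y\<in>K. sq x = g (sq y)"
proof (rule ccontr)
  assume "\<not> ?thesis"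
  then have disj: "sq ` K \<inter> g ` sq ` K = {}" by blast
  let ?A = "sq ` K" and ?r = "inv_into K sq"
  have fin: "finite ?A" "finite (?r ` ?A)" "finite (neg ` ?r ` ?A)" using K(1) by auto
  have r: "?r (sq x) \<in> K" "sq (?r (sq x)) = sq x" if "x \<in> K" for x
    using that inv_into_into[of "sq x" sq K] f_inv_into_f[of "sq x" sq K] by auto
  have "K \<subseteq> ?r ` ?A \<union> neg ` ?r ` ?A"
  proof
    fix x assume x: "x \<in> K"
    then show "x \<in> ?r ` ?A \<union> neg ` ?r ` ?A" using sq[OF r(1)[OF x] x r(2)[OF x]] by blast
  qed
  then have "card K \<le> card (?r ` ?A \<union> neg ` ?r ` ?A)" using fin by (intro card_mono) auto
  moreover have "card (?r ` ?A \<union> neg ` ?r ` ?A) + card (?r ` ?A \<inter> neg ` ?r ` ?A) = card (?r ` ?A) + card (neg ` ?r ` ?A)"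
    using card_Un_Int[OF fin(2,3)] by simp
  moreover have "card (?r ` ?A) \<le> card ?A" using fin(1) by (rule card_image_le)
  moreover have "card (neg ` ?r ` ?A) \<le> card (?r ` ?A)" using fin(2) by (rule card_image_le)
  moreover have "card (?r ` ?A \<inter> neg ` ?r ` ?A) > 0"
  proof -
    have "?r (sq z) = z" using sq[OF K(2) r(1)[OF K(2)] r(2)[OF K(2), symmetric]] K(3) by auto
    then have "z \<in> ?r ` ?A \<inter> neg ` ?r ` ?A" using K(2,3) by (metis IntI imageI)
    then show ?thesis using fin by (auto simp: card_gt_0_iff)
  qed
  moreover have "card ?A + card (g ` ?A) \<le> card K"
  proof -
    have "card (?A \<union> g ` ?A) = card ?A + card (g ` ?A)" using disj fin(1) by (intro card_Un_disjoint) auto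
    moreover have "?A \<union> g ` ?A \<subseteq> K" using sqK gK by blast
    ultimately show ?thesis using card_mono[OF K(1)] by metis
  qed
  moreover have "card (g ` ?A) = card ?A" using inj by (rule card_image)
  ultimately show False by linarith
qed

context symplectic_rep
begin

lemma symplectic_rep_restrict:
  assumes U: "subspace U" "U \<subseteq> V" "stable (carrier G) U" and nd: "\<And>u. u \<in> U \<Longrightarrow> (\<And>w. w \<in> U \<Longrightarrow> f u w = 0) \<Longrightarrow> u = 0"
  shows "symplectic_rep scale G U \<rho> f"
proof (intro symplectic_rep.intro group_rep.intro group_rep_axioms.intro symplectic_rep_axioms.intro
    finite_field_space_axioms is_group fin_G U(1))
  show "finite U" using U(2) V_finite by (rule finite_subset)
  show "linear_on U (\<rho> g)" if "g \<in> carrier G" for g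
    using linear_on_sub[OF \<rho>_linear[OF that] U(2)] U(3) that by (simp add: stable_def)
  show "\<rho> \<one> v = v" if "v \<in> U" for v using \<rho>_one that U(2) by blast
  show "\<rho> (g \<otimes> h) v = \<rho> g (\<rho> h v)" if "g \<in> carrier G" "h \<in> carrier G" "v \<in> U" for g h v
    using \<rho>_mult that U(2) by blast
  show "bilinear_on U U f" by (rule bilinear_on_subset[OF f_bilinear U(2) U(2)])
  show "f v v = 0" if "v \<in> U" for v using f_alt that U(2) by blast
  show "v = 0" if "v \<in> U" "\<And>w. w \<in> U \<Longrightarrow> f v w = 0" for v using nd that by blast
  show "f (\<rho> g v) (\<rho> g w) = f v w" if "g \<in> carrier G" "v \<in> U" "w \<in> U" for g v w
    using f_invariant that U(2) by blast
qed (fact odd_G two)+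

text \<open>A nonzero vector perpendicular to the kernel of \<open>h\<close> represents
  \<open>h\<close> up to a scalar.\<close>

lemma ex_functional_vector:
  assumes add: "\<And>x y. x \<in> V \<Longrightarrow> y \<in> V \<Longrightarrow> h (x + y) = h x + h y" and sc: "\<And>c x. x \<in> V \<Longrightarrow> h (scale c x) = c * h x"
  shows "\<exists>u\<in>V. \<forall>y\<in>V. f u y = h y"
proof (cases "\<forall>y\<in>V. h y = 0")
  case True
  then show ?thesis using V_0 f_zero(1)[OF V_0] by (intro bexI[of _ 0]) auto
next
  case False
  then obtain y0 where y0: "y0 \<in> V" "h y0 \<noteq> 0" by blast
  let ?K = "{y \<in> V. h y = 0}"
  have K: "subspace ?K" "?K \<subseteq> V"
    unfolding subspace_def using V_0 V_add V_scale add sc sc[OF V_0, of 0] by auto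
  have "perpV ?K \<noteq> {0}"
  proof
    assume "perpV ?K = {0}"
    then have "card ?K = card V" using card_perpV[OF K] by simp
    then have "?K = V" using card_subset_eq[OF V_finite K(2)] by blast
    then show False using y0 by blast
  qed
  then obtain u0 where u0: "u0 \<in> perpV ?K" "u0 \<noteq> 0" using subspace_0[OF subspace_perpV[OF K(2)]] by blast
  have u0V: "u0 \<in> V" using u0(1) perpV_subset by blast
  have key: "f u0 y = h y / h y0 * f u0 y0" if y: "y \<in> V" for y
  proof -
    let ?s = "scale (- (h y / h y0)) y0"
    have "h (y + ?s) = 0" using add[OF y V_scale[OF y0(1)]] sc[OF y0(1)] y0(2) by (simp del: scale_minus_left)
    then have "f u0 (y + ?s) = 0" using u0(1) V_add[OF y V_scale[OF y0(1), of "- (h y / h y0)"]] by (simp add: perpV_def)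
    moreover have "f u0 (y + ?s) = f u0 y + f u0 ?s" by (rule fD(3)[OF u0V y V_scale[OF y0(1)]])
    moreover have "f u0 ?s = - (h y / h y0) * f u0 y0" by (rule fD(4)[OF u0V y0(1)])
    ultimately show ?thesis by (simp del: scale_minus_left)
  qed
  have nz: "f u0 y0 \<noteq> 0"
  proof
    assume "f u0 y0 = 0"
    then have "f u0 y = 0" if "y \<in> V" for y using key[OF that] by simp
    then show False using f_nondeg[OF u0V] u0(2) by blast
  qed
  have "f (scale (h y0 / f u0 y0) u0) y = h y" if y: "y \<in> V" for y
    using fD(2)[OF u0V y, of "h y0 / f u0 y0"] key[OF y] nz y0(2) by simp
  then show ?thesis using V_scale[OF u0V] by blast
qed

section \<open>Equivariant endomorphisms and their adjoints\<close>

text \<open>The value 0 outside \<open>V\<close> makes equality of functions the same as equality on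
  \<open>V\<close> and keeps the set finite.\<close>

definition endos :: "('b \<Rightarrow> 'b) set"
  where "endos = {\<theta>. linear_on V \<theta> \<and> (\<forall>g\<in>carrier G. \<forall>v\<in>V. \<theta> (\<rho> g v) = \<rho> g (\<theta> v)) \<and> (\<forall>v. v \<notin> V \<longrightarrow> \<theta> v = 0)}"

lemma endosD:
  assumes "\<theta> \<in> endos"
  shows "linear_on V \<theta>" "\<And>g v. g \<in> carrier G \<Longrightarrow> v \<in> V \<Longrightarrow> \<theta> (\<rho> g v) = \<rho> g (\<theta> v)" "\<And>v. v \<notin> V \<Longrightarrow> \<theta> v = 0"
    "\<And>v. v \<in> V \<Longrightarrow> \<theta> v \<in> V" "\<And>v w. v \<in> V \<Longrightarrow> w \<in> V \<Longrightarrow> \<theta> (v + w) = \<theta> v + \<theta> w"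
    "\<And>v. v \<in> V \<Longrightarrow> \<theta> (- v) = - \<theta> v" "\<theta> 0 = 0"
proof -
  show l: "linear_on V \<theta>" using assms by (simp add: endos_def)
  show "\<theta> (\<rho> g v) = \<rho> g (\<theta> v)" if "g \<in> carrier G" "v \<in> V" for g v using assms that by (simp add: endos_def)
  show "\<theta> v = 0" if "v \<notin> V" for v using assms that by (simp add: endos_def)
qed (use linear_onD linear_on_more V_subspace assms in \<open>auto simp: endos_def\<close>)

lemma finite_endos: "finite endos"
proof -
  have "endos \<subseteq> {\<theta>. \<forall>x. (x \<in> V \<longrightarrow> \<theta> x \<in> V) \<and> (x \<notin> V \<longrightarrow> \<theta> x = 0)}" using endosD(3,4) by blast
  then show ?thesis using finite_set_of_finite_funs[OF V_finite V_finite] by (rule finite_subset)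
qed

lemma endos_zero: "(\<lambda>v. 0) \<in> endos"
  using V_0 linear_on_more(1)[OF \<rho>_linear V_subspace] by (auto simp: endos_def intro!: linear_onI)

lemma endos_plus:
  assumes "\<theta> \<in> endos" "\<eta> \<in> endos"
  shows "(\<lambda>v. \<theta> v + \<eta> v) \<in> endos"
proof -
  note a = endosD[OF assms(1)] and b = endosD[OF assms(2)]
  have "linear_on V (\<lambda>v. \<theta> v + \<eta> v)"
    using a(4,5) b(4,5) V_add linear_onD(3)[OF a(1)] linear_onD(3)[OF b(1)]
    by (intro linear_onI) (simp_all add: scale_right_distrib)
  then show ?thesis using a(2,3,4) b(2,3,4) linear_onD(4)[OF \<rho>_linear] by (simp add: endos_def)
qed

lemma endos_neg:
  assumes "\<theta> \<in> endos"
  shows "(\<lambda>v. - \<theta> v) \<in> endos"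
proof -
  note a = endosD[OF assms]
  have "linear_on V (\<lambda>v. - \<theta> v)"
    using a(4,5) V_neg linear_onD(3)[OF a(1)] by (intro linear_onI) simp_all
  then show ?thesis using a(2,3,4) linear_on_more(2)[OF \<rho>_linear V_subspace] by (simp add: endos_def)
qed

lemma endos_comp:
  assumes "\<theta> \<in> endos" "\<eta> \<in> endos"
  shows "(\<lambda>v. \<theta> (\<eta> v)) \<in> endos"
proof -
  note a = endosD[OF assms(1)] and b = endosD[OF assms(2)]
  have "linear_on V (\<lambda>v. \<theta> (\<eta> v))"
    using a(4,5) b(4,5) linear_onD(3)[OF a(1)] linear_onD(3)[OF b(1)] by (intro linear_onI) simp_all
  then show ?thesis using a(2,7) b(2,3,4) by (simp add: endos_def)
qed

lemma endos_cut:
  assumes l: "linear_on V \<theta>" and "\<And>g v. g \<in> carrier G \<Longrightarrow> v \<in> V \<Longrightarrow> \<theta> (\<rho> g v) = \<rho> g (\<theta> v)"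
  shows "(\<lambda>v. if v \<in> V then \<theta> v else 0) \<in> endos"
proof -
  have "linear_on V (\<lambda>v. if v \<in> V then \<theta> v else 0)"
    using linear_onD[OF l] V_add V_scale by (intro linear_onI) simp_all
  then show ?thesis using assms(2) \<rho>_closed by (simp add: endos_def)
qed

lemma endos_scalar: "(\<lambda>v. if v \<in> V then scale c v else 0) \<in> endos"
proof (rule endos_cut)
  show "linear_on V (scale c)" using V_scale by (intro linear_onI) (simp_all add: scale_right_distrib scale_left_commute)
qed (use linear_onD(3)[OF \<rho>_linear] in simp)

lemma endos_eqI:
  assumes "\<theta> \<in> endos" "\<eta> \<in> endos" and eq: "\<And>x y. x \<in> V \<Longrightarrow> y \<in> V \<Longrightarrow> f (\<theta> x) y = f (\<eta> x) y"
  shows "\<theta> = \<eta>"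
proof
  fix x
  note a = endosD[OF assms(1)] and b = endosD[OF assms(2)]
  show "\<theta> x = \<eta> x"
  proof (cases "x \<in> V")
    case True
    have "f (\<theta> x - \<eta> x) y = 0" if "y \<in> V" for y
      using f_diff(1)[OF a(4)[OF True] b(4)[OF True] that] eq[OF True that] by simp
    then have "\<theta> x - \<eta> x = 0" using f_nondeg[OF V_diff[OF a(4)[OF True] b(4)[OF True]]] by blast
    then show ?thesis by simp
  qed (use a(3) b(3) in simp)
qed

text \<open>Nondegeneracy represents each functional \<open>b x\<close> by a vector. Uniqueness of
  this vector gives linearity in \<open>x\<close> and equivariance.\<close>

lemma ex_representing_endo:
  assumes b: "bilinear_on V V b" and inv: "\<And>g x y. g \<in> carrier G \<Longrightarrow> x \<in> V \<Longrightarrow> y \<in> V \<Longrightarrow> b (\<rho> g x) (\<rho> g y) = b x y"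
  shows "\<exists>e\<in>endos. \<forall>x\<in>V. \<forall>y\<in>V. f (e x) y = b x y"
proof -
  note bD = bilinear_onD[OF b]
  have "\<forall>x\<in>V. \<exists>u. u \<in> V \<and> (\<forall>y\<in>V. f u y = b x y)"
    using ex_functional_vector bD(3,4) by (metis (no_types, lifting))
  then obtain e0 where e0: "\<And>x. x \<in> V \<Longrightarrow> e0 x \<in> V" "\<And>x y. x \<in> V \<Longrightarrow> y \<in> V \<Longrightarrow> f (e0 x) y = b x y"
    by (metis (no_types, lifting) bchoice)
  have eq: "u = v" if uv: "u \<in> V" "v \<in> V" and *: "\<And>y. y \<in> V \<Longrightarrow> f u y = f v y" for u v
  proof -
    have "f (u - v) y = 0" if "y \<in> V" for y using f_diff(1)[OF uv that] *[OF that] by simp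
    then have "u - v = 0" using f_nondeg[OF V_diff[OF uv]] by blast
    then show ?thesis by simp
  qed
  have lin: "linear_on V e0"
  proof (rule linear_onI)
    show "e0 x \<in> V" if "x \<in> V" for x using e0(1) that .
    show "e0 (x + y) = e0 x + e0 y" if xy: "x \<in> V" "y \<in> V" for x y
      by (rule eq[OF e0(1)[OF V_add[OF xy]] V_add[OF e0(1)[OF xy(1)] e0(1)[OF xy(2)]]])
        (use e0 xy V_add fD(1) bD(1) in simp)
    show "e0 (scale c x) = scale c (e0 x)" if x: "x \<in> V" for c x
      by (rule eq[OF e0(1)[OF V_scale[OF x]] V_scale[OF e0(1)[OF x]]])
        (use e0 x V_scale fD(2) bD(2) in simp)
  qed
  have comm: "e0 (\<rho> g x) = \<rho> g (e0 x)" if g: "g \<in> carrier G" and x: "x \<in> V" for g x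
  proof (rule eq[OF e0(1)[OF \<rho>_closed[OF g x]] \<rho>_closed[OF g e0(1)[OF x]]])
    fix y assume y: "y \<in> V"
    have iy: "\<rho> (inv g) y \<in> V" using g y \<rho>_closed by simp
    have "f (e0 (\<rho> g x)) y = b (\<rho> g x) (\<rho> g (\<rho> (inv g) y))"
      using e0(2)[OF \<rho>_closed[OF g x] y] \<rho>_inv(2)[OF g y] by simp
    also have "\<dots> = b x (\<rho> (inv g) y)" by (rule inv[OF g x iy])
    also have "\<dots> = f (e0 x) (\<rho> (inv g) y)" using e0(2)[OF x iy] by simp
    also have "\<dots> = f (\<rho> g (e0 x)) y" using f_move[OF g e0(1)[OF x] y] by simp
    finally show "f (e0 (\<rho> g x)) y = f (\<rho> g (e0 x)) y" .
  qed
  show ?thesis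
    by (rule bexI[OF _ endos_cut[OF lin comm]]) (use e0(2) in simp_all)
qed

definition dag :: "('b \<Rightarrow> 'b) \<Rightarrow> 'b \<Rightarrow> 'b"
  where "dag \<theta> = (SOME \<eta>. \<eta> \<in> endos \<and> (\<forall>x\<in>V. \<forall>y\<in>V. f (\<eta> x) y = f x (\<theta> y)))"

lemma dag:
  assumes "\<theta> \<in> endos"
  shows "dag \<theta> \<in> endos" "\<And>x y. x \<in> V \<Longrightarrow> y \<in> V \<Longrightarrow> f (dag \<theta> x) y = f x (\<theta> y)"
    "\<And>x y. x \<in> V \<Longrightarrow> y \<in> V \<Longrightarrow> f (\<theta> x) y = f x (dag \<theta> y)"
proof -
  note a = endosD[OF assms]
  have "bilinear_on V V (\<lambda>x y. f x (\<theta> y))"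
    unfolding bilinear_on_def using a(4,5) linear_onD(3)[OF a(1)] fD by simp
  moreover have "f (\<rho> g x) (\<theta> (\<rho> g y)) = f x (\<theta> y)" if "g \<in> carrier G" "x \<in> V" "y \<in> V" for g x y
    using a(2)[OF that(1,3)] f_invariant[OF that(1,2) a(4)[OF that(3)]] by simp
  ultimately have "\<exists>e\<in>endos. \<forall>x\<in>V. \<forall>y\<in>V. f (e x) y = f x (\<theta> y)" by (rule ex_representing_endo)
  then have "\<exists>\<eta>. \<eta> \<in> endos \<and> (\<forall>x\<in>V. \<forall>y\<in>V. f (\<eta> x) y = f x (\<theta> y))" by blast
  from someI_ex[OF this] have d: "dag \<theta> \<in> endos" "\<forall>x\<in>V. \<forall>y\<in>V. f (dag \<theta> x) y = f x (\<theta> y)"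
    unfolding dag_def by blast+
  show "dag \<theta> \<in> endos" by (rule d(1))
  show *: "f (dag \<theta> x) y = f x (\<theta> y)" if "x \<in> V" "y \<in> V" for x y using d(2) that by blast
  show "f (\<theta> x) y = f x (dag \<theta> y)" if xy: "x \<in> V" "y \<in> V" for x y
  proof -
    have "f (\<theta> x) y = - f y (\<theta> x)" by (rule f_skew[OF a(4)[OF xy(1)] xy(2)])
    also have "\<dots> = - f (dag \<theta> y) x" using *[OF xy(2,1)] by simp
    also have "\<dots> = f x (dag \<theta> y)" using f_skew[OF xy(1) endosD(4)[OF d(1) xy(2)]] by simp
    finally show ?thesis .
  qed
qed

lemma dag_unique:
  assumes "\<theta> \<in> endos" "\<eta> \<in> endos" "\<And>x y. x \<in> V \<Longrightarrow> y \<in> V \<Longrightarrow> f (\<eta> x) y = f x (\<theta> y)"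
  shows "dag \<theta> = \<eta>"
  by (rule endos_eqI[OF dag(1)[OF assms(1)] assms(2)]) (use dag(2)[OF assms(1)] assms(3) in simp)

lemma dag_dag: "\<theta> \<in> endos \<Longrightarrow> dag (dag \<theta>) = \<theta>"
  by (rule dag_unique[OF dag(1)]) (auto simp: dag)

lemma endos_schur:
  assumes irr: "\<And>U. subspace U \<Longrightarrow> U \<subseteq> V \<Longrightarrow> stable (carrier G) U \<Longrightarrow> U = {0} \<or> U = V" and l: "l \<in> endos"
  shows "(\<forall>v\<in>V. l v = 0) \<or> (\<forall>v\<in>V. l v = 0 \<longrightarrow> v = 0)"
proof -
  note a = endosD[OF l]
  have "subspace {v \<in> V. l v = 0}"
    unfolding subspace_def using V_0 V_add V_scale a(5,7) linear_onD(3)[OF a(1)] by auto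
  moreover have "stable (carrier G) {v \<in> V. l v = 0}"
    unfolding stable_def using a(2) \<rho>_closed linear_on_more(1)[OF \<rho>_linear V_subspace] by auto
  ultimately have "{v \<in> V. l v = 0} = {0} \<or> {v \<in> V. l v = 0} = V" using irr by blast
  then show ?thesis by blast
qed

text \<open>The equation for \<open>c\<close> is solved inside a maximal commutative family closed
  under adjoints. On a family fixed by the adjunction it may be unsolvable, but
  \<open>no_selfadj_commutant\<close> excludes this case. Otherwise there is a nonzero skew element,
  and the equation becomes one about two squares in the fixed part, as for norms in a quadratic
  extension of finite fields.\<close>

lemma ex_norm:
  assumes V: "V \<noteq> {0}" and irr: "\<And>U. subspace U \<Longrightarrow> U \<subseteq> V \<Longrightarrow> stable (carrier G) U \<Longrightarrow> U = {0} \<or> U = V"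
    and e: "e \<in> endos" "dag e = e"
  shows "\<exists>c\<in>endos. (\<forall>x\<in>V. dag c (c x) = - e x) \<and> (\<forall>x\<in>V. c (e x) = e (c x))"
proof -
  define cm where "cm l m \<longleftrightarrow> (\<forall>v\<in>V. l (m v) = m (l v))" for l m :: "'b \<Rightarrow> 'b"
  have cm_sym: "cm l m \<Longrightarrow> cm m l" and cm_refl: "cm l l" for l m by (simp_all add: cm_def)
  let ?good = "\<lambda>Z. Z \<subseteq> endos \<and> dag ` Z \<subseteq> Z \<and> (\<forall>l\<in>Z. \<forall>m\<in>Z. cm l m) \<and> e \<in> Z"
  have "?good {e}" using e by (simp add: cm_refl)
  then have "\<exists>Z. ?good Z \<and> (\<forall>Z'. ?good Z' \<longrightarrow> card Z' \<le> card Z)"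
    by (rule ex_has_greatest_nat[where b = "Suc (card endos)"])
      (auto simp: less_Suc_eq_le intro: card_mono[OF finite_endos])
  then obtain L where L: "?good L" and max: "\<And>Z'. ?good Z' \<Longrightarrow> card Z' \<le> card L" by blast
  have LE: "l \<in> endos" and Ldag: "dag l \<in> L" if "l \<in> L" for l using L that by blast+
  have Lcm: "cm l m" if "l \<in> L" "m \<in> L" for l m using L that by blast
  have Lfin: "finite L" using L finite_endos finite_subset by blast
  have eL: "e \<in> L" using L by blast
  have cm_dag: "cm (dag z) l" if z: "z \<in> endos" and l: "l \<in> endos" and c: "cm z (dag l)" for z l
  proof -
    have "(\<lambda>v. dag z (l v)) = (\<lambda>v. l (dag z v))"
    proof (rule endos_eqI[OF endos_comp[OF dag(1)[OF z] l] endos_comp[OF l dag(1)[OF z]]])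
      fix x y assume x: "x \<in> V" and y: "y \<in> V"
      note zc = endosD(4)[OF z] and lc = endosD(4)[OF l] and zd = endosD(4)[OF dag(1)[OF z]] and ldc = endosD(4)[OF dag(1)[OF l]]
      have "f (dag z (l x)) y = f (l x) (z y)" by (rule dag(2)[OF z lc[OF x] y])
      also have "\<dots> = f x (dag l (z y))" by (rule dag(3)[OF l x zc[OF y]])
      also have "dag l (z y) = z (dag l y)" using c y by (simp add: cm_def)
      also have "f x (z (dag l y)) = f (dag z x) (dag l y)" by (rule dag(2)[OF z x ldc[OF y], symmetric])
      also have "\<dots> = f (l (dag z x)) y" by (rule dag(3)[OF l zd[OF x] y, symmetric])
      finally show "f (dag z (l x)) y = f (l (dag z x)) y" .
    qed
    then show ?thesis unfolding cm_def by metis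
  qed
  \<comment> \<open>An element commuting with \<open>L\<close> and with its own adjoint could be
    added to \<open>L\<close> together with that adjoint, so maximality puts it into
    \<open>L\<close>.\<close>
  have max_mem: "z \<in> L" if z: "z \<in> endos" and zl: "\<And>l. l \<in> L \<Longrightarrow> cm z l" and zz: "cm z (dag z)" for z
  proof -
    let ?Z = "insert z (insert (dag z) L)"
    have dl: "cm (dag z) l" if "l \<in> L" for l by (rule cm_dag[OF z LE[OF that] zl[OF Ldag[OF that]]])
    have "cm l m" if lm: "l \<in> ?Z" "m \<in> ?Z" for l m
    proof -
      have "l = z \<or> l = dag z \<or> l \<in> L" "m = z \<or> m = dag z \<or> m \<in> L" using lm by auto
      then show ?thesis using zl dl zz Lcm cm_sym cm_refl by metis
    qed
    moreover have "?Z \<subseteq> endos" using z dag(1)[OF z] LE by auto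
    moreover have "dag ` ?Z \<subseteq> ?Z" using dag_dag[OF z] Ldag by auto
    ultimately have "card ?Z \<le> card L" using max[of ?Z] eL by blast
    moreover have "finite ?Z" using Lfin by simp
    ultimately have "?Z = L" using card_seteq[of ?Z L] by blast
    then show ?thesis by blast
  qed
  \<comment> \<open>Elements of the double commutant of \<open>L\<close> belong to \<open>L\<close>.
    Each closure property of \<open>L\<close> below is an instance of this.\<close>
  have dc: "z \<in> L" if z: "z \<in> endos" and m: "\<And>m. m \<in> endos \<Longrightarrow> (\<And>l. l \<in> L \<Longrightarrow> cm m l) \<Longrightarrow> cm m z" for z
  proof (rule max_mem[OF z])
    show zl: "cm z l" if "l \<in> L" for l using m[OF LE[OF that] Lcm[OF that]] by (rule cm_sym)
    have "cm (dag z) l" if "l \<in> L" for l by (rule cm_dag[OF z LE[OF that] zl[OF Ldag[OF that]]])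
    from m[OF dag(1)[OF z] this] show "cm z (dag z)" by (rule cm_sym)
  qed
  have plus: "(\<lambda>v. a v + b v) \<in> L" if ab: "a \<in> L" "b \<in> L" for a b
  proof (rule dc[OF endos_plus[OF LE[OF ab(1)] LE[OF ab(2)]]])
    fix m assume m: "m \<in> endos" "\<And>l. l \<in> L \<Longrightarrow> cm m l"
    show "cm m (\<lambda>v. a v + b v)"
      using m(2)[OF ab(1)] m(2)[OF ab(2)] endosD(5)[OF m(1)] endosD(4)[OF LE[OF ab(1)]] endosD(4)[OF LE[OF ab(2)]]
      by (simp add: cm_def)
  qed
  have neg: "(\<lambda>v. - a v) \<in> L" if a: "a \<in> L" for a
  proof (rule dc[OF endos_neg[OF LE[OF a]]])
    fix m assume m: "m \<in> endos" "\<And>l. l \<in> L \<Longrightarrow> cm m l"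
    show "cm m (\<lambda>v. - a v)"
      using m(2)[OF a] endosD(6)[OF m(1)] endosD(4)[OF LE[OF a]] by (simp add: cm_def)
  qed
  have comp: "(\<lambda>v. a (b v)) \<in> L" if ab: "a \<in> L" "b \<in> L" for a b
  proof (rule dc[OF endos_comp[OF LE[OF ab(1)] LE[OF ab(2)]]])
    fix m assume m: "m \<in> endos" "\<And>l. l \<in> L \<Longrightarrow> cm m l"
    show "cm m (\<lambda>v. a (b v))"
      using m(2)[OF ab(1)] m(2)[OF ab(2)] endosD(4)[OF LE[OF ab(2)]] by (simp add: cm_def)
  qed
  have zero: "(\<lambda>v. 0) \<in> L"
    by (rule dc[OF endos_zero]) (simp add: cm_def endosD(7))
  have scalar: "(\<lambda>v. if v \<in> V then scale c v else 0) \<in> L" for c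
  proof (rule dc[OF endos_scalar])
    fix m assume m: "m \<in> endos"
    show "cm m (\<lambda>v. if v \<in> V then scale c v else 0)"
      using linear_onD(3)[OF endosD(1)[OF m]] endosD(4)[OF m] by (simp add: cm_def)
  qed
  have "\<exists>s\<in>L. dag s \<noteq> s"
  proof (rule ccontr)
    assume "\<not> ?thesis"
    then have triv: "dag l = l" if "l \<in> L" for l using that by blast
    interpret I: simple_coef_ring scale G V \<rho> f L
    proof (intro simple_coef_ring.intro coef_ring.intro symplectic_rep_axioms coef_ring_axioms.intro simple_coef_ring_axioms.intro)
      show "l (m v) = m (l v)" if "l \<in> L" "m \<in> L" "v \<in> V" for l m v using Lcm[OF that(1,2)] that(3) by (simp add: cm_def)
      show "f (l v) w = f v (l w)" if "l \<in> L" "v \<in> V" "w \<in> V" for l v w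
        using dag(3)[OF LE[OF that(1)] that(2,3)] triv[OF that(1)] by simp
      show "\<exists>l\<in>L. \<forall>v\<in>V. l v = scale c v" for c using scalar[of c] by (rule bexI[rotated]) simp
      show "U = {0} \<or> U = V" if "subspace U" "U \<subseteq> V" "stable (carrier G) U" for U using irr that by blast
      \<comment> \<open>The cut-off \<open>t\<close> of \<open>\<theta>\<close> is not known to
        commute with its adjoint, but the sum and the difference of the two satisfy the conditions
        of \<open>max_mem\<close>. The difference is fixed by the adjunction, like all of
        \<open>L\<close>, and is also negated by it. So it is zero, and \<open>t\<close> is half of
        the sum.\<close>
      show "\<exists>l\<in>L. \<forall>v\<in>V. \<theta> v = l v" if \<theta>: "linear_on V \<theta>" "\<And>g v. g \<in> carrier G \<Longrightarrow> v \<in> V \<Longrightarrow> \<theta> (\<rho> g v) = \<rho> g (\<theta> v)"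
        "\<And>l v. l \<in> L \<Longrightarrow> v \<in> V \<Longrightarrow> \<theta> (l v) = l (\<theta> v)" for \<theta>
      proof -
        define t where "t = (\<lambda>v. if v \<in> V then \<theta> v else 0)"
        have t: "t \<in> endos" unfolding t_def by (rule endos_cut[OF \<theta>(1,2)])
        have tl: "cm t l" if "l \<in> L" for l
          using \<theta>(3)[OF that] endosD(4)[OF LE[OF that]] by (simp add: cm_def t_def)
        note dt = dag[OF t] and tD = endosD[OF t] and dD = endosD[OF dag(1)[OF t]]
        have dl: "cm (dag t) l" if "l \<in> L" for l by (rule cm_dag[OF t LE[OF that] tl[OF Ldag[OF that]]])
        let ?s = "\<lambda>v. t v + dag t v" and ?d = "\<lambda>v. t v + - dag t v"
        have s: "?s \<in> endos" and d: "?d \<in> endos" using endos_plus[OF t dt(1)] endos_plus[OF t endos_neg[OF dt(1)]] by auto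
        have ds: "dag ?s = ?s"
          by (rule dag_unique[OF s s]) (simp add: fD(1,3) tD(4) dD(4) dt(2) dt(3))
        have dd: "dag ?d = (\<lambda>v. - ?d v)"
        proof (rule dag_unique[OF d endos_neg[OF d]])
          fix x y assume x: "x \<in> V" and y: "y \<in> V"
          have m: "t x \<in> V" "t y \<in> V" "dag t x \<in> V" "dag t y \<in> V" using x y tD(4) dD(4) by auto
          have "f (- ?d x) y = f (dag t x - t x) y" by simp
          also have "\<dots> = f (dag t x) y - f (t x) y" by (rule f_diff(1)[OF m(3,1) y])
          also have "\<dots> = f x (t y) - f x (dag t y)" using dt(2,3)[OF x y] by simp
          also have "\<dots> = f x (t y - dag t y)" by (rule f_diff(2)[OF x m(2,4), symmetric])
          finally show "f (- ?d x) y = f x (?d y)" by simp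
        qed
        have "?s \<in> L"
        proof (rule max_mem[OF s])
          show "cm ?s l" if l: "l \<in> L" for l
            using tl[OF l] dl[OF l] endosD(5)[OF LE[OF l]] tD(4) dD(4) by (simp add: cm_def)
          show "cm ?s (dag ?s)" unfolding ds by (rule cm_refl)
        qed
        moreover have "?d \<in> L"
        proof (rule max_mem[OF d])
          show "cm ?d l" if l: "l \<in> L" for l
          proof -
            have "l (t v + - dag t v) = l (t v) + - l (dag t v)" if v: "v \<in> V" for v
              using endosD(5)[OF LE[OF l] tD(4)[OF v] V_neg[OF dD(4)[OF v]]] endosD(6)[OF LE[OF l] dD(4)[OF v]] by simp
            then show ?thesis using tl[OF l] dl[OF l] by (simp add: cm_def)
          qed
          show "cm ?d (dag ?d)" unfolding dd cm_def using endosD(6)[OF d endosD(4)[OF d]] by blast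
        qed
        then have "(\<lambda>v. - ?d v) = ?d" using dd triv[of ?d] by simp
        then have nd: "- ?d v = ?d v" for v by (rule fun_cong)
        have d0: "t v = dag t v" if v: "v \<in> V" for v
        proof -
          have dv: "?d v \<in> V" by (rule endosD(4)[OF d v])
          have "scale 2 (?d v) = ?d v + ?d v" using scale_left_distrib[of 1 1 "?d v"] by simp
          also have "\<dots> = - ?d v + ?d v" by (simp only: nd)
          finally have "scale 2 (?d v) = 0" by simp
          then have "?d v = 0" using two by (simp only: scale_eq_0_iff) simp
          then show ?thesis by simp
        qed
        let ?h = "\<lambda>v. if v \<in> V then scale (1/2) v else 0"
        have "\<theta> v = ?h (?s v)" if v: "v \<in> V" for v
        proof -
          have "?h (?s v) = scale (1/2) (t v + t v)" using endosD(4)[OF s v] d0[OF v] by simp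
          also have "t v + t v = scale 2 (t v)" using scale_left_distrib[of 1 1 "t v"] by simp
          also have "scale (1/2) (scale 2 (t v)) = t v" using two by simp
          finally show ?thesis using v by (simp add: t_def)
        qed
        moreover have "(\<lambda>v. ?h (?s v)) \<in> L" by (rule comp[OF scalar \<open>?s \<in> L\<close>])
        ultimately show ?thesis by (intro bexI[of _ "\<lambda>v. ?h (?s v)"]) blast+
      qed
      show "linear_on V l" if "l \<in> L" for l by (rule endosD(1)[OF LE[OF that]])
      show "l (\<rho> g v) = \<rho> g (l v)" if "l \<in> L" "g \<in> carrier G" "v \<in> V" for l g v
        by (rule endosD(2)[OF LE[OF that(1)] that(2,3)])
    qed (fact Lfin V plus neg comp zero)+
    show False by (rule I.no_selfadj_commutant)
  qed
  then obtain s where s: "s \<in> L" "dag s \<noteq> s" by blast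
  \<comment> \<open>Negated by the adjunction and nonzero, hence injective by Schur's lemma.\<close>
  define \<sigma> where "\<sigma> = (\<lambda>v. s v + - dag s v)"
  have \<sigma>L: "\<sigma> \<in> L" unfolding \<sigma>_def by (rule plus[OF s(1) neg[OF Ldag[OF s(1)]]])
  have f_\<sigma>: "f (\<sigma> x) y = - f x (\<sigma> y)" if x: "x \<in> V" and y: "y \<in> V" for x y
  proof -
    note sE = LE[OF s(1)] and dE = dag(1)[OF LE[OF s(1)]]
    have m: "s x \<in> V" "s y \<in> V" "dag s x \<in> V" "dag s y \<in> V" using x y endosD(4)[OF sE] endosD(4)[OF dE] by auto
    have "f (\<sigma> x) y = f (s x) y - f (dag s x) y" using f_diff(1)[OF m(1,3) y] by (simp add: \<sigma>_def)
    also have "\<dots> = f x (dag s y) - f x (s y)" using dag(2,3)[OF sE x y] by simp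
    also have "f x (\<sigma> y) = f x (s y) - f x (dag s y)" using f_diff(2)[OF x m(2,4)] by (simp add: \<sigma>_def)
    ultimately show ?thesis by simp
  qed
  have schur: "(\<forall>v\<in>V. l v = 0) \<or> (\<forall>v\<in>V. l v = 0 \<longrightarrow> v = 0)" if "l \<in> L" for l
    by (rule endos_schur[OF irr LE[OF that]])
  have Lext: "l = m" if "l \<in> L" "m \<in> L" "\<And>v. v \<in> V \<Longrightarrow> l v = m v" for l m
    by (rule endos_eqI[OF LE[OF that(1)] LE[OF that(2)]]) (simp add: that(3))
  have \<sigma>_inj: "v = 0" if "v \<in> V" "\<sigma> v = 0" for v
  proof -
    have "\<not> (\<forall>v\<in>V. \<sigma> v = 0)"
    proof
      assume "\<forall>v\<in>V. \<sigma> v = 0"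
      then have "dag s = s" by (intro Lext[OF Ldag[OF s(1)] s(1)]) (simp add: \<sigma>_def)
      then show False using s(2) by simp
    qed
    then show ?thesis using schur[OF \<sigma>L] that by blast
  qed
  define K where "K = {l \<in> L. dag l = l}"
  have KL: "l \<in> L" and Kself: "f (l x) y = f x (l y)" if "l \<in> K" "x \<in> V" "y \<in> V" for l x y
    using that dag(2)[OF LE, of l x y] by (auto simp: K_def)
  have KL': "l \<in> L" if "l \<in> K" for l using that by (simp add: K_def)
  have KI: "l \<in> K" if l: "l \<in> L" and sa: "\<And>x y. x \<in> V \<Longrightarrow> y \<in> V \<Longrightarrow> f (l x) y = f x (l y)" for l
    using dag_unique[OF LE[OF l] LE[OF l] sa] l by (simp add: K_def)
  have closed: "l v \<in> V" if "l \<in> L" "v \<in> V" for l v by (rule endosD(4)[OF LE[OF that(1)] that(2)])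
  have comm: "l (m v) = m (l v)" if "l \<in> L" "m \<in> L" "v \<in> V" for l m v
    using Lcm[OF that(1,2)] that(3) by (simp add: cm_def)
  have add: "l (v + w) = l v + l w" if "l \<in> L" "v \<in> V" "w \<in> V" for l v w
    by (rule endosD(5)[OF LE[OF that(1)] that(2,3)])
  have eK: "e \<in> K" using eL e(2) by (simp add: K_def)
  \<comment> \<open>The solution has the form \<open>c = \<alpha> + \<sigma> \<beta>\<close> with
    \<open>\<alpha>\<close> and \<open>\<beta>\<close> fixed by the adjunction. Its adjoint is
    \<open>\<alpha> - \<sigma> \<beta>\<close>, and their product is the square of
    \<open>\<alpha>\<close> minus the square of \<open>\<sigma> \<beta>\<close>. So the square of
    \<open>\<alpha>\<close> has to be the value of \<open>?g\<close> at the square of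
    \<open>\<beta>\<close>.\<close>
  let ?sq = "\<lambda>l v. l (l v)" and ?g = "\<lambda>m v. - e v + \<sigma> (\<sigma> (m v))"
  have gL: "?g m \<in> L" if "m \<in> L" for m by (rule plus[OF neg[OF eL] comp[OF \<sigma>L comp[OF \<sigma>L that]]])
  have sqK: "?sq l \<in> K" if l: "l \<in> K" for l
    by (rule KI[OF comp[OF KL'[OF l] KL'[OF l]]]) (simp add: Kself[OF l] closed[OF KL'[OF l]])
  have "\<exists>\<alpha>\<in>K. \<exists>\<beta>\<in>K. ?sq \<alpha> = ?g (?sq \<beta>)"
  proof (rule ex_common_value[where z = "\<lambda>v. 0" and neg = "\<lambda>l v. - l v" and sq = ?sq and g = ?g])
    show "finite K" using Lfin by (simp add: K_def)
    show "(\<lambda>v. 0) \<in> K" by (rule KI[OF zero]) (simp add: f_zero(1)[OF V_0] f_zero(2)[OF _ V_0])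
    show "(\<lambda>v. - (0::'b)) = (\<lambda>v. 0)" by simp
    show "?sq l \<in> K" if "l \<in> K" for l by (rule sqK[OF that])
    show "?g (?sq l) \<in> K" if "l \<in> K" for l
    proof (rule KI[OF gL[OF KL'[OF sqK[OF that]]]])
      fix x y assume x: "x \<in> V" and y: "y \<in> V"
      let ?m = "?sq l"
      note mK = sqK[OF that] and mL = KL'[OF sqK[OF that]]
      have mem: "e x \<in> V" "e y \<in> V" "?m x \<in> V" "?m y \<in> V" "\<sigma> (?m x) \<in> V" "\<sigma> (\<sigma> (?m x)) \<in> V" "\<sigma> y \<in> V" "\<sigma> (\<sigma> y) \<in> V"
        "\<sigma> (?m y) \<in> V" "\<sigma> (\<sigma> (?m y)) \<in> V"
        using closed[OF mL] closed[OF \<sigma>L] closed[OF eL] x y by auto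
      have "f (\<sigma> (\<sigma> (?m x))) y = f (?m x) (\<sigma> (\<sigma> y))"
        using f_\<sigma>[OF mem(5) y] f_\<sigma>[OF mem(3) mem(7)] by simp
      also have "\<dots> = f x (?m (\<sigma> (\<sigma> y)))" by (rule Kself[OF mK x mem(8)])
      also have "?m (\<sigma> (\<sigma> y)) = \<sigma> (\<sigma> (?m y))"
        using comm[OF mL \<sigma>L mem(7)] comm[OF mL \<sigma>L y] by simp
      finally have 1: "f (\<sigma> (\<sigma> (?m x))) y = f x (\<sigma> (\<sigma> (?m y)))" .
      have "f (- e x + \<sigma> (\<sigma> (?m x))) y = f (- e x) y + f (\<sigma> (\<sigma> (?m x))) y" by (rule fD(1)[OF V_neg[OF mem(1)] mem(6) y])
      also have "f (- e x) y = f x (- e y)"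
        using f_zero(3)[OF mem(1) y] f_zero(4)[OF x mem(2)] Kself[OF eK x y] by simp
      also have "f x (- e y) + f (\<sigma> (\<sigma> (?m x))) y = f x (- e y + \<sigma> (\<sigma> (?m y)))"
        unfolding 1 by (rule fD(3)[OF x V_neg[OF mem(2)] mem(10), symmetric])
      finally show "f (- e x + \<sigma> (\<sigma> (?m x))) y = f x (- e y + \<sigma> (\<sigma> (?m y)))" .
    qed
    show "inj_on ?g (?sq ` K)"
    proof (rule inj_onI)
      fix m m' assume m: "m \<in> ?sq ` K" "m' \<in> ?sq ` K" and eq: "?g m = ?g m'"
      have mL: "m \<in> L" "m' \<in> L" using m sqK KL' by blast+
      show "m = m'"
      proof (rule Lext[OF mL])
        fix v assume v: "v \<in> V"
        let ?d = "m v - m' v"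
        have dV: "m v \<in> V" "m' v \<in> V" "?d \<in> V" using closed mL v V_diff by auto
        note sd = linear_on_more(3)[OF endosD(1)[OF LE[OF \<sigma>L]] V_subspace]
        have "\<sigma> (\<sigma> (m v)) = \<sigma> (\<sigma> (m' v))" using fun_cong[OF eq, of v] by simp
        then have "\<sigma> (\<sigma> ?d) = 0" using sd[OF dV(1,2)] sd[OF closed[OF \<sigma>L dV(1)] closed[OF \<sigma>L dV(2)]] by simp
        then have "?d = 0" using \<sigma>_inj dV(3) closed[OF \<sigma>L dV(3)] by blast
        then show "m v = m' v" by simp
      qed
    qed
    fix x y assume xy: "x \<in> K" "y \<in> K" and eq: "?sq x = ?sq y"
    note xL = KL'[OF xy(1)] and yL = KL'[OF xy(2)]
    let ?p = "\<lambda>v. x v + - y v" and ?r = "\<lambda>v. x v + y v"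
    have pL: "?p \<in> L" and rL: "?r \<in> L" using plus[OF xL neg[OF yL]] plus[OF xL yL] by auto
    \<comment> \<open>The operators commute, so this is the difference of two squares. As members of
      \<open>L\<close> are zero or injective on \<open>V\<close>, one of the two factors
      vanishes.\<close>
    have pr: "?p (?r v) = 0" if v: "v \<in> V" for v
    proof -
      have "x (x v + y v) = x (x v) + x (y v)" by (rule add[OF xL closed[OF xL v] closed[OF yL v]])
      moreover have "y (x v + y v) = y (x v) + y (y v)" by (rule add[OF yL closed[OF xL v] closed[OF yL v]])
      moreover have "x (y v) = y (x v)" by (rule comm[OF xL yL v])
      moreover have "x (x v) = y (y v)" using fun_cong[OF eq, of v] .
      ultimately show ?thesis by simp
    qed
    show "y = x \<or> y = (\<lambda>v. - x v)"
    proof (cases "\<forall>v\<in>V. ?p v = 0")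
      case True
      then have "y = x" by (intro Lext[OF yL xL]) simp
      then show ?thesis ..
    next
      case False
      then have "?r v = 0" if "v \<in> V" for v using schur[OF pL] pr[OF that] closed[OF rL that] by blast
      then have "y = (\<lambda>v. - x v)" by (intro Lext[OF yL neg[OF xL]]) (simp add: eq_neg_iff_add_eq_0 add.commute)
      then show ?thesis ..
    qed
  qed
  then obtain \<alpha> \<beta> where ab: "\<alpha> \<in> K" "\<beta> \<in> K" "?sq \<alpha> = ?g (?sq \<beta>)" by blast
  note aL = KL'[OF ab(1)] and bL = KL'[OF ab(2)]
  let ?t = "\<lambda>v. \<sigma> (\<beta> v)"
  let ?c = "\<lambda>v. \<alpha> v + ?t v" and ?c' = "\<lambda>v. \<alpha> v + - ?t v"
  have tL: "?t \<in> L" by (rule comp[OF \<sigma>L bL])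
  have cL: "?c \<in> L" "?c' \<in> L" using plus[OF aL tL] plus[OF aL neg[OF tL]] by auto
  have dc: "dag ?c = ?c'"
  proof (rule dag_unique[OF LE[OF cL(1)] LE[OF cL(2)]])
    fix x y assume x: "x \<in> V" and y: "y \<in> V"
    note m = closed[OF aL x] closed[OF aL y] closed[OF tL x] closed[OF tL y]
    have "f (?t x) y = - f (\<beta> x) (\<sigma> y)" by (rule f_\<sigma>[OF closed[OF bL x] y])
    also have "f (\<beta> x) (\<sigma> y) = f x (\<beta> (\<sigma> y))" by (rule Kself[OF ab(2) x closed[OF \<sigma>L y]])
    also have "\<beta> (\<sigma> y) = ?t y" by (rule comm[OF bL \<sigma>L y])
    finally have 1: "f (?t x) y = - f x (?t y)" .
    have "f (?c' x) y = f (\<alpha> x) y - f (?t x) y" using f_diff(1)[OF m(1,3) y] by simp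
    also have "\<dots> = f x (\<alpha> y) + f x (?t y)" using 1 Kself[OF ab(1) x y] by simp
    also have "\<dots> = f x (?c y)" by (rule fD(3)[OF x m(2,4), symmetric])
    finally show "f (?c' x) y = f x (?c y)" .
  qed
  have "dag ?c (?c x) = - e x" if x: "x \<in> V" for x
  proof -
    note m = closed[OF aL x] closed[OF tL x]
    have "?c' (?c x) = \<alpha> (\<alpha> x) + \<alpha> (?t x) - (?t (\<alpha> x) + ?t (?t x))"
      using add[OF aL m] add[OF tL m] by simp
    also have "\<alpha> (?t x) = ?t (\<alpha> x)" by (rule comm[OF aL tL x])
    also have "\<alpha> (\<alpha> x) = - e x + \<sigma> (\<sigma> (\<beta> (\<beta> x)))" using fun_cong[OF ab(3), of x] .
    also have "?t (?t x) = \<sigma> (\<sigma> (\<beta> (\<beta> x)))" using comm[OF bL \<sigma>L closed[OF bL x]] by simp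
    finally show ?thesis unfolding dc by simp
  qed
  then show ?thesis using LE[OF cL(1)] comm[OF cL(1) eL] by (intro bexI[of _ ?c]) blast+
qed

end

section \<open>Anisotropic representations\<close>

context symplectic_rep
begin

definition irreducible_sub :: "'b set \<Rightarrow> bool"
  where "irreducible_sub W \<longleftrightarrow> subspace W \<and> W \<subseteq> V \<and> W \<noteq> {0} \<and> stable (carrier G) W \<and>
    (\<forall>U. subspace U \<longrightarrow> U \<subseteq> W \<longrightarrow> stable (carrier G) U \<longrightarrow> U = {0} \<or> U = W)"

lemma irreducible_subD:
  assumes "irreducible_sub W"
  shows "subspace W" "W \<subseteq> V" "W \<noteq> {0}" "stable (carrier G) W"
    "\<And>U. subspace U \<Longrightarrow> U \<subseteq> W \<Longrightarrow> stable (carrier G) U \<Longrightarrow> U = {0} \<or> U = W" "finite W"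
  using assms finite_subset[OF _ V_finite] by (simp_all add: irreducible_sub_def)

lemma ex_irreducible_sub:
  assumes "subspace U" "U \<subseteq> V" "stable (carrier G) U" "U \<noteq> {0}"
  shows "\<exists>W. irreducible_sub W \<and> W \<subseteq> U"
  using assms
proof (induction "card U" arbitrary: U rule: less_induct)
  case less
  show ?case
  proof (cases "irreducible_sub U")
    case False
    then obtain U' where U': "subspace U'" "U' \<subseteq> U" "stable (carrier G) U'" "U' \<noteq> {0}" "U' \<noteq> U"
      using less.prems by (auto simp: irreducible_sub_def)
    have "card U' < card U"
      using U'(2,5) finite_subset[OF less.prems(2) V_finite] by (intro psubset_card_mono) auto
    from less.hyps[OF this U'(1) _ U'(3,4)] obtain W where "irreducible_sub W" "W \<subseteq> U'"
      using U'(2) less.prems(2) by blast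
    then show ?thesis using U'(2) by blast
  qed blast
qed

end

locale anisotropic_rep = symplectic_rep +
  assumes anisotropic: "subspace S \<Longrightarrow> S \<subseteq> V \<Longrightarrow> stable (carrier G) S \<Longrightarrow> S \<subseteq> perpV S \<Longrightarrow> S = {0}"
begin

text \<open>The intersection is a stable subspace perpendicular to itself.\<close>

lemma Int_perpV:
  assumes U: "subspace U" "U \<subseteq> V" "stable (carrier G) U"
  shows "U \<inter> perpV U = {0}"
proof (rule anisotropic)
  show "subspace (U \<inter> perpV U)" by (rule subspace_inter[OF U(1) subspace_perpV[OF U(2)]])
  show "stable (carrier G) (U \<inter> perpV U)"
    using U(3) stable_perpV[OF subgroup_self U(3,2)] by (simp add: stable_def)
  show "U \<inter> perpV U \<subseteq> perpV (U \<inter> perpV U)" by (auto simp: perpV_def)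
qed (use U(2) in blast)

lemma decompose_perpV:
  assumes U: "subspace U" "U \<subseteq> V" "stable (carrier G) U" and v: "v \<in> V"
  shows "\<exists>u\<in>U. \<exists>w\<in>perpV U. v = u + w"
proof -
  note P = subspace_perpV[OF U(2)]
  let ?h = "\<lambda>(u, w). u + w"
  have inj: "inj_on ?h (U \<times> perpV U)"
  proof (rule inj_onI, clarify)
    fix u w u' w' assume m: "u \<in> U" "w \<in> perpV U" "u' \<in> U" "w' \<in> perpV U" and eq: "u + w = u' + w'"
    have d: "u - u' = w' - w" using eq by (simp add: algebra_simps)
    have "u - u' \<in> U \<inter> perpV U"
      using subspace_diff[OF U(1) m(1,3)] subspace_diff[OF P m(4,2)] d by simp
    then have "u - u' = 0" using Int_perpV[OF U] by blast
    then show "u = u' \<and> w = w'" using d by simp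
  qed
  have "?h ` (U \<times> perpV U) = V"
  proof (rule card_subset_eq[OF V_finite])
    show "?h ` (U \<times> perpV U) \<subseteq> V" using U(2) by (auto intro!: V_add simp: perpV_def)
    show "card (?h ` (U \<times> perpV U)) = card V"
      using card_image[OF inj] card_perpV[OF U(1,2)] by (simp add: card_cartesian_product)
  qed
  then have "v \<in> ?h ` (U \<times> perpV U)" using v by simp
  then show ?thesis by auto
qed

text \<open>Splitting off perpendicular complements exhibits \<open>U\<close> as a sum of
  irreducible submodules. Anisotropy takes the place of Maschke's theorem, whose hypothesis on the
  characteristic may fail.\<close>

lemma zero_on_irreducible_subs:
  assumes T: "linear_on V T" and U: "subspace U" "U \<subseteq> V" "stable (carrier G) U"
    and kill: "\<And>W w. irreducible_sub W \<Longrightarrow> W \<subseteq> U \<Longrightarrow> w \<in> W \<Longrightarrow> T w = 0" and u: "u \<in> U"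
  shows "T u = 0"
  using U kill u
proof (induction "card U" arbitrary: U u rule: less_induct)
  case less
  note U = less.prems(1-3)
  show ?case
  proof (cases "U = {0}")
    case True
    then show ?thesis using less.prems(5) linear_on_more(1)[OF T V_subspace] by simp
  next
    case False
    obtain W where W: "irreducible_sub W" "W \<subseteq> U" using ex_irreducible_sub[OF U False] by blast
    note Wd = irreducible_subD[OF W(1)]
    let ?U = "U \<inter> perpV W"
    have U': "subspace ?U" "?U \<subseteq> V" "stable (carrier G) ?U"
      using subspace_inter[OF U(1) subspace_perpV[OF Wd(2)]] U(2,3) stable_perpV[OF subgroup_self Wd(4,2)]
      by (auto simp: stable_def)
    obtain w where "w \<in> W" "w \<noteq> 0" using Wd(3) subspace_0[OF Wd(1)] by blast
    then have "w \<in> U" "w \<notin> ?U" using W(2) Int_perpV[OF Wd(1,2,4)] by auto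
    then have "card ?U < card U"
      by (intro psubset_card_mono finite_subset[OF U(2) V_finite]) auto
    from less.hyps[OF this U'] have IH: "T x = 0" if "x \<in> ?U" for x
      using less.prems(4) that by blast
    obtain w p where d: "w \<in> W" "p \<in> perpV W" "u = w + p"
      using decompose_perpV[OF Wd(1,2,4)] less.prems(5) U(2) by blast
    have "p = u - w" using d(3) by simp
    then have "p \<in> ?U" using d(1,2) W(2) subspace_diff[OF U(1) less.prems(5), of w] by auto
    then have "T p = 0" by (rule IH)
    moreover have "T w = 0" using less.prems(4)[OF W d(1)] .
    moreover have "w \<in> V" "p \<in> V" using d(1,2) Wd(2) perpV_subset by auto
    ultimately show ?thesis using linear_onD(4)[OF T, of w p] d(3) by simp
  qed
qed

text \<open>
  The form pulled back along \<psi> is given by a self-adjoint endomorphism \<open>e\<close>; with \<open>c\<close> as in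
  \<open>ex_norm\<close>, the submodule of all \<open>e x + \<psi> (c x)\<close> is isotropic.
\<close>

lemma no_orthogonal_copy:
  assumes V1: "irreducible_sub V1"
    and \<psi>P: "\<And>x. x \<in> V1 \<Longrightarrow> \<psi> x \<in> perpV V1"
    and \<psi>_add: "\<And>x y. x \<in> V1 \<Longrightarrow> y \<in> V1 \<Longrightarrow> \<psi> (x + y) = \<psi> x + \<psi> y"
    and \<psi>_scale: "\<And>c x. x \<in> V1 \<Longrightarrow> \<psi> (scale c x) = scale c (\<psi> x)"
    and \<psi>_\<rho>: "\<And>g x. g \<in> carrier G \<Longrightarrow> x \<in> V1 \<Longrightarrow> \<psi> (\<rho> g x) = \<rho> g (\<psi> x)"
    and nz: "\<exists>x\<in>V1. \<psi> x \<noteq> 0"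
  shows False
proof -
  note V1d = irreducible_subD[OF V1]
  note int = Int_perpV[OF V1d(1,2,4)]
  interpret S1: symplectic_rep scale G V1 \<rho> f
  proof (rule symplectic_rep_restrict[OF V1d(1,2,4)])
    fix u assume "u \<in> V1" "\<And>w. w \<in> V1 \<Longrightarrow> f u w = 0"
    then have "u \<in> V1 \<inter> perpV V1" using V1d(2) by (auto simp: perpV_def)
    then show "u = 0" using int by blast
  qed
  have \<psi>V: "\<psi> x \<in> V" if "x \<in> V1" for x using \<psi>P[OF that] perpV_subset by blast
  have V1V: "x \<in> V" if "x \<in> V1" for x using that V1d(2) by blast
  have \<rho>V1: "\<rho> g x \<in> V1" if "g \<in> carrier G" "x \<in> V1" for g x using V1d(4) that by (simp add: stable_def)
  have "bilinear_on V1 V1 (\<lambda>x y. f (\<psi> x) (\<psi> y))"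
    unfolding bilinear_on_def using \<psi>_add \<psi>_scale \<psi>V fD by simp
  moreover have "f (\<psi> (\<rho> g x)) (\<psi> (\<rho> g y)) = f (\<psi> x) (\<psi> y)" if "g \<in> carrier G" "x \<in> V1" "y \<in> V1" for g x y
    using \<psi>_\<rho>[OF that(1)] f_invariant[OF that(1) \<psi>V \<psi>V] that by simp
  ultimately have "\<exists>e\<in>S1.endos. \<forall>x\<in>V1. \<forall>y\<in>V1. f (e x) y = f (\<psi> x) (\<psi> y)" by (rule S1.ex_representing_endo)
  then obtain e where e: "e \<in> S1.endos" "\<forall>x\<in>V1. \<forall>y\<in>V1. f (e x) y = f (\<psi> x) (\<psi> y)" by blast
  note eD = S1.endosD[OF e(1)]
  have self: "S1.dag e = e"
  proof (rule S1.dag_unique[OF e(1) e(1)])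
    fix x y assume x: "x \<in> V1" and y: "y \<in> V1"
    have "f x (e y) = - f (e y) x" by (rule S1.f_skew[OF x eD(4)[OF y]])
    also have "\<dots> = - f (\<psi> y) (\<psi> x)" using e(2) x y by simp
    also have "\<dots> = f (\<psi> x) (\<psi> y)" using f_skew[OF \<psi>V[OF x] \<psi>V[OF y]] by simp
    finally show "f (e x) y = f x (e y)" using e(2) x y by simp
  qed
  have "\<exists>c\<in>S1.endos. (\<forall>x\<in>V1. S1.dag c (c x) = - e x) \<and> (\<forall>x\<in>V1. c (e x) = e (c x))"
    by (rule S1.ex_norm[OF V1d(3) V1d(5) e(1) self])
  then obtain c where c: "c \<in> S1.endos" "\<forall>x\<in>V1. S1.dag c (c x) = - e x" "\<forall>x\<in>V1. c (e x) = e (c x)" by blast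
  note cD = S1.endosD[OF c(1)]
  let ?h = "\<lambda>x. e x + \<psi> (c x)"
  have hV: "?h x \<in> V" if "x \<in> V1" for x using V_add[OF V1V[OF eD(4)[OF that]] \<psi>V[OF cD(4)[OF that]]] .
  have e_sc: "e (scale a x) = scale a (e x)" and c_sc: "c (scale a x) = scale a (c x)" if "x \<in> V1" for a x
    using linear_onD(3)[OF eD(1) that] linear_onD(3)[OF cD(1) that] by auto
  have sub: "subspace (?h ` V1)"
  proof (rule subspace_image[OF V1d(1)])
    show "additive_on V1 ?h" using eD(5) cD(4,5) \<psi>_add by (intro additive_onI) simp
    show "?h (scale a x) = scale a (?h x)" if "x \<in> V1" for a x
      using e_sc[OF that] c_sc[OF that] \<psi>_scale[OF cD(4)[OF that]] by (simp add: scale_right_distrib)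
  qed
  have stab: "stable (carrier G) (?h ` V1)"
    unfolding stable_def
  proof clarify
    fix g x assume g: "g \<in> carrier G" and x: "x \<in> V1"
    have "\<rho> g (?h x) = \<rho> g (e x) + \<rho> g (\<psi> (c x))"
      by (rule linear_onD(4)[OF \<rho>_linear[OF g] V1V[OF eD(4)[OF x]] \<psi>V[OF cD(4)[OF x]]])
    also have "\<dots> = ?h (\<rho> g x)" using eD(2)[OF g x] cD(2)[OF g x] \<psi>_\<rho>[OF g cD(4)[OF x]] by simp
    finally show "\<rho> g (?h x) \<in> ?h ` V1" using \<rho>V1[OF g x] by blast
  qed
  \<comment> \<open>The mixed terms vanish because \<open>\<psi>\<close> maps into
    \<open>perpV V1\<close>. The other two cancel: pulling the form back along \<open>\<psi>\<close>
    inserts \<open>e\<close>, which commutes with \<open>c\<close>, and the adjoint of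
    \<open>c\<close> times \<open>c\<close> is \<open>- e\<close>.\<close>
  have iso: "f (?h x) (?h y) = 0" if x: "x \<in> V1" and y: "y \<in> V1" for x y
  proof -
    note ex = eD(4)[OF x] and ey = eD(4)[OF y] and cx = cD(4)[OF x] and cy = cD(4)[OF y]
    note m = V1V[OF ex] V1V[OF ey] \<psi>V[OF cx] \<psi>V[OF cy]
    have 1: "f (\<psi> (c x)) (e y) = 0" using \<psi>P[OF cx] ey by (simp add: perpV_def)
    have "f (\<psi> (c y)) (e x) = 0" using \<psi>P[OF cy] ex by (simp add: perpV_def)
    then have 2: "f (e x) (\<psi> (c y)) = 0" using f_skew[OF m(1,4)] by simp
    have "f (\<psi> (c x)) (\<psi> (c y)) = f (e (c x)) (c y)" using e(2) cx cy by simp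
    also have "\<dots> = f (c (e x)) (c y)" using c(3) x by simp
    also have "\<dots> = f (e x) (S1.dag c (c y))" by (rule S1.dag(3)[OF c(1) ex cy])
    also have "\<dots> = - f (e x) (e y)" using c(2) y f_zero(4)[OF m(1,2)] by simp
    finally have 3: "f (\<psi> (c x)) (\<psi> (c y)) = - f (e x) (e y)" .
    have "f (?h x) (?h y) = f (e x) (?h y) + f (\<psi> (c x)) (?h y)" by (rule fD(1)[OF m(1,3) hV[OF y]])
    also have "\<dots> = f (e x) (e y) + f (e x) (\<psi> (c y)) + (f (\<psi> (c x)) (e y) + f (\<psi> (c x)) (\<psi> (c y)))"
      using fD(3)[OF m(1,2,4)] fD(3)[OF m(3,2,4)] by simp
    finally show ?thesis using 1 2 3 by simp
  qed
  have "?h ` V1 = {0}"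
    by (rule anisotropic[OF sub _ stab]) (use hV iso in \<open>auto simp: perpV_def\<close>)
  then have h0: "?h x = 0" if "x \<in> V1" for x using that by blast
  \<comment> \<open>Where the twisted diagonal vanishes, \<open>e x\<close> lies both in
    \<open>V1\<close> and in its perpendicular space. With \<open>e\<close> zero, the image of
    \<open>\<psi>\<close> is itself isotropic, which gives the contradiction.\<close>
  have e0: "e x = 0" if x: "x \<in> V1" for x
  proof -
    have "e x = - \<psi> (c x)" using h0[OF x] by (simp add: eq_neg_iff_add_eq_0)
    then have "e x \<in> perpV V1" using subspace_neg[OF subspace_perpV[OF V1d(2)] \<psi>P[OF cD(4)[OF x]]] by simp
    then show ?thesis using eD(4)[OF x] int by blast
  qed
  have "\<psi> ` V1 = {0}"
  proof (rule anisotropic)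
    show "subspace (\<psi> ` V1)" by (rule subspace_image[OF V1d(1)]) (use \<psi>_add \<psi>_scale in \<open>auto intro: additive_onI\<close>)
    show "stable (carrier G) (\<psi> ` V1)"
      unfolding stable_def
    proof clarify
      fix g x assume g: "g \<in> carrier G" and x: "x \<in> V1"
      show "\<rho> g (\<psi> x) \<in> \<psi> ` V1" using \<psi>_\<rho>[OF g x] \<rho>V1[OF g x] by (metis imageI)
    qed
    have "f (\<psi> x) (\<psi> y) = 0" if x: "x \<in> V1" and y: "y \<in> V1" for x y
    proof -
      have "f (\<psi> x) (\<psi> y) = f (e x) y" using e(2) x y by simp
      then show ?thesis using e0[OF x] S1.f_zero(1)[OF x y] by simp
    qed
    then show "\<psi> ` V1 \<subseteq> perpV (\<psi> ` V1)" using \<psi>V by (auto simp: perpV_def)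
  qed (use \<psi>V in blast)
  then show False using nz by blast
qed

text \<open>Suppose an irreducible \<open>V1\<close> had no orthogonal copy. A self-adjoint group
  ring element isolating the factors of type \<open>V1\<close> would then have Fitting component
  exactly \<open>V1\<close>, against the even multiplicity forced by the cyclic subgroups.\<close>

lemma trivial_if_hyp_cyclic:
  assumes cyc: "\<And>c. c \<in> carrier G \<Longrightarrow> hyp (generate G {c})"
  shows "V = {0}"
proof (rule ccontr)
  assume "V \<noteq> {0}"
  moreover have "stable (carrier G) V" using \<rho>_closed by (simp add: stable_def)
  ultimately obtain V1 where V1: "irreducible_sub V1" using ex_irreducible_sub[OF V_subspace] by blast
  note V1d = irreducible_subD[OF V1]
  note int = Int_perpV[OF V1d(1,2,4)]
  have V1V: "x \<in> V" if "x \<in> V1" for x using that V1d(2) by blast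
  \<comment> \<open>With scalars as coefficients, operator submodules of the copy of
    \<open>V\<close> are ordinary submodules.\<close>
  interpret C: coef_ring scale G V \<rho> f "range scale"
  proof (intro coef_ring.intro symplectic_rep_axioms coef_ring_axioms.intro)
    show "finite (range scale)" by simp
    show "linear_on V l" if "l \<in> range scale" for l
      using that V_scale by (auto intro!: linear_onI simp: scale_right_distrib mult.commute)
    show "l (\<rho> h v) = \<rho> h (l v)" if "l \<in> range scale" "h \<in> carrier G" "v \<in> V" for l h v
      using that linear_onD(3)[OF \<rho>_linear] by auto
    show "f (l v) w = f v (l w)" if "l \<in> range scale" "v \<in> V" "w \<in> V" for l v w
      using that fD(2,4) by auto
    show "l (m v) = m (l v)" if "l \<in> range scale" "m \<in> range scale" "v \<in> V" for l m v
      using that by (auto simp: mult.commute)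
    show "(\<lambda>v. l v + m v) \<in> range scale" if lm: "l \<in> range scale" "m \<in> range scale" for l m
    proof -
      obtain c d where "l = scale c" "m = scale d" using lm by blast
      then have "(\<lambda>v. l v + m v) = scale (c + d)" by (simp add: fun_eq_iff scale_left_distrib)
      then show ?thesis by simp
    qed
    show "(\<lambda>v. - l v) \<in> range scale" if l: "l \<in> range scale" for l
    proof -
      obtain c where "l = scale c" using l by blast
      then have "(\<lambda>v. - l v) = scale (- c)" by (simp add: fun_eq_iff)
      then show ?thesis by simp
    qed
    show "(\<lambda>v. l (m v)) \<in> range scale" if lm: "l \<in> range scale" "m \<in> range scale" for l m
    proof -
      obtain c d where "l = scale c" "m = scale d" using lm by blast
      then have "(\<lambda>v. l (m v)) = scale (c * d)" by (simp add: fun_eq_iff)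
      then show ?thesis by simp
    qed
    have "(\<lambda>v. 0) = scale 0" by (simp add: fun_eq_iff)
    then show "(\<lambda>v. 0) \<in> range scale" by simp
    show "\<exists>l\<in>range scale. \<forall>v\<in>V. l v = scale c v" for c by blast
  qed
  have fam_stable: "a g s \<in> U" if a: "a \<in> C.fam" and U: "subspace U" and g: "g \<in> carrier G" and s: "s \<in> U" for a g s U
  proof -
    obtain c where "a g = scale c" using a g by (auto simp: C.fam_def)
    then show ?thesis using subspace_scale[OF U s] by simp
  qed
  have act_stable: "C.act a s \<in> U" if "a \<in> C.fam" "subspace U" "stable (carrier G) U" "s \<in> U" for a s U
    by (rule C.act_stable[OF that(2,3) _ that(1,4)]) (use subspace_scale[OF that(2)] in auto)
  have simple: "C.op.simple_factor (C.iota ` W) {0}" if W: "irreducible_sub W" for W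
    by (rule C.simple_factor_iota[OF irreducible_subD(1,2,3,4)[OF W] _ irreducible_subD(5)[OF W]])
      (use subspace_scale[OF irreducible_subD(1)[OF W]] in auto)
  note s1 = simple[OF V1]
  let ?Q = "C.op.annihilator (C.iota ` V1) {0}"
  have "\<exists>a\<in>C.ext ` C.fam. (\<forall>v\<in>C.iota ` V1. a v = v) \<and>
    (\<forall>N N'. C.op.simple_factor N N' \<longrightarrow> C.op.annihilator N N' = ?Q \<or> a \<in> C.op.annihilator N N')"
    by (rule C.op.ex_separating_element[OF s1])
  then obtain a0 where a0: "a0 \<in> C.ext ` C.fam" "\<forall>v\<in>C.iota ` V1. a0 v = v"
    "\<forall>N N'. C.op.simple_factor N N' \<longrightarrow> C.op.annihilator N N' = ?Q \<or> a0 \<in> C.op.annihilator N N'"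
    by (elim bexE conjE)
  obtain b where b: "b \<in> C.fam" "a0 = C.ext b" using a0(1) by blast
  \<comment> \<open>The product of \<open>b\<close> with its adjoint is self-adjoint and still kills
    the factors that \<open>b\<close> kills. It is the identity on \<open>V1\<close>, since the form
    is nondegenerate there and so the adjoint of \<open>b\<close> is the identity on
    \<open>V1\<close> as well.\<close>
  define a where "a = conv_op b (star b)"
  have sb: "star b \<in> C.fam" by (rule C.fam_star[OF b(1)])
  have a: "a \<in> C.fam" unfolding a_def by (rule C.fam_conv[OF b(1) sb])
  have act_b: "C.act b v = v" if v: "v \<in> V1" for v
  proof (rule C.act_eqI[OF C.act_closed[OF b(1) V1V[OF v]] V1V[OF v]])
    have "C.ext b (C.iota v) = C.iota v" using a0(2) v b(2) by blast
    then show "C.iota (C.act b v) = C.iota v"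
      using C.ext_eq[OF C.iota_M[OF V1V[OF v]]] C.theta_iota[OF b(1) V1V[OF v]] by simp
  qed
  have act_sb: "C.act (star b) v = v" if v: "v \<in> V1" for v
  proof -
    let ?w = "C.act (star b) v"
    have w: "?w \<in> V1" by (rule act_stable[OF sb V1d(1,4) v])
    have "f (v - ?w) x = 0" if x: "x \<in> V1" for x
    proof -
      note m = V1V[OF v] V1V[OF w] V1V[OF x]
      have "f x v = f x ?w" using C.act_adjoint[OF b(1) m(3,1)] act_b[OF x] by simp
      then have "f x (v - ?w) = 0" using f_diff(2)[OF m(3,1,2)] by simp
      then show ?thesis using f_skew[OF V_diff[OF m(1,2)] m(3)] by simp
    qed
    then have "v - ?w \<in> V1 \<inter> perpV V1" using subspace_diff[OF V1d(1) v w] V1V by (auto simp: perpV_def)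
    then have "v - ?w = 0" using int by blast
    then show ?thesis by simp
  qed
  have act_a: "C.act a v = v" if v: "v \<in> V1" for v
    using C.act_conv[OF b(1) sb V1V[OF v]] act_sb[OF v] act_b[OF v] by (simp add: a_def)
  have th_a: "theta a \<phi> = theta b (theta (star b) \<phi>)" if "\<phi> \<in> C.M" for \<phi>
    using theta_conv_op[OF C.fam_coef[OF b(1)] C.fam_coef[OF sb] that] by (simp add: a_def)
  have aR: "C.ext a \<in> C.ext ` C.fam" using a by blast
  have a_id: "C.ext a x = x" if x: "x \<in> C.iota ` V1" for x
  proof -
    obtain v where v: "v \<in> V1" "x = C.iota v" using x by blast
    show ?thesis using C.ext_eq[OF C.iota_M[OF V1V[OF v(1)]]] C.theta_iota[OF a V1V[OF v(1)]] act_a[OF v(1)] v(2) by simp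
  qed
  have sep: "C.op.annihilator N N' = ?Q \<or> C.ext a \<in> C.op.annihilator N N'" if N: "C.op.simple_factor N N'" for N N'
  proof (cases "C.op.annihilator N N' = ?Q")
    case False
    then have bA: "C.ext b \<in> C.op.annihilator N N'" using a0(3) N b(2) by blast
    have sN: "C.op.submod N" using N unfolding C.op.simple_factor_def by blast
    note Nd = C.op.submodD[OF sN]
    have "C.ext a n \<in> N'" if n: "n \<in> N" for n
    proof -
      have nM: "n \<in> C.M" using n Nd(2) by blast
      have 1: "C.ext (star b) n \<in> N" using Nd(4)[OF imageI[OF sb] n] .
      then have "C.ext b (C.ext (star b) n) \<in> N'" using bA unfolding C.op.annihilator_def by blast
      moreover have "C.ext (star b) n \<in> C.M" using 1 Nd(2) by blast
      ultimately show ?thesis using th_a[OF nM] C.ext_eq nM by simp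
    qed
    then show ?thesis using aR unfolding C.op.annihilator_def by blast
  qed blast
  have card_V1: "card (C.iota ` V1) = card V1"
    by (rule card_image[OF inj_on_subset[OF C.iota_inj V1d(2)]])
  have pow: "\<exists>k. card (fit (theta a) N) = card V1 ^ k" if N: "C.op.submod N" for N
  proof -
    note Nd = C.op.submodD[OF N]
    have "fit (C.ext a) N = fit (theta a) N"
      by (rule fit_cong) (use Nd(4)[OF aR] Nd(2) C.ext_eq in blast)+
    then show ?thesis using C.op.card_fit_power[OF s1 aR a_id sep N] card_V1 by simp
  qed
  obtain d bas \<kappa> where "coords V1 d bas \<kappa>" using ex_coords[OF V1d(1,6)] by blast
  from card_coords[OF this V1d(1)] have V1q: "card V1 = card (UNIV :: 'a set) ^ d" .
  have q1: "card (UNIV :: 'a set) > 1"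
  proof -
    have "card {0, 1 :: 'a} \<le> card (UNIV :: 'a set)" by (rule card_mono) auto
    then show ?thesis by simp
  qed
  have V1_gt: "card V1 > 1"
  proof -
    obtain v where "v \<in> V1" "v \<noteq> 0" using V1d(3) subspace_0[OF V1d(1)] by blast
    then have "card {0, v} \<le> card V1" using subspace_0[OF V1d(1)] by (intro card_mono[OF V1d(6)]) auto
    then show ?thesis using \<open>v \<noteq> 0\<close> by simp
  qed
  have d0: "d > 0" using V1q V1_gt by (cases d) auto
  \<comment> \<open>The exponent is \<open>2 * d\<close>: as \<open>S\<close> is self-perpendicular,
    the two factors in \<open>card_fit_ind\<close> coincide, and each is a power of |V1|, which is
    the \<open>d\<close>-th power of the order of the field.\<close>
  have "\<exists>k. card (fit (theta a) (ind (carrier G))) ^ card (carrier G) = card (UNIV :: 'a set) ^ (2 * d * k)"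
  proof (rule fit_exponent[OF C.fam_coef[OF a]])
    fix c assume c: "c \<in> carrier G"
    let ?C = "generate G {c}"
    have Csub: "subgroup ?C G" using c by (intro generate_is_subgroup) auto
    obtain r t where rt: "is_transversal ?C r t" using ex_transversal[OF fin_G Csub] unfolding is_transversal_def by blast
    interpret I: induced scale G V \<rho> f ?C r t
      by (intro induced.intro induced_axioms.intro symplectic_rep_axioms Csub rt)
    obtain S where S: "subspace S" "S \<subseteq> V" "stable ?C S" "perpV S = S" using cyc[OF c] unfolding hyp_def by blast
    have ICM: "ind ?C \<subseteq> C.M" by (rule ind_subset_ind_one[OF Csub])
    have thc: "theta x \<phi> \<in> ind ?C" if "x \<in> C.fam" "\<phi> \<in> ind ?C" for x \<phi>
      using fn.linear_onD(1)[OF linear_on_theta[OF C.fam_coef[OF that(1)] Csub] that(2)] .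
    have ss: "theta (star (star b)) \<phi> = theta b \<phi>" for \<phi>
      by (auto simp: theta_def star_def fun_eq_iff intro!: sum.cong)
    have adj: "I.sform (theta a \<phi>) \<psi> = I.sform \<phi> (theta a \<psi>)" if \<phi>: "\<phi> \<in> ind ?C" and \<psi>: "\<psi> \<in> ind ?C" for \<phi> \<psi>
    proof -
      have "I.sform (theta b (theta (star b) \<phi>)) \<psi> = I.sform (theta (star b) \<phi>) (theta (star b) \<psi>)"
        by (rule I.sform_adjoint[OF C.fam_coef[OF b(1)] C.fam_selfadj[OF b(1)] thc[OF sb \<phi>] \<psi>])
      also have "\<dots> = I.sform \<phi> (theta (star (star b)) (theta (star b) \<psi>))"
        by (rule I.sform_adjoint[OF C.fam_coef[OF sb] C.fam_selfadj[OF sb] \<phi> thc[OF sb \<psi>]])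
      finally show ?thesis using th_a \<phi> \<psi> ICM by (simp add: ss subset_iff)
    qed
    have "card (fit (theta a) (ind ?C)) = card (fit (theta a) (I.sub_ind (perpV S))) * card (fit (theta a) (I.sub_ind S))"
      by (rule I.card_fit_ind[OF C.fam_coef[OF a] C.fam_coef[OF a] adj S(2,1,3)]) (use fam_stable[OF a S(1)] in auto)
    moreover have "C.op.submod (I.sub_ind S)"
    proof (rule C.op.submodI)
      show "add_subgroup (I.sub_ind S)" by (rule fn.subspace_add_subgroup[OF I.subspace_sub_ind[OF S(1)]])
      show sM: "I.sub_ind S \<subseteq> C.M" using ICM by (auto simp: I.sub_ind_def)
      show "r n \<in> I.sub_ind S" if "r \<in> C.ext ` C.fam" "n \<in> I.sub_ind S" for r n
      proof -
        obtain x where x: "x \<in> C.fam" "r = C.ext x" using \<open>r \<in> C.ext ` C.fam\<close> by blast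
        have "theta x ` I.sub_ind S \<subseteq> I.sub_ind S"
          by (rule I.theta_sub_ind[OF C.fam_coef[OF x(1)] S(1)]) (rule fam_stable[OF x(1) S(1)])
        then show ?thesis using C.ext_eq that(2) sM x(2) by (metis image_subset_iff subsetD)
      qed
    qed
    then obtain j where "card (fit (theta a) (I.sub_ind S)) = card V1 ^ j" using pow by blast
    ultimately have "card (fit (theta a) (ind ?C)) = card (UNIV :: 'a set) ^ (d * j * 2)"
      using S(4) V1q by (simp add: power_add[symmetric] power_mult[symmetric] mult_2_right flip: mult.assoc add_mult_distrib2)
    then show "\<exists>k. card (fit (theta a) (ind ?C)) = card (UNIV :: 'a set) ^ (2 * d * k)"
      by (intro exI[of _ j]) (simp add: mult_ac)
  qed
  then obtain m where m: "card (fit (theta a) (ind (carrier G))) ^ card (carrier G) = card (UNIV :: 'a set) ^ (2 * d * m)" by blast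
  \<comment> \<open>Multiplicity one would make d |G| a multiple of 2 d.\<close>
  have not1: "card (fit (theta a) (ind (carrier G))) \<noteq> card V1"
  proof
    assume "card (fit (theta a) (ind (carrier G))) = card V1"
    then have "card (UNIV :: 'a set) ^ (d * card (carrier G)) = card (UNIV :: 'a set) ^ (2 * d * m)"
      using m V1q by (simp add: power_mult[symmetric])
    then have "d * card (carrier G) = 2 * d * m" using q1 by simp
    then have "card (carrier G) = 2 * m" using d0 by simp
    then show False using odd_G by simp
  qed
  let ?P = "perpV V1"
  \<comment> \<open>Otherwise \<open>act a\<close> is zero on \<open>perpV V1\<close>, hence is the
    projection onto \<open>V1\<close>, and its Fitting component is \<open>V1\<close>.\<close>
  have "\<exists>W w. irreducible_sub W \<and> W \<subseteq> ?P \<and> w \<in> W \<and> C.act a w \<noteq> 0"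
  proof (rule ccontr)
    assume neg: "\<not> ?thesis"
    have kill: "C.act a u = 0" if "u \<in> ?P" for u
      by (rule zero_on_irreducible_subs[OF C.act_linear[OF a] subspace_perpV[OF V1d(2)] perpV_subset
            stable_perpV[OF subgroup_self V1d(4,2)] _ that]) (use neg in blast)
    have img: "C.act a v \<in> V1" if v: "v \<in> V" for v
    proof -
      obtain x y where xy: "x \<in> V1" "y \<in> ?P" "v = x + y" using decompose_perpV[OF V1d(1,2,4) v] by blast
      have "y \<in> V" using xy(2) perpV_subset by blast
      then have "C.act a v = x" using linear_onD(4)[OF C.act_linear[OF a] V1V[OF xy(1)]] act_a[OF xy(1)] kill[OF xy(2)] xy(3) by simp
      then show ?thesis using xy(1) by simp
    qed
    have stab: "C.act a ` V \<subseteq> V" using C.act_closed[OF a] by blast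
    have "fit (C.act a) V = V1"
    proof
      show "fit (C.act a) V \<subseteq> V1"
      proof
        fix v assume "v \<in> fit (C.act a) V"
        then have "v \<in> C.act a ` fit (C.act a) V" by (simp only: fit_image[OF V_finite stab])
        then obtain w where "w \<in> fit (C.act a) V" "v = C.act a w" by (rule imageE)
        then show "v \<in> V1" using img fit_subset[of "C.act a" V] by blast
      qed
      have "(C.act a ^^ n) ` V1 = V1" for n
      proof (induction n)
        case (Suc n)
        have "(C.act a ^^ Suc n) ` V1 = C.act a ` ((C.act a ^^ n) ` V1)" by (simp add: image_image)
        also have "\<dots> = V1" using act_a by (simp add: Suc)
        finally show ?case .
      qed simp
      then show "V1 \<subseteq> fit (C.act a) V" unfolding fit_def using V1d(2) by blast
    qed
    then show False using C.card_fit_act[OF a] not1 by simp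
  qed
  then obtain W w where W: "irreducible_sub W" "W \<subseteq> ?P" and w: "w \<in> W" "C.act a w \<noteq> 0" by blast
  note Wd = irreducible_subD[OF W(1)]
  have wV: "w \<in> V" using w(1) Wd(2) by blast
  have "C.ext a \<notin> C.op.annihilator (C.iota ` W) {0}"
  proof
    assume "C.ext a \<in> C.op.annihilator (C.iota ` W) {0}"
    then have "C.ext a (C.iota w) = 0" using w(1) unfolding C.op.annihilator_def by blast
    then have "C.iota (C.act a w) = C.iota 0"
      using C.ext_eq[OF C.iota_M[OF wV]] C.theta_iota[OF a wV] C.iota_zero by simp
    then show False using C.act_eqI[OF C.act_closed[OF a wV] V_0] w(2) by blast
  qed
  then have same: "?Q = C.op.annihilator (C.iota ` W) {0}" using sep[OF simple[OF W(1)]] by metis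
  have "\<exists>\<theta>. additive_on (C.iota ` V1) \<theta> \<and> \<theta> ` C.iota ` V1 = C.iota ` W \<and> {n \<in> C.iota ` V1. \<theta> n = 0} = {0} \<and>
      (\<forall>r\<in>C.ext ` C.fam. \<forall>n\<in>C.iota ` V1. \<theta> (r n) = r (\<theta> n))"
    by (rule C.op.same_annihilator_hom[OF simple[OF W(1)] s1 same])
  then obtain \<theta> where \<theta>: "additive_on (C.iota ` V1) \<theta>" "\<theta> ` C.iota ` V1 = C.iota ` W"
    "\<forall>r\<in>C.ext ` C.fam. \<forall>n\<in>C.iota ` V1. \<theta> (r n) = r (\<theta> n)" by (elim exE conjE)
  \<comment> \<open>\<open>\<theta>\<close> relates the copies of \<open>V1\<close> and
    \<open>W\<close> inside the induced module; evaluation at \<open>\<one>\<close> returns to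
    \<open>V\<close>.\<close>
  define \<psi> where "\<psi> x = \<theta> (C.iota x) \<one>" for x
  have \<psi>: "\<psi> x \<in> W" "C.iota (\<psi> x) = \<theta> (C.iota x)" if x: "x \<in> V1" for x
  proof -
    obtain z where z: "z \<in> W" "\<theta> (C.iota x) = C.iota z" using \<theta>(2) x by blast
    then have "\<psi> x = z" using C.iota_one Wd(2) by (auto simp: \<psi>_def)
    then show "\<psi> x \<in> W" "C.iota (\<psi> x) = \<theta> (C.iota x)" using z by auto
  qed
  have \<psi>V: "\<psi> x \<in> V" if "x \<in> V1" for x using \<psi>(1)[OF that] Wd(2) by blast
  have \<psi>_act: "\<psi> (C.act r x) = C.act r (\<psi> x)" if r: "r \<in> C.fam" and x: "x \<in> V1" for r x
  proof (rule C.act_eqI)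
    have rx: "C.act r x \<in> V1" by (rule act_stable[OF r V1d(1,4) x])
    show "\<psi> (C.act r x) \<in> V" by (rule \<psi>V[OF rx])
    show "C.act r (\<psi> x) \<in> V" by (rule C.act_closed[OF r \<psi>V[OF x]])
    have "C.iota (\<psi> (C.act r x)) = \<theta> (C.ext r (C.iota x))"
      using \<psi>(2)[OF rx] C.ext_eq[OF C.iota_M[OF V1V[OF x]]] C.theta_iota[OF r V1V[OF x]] by simp
    also have "\<dots> = C.ext r (\<theta> (C.iota x))" using \<theta>(3) r x by blast
    also have "\<dots> = C.iota (C.act r (\<psi> x))"
      using \<psi>(2)[OF x] C.ext_eq[OF C.iota_M[OF \<psi>V[OF x]]] C.theta_iota[OF r \<psi>V[OF x]] by simp
    finally show "C.iota (\<psi> (C.act r x)) = C.iota (C.act r (\<psi> x))" .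
  qed
  show False
  proof (rule no_orthogonal_copy[OF V1])
    show "\<psi> x \<in> perpV V1" if "x \<in> V1" for x using \<psi>(1)[OF that] W(2) by blast
    show "\<psi> (x + y) = \<psi> x + \<psi> y" if x: "x \<in> V1" and y: "y \<in> V1" for x y
    proof -
      have "\<theta> (C.iota x + C.iota y) = \<theta> (C.iota x) + \<theta> (C.iota y)"
        using \<theta>(1) x y unfolding additive_on_def by blast
      then show ?thesis using C.iota_linear(1)[OF V1V[OF x] V1V[OF y]] by (simp add: \<psi>_def)
    qed
    show "\<psi> (scale c x) = scale c (\<psi> x)" if x: "x \<in> V1" for c x
    proof -
      have "C.act (C.single \<one> (scale c)) y = scale c y" if "y \<in> V" for y
        using C.act_single[of "scale c" \<one> y] \<rho>_one[OF that] by simp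
      then show ?thesis using \<psi>_act[OF C.fam_single[of "scale c" \<one>] x] V1V[OF x] \<psi>V[OF x] by simp
    qed
    show "\<psi> (\<rho> g x) = \<rho> g (\<psi> x)" if g: "g \<in> carrier G" and x: "x \<in> V1" for g x
    proof -
      have "C.act (C.single g (scale 1)) y = \<rho> g y" for y
        using C.act_single[of "scale 1" g y] g by simp
      then show ?thesis using \<psi>_act[OF C.fam_single[of "scale 1" g] x] by simp
    qed
    have "C.iota w \<in> \<theta> ` C.iota ` V1" unfolding \<theta>(2) using w(1) by blast
    then obtain x where x: "x \<in> V1" "\<theta> (C.iota x) = C.iota w" by auto
    have "\<psi> x = w" using x(2) C.iota_one[OF wV] by (simp add: \<psi>_def)
    moreover have "w \<noteq> 0" using w(2) linear_on_more(1)[OF C.act_linear[OF a] V_subspace] by auto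
    ultimately show "\<exists>x\<in>V1. \<psi> x \<noteq> 0" using x(1) by blast
  qed
qed

end

section \<open>Reduction to the anisotropic case\<close>

context symplectic_rep
begin

text \<open>
  The subquotient \<open>S\<^sup>\<bottom>/S\<close> for a maximal isotropic submodule \<open>S\<close> is modelled by a vector space
  complement \<open>T\<close> of \<open>S\<close> in \<open>S\<^sup>\<bottom>\<close>, on which the group acts through the projection \<open>\<pi>\<close> along \<open>S\<close>.
\<close>

theorem hyp_if_hyp_cyclic:
  assumes cyc: "\<And>c. c \<in> carrier G \<Longrightarrow> hyp (generate G {c})"
  shows "hyp (carrier G)"
proof -
  let ?good = "\<lambda>S. subspace S \<and> S \<subseteq> V \<and> stable (carrier G) S \<and> S \<subseteq> perpV S"
  have "?good {0}"
    using linear_on_more(1)[OF \<rho>_linear V_subspace] V_0 f_zero(1)[OF V_0 V_0] subspace_single_0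
    by (auto simp: stable_def perpV_def)
  then have "\<exists>S. ?good S \<and> (\<forall>S'. ?good S' \<longrightarrow> card S' \<le> card S)"
    by (rule ex_has_greatest_nat[where b = "Suc (card V)"])
      (auto simp: less_Suc_eq_le intro: card_mono[OF V_finite])
  then obtain S where good: "?good S" and Smax: "\<And>S'. ?good S' \<Longrightarrow> card S' \<le> card S" by blast
  have S: "subspace S" "S \<subseteq> V" "stable (carrier G) S" "S \<subseteq> perpV S" using good by blast+
  let ?P = "perpV S"
  have P: "subspace ?P" "?P \<subseteq> V" "stable (carrier G) ?P"
    by (rule subspace_perpV[OF S(2)], rule perpV_subset, rule stable_perpV[OF subgroup_self S(3,2)])
  have PV: "v \<in> V" if "v \<in> ?P" for v using P(2) that by blast
  have finP: "finite ?P" using P(2) V_finite by (rule finite_subset)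
  have f_SP: "f s v = 0" "f v s = 0" if s: "s \<in> S" and v: "v \<in> ?P" for s v
  proof -
    show "f v s = 0" using s v by (simp add: perpV_def)
    then show "f s v = 0" using f_skew[of s v] s v S(2) PV by auto
  qed
  let ?compl = "\<lambda>T. subspace T \<and> T \<subseteq> ?P \<and> S \<inter> T = {0}"
  have "?compl {0}" using subspace_single_0 subspace_0[OF S(1)] subspace_0[OF P(1)] by auto
  then have "\<exists>T. ?compl T \<and> (\<forall>T'. ?compl T' \<longrightarrow> card T' \<le> card T)"
    by (rule ex_has_greatest_nat[where b = "Suc (card ?P)"])
      (auto simp: less_Suc_eq_le intro: card_mono[OF finP])
  then obtain T where compl: "?compl T" and Tmax: "\<And>T'. ?compl T' \<Longrightarrow> card T' \<le> card T" by blast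
  have T: "subspace T" "T \<subseteq> ?P" "S \<inter> T = {0}" using compl by blast+
  have TP: "v \<in> ?P" and TV: "v \<in> V" if "v \<in> T" for v using T(2) PV that by auto
  have finT: "finite T" using T(2) finP by (rule finite_subset)
  \<comment> \<open>A vector of \<open>?P\<close> outside \<open>S + T\<close> could be adjoined to
    \<open>T\<close>, against maximality.\<close>
  have dec: "\<exists>t. t \<in> T \<and> v - t \<in> S" if v: "v \<in> ?P" for v
  proof (rule ccontr)
    assume neg: "\<not> ?thesis"
    have vT: "v \<notin> T" using neg subspace_0[OF S(1)] by auto
    have "S \<inter> extend T v = {0}"
    proof
      show "S \<inter> extend T v \<subseteq> {0}"
      proof clarify
        fix x assume x: "x \<in> S" "x \<in> extend T v"
        obtain t c where t: "t \<in> T" "x = t + scale c v" using x(2) by (rule extendE)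
        show "x = 0"
        proof (cases "c = 0")
          case True
          then have "x \<in> S \<inter> T" using t x(1) by simp
          then show ?thesis using T(3) by blast
        next
          case False
          have "v - scale (- inverse c) t = scale (inverse c) x"
            using False t(2) by (simp add: scale_right_distrib)
          then have "v - scale (- inverse c) t \<in> S" using subspace_scale[OF S(1) x(1)] by simp
          then show ?thesis using neg subspace_scale[OF T(1) t(1)] by blast
        qed
      qed
      show "{0} \<subseteq> S \<inter> extend T v" using subspace_0[OF S(1)] subspace_0[OF subspace_extend[OF T(1)]] by simp
    qed
    then have "card (extend T v) \<le> card T"
      using Tmax[of "extend T v"] subspace_extend[OF T(1)] extend_props(3)[OF T(1) P(1) T(2) v] by blast
    moreover have "card T < card (extend T v)"
      using extend_props(1,2)[OF T(1), of v] vT finite_subset[OF extend_props(3)[OF T(1) P(1) T(2) v] finP]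
      by (intro psubset_card_mono) auto
    ultimately show False by simp
  qed
  define \<pi> where "\<pi> v = (SOME t. t \<in> T \<and> v - t \<in> S)" for v
  have \<pi>: "\<pi> v \<in> T" "v - \<pi> v \<in> S" if "v \<in> ?P" for v
    using someI_ex[OF dec[OF that]] by (simp_all add: \<pi>_def)
  have \<pi>_eq: "\<pi> v = t" if v: "v \<in> ?P" and t: "t \<in> T" "v - t \<in> S" for v t
  proof -
    have "(v - t) - (v - \<pi> v) \<in> S" using subspace_diff[OF S(1) t(2) \<pi>(2)[OF v]] .
    moreover have "(v - t) - (v - \<pi> v) = \<pi> v - t" by simp
    ultimately have "\<pi> v - t \<in> S \<inter> T" using subspace_diff[OF T(1) \<pi>(1)[OF v] t(1)] by simp
    then have "\<pi> v - t = 0" using T(3) by blast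
    then show ?thesis by simp
  qed
  have \<pi>_add: "\<pi> (v + w) = \<pi> v + \<pi> w" if v: "v \<in> ?P" and w: "w \<in> ?P" for v w
  proof (rule \<pi>_eq[OF subspace_add[OF P(1) v w] subspace_add[OF T(1) \<pi>(1)[OF v] \<pi>(1)[OF w]]])
    have "(v + w) - (\<pi> v + \<pi> w) = (v - \<pi> v) + (w - \<pi> w)" by simp
    then show "(v + w) - (\<pi> v + \<pi> w) \<in> S" using subspace_add[OF S(1) \<pi>(2)[OF v] \<pi>(2)[OF w]] by (simp only:)
  qed
  have \<pi>_scale: "\<pi> (scale c v) = scale c (\<pi> v)" if v: "v \<in> ?P" for c v
    by (rule \<pi>_eq[OF subspace_scale[OF P(1) v] subspace_scale[OF T(1) \<pi>(1)[OF v]]])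
      (use subspace_scale[OF S(1) \<pi>(2)[OF v], of c] in \<open>simp add: scale_right_diff_distrib\<close>)
  have \<pi>_T: "\<pi> t = t" if "t \<in> T" for t by (rule \<pi>_eq[OF TP[OF that] that]) (simp add: subspace_0[OF S(1)])
  have \<rho>P: "\<rho> g v \<in> ?P" if "g \<in> carrier G" "v \<in> ?P" for g v using P(3) that by (simp add: stable_def)
  \<comment> \<open>\<open>S\<close> is stable, so projecting before the group acts changes nothing
    modulo \<open>S\<close>. This makes the action on \<open>T\<close> multiplicative.\<close>
  have \<pi>_\<rho>: "\<pi> (\<rho> g (\<pi> v)) = \<pi> (\<rho> g v)" if g: "g \<in> carrier G" and v: "v \<in> ?P" for g v
  proof (rule \<pi>_eq[OF \<rho>P[OF g TP[OF \<pi>(1)[OF v]]] \<pi>(1)[OF \<rho>P[OF g v]]])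
    have 1: "\<rho> g (v - \<pi> v) = \<rho> g v - \<rho> g (\<pi> v)"
      by (rule linear_on_more(3)[OF \<rho>_linear[OF g] V_subspace PV[OF v] TV[OF \<pi>(1)[OF v]]])
    have "\<rho> g (v - \<pi> v) \<in> S" using S(3) g \<pi>(2)[OF v] by (simp add: stable_def)
    from subspace_diff[OF S(1) \<pi>(2)[OF \<rho>P[OF g v]] this]
    show "\<rho> g (\<pi> v) - \<pi> (\<rho> g v) \<in> S" unfolding 1 by simp
  qed
  \<comment> \<open>Elements of \<open>S\<close> are perpendicular to \<open>?P\<close>, so the form
    on \<open>?P\<close> is unchanged by projection along \<open>S\<close>.\<close>
  have f_\<pi>_right: "f v (\<pi> w) = f v w" if v: "v \<in> ?P" and w: "w \<in> ?P" for v w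
    using f_diff(2)[OF PV[OF v] PV[OF w] TV[OF \<pi>(1)[OF w]]] f_SP(2)[OF \<pi>(2)[OF w] v] by simp
  have f_\<pi>_left: "f (\<pi> v) w = f v w" if v: "v \<in> ?P" and w: "w \<in> ?P" for v w
    using f_diff(1)[OF PV[OF v] TV[OF \<pi>(1)[OF v]] PV[OF w]] f_SP(1)[OF \<pi>(2)[OF v] w] by simp
  have rep: "symplectic_rep scale G T (\<lambda>g t. \<pi> (\<rho> g t)) f"
  proof (intro symplectic_rep.intro group_rep.intro group_rep_axioms.intro symplectic_rep_axioms.intro
      finite_field_space_axioms is_group fin_G T(1) finT)
    show "linear_on T (\<lambda>t. \<pi> (\<rho> g t))" if g: "g \<in> carrier G" for g
      using \<pi>(1) \<rho>P[OF g] TP TV \<pi>_add \<pi>_scale linear_onD(3,4)[OF \<rho>_linear[OF g]]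
      by (intro linear_onI) simp_all
    show "\<pi> (\<rho> \<one> t) = t" if "t \<in> T" for t using \<rho>_one[OF TV[OF that]] \<pi>_T[OF that] by simp
    show "\<pi> (\<rho> (g \<otimes> h) t) = \<pi> (\<rho> g (\<pi> (\<rho> h t)))" if "g \<in> carrier G" "h \<in> carrier G" "t \<in> T" for g h t
      using \<rho>_mult[OF that(1,2) TV[OF that(3)]] \<pi>_\<rho>[OF that(1) \<rho>P[OF that(2) TP[OF that(3)]]] by simp
    show "bilinear_on T T f" by (rule bilinear_on_subset[OF f_bilinear]) (use TV in auto)
    show "f t t = 0" if "t \<in> T" for t using f_alt[OF TV[OF that]] .
    show "t = 0" if t: "t \<in> T" and nd: "\<And>w. w \<in> T \<Longrightarrow> f t w = 0" for t
    proof -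
      have "f t v = 0" if v: "v \<in> ?P" for v using f_\<pi>_right[OF TP[OF t] v] nd[OF \<pi>(1)[OF v]] by simp
      then have "t \<in> perpV ?P" using TV[OF t] by (simp add: perpV_def)
      then have "t \<in> S \<inter> T" using perpV_perpV[OF S(1,2)] t by simp
      then show ?thesis using T(3) by blast
    qed
    show "f (\<pi> (\<rho> g v)) (\<pi> (\<rho> g w)) = f v w" if g: "g \<in> carrier G" and v: "v \<in> T" and w: "w \<in> T" for g v w
      using f_\<pi>_left[OF \<rho>P[OF g TP[OF v]] TP[OF \<pi>(1)[OF \<rho>P[OF g TP[OF w]]]]]
        f_\<pi>_right[OF \<rho>P[OF g TP[OF v]] \<rho>P[OF g TP[OF w]]] f_invariant[OF g TV[OF v] TV[OF w]] by simp
  qed (fact odd_G two)+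
  interpret R: symplectic_rep scale G T "\<lambda>g t. \<pi> (\<rho> g t)" f by (rule rep)
  \<comment> \<open>An isotropic submodule \<open>U\<close> for the action on \<open>T\<close>
    yields the isotropic submodule \<open>S + U\<close> of \<open>V\<close>, which by maximality of
    \<open>S\<close> is \<open>S\<close>.\<close>
  interpret R: anisotropic_rep scale G T "\<lambda>g t. \<pi> (\<rho> g t)" f
  proof unfold_locales
    fix U assume U: "subspace U" "U \<subseteq> T" "R.stable (carrier G) U" "U \<subseteq> R.perpV U"
    let ?S = "{s + u | s u. s \<in> S \<and> u \<in> U}"
    have UP: "u \<in> ?P" and UV: "u \<in> V" if "u \<in> U" for u using U(2) TP TV that by auto
    have SV: "s \<in> V" and SP: "s \<in> ?P" if "s \<in> S" for s using S(2,4) that by auto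
    have "?good ?S"
    proof (intro conjI)
      show "subspace ?S" by (rule subspace_sums[OF S(1) U(1)])
      show sub: "?S \<subseteq> V" using V_add SV UV by blast
      show "stable (carrier G) ?S"
        unfolding stable_def
      proof clarify
        fix g s u assume g: "g \<in> carrier G" and s: "s \<in> S" and u: "u \<in> U"
        let ?u = "\<pi> (\<rho> g u)"
        have "\<rho> g (s + u) = \<rho> g s + \<rho> g u" by (rule linear_onD(4)[OF \<rho>_linear[OF g] SV[OF s] UV[OF u]])
        then have "\<rho> g (s + u) = (\<rho> g s + (\<rho> g u - ?u)) + ?u" by simp
        moreover have "\<rho> g s + (\<rho> g u - ?u) \<in> S"
          using S(3) g s \<pi>(2)[OF \<rho>P[OF g UP[OF u]]] subspace_add[OF S(1)] by (simp add: stable_def)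
        moreover have "?u \<in> U" using U(3) g u by (simp add: R.stable_def)
        ultimately show "\<exists>s' u'. \<rho> g (s + u) = s' + u' \<and> s' \<in> S \<and> u' \<in> U" by blast
      qed
      have "f (s + u) (s' + u') = 0" if s: "s \<in> S" "s' \<in> S" and u: "u \<in> U" "u' \<in> U" for s s' u u'
      proof -
        note m = SV[OF s(1)] UV[OF u(1)] SV[OF s(2)] UV[OF u(2)]
        have "f u u' = 0" using U(4) u by (auto simp: R.perpV_def)
        then show ?thesis
          using fD(1)[OF m(1,2) V_add[OF m(3,4)]] fD(3)[OF m(1,3,4)] fD(3)[OF m(2,3,4)]
            f_SP(1)[OF s(1) SP[OF s(2)]] f_SP(1)[OF s(1) UP[OF u(2)]] f_SP(2)[OF s(2) UP[OF u(1)]] by simp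
      qed
      then show "?S \<subseteq> perpV ?S" using V_add[OF SV UV] by (auto simp: perpV_def)
    qed
    from Smax[OF this] have "card ?S \<le> card S" .
    moreover have "S \<subseteq> ?S"
    proof
      fix s assume "s \<in> S"
      then have "s + 0 \<in> ?S" using subspace_0[OF U(1)] by blast
      then show "s \<in> ?S" by simp
    qed
    moreover have "finite ?S" using \<open>?good ?S\<close> V_finite finite_subset by blast
    ultimately have eq: "?S = S" using card_seteq[of ?S S] by blast
    show "U = {0}"
    proof
      show "U \<subseteq> {0}"
      proof
        fix u assume u: "u \<in> U"
        have "0 + u \<in> ?S" using subspace_0[OF S(1)] u by blast
        then have "u \<in> S \<inter> T" using eq u U(2) by auto
        then show "u \<in> {0}" using T(3) by simp
      qed
      show "{0} \<subseteq> U" using subspace_0[OF U(1)] by simp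
    qed
  qed
  have "R.hyp (generate G {c})" if c: "c \<in> carrier G" for c
  proof -
    let ?C = "generate G {c}"
    have CG: "g \<in> carrier G" if "g \<in> ?C" for g
      using generate_in_carrier[of "{c}" g] c that by simp
    obtain H where H: "subspace H" "H \<subseteq> V" "stable ?C H" "perpV H = H" using cyc[OF c] unfolding hyp_def by blast
    \<comment> \<open>The image of \<open>H\<close> in the subquotient. It is self-perpendicular
      because the perpendicular space of \<open>H \<inter> ?P\<close> is \<open>H + S\<close>,
      obtained by taking perpendicular spaces twice.\<close>
    let ?H = "\<pi> ` (H \<inter> ?P)"
    have int: "subspace (H \<inter> ?P)" by (rule subspace_inter[OF H(1) P(1)])
    have f_H: "f h h' = 0" if "h \<in> H" "h' \<in> H" for h h'
    proof -
      have "h \<in> perpV H" using that(1) by (simp only: H(4))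
      then show ?thesis using that(2) by (simp add: perpV_def)
    qed
    have "subspace ?H"
      by (rule subspace_image[OF int]) (use \<pi>_add \<pi>_scale in \<open>auto intro: additive_onI\<close>)
    moreover have HT: "?H \<subseteq> T" using \<pi>(1) by blast
    moreover have "R.stable ?C ?H"
      unfolding R.stable_def
    proof clarify
      fix g h assume g: "g \<in> ?C" and h: "h \<in> H" "h \<in> ?P"
      have "\<rho> g h \<in> H \<inter> ?P" using H(3) g h \<rho>P[OF CG[OF g] h(2)] by (simp add: stable_def)
      then show "\<pi> (\<rho> g (\<pi> h)) \<in> ?H" using \<pi>_\<rho>[OF CG[OF g] h(2)] by simp
    qed
    moreover have "R.perpV ?H = ?H"
    proof
      have "f (\<pi> h) (\<pi> h') = 0" if "h \<in> H" "h \<in> ?P" "h' \<in> H" "h' \<in> ?P" for h h'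
        using f_\<pi>_left[OF that(2) TP[OF \<pi>(1)[OF that(4)]]] f_\<pi>_right[OF that(2,4)] f_H[OF that(1,3)] by simp
      then show "?H \<subseteq> R.perpV ?H" using HT by (auto simp: R.perpV_def)
      show "R.perpV ?H \<subseteq> ?H"
      proof
        fix t assume "t \<in> R.perpV ?H"
        then have t: "t \<in> T" and ft: "\<And>h. h \<in> H \<Longrightarrow> h \<in> ?P \<Longrightarrow> f t (\<pi> h) = 0" by (auto simp: R.perpV_def)
        let ?A = "{h + s | h s. h \<in> H \<and> s \<in> S}"
        have A: "subspace ?A" "?A \<subseteq> V" using subspace_sums[OF H(1) S(1)] V_add H(2) S(2) by blast+
        have "perpV ?A = H \<inter> ?P"
        proof
          have "h + 0 \<in> ?A" if "h \<in> H" for h using that subspace_0[OF S(1)] by blast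
          then have HA: "h \<in> ?A" if "h \<in> H" for h using that by simp
          have "0 + s \<in> ?A" if "s \<in> S" for s using that subspace_0[OF H(1)] by blast
          then have SA: "s \<in> ?A" if "s \<in> S" for s using that by simp
          show "perpV ?A \<subseteq> H \<inter> ?P"
          proof
            fix v assume v: "v \<in> perpV ?A"
            have "v \<in> perpV H" "v \<in> perpV S" using v HA SA unfolding perpV_def by blast+
            then show "v \<in> H \<inter> ?P" using H(4) by simp
          qed
          show "H \<inter> ?P \<subseteq> perpV ?A"
          proof
            fix v assume v: "v \<in> H \<inter> ?P"
            then have vV: "v \<in> V" using H(2) by blast
            have "f v (h + s) = 0" if "h \<in> H" "s \<in> S" for h s
              using fD(3)[OF vV, of h s] H(2) S(2) that f_H[of v h] f_SP(2)[of s v] v by auto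
            then show "v \<in> perpV ?A" using vV by (auto simp: perpV_def)
          qed
        qed
        then have "perpV (H \<inter> ?P) = ?A" using perpV_perpV[OF A] by simp
        moreover have "f t h = 0" if "h \<in> H \<inter> ?P" for h
          using f_\<pi>_right[OF TP[OF t], of h] ft[of h] that by simp
        then have "t \<in> perpV (H \<inter> ?P)" using TV[OF t] by (simp add: perpV_def)
        ultimately obtain h s where hs: "h \<in> H" "s \<in> S" "t = h + s" by blast
        have "h = t - s" using hs(3) by simp
        then have hP: "h \<in> ?P" using subspace_diff[OF P(1) TP[OF t]] hs(2) S(4) by blast
        have "h - t \<in> S" using subspace_neg[OF S(1) hs(2)] hs(3) by simp
        then have "\<pi> h = t" by (rule \<pi>_eq[OF hP t])
        then show "t \<in> ?H" using hs(1) hP by blast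
      qed
    qed
    ultimately show ?thesis unfolding R.hyp_def by blast
  qed
  \<comment> \<open>The subquotient vanishes, so the maximal isotropic submodule \<open>S\<close> is
    self-perpendicular.\<close>
  then have T0: "T = {0}" by (rule R.trivial_if_hyp_cyclic)
  have "?P \<subseteq> S"
  proof
    fix v assume v: "v \<in> ?P"
    then show "v \<in> S" using \<pi>[OF v] T0 by simp
  qed
  then show ?thesis unfolding hyp_def using S by blast
qed

end

section \<open>Passage from finite-dimensional modules to finite representations\<close>

lemma (in vector_space) finite_span_finite_field:
  assumes "finite (UNIV :: 'a set)" "finite B"
  shows "finite (span B)"
  using assms(2)
proof (induction B rule: finite_induct)
  case (insert b B)
  have "span (insert b B) \<subseteq> (\<lambda>(k, y). y + scale k b) ` (UNIV \<times> span B)"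
  proof
    fix x assume "x \<in> span (insert b B)"
    then obtain k where "x - scale k b \<in> span B" by (auto simp: span_insert)
    then show "x \<in> (\<lambda>(k, y). y + scale k b) ` (UNIV \<times> span B)"
      by (intro image_eqI[of _ _ "(k, x - scale k b)"]) auto
  qed
  then show ?case using insert.IH assms(1) by (auto intro: finite_subset)
qed simp

lemma (in group) cyclic_group_generate:
  assumes c: "c \<in> carrier G"
  shows "cyclic_group (G\<lparr>carrier := generate G {c}\<rparr>)"
proof -
  let ?C = "generate G {c}"
  have sub: "subgroup ?C G" using c by (intro generate_is_subgroup) auto
  interpret C: group "G\<lparr>carrier := ?C\<rparr>" by (rule subgroup_imp_group[OF sub])
  have cC: "c \<in> ?C" by (rule generate.incl) simp
  have "carrier (G\<lparr>carrier := ?C\<rparr>) = range (\<lambda>n::int. c [^]\<^bsub>G\<lparr>carrier := ?C\<rparr>\<^esub> n)"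
    unfolding image_def using generate_pow[OF c] int_pow_consistent[OF sub cC] by simp
  then show ?thesis using C.cyclic_group cC by auto
qed

theorem theoremA:
  fixes scale :: "'f::{field,finite} \<Rightarrow> 'b::ab_group_add \<Rightarrow> 'b"
    and G :: "'g monoid"
    and act :: "'g \<Rightarrow> 'b \<Rightarrow> 'b"
    and form :: "'b \<Rightarrow> 'b \<Rightarrow> 'f"
    and p :: nat
  assumes "CHAR('f) = p" and "odd p"
    and "group G" and "finite (carrier G)" and "odd (Coset.order G)"
    and "symplectic_module scale G act form"
    and "\<And>N. subgroup N G \<Longrightarrow> cyclic_group (G\<lparr>carrier := N\<rparr>) \<Longrightarrow>
      hyperbolic scale (G\<lparr>carrier := N\<rparr>) act form"
  shows "hyperbolic scale G act form"
proof -
  interpret symplectic_module scale G act form by (rule assms(6))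
  interpret G: group G by (rule assms(3))
  \<comment> \<open>An odd divisor of 2 is 1, which is not the characteristic of a field.\<close>
  have two: "(2 :: 'f) \<noteq> 0"
  proof
    assume "(2 :: 'f) = 0"
    then have "(of_nat 2 :: 'f) = 0" by simp
    then have "p dvd 2" using assms(1) by (simp only: of_nat_eq_0_iff_char_dvd)
    then have "p \<le> 2" "p \<noteq> 2" "p \<noteq> 0" using assms(2) by (auto dest: dvd_imp_le intro!: Nat.gr0I)
    then have "p = 1" by simp
    then have "(of_nat 1 :: 'f) = 0" using assms(1) of_nat_CHAR by metis
    then show False by simp
  qed
  obtain Basis where "finite_dimensional_vector_space scale Basis" using finite_dimensional by blast
  then have "finite Basis" "span Basis = UNIV"
    by (simp_all add: finite_dimensional_vector_space.finite_Basis finite_dimensional_vector_space.span_Basis)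
  then have fin: "finite (UNIV :: 'b set)" using finite_span_finite_field[of Basis] by simp
  have fl: "form (x + y) t = form x t + form y t" "form (scale c x) t = c * form x t" for x y t c
    by (rule Modules.module_hom.add[OF Vector_Spaces.linear.axioms(3)[OF linear_form_left]], rule Modules.module_hom.scale[OF Vector_Spaces.linear.axioms(3)[OF linear_form_left]])
  have fr: "form t (x + y) = form t x + form t y" "form t (scale c x) = c * form t x" for x y t c
    by (rule Modules.module_hom.add[OF Vector_Spaces.linear.axioms(3)[OF linear_form_right]], rule Modules.module_hom.scale[OF Vector_Spaces.linear.axioms(3)[OF linear_form_right]])
  have la: "act g (x + y) = act g x + act g y" "act g (scale c x) = scale c (act g x)" if "g \<in> carrier G" for g x y c
    by (rule Modules.module_hom.add[OF Vector_Spaces.linear.axioms(3)[OF linear_act[OF that]]], rule Modules.module_hom.scale[OF Vector_Spaces.linear.axioms(3)[OF linear_act[OF that]]])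
  interpret F: finite_field_space scale ..
  interpret R: symplectic_rep scale G UNIV act form
  proof (intro symplectic_rep.intro group_rep.intro group_rep_axioms.intro symplectic_rep_axioms.intro
      F.finite_field_space_axioms assms(3,4) fin two)
    show "F.linear_on UNIV (act g)" if "g \<in> carrier G" for g by (rule F.linear_onI) (use la[OF that] in auto)
    show "act \<one>\<^bsub>G\<^esub> v = v" for v using id_eq_one by (metis UNIV_I restrict_apply')
    show "act (g \<otimes>\<^bsub>G\<^esub> h) v = act g (act h v)" if "g \<in> carrier G" "h \<in> carrier G" for g h v
      using composition_rule[OF UNIV_I that] .
    show "F.bilinear_on UNIV UNIV form" using fl fr by (simp add: F.bilinear_on_def)
    show "form (act g v) (act g w) = form v w" if "g \<in> carrier G" for g v w by (rule invariant[OF that])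
    show "odd (card (carrier G))" using assms(5) by (simp add: Coset.order_def)
  qed (use non_singular alternating subspace_UNIV in auto)
  \<comment> \<open>\<open>perp\<close> puts \<open>S\<close> into the first argument of the form
    and \<open>perpV\<close> into the second; skew-symmetry identifies the two.\<close>
  have perp: "perp form S = R.perpV S" for S
    using R.perpV_sym[of S] by (auto simp: perp_def)
  have "R.hyp (carrier G)"
  proof (rule R.hyp_if_hyp_cyclic)
    fix c assume c: "c \<in> carrier G"
    let ?C = "generate G {c}"
    have "subgroup ?C G" using c by (intro G.generate_is_subgroup) auto
    then have "hyperbolic scale (G\<lparr>carrier := ?C\<rparr>) act form"
      by (rule assms(7)[OF _ G.cyclic_group_generate[OF c]])
    then obtain S where S: "group_submodule scale (G\<lparr>carrier := ?C\<rparr>) act S" "S = R.perpV S"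
      unfolding hyperbolic_def perp by blast
    then show "R.hyp ?C"
      unfolding R.hyp_def R.stable_def group_submodule_def by (intro exI[of _ S]) auto
  qed
  then obtain S where "subspace S" "R.stable (carrier G) S" "R.perpV S = S" unfolding R.hyp_def by blast
  then show ?thesis
    unfolding hyperbolic_def group_submodule_def R.stable_def perp by (intro exI[of _ S]) auto
qed

end
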